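(* Let $(b_n)$ be a deterministic positive sequence such that $r_n^2/\mu_{2,n}\to0$ and $2\mu_{2,n}/b_n\to\mathfrak c$ in probability for some constant $\mathfrak c>0$. Let $\mathcal X_n=b_n^{-1/2}(\hat\theta_n-\theta)$ and $\alpha_n=\sqrt3\,\sigma^2r_nb_n^{-1/2}$, and for some fixed $\mathfrak c_1>0$ let $\mathcal P_n(\delta)=\{\Pi:\alpha_n<\delta,\ \bar\lambda_{2,n}<\mathfrak c_1\}$, $\delta>0$. Then for every $j\in\{0,1,2,\dots\}$ there exist positive constants $C$ and $q$ such that $$\frac{d^j}{du^j}\Big(\mathbf E^\Pi[e^{\mathrm iu\mathcal X_n}]\Big)=\frac{d^j}{du^j}\Big\{e^{-\bar\lambda_{2,n}u^2/2}\Big(1+\frac{(\mathrm iu)^3b_n^{1/2}}6\bar\lambda_{3,n}\Big)\Big\}+\mathcal O(\delta^2)\,(1+|u|^q)\,e^{-\bar\lambda_{2,n}u^2/2}$$ for every real $u$ with $|u|\le C\delta^{-1/3}$ and every $\Pi_n\in\mathcal P_n(\delta)$. Here $\mathcal O(\delta^2)$ denotes a quantity bounded in absolute value, uniformly in such $u$, by a variable $R=R_{n,\delta}(\Pi_n)$ depending only on the partitions and satisfying $\limsup_{\delta\to0}\sup_n\sup_{\Pi_n\in\mathcal P_n(\delta)}|R_{n,\delta}(\Pi_n)|\,\delta^{-2}<\infty$.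
   Context: Model (no drift). Fix $T>0$. Let $\rho:[0,T]\to[-1,1]$ and $\sigma_1,\sigma_2:[0,T]\to(0,\infty)$ be deterministic measurable functions with $\sigma_1,\sigma_2\le\sigma$ on $[0,T]$ for some constant $\sigma$. $B=(B_1,B_2)$ is a centered two-dimensional Gaussian process with independent increments, $\mathbf E[B_{1,t}^2]=\mathbf E[B_{2,t}^2]=t$, $\mathbf E[B_{1,t}B_{2,t}]=\int_0^t\rho_s\,ds$, and $X_{i,t}=X_{i,0}+\int_0^t\sigma_{i,s}\,dB_{i,s}$. Sampling. For each $n$, $\Pi_n=(\Pi_n^1,\Pi_n^2)$, where $\Pi^1_n=\{I^i=(S^{i-1},S^i],\,i\le N_1\}$, $0=S^0<\dots<S^{N_1}=T$, and $\Pi^2_n=\{J^j=(T^{j-1},T^j],\,j\le N_2\}$, $0=T^0<\dots<T^{N_2}=T$, are (possibly random) partitions of $(0,T]$, independent of $(X_{1,t}-X_{1,0},X_{2,t}-X_{2,0})_{t\in[0,T]}$. $\mathbf E^\Pi$ is conditional expectation given $\Pi_n$. $r_n=(\max_i|I^i|)\vee(\max_j|J^j|)$. Estimator. $\theta=\int_0^T\rho_t\sigma_{1,t}\sigma_{2,t}dt$, $\hat\theta_n=\sum_{i,j}(X_{1,S^i}-X_{1,S^{i-1}})(X_{2,T^j}-X_{2,T^{j-1}})\mathbf 1(I^i\cap J^j\neq\emptyset)$. Cumulants. $v(S)=\int_S\rho_t\sigma_{1,t}\sigma_{2,t}dt$, $v_k(S)=\int_S\sigma_{k,t}^2dt$ ($k=1,2$),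 $K_{IJ}=\mathbf 1(I\cap J\neq\emptyset)$, sums over $I\in\Pi^1_n,J\in\Pi^2_n$, $$\mu_{2,n}=\tfrac12\Big\{\sum_{I,J}v_1(I)v_2(J)K_{IJ}+\sum_Iv(I)^2+\sum_Jv(J)^2-\sum_{I,J}v(I\cap J)^2\Big\},$$ $$\mu_{3,n}=\tfrac14\Big\{\sum_Iv(I)^3+\sum_Jv(J)^3+2\sum_{I,J}v(I\cap J)^3+3\sum_{I,J}v_1(I)v_2(J)v(I\cup J)K_{IJ}-3\sum_{I,J}\big[v(I\cap J)^2(v(I)+v(J))-v(I\cap J)v(I)v(J)\big]\Big\},$$ $\bar\lambda_{2,n}=2b_n^{-1}\mu_{2,n}$, $\bar\lambda_{3,n}=8b_n^{-2}\mu_{3,n}$. *)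

theory Defs
  imports "HOL-Probability.Probability"
begin

section \<open>The driving Gaussian process and Wiener integrals\<close>

text \<open>Degenerate (almost surely constant) variables count as Gaussian.\<close>

definition gaussian_rv :: "'a measure \<Rightarrow> ('a \<Rightarrow> real) \<Rightarrow> bool" where
  "gaussian_rv M Y \<longleftrightarrow> Y \<in> borel_measurable M \<and>
     (\<exists>m. (AE \<omega> in M. Y \<omega> = m) \<or> (\<exists>s>0. distributed M lborel Y (normal_density m s)))"

definition gaussian_process ::
  "'a measure \<Rightarrow> 'i set \<Rightarrow> ('i \<Rightarrow> 'a \<Rightarrow> 'b::euclidean_space) \<Rightarrow> bool" where
  "gaussian_process M I Z \<longleftrightarrow>
     (\<forall>F c. finite F \<and> F \<subseteq> I \<longrightarrow> gaussian_rv M (\<lambda>\<omega>. \<Sum>t\<in>F. c t \<bullet> Z t \<omega>))"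

definition independent_increments ::
  "'a measure \<Rightarrow> real set \<Rightarrow> (real \<Rightarrow> 'a \<Rightarrow> 'b::euclidean_space) \<Rightarrow> bool" where
  "independent_increments M I Z \<longleftrightarrow>
     (\<forall>(m::nat) t. (\<forall>k\<le>m. t k \<in> I) \<and> (\<forall>k<m. t k \<le> t (Suc k)) \<longrightarrow>
        prob_space.indep_vars M (\<lambda>_. borel) (\<lambda>k \<omega>. Z (t (Suc k)) \<omega> - Z (t k) \<omega>) {..<m})"

definition step_fun :: "nat \<Rightarrow> (nat \<Rightarrow> real) \<Rightarrow> (nat \<Rightarrow> real) \<Rightarrow> real \<Rightarrow> real" where
  "step_fun m c \<tau> s = (\<Sum>k<m. c k * indicator {\<tau> k<..\<tau> (Suc k)} s)"

definition step_integral ::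
  "(real \<Rightarrow> 'a \<Rightarrow> real) \<Rightarrow> nat \<Rightarrow> (nat \<Rightarrow> real) \<Rightarrow> (nat \<Rightarrow> real) \<Rightarrow> 'a \<Rightarrow> real" where
  "step_integral W m c \<tau> \<omega> = (\<Sum>k<m. c k * (W (\<tau> (Suc k)) \<omega> - W (\<tau> k) \<omega>))"

text \<open>\<open>is_wiener_integral M W f t Y\<close>: the variable \<open>Y\<close> is a version of the stochastic integral of
  the deterministic integrand \<open>f\<close> against \<open>W\<close> over \<open>[0, t]\<close>, i.e. an \<open>L\<^sup>2(M)\<close> limit of
  elementary integrals of step functions converging to \<open>f\<close> in \<open>L\<^sup>2([0, t])\<close>.\<close>

definition is_wiener_integral ::
  "'a measure \<Rightarrow> (real \<Rightarrow> 'a \<Rightarrow> real) \<Rightarrow> (real \<Rightarrow> real) \<Rightarrow> real \<Rightarrow> ('a \<Rightarrow> real) \<Rightarrow> bool" where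
  "is_wiener_integral M W f t Y \<longleftrightarrow> Y \<in> borel_measurable M \<and>
     (\<exists>(m :: nat \<Rightarrow> nat) c \<tau>.
        (\<forall>l. (\<forall>k\<le>m l. \<tau> l k \<in> {0..t}) \<and> (\<forall>k<m l. \<tau> l k \<le> \<tau> l (Suc k))) \<and>
        (\<lambda>l. \<integral>\<^sup>+s\<in>{0..t}. ennreal ((f s - step_fun (m l) (c l) (\<tau> l) s)\<^sup>2) \<partial>lborel)
          \<longlonglongrightarrow> 0 \<and>
        (\<lambda>l. \<integral>\<^sup>+\<omega>. ennreal ((Y \<omega> - step_integral W (m l) (c l) (\<tau> l) \<omega>)\<^sup>2) \<partial>M)
          \<longlonglongrightarrow> 0)"

text \<open>As usual for stochastic integrals, the integral process is taken in its continuous version.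
  Without this, evaluating \<open>X\<close> at random sampling times is not determined by the law of \<open>X\<close>.\<close>

definition is_wiener_integral_process ::
  "'a measure \<Rightarrow> real \<Rightarrow> (real \<Rightarrow> 'a \<Rightarrow> real) \<Rightarrow> (real \<Rightarrow> real) \<Rightarrow> (real \<Rightarrow> 'a \<Rightarrow> real) \<Rightarrow> bool" where
  "is_wiener_integral_process M T W f X \<longleftrightarrow>
     (\<forall>t\<in>{0..T}. X t \<in> borel_measurable M) \<and>
     (\<forall>t\<in>{0..T}. is_wiener_integral M W f t (\<lambda>\<omega>. X t \<omega> - X 0 \<omega>)) \<and>
     (\<forall>\<omega>\<in>space M. continuous_on {0..T} (\<lambda>t. X t \<omega>))"


section \<open>Partitions\<close>

text \<open>A pair \<open>(N, s)\<close> stands for the partition of \<open>(0, T]\<close> into the intervals \<open>(s i, s (i + 1)]\<close>,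
  \<open>i < N\<close>. The irrelevant values of \<open>s\<close> beyond \<open>N\<close> are fixed to \<open>T\<close>, so that the \<open>\<sigma>\<close>-algebra
  generated by a random pair \<open>(N, s)\<close> is the one generated by the random partition.\<close>

type_synonym partition = "nat \<times> (nat \<Rightarrow> real)"

definition is_partition :: "real \<Rightarrow> partition \<Rightarrow> bool" where
  "is_partition T p \<longleftrightarrow> snd p 0 = 0 \<and> snd p (fst p) = T \<and>
     (\<forall>i<fst p. snd p i < snd p (Suc i)) \<and> (\<forall>i>fst p. snd p i = T)"

definition partition_pairs :: "real \<Rightarrow> (partition \<times> partition) set" where
  "partition_pairs T = {\<pi>. is_partition T (fst \<pi>) \<and> is_partition T (snd \<pi>)}"

definition partition_space :: "partition measure" where
  "partition_space = count_space UNIV \<Otimes>\<^sub>M Pi\<^sub>M UNIV (\<lambda>_. borel)"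

definition partition_pair_space :: "(partition \<times> partition) measure" where
  "partition_pair_space = partition_space \<Otimes>\<^sub>M partition_space"

definition cell :: "partition \<Rightarrow> nat \<Rightarrow> real set" where
  "cell p i = {snd p i<..snd p (Suc i)}"

definition cells :: "partition \<Rightarrow> real set set" where
  "cells p = cell p ` {..<fst p}"

definition overlap :: "real set \<Rightarrow> real set \<Rightarrow> real" where
  "overlap I J = (if I \<inter> J \<noteq> {} then 1 else 0)"

definition mesh :: "partition \<times> partition \<Rightarrow> real" where
  "mesh \<pi> = max (Max (measure lborel ` cells (fst \<pi>))) (Max (measure lborel ` cells (snd \<pi>)))"


section \<open>The covariation estimator\<close>

definition theta_hat ::
  "(real \<Rightarrow> 'a \<Rightarrow> real) \<Rightarrow> (real \<Rightarrow> 'a \<Rightarrow> real) \<Rightarrow> partition \<times> partition \<Rightarrow> 'a \<Rightarrow> real" where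
  "theta_hat X1 X2 \<pi> \<omega> =
     (\<Sum>i<fst (fst \<pi>). \<Sum>j<fst (snd \<pi>).
        (X1 (snd (fst \<pi>) (Suc i)) \<omega> - X1 (snd (fst \<pi>) i) \<omega>) *
        (X2 (snd (snd \<pi>) (Suc j)) \<omega> - X2 (snd (snd \<pi>) j) \<omega>) *
        overlap (cell (fst \<pi>) i) (cell (snd \<pi>) j))"

definition cov_meas ::
  "(real \<Rightarrow> real) \<Rightarrow> (real \<Rightarrow> real) \<Rightarrow> (real \<Rightarrow> real) \<Rightarrow> real set \<Rightarrow> real" where
  "cov_meas \<rho> \<sigma>1 \<sigma>2 S = (LBINT t:S. \<rho> t * \<sigma>1 t * \<sigma>2 t)"

definition var_meas :: "(real \<Rightarrow> real) \<Rightarrow> real set \<Rightarrow> real" where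
  "var_meas \<sigma>k S = (LBINT t:S. (\<sigma>k t)\<^sup>2)"

definition theta :: "real \<Rightarrow> (real \<Rightarrow> real) \<Rightarrow> (real \<Rightarrow> real) \<Rightarrow> (real \<Rightarrow> real) \<Rightarrow> real" where
  "theta T \<rho> \<sigma>1 \<sigma>2 = (LBINT t:{0..T}. \<rho> t * \<sigma>1 t * \<sigma>2 t)"

definition normalized_error ::
  "real \<Rightarrow> (real \<Rightarrow> real) \<Rightarrow> (real \<Rightarrow> real) \<Rightarrow> (real \<Rightarrow> real) \<Rightarrow>
   (real \<Rightarrow> 'a \<Rightarrow> real) \<Rightarrow> (real \<Rightarrow> 'a \<Rightarrow> real) \<Rightarrow> real \<Rightarrow> partition \<times> partition \<Rightarrow> 'a \<Rightarrow> real" where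
  "normalized_error T \<rho> \<sigma>1 \<sigma>2 X1 X2 \<beta> \<pi> \<omega> =
     (theta_hat X1 X2 \<pi> \<omega> - theta T \<rho> \<sigma>1 \<sigma>2) / sqrt \<beta>"


section \<open>Cumulants\<close>

definition mu2 ::
  "(real \<Rightarrow> real) \<Rightarrow> (real \<Rightarrow> real) \<Rightarrow> (real \<Rightarrow> real) \<Rightarrow> partition \<times> partition \<Rightarrow> real" where
  "mu2 \<rho> \<sigma>1 \<sigma>2 \<pi> =
    (let v = cov_meas \<rho> \<sigma>1 \<sigma>2; v1 = var_meas \<sigma>1; v2 = var_meas \<sigma>2;
         P = cells (fst \<pi>); Q = cells (snd \<pi>)
     in 1/2 * ((\<Sum>I\<in>P. \<Sum>J\<in>Q. v1 I * v2 J * overlap I J)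
               + (\<Sum>I\<in>P. (v I)^2) + (\<Sum>J\<in>Q. (v J)^2)
               - (\<Sum>I\<in>P. \<Sum>J\<in>Q. (v (I \<inter> J))^2)))"

definition mu3 ::
  "(real \<Rightarrow> real) \<Rightarrow> (real \<Rightarrow> real) \<Rightarrow> (real \<Rightarrow> real) \<Rightarrow> partition \<times> partition \<Rightarrow> real" where
  "mu3 \<rho> \<sigma>1 \<sigma>2 \<pi> =
    (let v = cov_meas \<rho> \<sigma>1 \<sigma>2; v1 = var_meas \<sigma>1; v2 = var_meas \<sigma>2;
         P = cells (fst \<pi>); Q = cells (snd \<pi>)
     in 1/4 * ((\<Sum>I\<in>P. (v I)^3) + (\<Sum>J\<in>Q. (v J)^3)
               + 2 * (\<Sum>I\<in>P. \<Sum>J\<in>Q. (v (I \<inter> J))^3)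
               + 3 * (\<Sum>I\<in>P. \<Sum>J\<in>Q. v1 I * v2 J * v (I \<union> J) * overlap I J)
               - 3 * (\<Sum>I\<in>P. \<Sum>J\<in>Q.
                        (v (I \<inter> J))^2 * (v I + v J) - v (I \<inter> J) * v I * v J)))"

definition lambda2 ::
  "(real \<Rightarrow> real) \<Rightarrow> (real \<Rightarrow> real) \<Rightarrow> (real \<Rightarrow> real) \<Rightarrow> real \<Rightarrow> partition \<times> partition \<Rightarrow> real" where
  "lambda2 \<rho> \<sigma>1 \<sigma>2 \<beta> \<pi> = 2 * mu2 \<rho> \<sigma>1 \<sigma>2 \<pi> / \<beta>"

definition lambda3 ::
  "(real \<Rightarrow> real) \<Rightarrow> (real \<Rightarrow> real) \<Rightarrow> (real \<Rightarrow> real) \<Rightarrow> real \<Rightarrow> partition \<times> partition \<Rightarrow> real" where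
  "lambda3 \<rho> \<sigma>1 \<sigma>2 \<beta> \<pi> = 8 * mu3 \<rho> \<sigma>1 \<sigma>2 \<pi> / \<beta>^2"

definition alpha :: "real \<Rightarrow> real \<Rightarrow> partition \<times> partition \<Rightarrow> real" where
  "alpha \<sigma> \<beta> \<pi> = sqrt 3 * \<sigma>^2 * mesh \<pi> / sqrt \<beta>"

definition good_partitions ::
  "real \<Rightarrow> (real \<Rightarrow> real) \<Rightarrow> (real \<Rightarrow> real) \<Rightarrow> (real \<Rightarrow> real) \<Rightarrow> real \<Rightarrow> real \<Rightarrow> real \<Rightarrow> real \<Rightarrow>
   (partition \<times> partition) set" where
  "good_partitions T \<rho> \<sigma>1 \<sigma>2 \<sigma> c1 \<beta> \<delta> =
     {\<pi> \<in> partition_pairs T. alpha \<sigma> \<beta> \<pi> < \<delta> \<and> lambda2 \<rho> \<sigma>1 \<sigma>2 \<beta> \<pi> < c1}"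


section \<open>Conditional expectation, convergence in probability, derivatives\<close>

definition generated_by :: "'a measure \<Rightarrow> 'b measure \<Rightarrow> ('a \<Rightarrow> 'b) \<Rightarrow> 'a measure" where
  "generated_by M N Z = vimage_algebra (space M) Z N"

definition complex_cond_exp :: "'a measure \<Rightarrow> 'a measure \<Rightarrow> ('a \<Rightarrow> complex) \<Rightarrow> 'a \<Rightarrow> complex" where
  "complex_cond_exp M F f \<omega> =
     Complex (real_cond_exp M F (\<lambda>\<omega>. Re (f \<omega>)) \<omega>) (real_cond_exp M F (\<lambda>\<omega>. Im (f \<omega>)) \<omega>)"

text \<open>Characteristic function of the normalized error with the partitions held fixed at \<open>\<pi>\<close>.
  This is the value at \<open>\<Pi> = \<pi>\<close> of the conditional characteristic function given \<open>\<Pi>\<close>, when \<open>\<Pi>\<close>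
  is independent of the observed processes.\<close>

definition cond_char_at ::
  "'a measure \<Rightarrow> real \<Rightarrow> (real \<Rightarrow> real) \<Rightarrow> (real \<Rightarrow> real) \<Rightarrow> (real \<Rightarrow> real) \<Rightarrow>
   (real \<Rightarrow> 'a \<Rightarrow> real) \<Rightarrow> (real \<Rightarrow> 'a \<Rightarrow> real) \<Rightarrow> real \<Rightarrow> partition \<times> partition \<Rightarrow> real \<Rightarrow> complex" where
  "cond_char_at M T \<rho> \<sigma>1 \<sigma>2 X1 X2 \<beta> \<pi> u =
     (\<integral>\<omega>. exp (\<i> * of_real (u * normalized_error T \<rho> \<sigma>1 \<sigma>2 X1 X2 \<beta> \<pi> \<omega>)) \<partial>M)"

definition tendsto_in_prob :: "'a measure \<Rightarrow> (nat \<Rightarrow> 'a \<Rightarrow> real) \<Rightarrow> real \<Rightarrow> bool" where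
  "tendsto_in_prob M Y c \<longleftrightarrow>
     (\<forall>\<epsilon>>0. (\<lambda>n. measure M {\<omega> \<in> space M. \<bar>Y n \<omega> - c\<bar> > \<epsilon>}) \<longlonglongrightarrow> 0)"

definition nth_deriv :: "nat \<Rightarrow> (real \<Rightarrow> complex) \<Rightarrow> real \<Rightarrow> complex" where
  "nth_deriv j f = ((\<lambda>g u. vector_derivative g (at u)) ^^ j) f"

end

theory Submission
  imports Defs "HOL-Complex_Analysis.Complex_Analysis"
begin

text \<open>With the partitions held fixed, the Gram--Schmidt procedure in each cell of the common refinement
  of the two grids turns the estimator into a quadratic form
  \<open>Q = \<Sum>\<^sub>e\<^sub>f S\<^sub>e\<^sub>f g\<^sub>e g\<^sub>f / 2\<close> in independent centered Gaussian variables, with \<open>\<theta> = tr S / 2\<close> up to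
  the factor \<open>1 / sqrt b\<close>. Gaussian integration by parts yields a recursion for the moments of \<open>Q\<close>
  in terms of \<open>tr S\<^sup>k\<close>, and this recursion says that the moment generating function is
  \<open>exp (\<Sum>\<^sub>k tr (S\<^sup>k) z\<^sup>k / (2 k))\<close> for small \<open>z\<close>. The combinatorics of overlapping intervals gives
  \<open>tr S\<^sup>2 = 2 \<lambda>\<^sub>2\<close> and \<open>tr S\<^sup>3 = sqrt b \<lambda>\<^sub>3\<close>. An interval of one grid meets intervals of the other grid of
  total length at most three times the mesh, whence \<open>\<parallel>S\<parallel> \<le> 4 \<alpha> < 4 \<delta>\<close>, and since
  \<open>\<bar>tr S\<^sup>k\<bar> \<le> \<parallel>S\<parallel>\<^bsup>k-2\<^esup> tr S\<^sup>2\<close>, the cumulants of order at least four contribute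
  \<open>O(\<delta>\<^sup>2 \<bar>z\<bar>\<^sup>4)\<close>. All this holds on complex discs of radius \<open>1 / (16 (1 + \<bar>u\<bar>))\<close> around \<open>u\<close>,
  so Cauchy's inequality transfers the estimate to the derivatives.\<close>

section \<open>Powers and traces of symmetric matrices\<close>

text \<open>No diagonalization of S occurs: the expectations of the forms with matrices S^k,
  multiplied by Q^n, satisfy a closed recursion in k and n. The range of u is dictated by the third
  cumulant. It is O(\<delta>), so its contribution \<delta> |z|^3 to the exponent stays bounded for
  |z| of order \<delta>^(-1/3). There the exponential of the correction differs from its
  linearization by the square of the correction, which is O(\<delta>^2) up to a power of |z|. The
  discs shrink like 1 / (1 + |u|) so that the real part of z^2 - u^2 stays bounded and the Gaussian
  weight at z is the weight at u up to a constant factor. Cauchy's inequality then costs (1 +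
  |u|)^j, which the exponent q absorbs. Since \<delta> ranges over all positive numbers, the case
  \<delta> > 1 gets a crude bound of its own; the range of u is bounded there. Conditioning has a
  separate obstacle: the paths are evaluated at random times. Independence is therefore exploited
  for time-discretized estimators, and continuity of the paths carries the result to the
  limit.\<close>

primrec mat_pow :: "'e set \<Rightarrow> ('e \<Rightarrow> 'e \<Rightarrow> real) \<Rightarrow> nat \<Rightarrow> 'e \<Rightarrow> 'e \<Rightarrow> real" where
  "mat_pow E S 0 e f = (if e = f then 1 else 0)"
| "mat_pow E S (Suc k) e f = (\<Sum>h\<in>E. S e h * mat_pow E S k h f)"

definition mat_tr :: "'e set \<Rightarrow> ('e \<Rightarrow> 'e \<Rightarrow> real) \<Rightarrow> real" where
  "mat_tr E A = (\<Sum>e\<in>E. A e e)"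

lemma mat_pow_1: "finite E \<Longrightarrow> f \<in> E \<Longrightarrow> mat_pow E S (Suc 0) e f = S e f"
  by (simp add: if_distrib sum.delta cong: if_cong)

lemma mat_pow_Suc_right:
  assumes "finite E" "e \<in> E" "f \<in> E"
  shows "mat_pow E S (Suc k) e f = (\<Sum>h\<in>E. mat_pow E S k e h * S h f)"
  using assms(2)
proof (induction k arbitrary: e)
  case 0
  have "(\<Sum>h\<in>E. (if e = h then 1 else 0) * S h f) = (\<Sum>h\<in>E. if e = h then S h f else 0)"
    by (rule sum.cong) auto
  then show ?case using 0 mat_pow_1[OF assms(1,3), of S e] by (simp add: assms(1) sum.delta')
next
  case (Suc k)
  have "mat_pow E S (Suc (Suc k)) e f = (\<Sum>h\<in>E. S e h * (\<Sum>g\<in>E. mat_pow E S k h g * S g f))"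
    using Suc by simp
  also have "\<dots> = (\<Sum>g\<in>E. (\<Sum>h\<in>E. S e h * mat_pow E S k h g) * S g f)"
    by (simp add: sum_distrib_left sum_distrib_right mult.assoc) (rule sum.swap)
  finally show ?case by simp
qed

lemma mat_pow_sym:
  assumes "finite E" and S: "\<And>e f. e \<in> E \<Longrightarrow> f \<in> E \<Longrightarrow> S e f = S f e" "e \<in> E" "f \<in> E"
  shows "mat_pow E S k e f = mat_pow E S k f e"
  using assms(3,4)
proof (induction k arbitrary: e f)
  case (Suc k)
  have "mat_pow E S (Suc k) e f = (\<Sum>h\<in>E. mat_pow E S k f h * S h e)"
    using Suc S by (auto intro!: sum.cong)
  also have "\<dots> = mat_pow E S (Suc k) f e"
    using mat_pow_Suc_right[OF assms(1) Suc.prems(2,1)] by simp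
  finally show ?case .
qed auto

lemma mat_tr_pow_2:
  assumes "finite E" shows "mat_tr E (mat_pow E S 2) = (\<Sum>e\<in>E. \<Sum>f\<in>E. S e f * S f e)"
  unfolding mat_tr_def numeral_2_eq_2
  by (subst mat_pow.simps) (intro sum.cong refl, simp only: mat_pow_1[OF assms])

lemma mat_tr_pow_3:
  assumes "finite E"
  shows "mat_tr E (mat_pow E S 3) = (\<Sum>e\<in>E. \<Sum>f\<in>E. \<Sum>g\<in>E. S e f * S f g * S g e)"
  unfolding mat_tr_def numeral_3_eq_3
  apply (subst mat_pow.simps, subst mat_pow.simps)
  apply (intro sum.cong refl)
  apply (simp only: mat_pow_1[OF assms] sum_distrib_left mult.assoc)
  done

lemma abs_sum_prod_le:
  fixes f g :: "'x \<Rightarrow> real"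
  shows "\<bar>\<Sum>x\<in>A. f x * g x\<bar> \<le> sqrt (\<Sum>x\<in>A. (f x)\<^sup>2) * sqrt (\<Sum>x\<in>A. (g x)\<^sup>2)"
proof -
  have "\<bar>\<Sum>x\<in>A. f x * g x\<bar> \<le> (\<Sum>x\<in>A. \<bar>f x\<bar> * \<bar>g x\<bar>)"
    by (rule order.trans[OF sum_abs]) (simp add: abs_mult)
  also have "\<dots> \<le> L2_set f A * L2_set g A" by (rule L2_set_mult_ineq)
  finally show ?thesis by (simp add: L2_set_def)
qed

text \<open>For symmetric S the trace of S^(k+2) is the Frobenius inner product of S and S^(k+1), so
  Cauchy-Schwarz reduces the claim to the squared Frobenius norms \<open>F\<close>. Applied column
  by column, \<open>op\<close> shows that one more factor S multiplies \<open>F\<close> by at most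
  s^2.\<close>

lemma mat_tr_pow_bound:
  assumes fin: "finite E"
    and sym: "\<And>e f. e \<in> E \<Longrightarrow> f \<in> E \<Longrightarrow> S e f = S f e"
    and op: "\<And>h. (\<Sum>e\<in>E. (\<Sum>f\<in>E. S e f * h f)\<^sup>2) \<le> s\<^sup>2 * (\<Sum>e\<in>E. (h e)\<^sup>2)" and "s \<ge> 0"
  shows "\<bar>mat_tr E (mat_pow E S (k + 2))\<bar> \<le> s ^ k * mat_tr E (mat_pow E S 2)"
    and "0 \<le> mat_tr E (mat_pow E S 2)"
proof -
  define F where "F m = (\<Sum>e\<in>E. \<Sum>f\<in>E. (mat_pow E S m f e)\<^sup>2)" for m
  have F1: "F (Suc 0) = mat_tr E (mat_pow E S 2)"
    unfolding mat_tr_pow_2[OF fin] F_def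
    by (intro sum.cong refl) (simp add: mat_pow_1[OF fin] sym power2_eq_square del: mat_pow.simps)
  have F0: "0 \<le> F m" for m unfolding F_def by (intro sum_nonneg) auto
  show "0 \<le> mat_tr E (mat_pow E S 2)" using F0[of "Suc 0"] F1 by simp
  have step: "F (Suc m) \<le> s\<^sup>2 * F m" for m
  proof -
    have "s\<^sup>2 * F m = (\<Sum>e\<in>E. s\<^sup>2 * (\<Sum>f\<in>E. (mat_pow E S m f e)\<^sup>2))"
      unfolding F_def by (rule sum_distrib_left)
    moreover have "F (Suc m) \<le> \<dots>"
      unfolding F_def by (rule sum_mono) (simp add: op)
    ultimately show ?thesis by simp
  qed
  have Fk: "F (Suc m) \<le> (s ^ m)\<^sup>2 * F (Suc 0)" for m
  proof (induction m)
    case (Suc m)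
    have "F (Suc (Suc m)) \<le> s\<^sup>2 * F (Suc m)" by (rule step)
    also have "\<dots> \<le> s\<^sup>2 * ((s ^ m)\<^sup>2 * F (Suc 0))" by (intro mult_left_mono Suc) auto
    finally show ?case by (simp add: power_mult_distrib mult.assoc)
  qed simp
  have "mat_tr E (mat_pow E S (k + 2)) = (\<Sum>e\<in>E. \<Sum>h\<in>E. S h e * mat_pow E S (Suc k) h e)"
    unfolding mat_tr_def by (intro sum.cong refl) (simp add: sym cong: sum.cong)
  also have "\<dots> = (\<Sum>(e,h)\<in>E\<times>E. S h e * mat_pow E S (Suc k) h e)"
    by (rule sum.cartesian_product)
  also have "\<bar>\<dots>\<bar> \<le> sqrt (\<Sum>x\<in>E\<times>E. (S (snd x) (fst x))\<^sup>2) * sqrt (\<Sum>x\<in>E\<times>E. (mat_pow E S (Suc k) (snd x) (fst x))\<^sup>2)"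
    unfolding case_prod_beta by (rule abs_sum_prod_le)
  also have "(\<Sum>x\<in>E\<times>E. (mat_pow E S (Suc k) (snd x) (fst x))\<^sup>2) = F (Suc k)"
    unfolding F_def sum.cartesian_product by (simp add: case_prod_beta)
  also have "(\<Sum>x\<in>E\<times>E. (S (snd x) (fst x))\<^sup>2) = F (Suc 0)"
    unfolding F_def sum.cartesian_product
    by (intro sum.cong refl) (auto simp: mat_pow_1[OF fin] simp del: mat_pow.simps)
  also have "sqrt (F (Suc 0)) * sqrt (F (Suc k)) \<le> sqrt (F (Suc 0)) * sqrt ((s ^ k)\<^sup>2 * F (Suc 0))"
    using Fk[of k] F0 by (intro mult_left_mono) auto
  also have "\<dots> = s ^ k * F (Suc 0)" using F0[of "Suc 0"] \<open>s \<ge> 0\<close> by (simp add: real_sqrt_mult)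
  finally show "\<bar>mat_tr E (mat_pow E S (k + 2))\<bar> \<le> s ^ k * mat_tr E (mat_pow E S 2)" unfolding F1 .
qed

section \<open>Overlaps of two grids\<close>

text \<open>The double sum factors into two-dimensional dot products within one cell
  (\<open>al\<close>, \<open>be\<close>) and within another (\<open>al'\<close>,
  \<open>be'\<close>). Abstract scalars stand for the overlap indicators, which makes this a pure
  polynomial identity.\<close>

lemma dot_contraction:
  fixes kpq kqr krq kqp krp kpr aq bq cq :: real and al be al' be' :: "bool \<Rightarrow> real"
  shows "(\<Sum>e\<in>UNIV. \<Sum>g\<in>UNIV.
     (kpq * kqr * cq * al e * be' g + kpq * krq * bq * al e * al' g
     + kqp * kqr * aq * be e * be' g + kqp * krq * cq * be e * al' g) * (krp * al' g * be e + kpr * be' g * al e))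
 = kpq * kqr * cq * (krp * (al True * be True + al False * be False) * (al' True * be' True + al' False * be' False)
         + kpr * (al True * al True + al False * al False) * (be' True * be' True + be' False * be' False))
     + kpq * krq * bq * (krp * (al True * be True + al False * be False) * (al' True * al' True + al' False * al' False)
         + kpr * (al True * al True + al False * al False) * (al' True * be' True + al' False * be' False))
     + kqp * kqr * aq * (krp * (be True * be True + be False * be False) * (al' True * be' True + al' False * be' False)
         + kpr * (al True * be True + al False * be False) * (be' True * be' True + be' False * be' False))
     + kqp * krq * cq * (krp * (be True * be True + be False * be False) * (al' True * al' True + al' False * al' False)
         + kpr * (al True * be True + al False * be False) * (al' True * be' True + al' False * be' False))"
  unfolding UNIV_bool by (simp, algebra)

section \<open>The staircase of meeting pairs of intervals\<close>

locale two_grids =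
  fixes s t :: "nat \<Rightarrow> real" and m n :: nat
  assumes s_less: "\<And>i. i < m \<Longrightarrow> s i < s (Suc i)" and t_less: "\<And>j. j < n \<Longrightarrow> t j < t (Suc j)"
begin

text \<open>For nondegenerate half-open intervals the two strict inequalities amount to a nonempty
  intersection, so all facts about overlaps become chains of inequalities between grid
  points.\<close>

definition meet :: "nat \<Rightarrow> nat \<Rightarrow> bool" where
  "meet i j \<longleftrightarrow> s i < t (Suc j) \<and> t j < s (Suc i)"

lemma s_le: "i < i' \<Longrightarrow> i' \<le> m \<Longrightarrow> s (Suc i) \<le> s i'"
proof (induction i')
  case (Suc k)
  then show ?case
  proof (cases "i = k")
    case False
    then have "s (Suc i) \<le> s k" using Suc by simp
    then show ?thesis using s_less[of k] Suc.prems by simp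
  qed simp
qed simp

lemma t_le: "j < j' \<Longrightarrow> j' \<le> n \<Longrightarrow> t (Suc j) \<le> t j'"
proof (induction j')
  case (Suc k)
  then show ?case
  proof (cases "j = k")
    case False
    then have "t (Suc j) \<le> t k" using Suc by simp
    then show ?thesis using t_less[of k] Suc.prems by simp
  qed simp
qed simp

text \<open>The meeting pairs form a monotone staircase; a descent would give
  \<open>s i' < t (Suc j') \<le> t j < s (Suc i) \<le> s i'\<close>.\<close>

lemma meet_mono:
  assumes "meet i j" "meet i' j'" "i < m" "i' < m" "j < n" "j' < n" "i < i'"
  shows "j \<le> j'"
proof (rule ccontr)
  assume "\<not> j \<le> j'"
  then have "t (Suc j') \<le> t j" using t_le[of j' j] assms by simp
  moreover have "s (Suc i) \<le> s i'" using s_le[of i i'] assms by simp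
  ultimately show False using assms unfolding meet_def by linarith
qed

text \<open>The two off-diagonal meetings would give
  \<open>s i' < t (Suc j) \<le> t j' < s (Suc i) \<le> s i'\<close>.\<close>

lemma meet_cross_strict:
  assumes "meet i j" "meet i' j'" "i < m" "i' < m" "j < n" "j' < n" "i < i'" "j < j'"
    "meet i j'" "meet i' j"
  shows False
  using s_le[of i i'] t_le[of j j'] assms unfolding meet_def by linarith

text \<open>A staircase contains no proper rectangle: cells that differ in both coordinates are
  ordered diagonally by \<open>meet_mono\<close>, and then the two remaining corners cannot both
  meet.\<close>

lemma meet_cross:
  assumes "meet i j" "meet i' j'" "i < m" "i' < m" "j < n" "j' < n"
  shows "meet i j' \<and> meet i' j \<longleftrightarrow> i = i' \<or> j = j'"
proof
  assume *: "meet i j' \<and> meet i' j"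
  show "i = i' \<or> j = j'"
  proof (rule ccontr)
    assume n: "\<not> (i = i' \<or> j = j')"
    then consider "i < i'" | "i' < i" by linarith
    then show False
    proof cases
      case 1
      then have "j < j'" using meet_mono[of i j i' j'] assms n by simp
      then show ?thesis using meet_cross_strict[of i j i' j'] assms * 1 by simp
    next
      case 2
      then have "j' < j" using meet_mono[of i' j' i j] assms n by simp
      then show ?thesis using meet_cross_strict[of i' j' i j] assms * 2 by simp
    qed
  qed
qed (use assms in auto)

text \<open>Such a meeting would have to jump over the middle pair:
  \<open>t j3 < s (Suc i1) \<le> s i2 < t (Suc j2) \<le> t j3\<close>, and symmetrically.\<close>

lemma meet_far:
  assumes "i1 < i2" "i2 < i3" "j1 < j2" "j2 < j3" "i3 < m" "j3 < n" "meet i1 j1" "meet i2 j2" "meet i3 j3"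
  shows "\<not> meet i1 j3" "\<not> meet i3 j1"
  using s_le[of i1 i2] s_le[of i2 i3] t_le[of j1 j2] t_le[of j2 j3] assms
  unfolding meet_def by linarith+

text \<open>The index \<open>(i, j)\<close> stands for the possibly empty cell \<open>I\<^sup>i \<inter> J\<^sup>j\<close> of the common refinement.\<close>

definition cells2 :: "(nat \<times> nat) set" where "cells2 = {..<m} \<times> {..<n}"

abbreviation ok :: "nat \<times> nat \<Rightarrow> bool" where
  "ok p \<equiv> p \<in> cells2 \<and> meet (fst p) (snd p)"

text \<open>\<open>kf p q\<close> is \<open>K\<^sub>I\<^sub>J\<close> for the interval \<open>I\<close> of the cell \<open>p\<close> and the interval \<open>J\<close> of the cell \<open>q\<close>.\<close>

definition kf :: "nat \<times> nat \<Rightarrow> nat \<times> nat \<Rightarrow> real" where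
  "kf p q = of_bool (meet (fst p) (snd q))"

definition nb :: "nat \<times> nat \<Rightarrow> nat \<times> nat \<Rightarrow> bool" where
  "nb p q \<longleftrightarrow> fst p = fst q \<or> snd p = snd q"

lemma nb_sym: "nb p q = nb q p" by (auto simp: nb_def)

lemma kf_mult: "ok p \<Longrightarrow> ok q \<Longrightarrow> kf p q * kf q p = of_bool (nb p q)"
  using meet_cross[of "fst p" "snd p" "fst q" "snd q"]
  by (auto simp: kf_def nb_def cells2_def)

lemma kf_nb: "ok p \<Longrightarrow> ok q \<Longrightarrow> nb p q \<Longrightarrow> kf p q = 1"
  using meet_cross[of "fst p" "snd p" "fst q" "snd q"]
  by (auto simp: kf_def nb_def cells2_def)

lemma kf_01: "kf p q = 0 \<or> kf p q = 1" by (simp add: kf_def)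

text \<open>Sorted by rows, the three cells are sorted by columns as well, and by
  \<open>meet_far\<close> the extreme ones do not meet in either direction. A three-cycle uses the
  edge between them in one of the two directions, so the product vanishes whatever the
  orientation.\<close>

lemma kf_triple_far:
  assumes "ok p" "ok q" "ok r" "\<not> nb p q" "\<not> nb q r" "\<not> nb r p"
  shows "kf p q * kf q r * kf r p = 0"
proof -
  have *: "kf p' r' = 0 \<and> kf r' p' = 0" if "ok p'" "ok q'" "ok r'" "\<not> nb p' q'" "\<not> nb q' r'" "\<not> nb r' p'"
    "fst p' < fst q'" "fst q' < fst r'" for p' q' r'
  proof -
    have "snd p' < snd q'" "snd q' < snd r'"
      using that meet_mono[of "fst p'" "snd p'" "fst q'" "snd q'"] meet_mono[of "fst q'" "snd q'" "fst r'" "snd r'"]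
      by (auto simp: nb_def cells2_def)
    then show ?thesis
      using meet_far[of "fst p'" "fst q'" "fst r'" "snd p'" "snd q'" "snd r'"] that by (auto simp: kf_def cells2_def)
  qed
  have "fst p \<noteq> fst q" "fst q \<noteq> fst r" "fst r \<noteq> fst p" using assms by (auto simp: nb_def)
  then consider "fst p < fst q" "fst q < fst r" | "fst p < fst r" "fst r < fst q"
    | "fst q < fst p" "fst p < fst r" | "fst q < fst r" "fst r < fst p"
    | "fst r < fst p" "fst p < fst q" | "fst r < fst q" "fst q < fst p" by linarith
  then show ?thesis
  proof cases
    case 1 then show ?thesis using *[of p q r] assms by (simp add: nb_sym)
  next
    case 2 then show ?thesis using *[of p r q] assms by (simp add: nb_sym)
  next
    case 3 then show ?thesis using *[of q p r] assms by (simp add: nb_sym)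
  next
    case 4 then show ?thesis using *[of q r p] assms by (simp add: nb_sym)
  next
    case 5 then show ?thesis using *[of r p q] assms by (simp add: nb_sym)
  next
    case 6 then show ?thesis using *[of r q p] assms by (simp add: nb_sym)
  qed
qed

text \<open>Cells p and q in a common row have the same outgoing indicators, so the product contains
  \<open>kf p r * kf r p\<close>, which vanishes because p and r are not neighbours. A common column
  works the same way with incoming indicators.\<close>

lemma kf_triple_one:
  assumes "ok p" "ok q" "ok r" "nb p q" "\<not> nb q r" "\<not> nb r p"
  shows "kf p q * kf q r * kf r p = 0"
proof (cases "fst p = fst q")
  case True
  then have "kf p r = kf q r" by (simp add: kf_def)
  then show ?thesis using kf_mult[of p r] assms by (simp add: nb_sym)
next
  case False
  then have "kf r p = kf r q" using assms by (simp add: kf_def nb_def)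
  then show ?thesis using kf_mult[of q r] assms by auto
qed

text \<open>The three cells form an L with corner q. One of the two pairs mixing p and r is the
  corner itself and meets; the other cannot meet, because p and r are not neighbours.\<close>

lemma kf_triple_two:
  assumes "ok p" "ok q" "ok r" "nb p q" "nb q r" "\<not> nb r p"
  shows "kf p q * kf q r * kf r p + kf r q * kf q p * kf p r = 1"
proof -
  have "kf p q = 1" "kf q r = 1" "kf r q = 1" "kf q p = 1"
    using kf_nb[of p q] kf_nb[of q p] kf_nb[of q r] kf_nb[of r q] assms by (simp_all add: nb_sym)
  moreover have "kf r p = 1 \<or> kf p r = 1"
  proof (cases "fst p = fst q")
    case True
    then have "snd q = snd r" using assms by (auto simp: nb_def)
    then show ?thesis using True assms by (auto simp: kf_def)
  next
    case False
    then have "snd p = snd q" "fst q = fst r" using assms by (auto simp: nb_def)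
    then show ?thesis using assms by (auto simp: kf_def)
  qed
  moreover have "kf r p * kf p r = 0" using kf_mult[of r p] assms by auto
  ultimately show ?thesis using kf_01[of r p] kf_01[of p r] by auto
qed

text \<open>The staircase shape of the set of meeting pairs determines the three-cycles of \<open>kf\<close> up to
  orientation, which is why only the sum over both orientations is a function of \<open>nb\<close>.\<close>

lemma kf_cycle:
  assumes "ok p" "ok q" "ok r"
  shows "kf p q * kf q r * kf r p + kf r q * kf q p * kf p r =
    (if nb p q \<and> nb q r \<and> nb r p then 2
     else if (nb p q \<and> nb q r) \<or> (nb q r \<and> nb r p) \<or> (nb r p \<and> nb p q) then 1 else 0)"
proof -
  have sy: "nb q p = nb p q" "nb r q = nb q r" "nb p r = nb r p" by (rule nb_sym)+
  consider "nb p q" "nb q r" "nb r p" | "nb p q" "nb q r" "\<not> nb r p"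
    | "nb q r" "nb r p" "\<not> nb p q" | "nb r p" "nb p q" "\<not> nb q r"
    | "nb p q" "\<not> nb q r" "\<not> nb r p" | "nb q r" "\<not> nb r p" "\<not> nb p q"
    | "nb r p" "\<not> nb p q" "\<not> nb q r" | "\<not> nb p q" "\<not> nb q r" "\<not> nb r p" by blast
  then show ?thesis
  proof cases
    case 1
    then show ?thesis using kf_nb[of p q] kf_nb[of q p] kf_nb[of q r] kf_nb[of r q] kf_nb[of p r] kf_nb[of r p] assms by (simp add: sy)
  next
    case 2
    then show ?thesis using kf_triple_two[of p q r] assms by (simp add: sy)
  next
    case 3
    then show ?thesis using kf_triple_two[of q r p] assms by (simp add: sy ac_simps)
  next
    case 4
    then show ?thesis using kf_triple_two[of r p q] assms by (simp add: sy ac_simps)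
  next
    case 5
    then show ?thesis using kf_triple_one[of p q r] kf_triple_one[of q p r] assms by (auto simp: sy ac_simps)
  next
    case 6
    then show ?thesis using kf_triple_one[of q r p] kf_triple_one[of r q p] assms by (auto simp: sy ac_simps)
  next
    case 7
    then show ?thesis using kf_triple_one[of r p q] kf_triple_one[of p r q] assms by (auto simp: sy ac_simps)
  next
    case 8
    then show ?thesis using kf_triple_far[of p q r] kf_triple_far[of r q p] assms by (auto simp: sy ac_simps)
  qed
qed

abbreviation eI :: "nat \<times> nat \<Rightarrow> nat \<times> nat \<Rightarrow> real" where "eI p q \<equiv> of_bool (fst q = fst p)"
abbreviation eJ :: "nat \<times> nat \<Rightarrow> nat \<times> nat \<Rightarrow> real" where "eJ p q \<equiv> of_bool (snd q = snd p)"
abbreviation eP :: "nat \<times> nat \<Rightarrow> nat \<times> nat \<Rightarrow> real" where "eP p q \<equiv> of_bool (q = p)"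

text \<open>The values 2, 1, 0 in \<open>kf_cycle\<close> are those of xy + yz + zx - xyz for the
  three neighbour indicators, and each indicator is eI + eJ - eP by inclusion-exclusion. After
  expansion every term reduces to a product of two indicators sharing a cell, so that a weighted sum
  over triples factors into row and column sums.\<close>

lemma kf_cycle_expand:
  assumes "ok p" "ok q" "ok r"
  shows "kf p q * kf q r * kf r p + kf r q * kf q p * kf p r =
    2 * (eI p q * eI p r) + 2 * (eJ p q * eJ p r) + 4 * (eP p q * eP p r)
    - 2 * (eP p q * eI p r + eP q r * eI q p + eP r p * eI r q)
    - 2 * (eP p q * eJ p r + eP q r * eJ q p + eP r p * eJ r q)
    + (eI p q * eJ p r + eI p r * eJ p q + eI q r * eJ q p + eI q p * eJ q r
       + eI r p * eJ r q + eI r q * eJ r p)"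
  unfolding kf_cycle[OF assms] nb_def prod_eq_iff
  apply (cases "fst p = fst q"; cases "fst q = fst r"; cases "fst r = fst p")
         apply (simp_all only: simp_thms if_True if_False)
  apply (cases "snd p = snd q"; cases "snd q = snd r"; cases "snd r = snd p"; simp)+
  done

section \<open>Weighted sums over triples of cells\<close>

definition Sum3 :: "(nat \<times> nat \<Rightarrow> real) \<Rightarrow> (nat \<times> nat \<Rightarrow> nat \<times> nat \<Rightarrow> nat \<times> nat \<Rightarrow> real) \<Rightarrow> real" where
  "Sum3 c F = (\<Sum>p\<in>cells2. \<Sum>q\<in>cells2. \<Sum>r\<in>cells2. c p * c q * c r * F p q r)"

text \<open>The weight \<open>c p * c q * c r\<close> is symmetric, so relabelling the three cells
  changes the kernel only.\<close>

lemma Sum3_rot: "Sum3 c (\<lambda>p q r. F q r p) = Sum3 c F"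
proof -
  have "Sum3 c (\<lambda>p q r. F q r p) = (\<Sum>q\<in>cells2. \<Sum>p\<in>cells2. \<Sum>r\<in>cells2. c p * c q * c r * F q r p)"
    unfolding Sum3_def by (rule sum.swap)
  also have "\<dots> = (\<Sum>q\<in>cells2. \<Sum>r\<in>cells2. \<Sum>p\<in>cells2. c p * c q * c r * F q r p)"
    by (intro sum.cong refl sum.swap)
  finally show ?thesis by (simp add: Sum3_def ac_simps)
qed

lemma Sum3_swap: "Sum3 c (\<lambda>p q r. F q p r) = Sum3 c F"
proof -
  have "Sum3 c (\<lambda>p q r. F q p r) = (\<Sum>q\<in>cells2. \<Sum>p\<in>cells2. \<Sum>r\<in>cells2. c p * c q * c r * F q p r)"
    unfolding Sum3_def by (rule sum.swap)
  then show ?thesis by (simp add: Sum3_def ac_simps)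
qed

lemma Sum3_add: "Sum3 c (\<lambda>p q r. F p q r + G p q r) = Sum3 c F + Sum3 c G"
  by (simp add: Sum3_def algebra_simps sum.distrib)

lemma Sum3_diff: "Sum3 c (\<lambda>p q r. F p q r - G p q r) = Sum3 c F - Sum3 c G"
  by (simp add: Sum3_def algebra_simps sum_subtractf)

lemma Sum3_cmult: "Sum3 c (\<lambda>p q r. k * F p q r) = k * Sum3 c F"
  by (simp add: Sum3_def sum_distrib_left mult.assoc mult.left_commute)

lemma Sum3_prod: "Sum3 c (\<lambda>p q r. F p q * G p r) =
  (\<Sum>p\<in>cells2. c p * (\<Sum>q\<in>cells2. c q * F p q) * (\<Sum>r\<in>cells2. c r * G p r))"
  unfolding Sum3_def by (simp add: sum_distrib_left sum_distrib_right ac_simps)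

definition row :: "(nat \<times> nat \<Rightarrow> real) \<Rightarrow> nat \<Rightarrow> real" where "row c i = (\<Sum>j<n. c (i, j))"
definition col :: "(nat \<times> nat \<Rightarrow> real) \<Rightarrow> nat \<Rightarrow> real" where "col c j = (\<Sum>i<m. c (i, j))"

lemma finite_cells2: "finite cells2" by (simp add: cells2_def)

lemma sum_cells2: "(\<Sum>p\<in>cells2. F p) = (\<Sum>i<m. \<Sum>j<n. F (i, j))"
  by (simp add: cells2_def sum.cartesian_product)

lemma sum_cells2': "(\<Sum>p\<in>cells2. F p) = (\<Sum>j<n. \<Sum>i<m. F (i, j))"
  unfolding sum_cells2 by (rule sum.swap)

lemma sum_eI: "p \<in> cells2 \<Longrightarrow> (\<Sum>q\<in>cells2. c q * eI p q) = row c (fst p)"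
proof -
  assume p: "p \<in> cells2"
  have "(\<Sum>q\<in>cells2. c q * eI p q) = (\<Sum>i<m. if i = fst p then row c i else 0)"
    unfolding sum_cells2 by (intro sum.cong) (auto simp: row_def)
  then show ?thesis using p by (auto simp: cells2_def)
qed

lemma sum_eJ: "p \<in> cells2 \<Longrightarrow> (\<Sum>q\<in>cells2. c q * eJ p q) = col c (snd p)"
proof -
  assume p: "p \<in> cells2"
  have "(\<Sum>q\<in>cells2. c q * eJ p q) = (\<Sum>j<n. if j = snd p then col c j else 0)"
    unfolding sum_cells2' by (intro sum.cong) (auto simp: col_def)
  then show ?thesis using p by (auto simp: cells2_def)
qed

lemma sum_eP: "p \<in> cells2 \<Longrightarrow> (\<Sum>q\<in>cells2. c q * eP p q) = c p"
  using finite_cells2 by (simp add: sum.delta cong: if_cong)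

text \<open>Reversing the orientation of the cycle does not change a symmetrically weighted sum, so
  twice the left side is the sum over both orientations, to which \<open>kf_cycle_expand\<close>
  applies. That identity needs all three cells to be meeting pairs; \<open>c0\<close> removes the
  other triples. Rotations merge the three choices of the shared cell, whence the factor 3.\<close>

lemma Sum3_cycle:
  assumes c0: "\<And>p. p \<in> cells2 \<Longrightarrow> \<not> meet (fst p) (snd p) \<Longrightarrow> c p = 0"
  shows "Sum3 c (\<lambda>p q r. kf p q * kf q r * kf r p) =
     (\<Sum>i<m. (row c i)^3) + (\<Sum>j<n. (col c j)^3) + 2 * (\<Sum>p\<in>cells2. (c p)^3)
     - 3 * (\<Sum>p\<in>cells2. (c p)\<^sup>2 * (row c (fst p) + col c (snd p)) - c p * row c (fst p) * col c (snd p))"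
proof -
  let ?f = "\<lambda>p q r. kf p q * kf q r * kf r p"
  have rev: "Sum3 c (\<lambda>p q r. kf r q * kf q p * kf p r) = Sum3 c ?f"
    using Sum3_swap[of c "\<lambda>p q r. kf q p * kf p r * kf r q"] Sum3_rot[of c ?f] Sum3_swap[of c ?f]
    by (simp add: ac_simps)
  have II: "Sum3 c (\<lambda>p q r. eI p q * eI p r) = (\<Sum>i<m. (row c i)^3)"
  proof -
    have "Sum3 c (\<lambda>p q r. eI p q * eI p r) = (\<Sum>p\<in>cells2. c p * (row c (fst p))\<^sup>2)"
      unfolding Sum3_prod by (intro sum.cong refl) (simp add: sum_eI power2_eq_square)
    also have "\<dots> = (\<Sum>i<m. row c i * (row c i)\<^sup>2)"
      unfolding sum_cells2 by (simp add: row_def sum_distrib_right)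
    finally show ?thesis by (simp add: power2_eq_square power3_eq_cube mult.assoc)
  qed
  have JJ: "Sum3 c (\<lambda>p q r. eJ p q * eJ p r) = (\<Sum>j<n. (col c j)^3)"
  proof -
    have "Sum3 c (\<lambda>p q r. eJ p q * eJ p r) = (\<Sum>p\<in>cells2. c p * (col c (snd p))\<^sup>2)"
      unfolding Sum3_prod by (intro sum.cong refl) (simp add: sum_eJ power2_eq_square)
    also have "\<dots> = (\<Sum>j<n. col c j * (col c j)\<^sup>2)"
      unfolding sum_cells2' by (simp add: col_def sum_distrib_right)
    finally show ?thesis by (simp add: power2_eq_square power3_eq_cube mult.assoc)
  qed
  have PP: "Sum3 c (\<lambda>p q r. eP p q * eP p r) = (\<Sum>p\<in>cells2. (c p)^3)"
    unfolding Sum3_prod by (intro sum.cong refl) (simp only: sum_eP power3_eq_cube)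
  have PI: "Sum3 c (\<lambda>p q r. eP p q * eI p r) = (\<Sum>p\<in>cells2. (c p)\<^sup>2 * row c (fst p))"
    unfolding Sum3_prod by (intro sum.cong refl) (simp only: sum_eP sum_eI power2_eq_square)
  have PJ: "Sum3 c (\<lambda>p q r. eP p q * eJ p r) = (\<Sum>p\<in>cells2. (c p)\<^sup>2 * col c (snd p))"
    unfolding Sum3_prod by (intro sum.cong refl) (simp only: sum_eP sum_eJ power2_eq_square)
  have IJ: "Sum3 c (\<lambda>p q r. eI p q * eJ p r) = (\<Sum>p\<in>cells2. c p * row c (fst p) * col c (snd p))"
    unfolding Sum3_prod by (intro sum.cong refl) (simp only: sum_eI sum_eJ)
  have JI: "Sum3 c (\<lambda>p q r. eI p r * eJ p q) = (\<Sum>p\<in>cells2. c p * row c (fst p) * col c (snd p))"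
    using Sum3_prod[of c eJ eI] by (simp add: mult.commute mult.assoc sum_eI sum_eJ mult.left_commute cong: sum.cong)
  have rot1: "Sum3 c (\<lambda>p q r. F q r p) = Sum3 c F" "Sum3 c (\<lambda>p q r. F r p q) = Sum3 c F" for F
    using Sum3_rot[of c F] Sum3_rot[of c "\<lambda>p q r. F q r p"] by auto
  have "2 * Sum3 c ?f = Sum3 c (\<lambda>p q r. ?f p q r + kf r q * kf q p * kf p r)"
    using rev by (simp add: Sum3_add)
  also have "\<dots> = Sum3 c (\<lambda>p q r.
    2 * (eI p q * eI p r) + 2 * (eJ p q * eJ p r) + 4 * (eP p q * eP p r)
    - 2 * (eP p q * eI p r + eP q r * eI q p + eP r p * eI r q)
    - 2 * (eP p q * eJ p r + eP q r * eJ q p + eP r p * eJ r q)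
    + (eI p q * eJ p r + eI p r * eJ p q + eI q r * eJ q p + eI q p * eJ q r
       + eI r p * eJ r q + eI r q * eJ r p))"
    unfolding Sum3_def
  proof (intro sum.cong refl)
    fix p q r assume "p \<in> cells2" "q \<in> cells2" "r \<in> cells2"
    then show "c p * c q * c r * (kf p q * kf q r * kf r p + kf r q * kf q p * kf p r) =
      c p * c q * c r * (2 * (eI p q * eI p r) + 2 * (eJ p q * eJ p r) + 4 * (eP p q * eP p r)
    - 2 * (eP p q * eI p r + eP q r * eI q p + eP r p * eI r q)
    - 2 * (eP p q * eJ p r + eP q r * eJ q p + eP r p * eJ r q)
    + (eI p q * eJ p r + eI p r * eJ p q + eI q r * eJ q p + eI q p * eJ q r
       + eI r p * eJ r q + eI r q * eJ r p))"
      using kf_cycle_expand[of p q r] c0[of p] c0[of q] c0[of r] by (cases "ok p \<and> ok q \<and> ok r") auto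
  qed
  also have "\<dots> = 2 * Sum3 c (\<lambda>p q r. eI p q * eI p r) + 2 * Sum3 c (\<lambda>p q r. eJ p q * eJ p r)
     + 4 * Sum3 c (\<lambda>p q r. eP p q * eP p r)
     - 6 * Sum3 c (\<lambda>p q r. eP p q * eI p r) - 6 * Sum3 c (\<lambda>p q r. eP p q * eJ p r)
     + 3 * Sum3 c (\<lambda>p q r. eI p q * eJ p r) + 3 * Sum3 c (\<lambda>p q r. eI p r * eJ p q)"
    unfolding Sum3_add Sum3_diff Sum3_cmult
      rot1[of "\<lambda>p q r. eP p q * eI p r"] rot1[of "\<lambda>p q r. eP p q * eJ p r"]
      rot1[of "\<lambda>p q r. eI p q * eJ p r"] rot1[of "\<lambda>p q r. eI p r * eJ p q"]
    by (simp only: distrib_left)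
  finally show ?thesis
    unfolding II JJ PP PI PJ IJ JI
    by (simp add: sum.distrib sum_subtractf algebra_simps)
qed

text \<open>With two independent standard Gaussian coordinates per cell, indexed by \<^typ>\<open>bool\<close>, and increments
  \<open>x p = \<Sum>\<^sub>e al p e g (p, e)\<close> and \<open>y p = \<Sum>\<^sub>e be p e g (p, e)\<close>, this is twice the symmetrized matrix of
  \<open>\<Sum>\<^sub>p\<^sub>q kf p q x p y q\<close>.\<close>

definition Smat :: "(nat \<times> nat \<Rightarrow> bool \<Rightarrow> real) \<Rightarrow> (nat \<times> nat \<Rightarrow> bool \<Rightarrow> real) \<Rightarrow>
    (nat \<times> nat) \<times> bool \<Rightarrow> (nat \<times> nat) \<times> bool \<Rightarrow> real" where
  "Smat al be x y = kf (fst x) (fst y) * al (fst x) (snd x) * be (fst y) (snd y)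
     + kf (fst y) (fst x) * be (fst x) (snd x) * al (fst y) (snd y)"

abbreviation index :: "((nat \<times> nat) \<times> bool) set" where "index \<equiv> cells2 \<times> UNIV"

lemma Smat_sym: "Smat al be x y = Smat al be y x"
  by (simp add: Smat_def)

lemma sum_index: "(\<Sum>x\<in>index. F x) = (\<Sum>p\<in>cells2. F (p, True) + F (p, False))"
  using sum.cartesian_product[of "\<lambda>p e. F (p, e)" "UNIV :: bool set" cells2] by (simp add: UNIV_bool add.commute)

lemma sum3_perm:
  fixes G :: "'b \<Rightarrow> 'b \<Rightarrow> 'b \<Rightarrow> real"
  shows "(\<Sum>p\<in>A. \<Sum>q\<in>A. \<Sum>r\<in>A. G q p r) = (\<Sum>p\<in>A. \<Sum>q\<in>A. \<Sum>r\<in>A. G p q r)"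
    "(\<Sum>p\<in>A. \<Sum>q\<in>A. \<Sum>r\<in>A. G p r q) = (\<Sum>p\<in>A. \<Sum>q\<in>A. \<Sum>r\<in>A. G p q r)"
    "(\<Sum>p\<in>A. \<Sum>q\<in>A. \<Sum>r\<in>A. G q r p) = (\<Sum>p\<in>A. \<Sum>q\<in>A. \<Sum>r\<in>A. G p q r)"
    "(\<Sum>p\<in>A. \<Sum>q\<in>A. \<Sum>r\<in>A. G r p q) = (\<Sum>p\<in>A. \<Sum>q\<in>A. \<Sum>r\<in>A. G p q r)"
    "(\<Sum>p\<in>A. \<Sum>q\<in>A. \<Sum>r\<in>A. G r q p) = (\<Sum>p\<in>A. \<Sum>q\<in>A. \<Sum>r\<in>A. G p q r)"
proof -
  have a: "(\<Sum>p\<in>A. \<Sum>q\<in>A. \<Sum>r\<in>A. H q p r) = (\<Sum>p\<in>A. \<Sum>q\<in>A. \<Sum>r\<in>A. H p q r)" for H :: "'b \<Rightarrow> 'b \<Rightarrow> 'b \<Rightarrow> real"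
    by (rule sum.swap)
  have b: "(\<Sum>p\<in>A. \<Sum>q\<in>A. \<Sum>r\<in>A. H p r q) = (\<Sum>p\<in>A. \<Sum>q\<in>A. \<Sum>r\<in>A. H p q r)" for H :: "'b \<Rightarrow> 'b \<Rightarrow> 'b \<Rightarrow> real"
    by (intro sum.cong refl sum.swap)
  show "(\<Sum>p\<in>A. \<Sum>q\<in>A. \<Sum>r\<in>A. G q p r) = (\<Sum>p\<in>A. \<Sum>q\<in>A. \<Sum>r\<in>A. G p q r)" by (rule a)
  show "(\<Sum>p\<in>A. \<Sum>q\<in>A. \<Sum>r\<in>A. G p r q) = (\<Sum>p\<in>A. \<Sum>q\<in>A. \<Sum>r\<in>A. G p q r)" by (rule b)
  show "(\<Sum>p\<in>A. \<Sum>q\<in>A. \<Sum>r\<in>A. G q r p) = (\<Sum>p\<in>A. \<Sum>q\<in>A. \<Sum>r\<in>A. G p q r)"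
    by (subst a) (rule b)
  show "(\<Sum>p\<in>A. \<Sum>q\<in>A. \<Sum>r\<in>A. G r p q) = (\<Sum>p\<in>A. \<Sum>q\<in>A. \<Sum>r\<in>A. G p q r)"
    by (subst b) (rule a)
  show "(\<Sum>p\<in>A. \<Sum>q\<in>A. \<Sum>r\<in>A. G r q p) = (\<Sum>p\<in>A. \<Sum>q\<in>A. \<Sum>r\<in>A. G p q r)"
    by (subst a, subst b) (rule a)
qed

text \<open>\<open>kf p q\<close> depends only on the row of p and the column of q; summing over the
  two free coordinates leaves row sums of \<open>a\<close> and column sums of
  \<open>b\<close>.\<close>

lemma sum_kf_prod:
  "(\<Sum>p\<in>cells2. \<Sum>q\<in>cells2. kf p q * a p * b q) = (\<Sum>i<m. \<Sum>j<n. row a i * col b j * of_bool (meet i j))"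
proof -
  have "(\<Sum>p\<in>cells2. \<Sum>q\<in>cells2. kf p q * a p * b q) =
    (\<Sum>i<m. \<Sum>j'<n. \<Sum>j<n. \<Sum>i'<m. of_bool (meet i j) * a (i, j') * b (i', j))"
    unfolding sum_cells2' sum_cells2 kf_def by (simp add: sum.swap[of _ "{..<m}" "{..<n}"])
  also have "\<dots> = (\<Sum>i<m. \<Sum>j<n. \<Sum>j'<n. \<Sum>i'<m. of_bool (meet i j) * a (i, j') * b (i', j))"
    by (intro sum.cong refl sum.swap)
  also have "\<dots> = (\<Sum>i<m. \<Sum>j<n. row a i * col b j * of_bool (meet i j))"
  proof (intro sum.cong refl)
    fix i j
    have "row a i * col b j * X = (\<Sum>j'<n. \<Sum>i'<m. a (i, j') * b (i', j)) * X" for X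
      unfolding row_def col_def sum_product ..
    then have "row a i * col b j * X = (\<Sum>j'<n. \<Sum>i'<m. a (i, j') * b (i', j) * X)" for X
      unfolding sum_distrib_right .
    from this[of "of_bool (meet i j)"]
    show "(\<Sum>j'<n. \<Sum>i'<m. of_bool (meet i j) * a (i, j') * b (i', j)) = row a i * col b j * of_bool (meet i j)"
      by (simp only: ac_simps)
  qed
  finally show ?thesis .
qed

section \<open>Traces of the symmetrized matrix\<close>

context
  fixes a b c :: "nat \<times> nat \<Rightarrow> real" and al be :: "nat \<times> nat \<Rightarrow> bool \<Rightarrow> real"
  assumes aa: "\<And>p. p \<in> cells2 \<Longrightarrow> al p True * al p True + al p False * al p False = a p"
    and ab: "\<And>p. p \<in> cells2 \<Longrightarrow> al p True * be p True + al p False * be p False = c p"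
    and bb: "\<And>p. p \<in> cells2 \<Longrightarrow> be p True * be p True + be p False * be p False = b p"
    and c0: "\<And>p. p \<in> cells2 \<Longrightarrow> \<not> meet (fst p) (snd p) \<Longrightarrow> c p = 0"
begin

lemma Smat_tr_1: "(\<Sum>x\<in>index. Smat al be x x) = 2 * (\<Sum>p\<in>cells2. c p)"
  unfolding sum_index sum_distrib_left
proof (intro sum.cong refl)
  fix p assume p: "p \<in> cells2"
  have "Smat al be (p, True) (p, True) + Smat al be (p, False) (p, False) = kf p p * (2 * c p)"
    unfolding ab[OF p, symmetric] by (simp add: Smat_def algebra_simps)
  also have "\<dots> = 2 * c p"
    using c0[OF p] by (cases "meet (fst p) (snd p)") (auto simp: kf_def)
  finally show "Smat al be (p, True) (p, True) + Smat al be (p, False) (p, False) = 2 * c p" .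
qed

text \<open>Summing over the Gaussian coordinates leaves only the Gram entries \<open>a\<close>,
  \<open>b\<close>, \<open>c\<close> of the vectors \<open>al\<close> and \<open>be\<close>. The
  pure products give the overlap sum via \<open>sum_kf_prod\<close>; the mixed ones carry
  \<open>kf p q * kf q p\<close>, the neighbour indicator eI + eJ - eP, and give the three sums of
  squares.\<close>

lemma Smat_tr_2: "(\<Sum>x\<in>index. \<Sum>y\<in>index. Smat al be x y * Smat al be y x) =
   2 * (\<Sum>i<m. \<Sum>j<n. row a i * col b j * of_bool (meet i j))
   + 2 * ((\<Sum>i<m. (row c i)\<^sup>2) + (\<Sum>j<n. (col c j)\<^sup>2) - (\<Sum>p\<in>cells2. (c p)\<^sup>2))"
proof -
  have "(\<Sum>x\<in>index. \<Sum>y\<in>index. Smat al be x y * Smat al be y x) =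
    (\<Sum>p\<in>cells2. \<Sum>q\<in>cells2. kf p q * a p * b q + kf q p * a q * b p + 2 * (c p * c q * (kf p q * kf q p)))"
    unfolding sum_index sum.distrib[symmetric]
  proof (intro sum.cong refl)
    fix p q assume p: "p \<in> cells2" and q: "q \<in> cells2"
    have k: "kf u v * kf u v = kf u v" for u v using kf_01[of u v] by auto
    have "(Smat al be (p, True) (q, True) * Smat al be (q, True) (p, True) +
        Smat al be (p, True) (q, False) * Smat al be (q, False) (p, True)) +
       (Smat al be (p, False) (q, True) * Smat al be (q, True) (p, False) +
        Smat al be (p, False) (q, False) * Smat al be (q, False) (p, False))
      = (kf p q * kf p q) * a p * b q + (kf q p * kf q p) * a q * b p + 2 * (c p * c q * (kf p q * kf q p))"
      unfolding aa[OF p, symmetric] aa[OF q, symmetric] ab[OF p, symmetric] ab[OF q, symmetric]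
        bb[OF p, symmetric] bb[OF q, symmetric] Smat_def fst_conv snd_conv
      by algebra
    then show "(Smat al be (p, True) (q, True) * Smat al be (q, True) (p, True) +
        Smat al be (p, True) (q, False) * Smat al be (q, False) (p, True)) +
       (Smat al be (p, False) (q, True) * Smat al be (q, True) (p, False) +
        Smat al be (p, False) (q, False) * Smat al be (q, False) (p, False))
      = kf p q * a p * b q + kf q p * a q * b p + 2 * (c p * c q * (kf p q * kf q p))"
      by (simp only: k)
  qed
  also have "\<dots> = 2 * (\<Sum>p\<in>cells2. \<Sum>q\<in>cells2. kf p q * a p * b q)
      + 2 * (\<Sum>p\<in>cells2. \<Sum>q\<in>cells2. c p * c q * (kf p q * kf q p))"
  proof -
    have "(\<Sum>p\<in>cells2. \<Sum>q\<in>cells2. kf q p * a q * b p) = (\<Sum>p\<in>cells2. \<Sum>q\<in>cells2. kf p q * a p * b q)"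
      by (rule sum.swap)
    then show ?thesis by (simp add: sum.distrib sum_distrib_left)
  qed
  also have "(\<Sum>p\<in>cells2. \<Sum>q\<in>cells2. kf p q * a p * b q) = (\<Sum>i<m. \<Sum>j<n. row a i * col b j * of_bool (meet i j))"
    by (rule sum_kf_prod)
  also have "(\<Sum>p\<in>cells2. \<Sum>q\<in>cells2. c p * c q * (kf p q * kf q p)) =
    (\<Sum>p\<in>cells2. \<Sum>q\<in>cells2. c p * (c q * eI p q + c q * eJ p q - c q * eP p q))"
  proof (intro sum.cong refl)
    fix p q assume pq: "p \<in> cells2" "q \<in> cells2"
    show "c p * c q * (kf p q * kf q p) = c p * (c q * eI p q + c q * eJ p q - c q * eP p q)"
    proof (cases "ok p \<and> ok q")
      case True
      then show ?thesis by (auto simp: kf_mult nb_def prod_eq_iff)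
    next
      case False
      then show ?thesis using pq c0[of p] c0[of q] by auto
    qed
  qed
  also have "\<dots> = (\<Sum>p\<in>cells2. c p * (row c (fst p) + col c (snd p) - c p))"
    unfolding sum_distrib_left[symmetric]
    by (intro sum.cong refl) (simp only: sum.distrib sum_subtractf sum_eI sum_eJ sum_eP)
  also have "\<dots> = (\<Sum>p\<in>cells2. c p * row c (fst p)) + (\<Sum>p\<in>cells2. c p * col c (snd p)) - (\<Sum>p\<in>cells2. (c p)\<^sup>2)"
    by (simp add: algebra_simps sum.distrib sum_subtractf power2_eq_square)
  also have "(\<Sum>p\<in>cells2. c p * row c (fst p)) = (\<Sum>i<m. (row c i)\<^sup>2)"
    unfolding sum_cells2 power2_eq_square by (simp add: row_def sum_distrib_right)
  also have "(\<Sum>p\<in>cells2. c p * col c (snd p)) = (\<Sum>j<n. (col c j)\<^sup>2)"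
    unfolding sum_cells2' power2_eq_square by (simp add: col_def sum_distrib_right)
  finally show ?thesis by simp
qed

text \<open>Each factor is a sum of two arrows between its cells, so the product runs over the eight
  tournaments on p, q, r. A cell with two outgoing arrows contributes \<open>a\<close>, one with two
  incoming arrows \<open>b\<close>, and one that is passed through \<open>c\<close>. The two cyclic
  tournaments give the c-terms, the six transitive ones the terms \<open>H\<close>.\<close>

lemma Smat_cycle_term:
  assumes p: "p \<in> cells2" and q: "q \<in> cells2" and r: "r \<in> cells2"
  defines "H \<equiv> \<lambda>p q r. a p * c q * b r * (kf p q * kf q r * kf p r)"
  shows "(\<Sum>e\<in>UNIV. \<Sum>f\<in>UNIV. \<Sum>g\<in>UNIV. Smat al be (p, e) (q, f) * Smat al be (q, f) (r, g) * Smat al be (r, g) (p, e))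
    = c p * c q * c r * (kf p q * kf q r * kf r p + kf r q * kf q p * kf p r)
      + H p q r + H q r p + H r p q + H r q p + H q p r + H p r q"
proof -
  \<comment> \<open>The middle cell q is contracted separately; what remains has the shape required
    by \<open>dot_contraction\<close>.\<close>
  define M where "M e g = kf p q * kf q r * c q * al p e * be r g + kf p q * kf r q * b q * al p e * al r g
     + kf q p * kf q r * a q * be p e * be r g + kf q p * kf r q * c q * be p e * al r g" for e g
  have M: "(\<Sum>f\<in>UNIV. Smat al be (p, e) (q, f) * Smat al be (q, f) (r, g)) = M e g" for e g
    unfolding M_def aa[OF q, symmetric] ab[OF q, symmetric] bb[OF q, symmetric] Smat_def fst_conv snd_conv
    unfolding UNIV_bool by (simp, algebra)
  have "(\<Sum>e\<in>UNIV. \<Sum>f\<in>UNIV. \<Sum>g\<in>UNIV. Smat al be (p, e) (q, f) * Smat al be (q, f) (r, g) * Smat al be (r, g) (p, e))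
    = (\<Sum>e\<in>UNIV. \<Sum>g\<in>UNIV. (\<Sum>f\<in>UNIV. Smat al be (p, e) (q, f) * Smat al be (q, f) (r, g)) * Smat al be (r, g) (p, e))"
    unfolding sum_distrib_right by (intro sum.cong refl sum.swap)
  also have "\<dots> = (\<Sum>e\<in>UNIV. \<Sum>g\<in>UNIV. M e g * Smat al be (r, g) (p, e))" unfolding M ..
  also have "\<dots> = kf p q * kf q r * c q * (kf r p * c p * c r + kf p r * a p * b r)
     + kf p q * kf r q * b q * (kf r p * c p * a r + kf p r * a p * c r)
     + kf q p * kf q r * a q * (kf r p * b p * c r + kf p r * c p * b r)
     + kf q p * kf r q * c q * (kf r p * b p * a r + kf p r * c p * c r)"
    unfolding M_def aa[OF p, symmetric] aa[OF r, symmetric] ab[OF p, symmetric]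
      ab[OF r, symmetric] bb[OF p, symmetric] bb[OF r, symmetric] Smat_def fst_conv snd_conv
    by (rule dot_contraction)
  finally show ?thesis unfolding H_def by algebra
qed

text \<open>By \<open>meet_cross\<close> the cells q through which I and J are linked are those in
  row i or column j, and the cell (i, j) would be counted twice. For covariance weights the value is
  v(I \<union> J).\<close>

lemma sum_via:
  assumes "i < m" "j < n" "meet i j"
  shows "(\<Sum>q\<in>cells2. c q * (of_bool (meet i (snd q)) * of_bool (meet (fst q) j))) = row c i + col c j - c (i, j)"
proof -
  have ij: "(i, j) \<in> cells2" using assms by (simp add: cells2_def)
  have "(\<Sum>q\<in>cells2. c q * (of_bool (meet i (snd q)) * of_bool (meet (fst q) j))) =
    (\<Sum>q\<in>cells2. c q * eI (i, j) q + c q * eJ (i, j) q - c q * eP (i, j) q)"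
  proof (intro sum.cong refl)
    fix q assume q: "q \<in> cells2"
    show "c q * (of_bool (meet i (snd q)) * of_bool (meet (fst q) j)) =
       c q * eI (i, j) q + c q * eJ (i, j) q - c q * eP (i, j) q"
    proof (cases "meet (fst q) (snd q)")
      case True
      then have "meet i (snd q) \<and> meet (fst q) j \<longleftrightarrow> i = fst q \<or> j = snd q"
        using meet_cross[of i j "fst q" "snd q"] assms q by (auto simp: cells2_def)
      then have "of_bool (meet i (snd q)) * of_bool (meet (fst q) j) = (of_bool (i = fst q \<or> j = snd q) :: real)"
        unfolding of_bool_conj[symmetric] by (simp only:)
      then show ?thesis by (auto simp: prod_eq_iff)
    qed (use c0[OF q] in auto)
  qed
  also have "\<dots> = row c i + col c j - c (i, j)"
    unfolding sum.distrib sum_subtractf sum_eI[OF ij] sum_eJ[OF ij] sum_eP[OF ij] by simp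
  finally show ?thesis .
qed

text \<open>The two cyclic tournaments contribute \<open>Sum3_cycle\<close> each. The six transitive
  ones agree after relabelling, and summing over the cell that is passed through is
  \<open>sum_via\<close>.\<close>

lemma Smat_tr_3: "(\<Sum>x\<in>index. \<Sum>y\<in>index. \<Sum>z\<in>index. Smat al be x y * Smat al be y z * Smat al be z x) =
   2 * ((\<Sum>i<m. (row c i)^3) + (\<Sum>j<n. (col c j)^3) + 2 * (\<Sum>p\<in>cells2. (c p)^3)
     - 3 * (\<Sum>p\<in>cells2. (c p)\<^sup>2 * (row c (fst p) + col c (snd p)) - c p * row c (fst p) * col c (snd p)))
   + 6 * (\<Sum>i<m. \<Sum>j<n. row a i * col b j * (row c i + col c j - c (i, j)) * of_bool (meet i j))"
proof -
  let ?T = "\<lambda>x y z. Smat al be x y * Smat al be y z * Smat al be z x"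
  define H where "H p q r = a p * c q * b r * (kf p q * kf q r * kf p r)" for p q r
  let ?F = "\<lambda>p q r. c p * c q * c r * (kf p q * kf q r * kf r p)"
  have sx: "(\<Sum>x\<in>index. F x) = (\<Sum>p\<in>cells2. \<Sum>e\<in>UNIV. F (p, e))" for F :: "(nat \<times> nat) \<times> bool \<Rightarrow> real"
    by (simp add: sum.cartesian_product)
  have "(\<Sum>x\<in>index. \<Sum>y\<in>index. \<Sum>z\<in>index. ?T x y z) =
    (\<Sum>p\<in>cells2. \<Sum>e\<in>UNIV. \<Sum>q\<in>cells2. \<Sum>f\<in>UNIV. \<Sum>r\<in>cells2. \<Sum>g\<in>UNIV. ?T (p,e) (q,f) (r,g))"
    unfolding sx ..
  also have "\<dots> = (\<Sum>p\<in>cells2. \<Sum>q\<in>cells2. \<Sum>r\<in>cells2. \<Sum>e\<in>UNIV. \<Sum>f\<in>UNIV. \<Sum>g\<in>UNIV. ?T (p,e) (q,f) (r,g))"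
    unfolding sum.swap[of _ cells2 "UNIV :: bool set"] ..
  also have "\<dots> = (\<Sum>p\<in>cells2. \<Sum>q\<in>cells2. \<Sum>r\<in>cells2.
     c p * c q * c r * (kf p q * kf q r * kf r p + kf r q * kf q p * kf p r)
      + H p q r + H q r p + H r p q + H r q p + H q p r + H p r q)"
    unfolding H_def by (intro sum.cong refl) (rule Smat_cycle_term)
  also have "\<dots> = (\<Sum>p\<in>cells2. \<Sum>q\<in>cells2. \<Sum>r\<in>cells2.
     ?F p q r + ?F r q p + H p q r + H q r p + H r p q + H r q p + H q p r + H p r q)"
    by (intro sum.cong refl) (simp add: algebra_simps)
  also have "\<dots> = 2 * (\<Sum>p\<in>cells2. \<Sum>q\<in>cells2. \<Sum>r\<in>cells2. ?F p q r)
      + 6 * (\<Sum>p\<in>cells2. \<Sum>q\<in>cells2. \<Sum>r\<in>cells2. H p q r)"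
    unfolding sum.distrib sum3_perm[where G = H] sum3_perm(5)[where G = ?F] by simp
  also have "(\<Sum>p\<in>cells2. \<Sum>q\<in>cells2. \<Sum>r\<in>cells2. ?F p q r) = Sum3 c (\<lambda>p q r. kf p q * kf q r * kf r p)"
    by (simp add: Sum3_def)
  also have "(\<Sum>p\<in>cells2. \<Sum>q\<in>cells2. \<Sum>r\<in>cells2. H p q r) =
     (\<Sum>i<m. \<Sum>j<n. row a i * col b j * (row c i + col c j - c (i, j)) * of_bool (meet i j))"
  proof -
    have "(\<Sum>p\<in>cells2. \<Sum>q\<in>cells2. \<Sum>r\<in>cells2. H p q r) = (\<Sum>p\<in>cells2. \<Sum>r\<in>cells2. \<Sum>q\<in>cells2. H p q r)"
      by (intro sum.cong refl sum.swap)
    also have "\<dots> = (\<Sum>p\<in>cells2. \<Sum>r\<in>cells2. a p * b r *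
       ((row c (fst p) + col c (snd r) - c (fst p, snd r)) * of_bool (meet (fst p) (snd r))))"
    proof (intro sum.cong refl)
      fix p r assume pr: "p \<in> cells2" "r \<in> cells2"
      have "(\<Sum>q\<in>cells2. H p q r) = a p * b r * (of_bool (meet (fst p) (snd r)) *
         (\<Sum>q\<in>cells2. c q * (of_bool (meet (fst p) (snd q)) * of_bool (meet (fst q) (snd r)))))"
        unfolding H_def kf_def sum_distrib_left by (intro sum.cong refl) (simp add: ac_simps)
      then show "(\<Sum>q\<in>cells2. H p q r) = a p * b r *
       ((row c (fst p) + col c (snd r) - c (fst p, snd r)) * of_bool (meet (fst p) (snd r)))"
        using sum_via[of "fst p" "snd r"] pr by (auto simp: cells2_def)
    qed
    also have "\<dots> = (\<Sum>i<m. \<Sum>j'<n. \<Sum>j<n. \<Sum>i'<m. a (i, j') * b (i', j) * ((row c i + col c j - c (i, j)) * of_bool (meet i j)))"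
      unfolding sum_cells2' sum_cells2 by (simp add: sum.swap[of _ "{..<m}" "{..<n}"])
    also have "\<dots> = (\<Sum>i<m. \<Sum>j<n. \<Sum>j'<n. \<Sum>i'<m. a (i, j') * b (i', j) * ((row c i + col c j - c (i, j)) * of_bool (meet i j)))"
      by (intro sum.cong refl sum.swap)
    also have "\<dots> = (\<Sum>i<m. \<Sum>j<n. row a i * col b j * (row c i + col c j - c (i, j)) * of_bool (meet i j))"
    proof (intro sum.cong refl)
      fix i j
      have "row a i * col b j * X = (\<Sum>j'<n. \<Sum>i'<m. a (i, j') * b (i', j)) * X" for X
        unfolding row_def col_def sum_product ..
      then have "row a i * col b j * X = (\<Sum>j'<n. \<Sum>i'<m. a (i, j') * b (i', j) * X)" for X
        unfolding sum_distrib_right .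
      then show "(\<Sum>j'<n. \<Sum>i'<m. a (i, j') * b (i', j) * ((row c i + col c j - c (i, j)) * of_bool (meet i j)))
        = row a i * col b j * (row c i + col c j - c (i, j)) * of_bool (meet i j)"
        by (simp add: mult.assoc)
    qed
    finally show ?thesis .
  qed
  also have "Sum3 c (\<lambda>p q r. kf p q * kf q r * kf r p) =
     (\<Sum>i<m. (row c i)^3) + (\<Sum>j<n. (col c j)^3) + 2 * (\<Sum>p\<in>cells2. (c p)^3)
     - 3 * (\<Sum>p\<in>cells2. (c p)\<^sup>2 * (row c (fst p) + col c (snd p)) - c p * row c (fst p) * col c (snd p))"
    using Sum3_cycle[where c = c] c0 by blast
  finally show ?thesis .
qed

end

text \<open>Schur's test: the weights are exchanged before Cauchy-Schwarz,
  \<open>a p * G p * b q * H q\<close> being split into \<open>b q * G p\<close> and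
  \<open>a p * H q\<close>. The inner sums over q and over p are then bounded by B through
  \<open>rb\<close> and \<open>cb\<close>.\<close>

lemma kf_bilinear_bound:
  fixes a b x y G H :: "nat \<times> nat \<Rightarrow> real"
  assumes nonneg: "\<And>p. p \<in> cells2 \<Longrightarrow> 0 \<le> a p" "\<And>p. p \<in> cells2 \<Longrightarrow> 0 \<le> b p"
      "\<And>p. p \<in> cells2 \<Longrightarrow> 0 \<le> G p" "\<And>p. p \<in> cells2 \<Longrightarrow> 0 \<le> H p" "0 \<le> B"
    and rb: "\<And>p. p \<in> cells2 \<Longrightarrow> (\<Sum>q\<in>cells2. kf p q * b q) \<le> B"
    and cb: "\<And>q. q \<in> cells2 \<Longrightarrow> (\<Sum>p\<in>cells2. kf p q * a p) \<le> B"
    and x: "\<And>p. p \<in> cells2 \<Longrightarrow> (x p)\<^sup>2 \<le> a p * G p"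
    and y: "\<And>q. q \<in> cells2 \<Longrightarrow> (y q)\<^sup>2 \<le> b q * H q"
  shows "\<bar>\<Sum>p\<in>cells2. \<Sum>q\<in>cells2. kf p q * x p * y q\<bar> \<le> B * sqrt (\<Sum>p\<in>cells2. G p) * sqrt (\<Sum>q\<in>cells2. H q)"
proof -
  let ?f = "\<lambda>z. sqrt (kf (fst z) (snd z) * b (snd z) * G (fst z))"
  let ?g = "\<lambda>z. sqrt (kf (fst z) (snd z) * a (fst z) * H (snd z))"
  have kn: "0 \<le> kf p q" for p q using kf_01[of p q] by auto
  have "\<bar>\<Sum>p\<in>cells2. \<Sum>q\<in>cells2. kf p q * x p * y q\<bar> = \<bar>\<Sum>z\<in>cells2\<times>cells2. kf (fst z) (snd z) * x (fst z) * y (snd z)\<bar>"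
    by (simp add: sum.cartesian_product case_prod_beta)
  also have "\<dots> \<le> (\<Sum>z\<in>cells2\<times>cells2. \<bar>kf (fst z) (snd z) * x (fst z) * y (snd z)\<bar>)" by (rule sum_abs)
  also have "\<dots> \<le> (\<Sum>z\<in>cells2\<times>cells2. ?f z * ?g z)"
  proof (rule sum_mono)
    fix z assume z: "z \<in> cells2 \<times> cells2"
    then have p: "fst z \<in> cells2" and q: "snd z \<in> cells2" by auto
    have "\<bar>x (fst z)\<bar> * \<bar>y (snd z)\<bar> \<le> sqrt (a (fst z) * G (fst z)) * sqrt (b (snd z) * H (snd z))"
      using real_sqrt_le_mono[OF x[OF p]] real_sqrt_le_mono[OF y[OF q]] by (intro mult_mono) (auto simp: nonneg p q)
    then show "\<bar>kf (fst z) (snd z) * x (fst z) * y (snd z)\<bar> \<le> ?f z * ?g z"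
      using kf_01[of "fst z" "snd z"] by (auto simp: abs_mult real_sqrt_mult ac_simps)
  qed
  also have "\<dots> \<le> \<bar>\<Sum>z\<in>cells2\<times>cells2. ?f z * ?g z\<bar>" by simp
  also have "\<dots> \<le> sqrt (\<Sum>z\<in>cells2\<times>cells2. (?f z)\<^sup>2) * sqrt (\<Sum>z\<in>cells2\<times>cells2. (?g z)\<^sup>2)"
    by (rule abs_sum_prod_le)
  also have "(\<Sum>z\<in>cells2\<times>cells2. (?f z)\<^sup>2) = (\<Sum>p\<in>cells2. (\<Sum>q\<in>cells2. kf p q * b q) * G p)"
    unfolding sum_distrib_right sum.cartesian_product
    by (intro sum.cong refl) (auto simp: nonneg kn)
  also have "(\<Sum>z\<in>cells2\<times>cells2. (?g z)\<^sup>2) = (\<Sum>p\<in>cells2. \<Sum>q\<in>cells2. kf p q * a p * H q)"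
    unfolding sum.cartesian_product
    by (intro sum.cong refl) (auto simp: nonneg kn)
  also have "\<dots> = (\<Sum>q\<in>cells2. (\<Sum>p\<in>cells2. kf p q * a p) * H q)"
    unfolding sum_distrib_right by (rule sum.swap)
  also have "sqrt (\<Sum>p\<in>cells2. (\<Sum>q\<in>cells2. kf p q * b q) * G p) * sqrt (\<Sum>q\<in>cells2. (\<Sum>p\<in>cells2. kf p q * a p) * H q)
     \<le> sqrt (\<Sum>p\<in>cells2. B * G p) * sqrt (\<Sum>q\<in>cells2. B * H q)"
    by (intro mult_mono real_sqrt_le_mono sum_mono mult_right_mono rb cb nonneg)
       (auto intro!: sum_nonneg mult_nonneg_nonneg nonneg kn)
  also have "\<dots> = B * sqrt (\<Sum>p\<in>cells2. G p) * sqrt (\<Sum>q\<in>cells2. H q)"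
    using nonneg(5) by (simp add: sum_distrib_left[symmetric] real_sqrt_mult)
  finally show ?thesis .
qed

text \<open>With g = S h, the squared norm of g equals the pairing of g with S h, which splits into
  two bilinear forms, each at most B times the norms of g and h. Cancelling one norm of g gives 2
  B.\<close>

lemma Smat_op_bound:
  fixes h :: "(nat \<times> nat) \<times> bool \<Rightarrow> real"
  assumes aa: "\<And>p. p \<in> cells2 \<Longrightarrow> al p True * al p True + al p False * al p False = a p"
    and bb: "\<And>p. p \<in> cells2 \<Longrightarrow> be p True * be p True + be p False * be p False = b p"
    and B: "0 \<le> B"
    and rb: "\<And>p. p \<in> cells2 \<Longrightarrow> (\<Sum>q\<in>cells2. kf p q * b q) \<le> B"
    and cb: "\<And>q. q \<in> cells2 \<Longrightarrow> (\<Sum>p\<in>cells2. kf p q * a p) \<le> B"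
  shows "(\<Sum>x\<in>index. (\<Sum>y\<in>index. Smat al be x y * h y)\<^sup>2) \<le> (2 * B)\<^sup>2 * (\<Sum>x\<in>index. (h x)\<^sup>2)"
proof -
  have a0: "0 \<le> a p" if "p \<in> cells2" for p unfolding aa[OF that, symmetric] by simp
  have b0: "0 \<le> b p" if "p \<in> cells2" for p unfolding bb[OF that, symmetric] by simp
  define g where "g x = (\<Sum>y\<in>index. Smat al be x y * h y)" for x
  define N where "N f p = (f (p, True))\<^sup>2 + (f (p, False))\<^sup>2" for f :: "(nat \<times> nat) \<times> bool \<Rightarrow> real" and p
  define A where "A f p = al p True * f (p, True) + al p False * f (p, False)" for f :: "(nat \<times> nat) \<times> bool \<Rightarrow> real" and p
  define D where "D f p = be p True * f (p, True) + be p False * f (p, False)" for f :: "(nat \<times> nat) \<times> bool \<Rightarrow> real" and p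
  have cs: "(u * x + v * y)\<^sup>2 \<le> (u * u + v * v) * (x\<^sup>2 + y\<^sup>2)" for u v x y :: real
  proof -
    have "(u * u + v * v) * (x\<^sup>2 + y\<^sup>2) - (u * x + v * y)\<^sup>2 = (u * y - v * x)\<^sup>2"
      by (simp add: power2_eq_square algebra_simps)
    then show ?thesis by (metis diff_ge_0_iff_ge zero_le_power2)
  qed
  have Ab: "(A f p)\<^sup>2 \<le> a p * N f p" if "p \<in> cells2" for f p
    using cs[of "al p True" "f (p, True)" "al p False" "f (p, False)"] aa[OF that] by (simp add: A_def N_def)
  have Db: "(D f p)\<^sup>2 \<le> b p * N f p" if "p \<in> cells2" for f p
    using cs[of "be p True" "f (p, True)" "be p False" "f (p, False)"] bb[OF that] by (simp add: D_def N_def)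
  have N0: "0 \<le> N f p" for f p by (simp add: N_def)
  let ?n = "\<lambda>f. sqrt (\<Sum>p\<in>cells2. N f p)"
  have bil: "\<bar>\<Sum>p\<in>cells2. \<Sum>q\<in>cells2. kf p q * A f p * D f' q\<bar> \<le> B * ?n f * ?n f'" for f f'
    by (rule kf_bilinear_bound[where a = a and b = b]) (auto intro: a0 b0 N0 B rb cb Ab Db)
  have sq: "(\<Sum>x\<in>index. (f x)\<^sup>2) = (\<Sum>p\<in>cells2. N f p)" for f
    unfolding sum_index N_def ..
  have "(\<Sum>x\<in>index. (g x)\<^sup>2) = (\<Sum>x\<in>index. \<Sum>y\<in>index. g x * (Smat al be x y * h y))"
    by (simp only: power2_eq_square sum_distrib_left[symmetric] g_def[symmetric])
  also have "\<dots> = (\<Sum>p\<in>cells2. \<Sum>q\<in>cells2. kf p q * A g p * D h q + kf q p * A h q * D g p)"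
    unfolding sum_index sum.distrib[symmetric]
    by (intro sum.cong refl) (simp add: Smat_def A_def D_def algebra_simps)
  also have "\<dots> = (\<Sum>p\<in>cells2. \<Sum>q\<in>cells2. kf p q * A g p * D h q) + (\<Sum>p\<in>cells2. \<Sum>q\<in>cells2. kf p q * A h p * D g q)"
    unfolding sum.distrib by (rule arg_cong2[where f = "(+)", OF refl sum.swap])
  also have "\<dots> \<le> B * ?n g * ?n h + B * ?n h * ?n g"
    by (rule add_mono[OF abs_le_D1[OF bil] abs_le_D1[OF bil]])
  finally have le: "(\<Sum>p\<in>cells2. N g p) \<le> 2 * B * ?n g * ?n h" unfolding sq by simp
  define u v where "u = ?n g" and "v = ?n h"
  have uv: "0 \<le> u" "0 \<le> v" unfolding u_def v_def by (auto intro!: sum_nonneg N0)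
  have sg: "(\<Sum>p\<in>cells2. N g p) = u\<^sup>2" and sh: "(\<Sum>p\<in>cells2. N h p) = v\<^sup>2"
    unfolding u_def v_def by (auto simp: sum_nonneg N0)
  have "u * u \<le> u * (2 * B * v)"
    using le[folded u_def v_def] unfolding sg power2_eq_square by (simp add: ac_simps)
  then have "u \<le> 2 * B * v"
    using uv B by (cases "u = 0") (auto simp: mult_le_cancel_left_pos)
  then have "(\<Sum>p\<in>cells2. N g p) \<le> (2 * B)\<^sup>2 * (\<Sum>p\<in>cells2. N h p)"
    unfolding sg sh power_mult_distrib[symmetric] using uv by (intro power_mono)
  then show ?thesis unfolding sq[symmetric] g_def .
qed

end

section \<open>Gaussian integration by parts\<close>

lemma has_vector_derivative_quadratic:
  fixes f :: "real \<Rightarrow> complex"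
  assumes "\<And>h. norm (f (s + h) - f s - of_real h * D) \<le> K * h\<^sup>2"
  shows "(f has_vector_derivative D) (at s)"
proof -
  have K: "((\<lambda>h. K * \<bar>h\<bar>) \<longlongrightarrow> 0) (at 0)"
    by (rule tendsto_eq_intros refl | simp)+
  have "((\<lambda>h. norm (f (s + h) - f s - h *\<^sub>R D) / norm h) \<longlongrightarrow> 0) (at 0)"
  proof (rule tendsto_sandwich[OF _ _ tendsto_const K])
    show "\<forall>\<^sub>F h in at 0. norm (f (s + h) - f s - h *\<^sub>R D) / norm h \<le> K * \<bar>h\<bar>"
      using eventually_neq_at_within[of "0::real" 0 UNIV]
    proof eventually_elim
      case (elim h)
      have "norm (f (s + h) - f s - h *\<^sub>R D) \<le> K * h\<^sup>2" using assms[of h] by (simp add: scaleR_conv_of_real)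
      also have "\<dots> = K * \<bar>h\<bar> * norm h" by (simp add: power2_eq_square)
      finally show ?case using elim by (simp add: divide_le_eq)
    qed
  qed (simp add: always_eventually)
  then show ?thesis
    unfolding has_vector_derivative_def has_derivative_at by (simp add: bounded_linear_scaleR_left)
qed

lemma norm_integral_le:
  fixes f :: "'a \<Rightarrow> 'b :: {banach, second_countable_topology}" and g :: "'a \<Rightarrow> real"
  assumes "integrable M g" "integrable M f" "\<And>x. norm (f x) \<le> g x"
  shows "norm (integral\<^sup>L M f) \<le> integral\<^sup>L M g"
proof -
  have "norm (integral\<^sup>L M f) \<le> (\<integral>x. norm (f x) \<partial>M)" by (rule integral_norm_bound)
  also have "\<dots> \<le> integral\<^sup>L M g" using assms by (intro integral_mono) auto
  finally show ?thesis .
qed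

text \<open>A centered Gaussian space described through characteristic functions: linearity together
  with \<open>L_char\<close> encodes joint Gaussianity, degenerate variables included, and the
  condition on characteristic functions passes to limits in the square mean.\<close>

locale gaussian_linear_space = prob_space M for M :: "'a measure" +
  fixes L :: "('a \<Rightarrow> real) set"
  assumes L_meas: "Y \<in> L \<Longrightarrow> Y \<in> borel_measurable M"
    and L_sq: "Y \<in> L \<Longrightarrow> integrable M (\<lambda>\<omega>. (Y \<omega>)\<^sup>2)"
    and L_zero: "(\<lambda>\<omega>. 0) \<in> L"
    and L_lin: "Y \<in> L \<Longrightarrow> Z \<in> L \<Longrightarrow> (\<lambda>\<omega>. Y \<omega> + s * Z \<omega>) \<in> L"
    and L_char: "Y \<in> L \<Longrightarrow> (CLINT \<omega>|M. iexp (Y \<omega>)) = exp (- of_real (\<integral>\<omega>. (Y \<omega>)\<^sup>2 \<partial>M) / 2)"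
begin

lemma L_scale: "Y \<in> L \<Longrightarrow> (\<lambda>\<omega>. s * Y \<omega>) \<in> L"
  using L_lin[OF L_zero, of Y s] by simp

text \<open>Closed under sums and products, so polynomials in Gaussian variables can be integrated
  without tracking exponents.\<close>

definition all_moments :: "('a \<Rightarrow> real) \<Rightarrow> bool" where
  "all_moments F \<longleftrightarrow> F \<in> borel_measurable M \<and> (\<forall>k. integrable M (\<lambda>\<omega>. \<bar>F \<omega>\<bar> ^ k))"

lemma all_moments_meas[measurable_dest]: "all_moments F \<Longrightarrow> F \<in> borel_measurable M"
  by (simp add: all_moments_def)

lemma all_moments_integrable: "all_moments F \<Longrightarrow> integrable M F"
proof -
  assume F: "all_moments F"
  then have "integrable M (\<lambda>\<omega>. \<bar>F \<omega>\<bar> ^ 1)" unfolding all_moments_def by blast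
  then show ?thesis using F by (simp add: all_moments_def integrable_abs_iff)
qed

lemma all_moments_const: "all_moments (\<lambda>\<omega>. c)"
  by (simp add: all_moments_def)

lemma all_moments_mult:
  assumes F: "all_moments F" and G: "all_moments G"
  shows "all_moments (\<lambda>\<omega>. F \<omega> * G \<omega>)"
  unfolding all_moments_def
proof (intro conjI allI)
  have [measurable]: "F \<in> borel_measurable M" "G \<in> borel_measurable M"
    using F G by (auto simp: all_moments_def)
  show "(\<lambda>\<omega>. F \<omega> * G \<omega>) \<in> borel_measurable M" by measurable
  fix k
  show "integrable M (\<lambda>\<omega>. \<bar>F \<omega> * G \<omega>\<bar> ^ k)"
  proof (rule Bochner_Integration.integrable_bound)
    show "integrable M (\<lambda>\<omega>. \<bar>F \<omega>\<bar> ^ (2 * k) + \<bar>G \<omega>\<bar> ^ (2 * k))"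
      using F G by (auto simp: all_moments_def)
    show "AE \<omega> in M. norm (\<bar>F \<omega> * G \<omega>\<bar> ^ k) \<le> norm (\<bar>F \<omega>\<bar> ^ (2 * k) + \<bar>G \<omega>\<bar> ^ (2 * k))"
    proof (rule AE_I2)
      fix \<omega>
      let ?u = "\<bar>F \<omega>\<bar> ^ k" and ?v = "\<bar>G \<omega>\<bar> ^ k"
      have "0 \<le> (?u - ?v)\<^sup>2" by simp
      then have "2 * (?u * ?v) \<le> ?u\<^sup>2 + ?v\<^sup>2" by (simp add: power2_diff)
      moreover have "0 \<le> ?u * ?v" by simp
      ultimately have "?u * ?v \<le> ?u\<^sup>2 + ?v\<^sup>2" by linarith
      then show "norm (\<bar>F \<omega> * G \<omega>\<bar> ^ k) \<le> norm (\<bar>F \<omega>\<bar> ^ (2 * k) + \<bar>G \<omega>\<bar> ^ (2 * k))"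
        by (simp add: abs_mult power_mult_distrib power_mult[symmetric] mult.commute)
    qed
  qed simp
qed

lemma all_moments_add:
  assumes F: "all_moments F" and G: "all_moments G"
  shows "all_moments (\<lambda>\<omega>. F \<omega> + G \<omega>)"
  unfolding all_moments_def
proof (intro conjI allI)
  have [measurable]: "F \<in> borel_measurable M" "G \<in> borel_measurable M"
    using F G by (auto simp: all_moments_def)
  show "(\<lambda>\<omega>. F \<omega> + G \<omega>) \<in> borel_measurable M" by measurable
  fix k
  show "integrable M (\<lambda>\<omega>. \<bar>F \<omega> + G \<omega>\<bar> ^ k)"
  proof (rule Bochner_Integration.integrable_bound)
    show "integrable M (\<lambda>\<omega>. 2 ^ k * (\<bar>F \<omega>\<bar> ^ k + \<bar>G \<omega>\<bar> ^ k))"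
      using F G by (auto simp: all_moments_def)
    show "AE \<omega> in M. norm (\<bar>F \<omega> + G \<omega>\<bar> ^ k) \<le> norm (2 ^ k * (\<bar>F \<omega>\<bar> ^ k + \<bar>G \<omega>\<bar> ^ k))"
    proof (rule AE_I2)
      fix \<omega>
      have "\<bar>F \<omega> + G \<omega>\<bar> ^ k \<le> (2 * max \<bar>F \<omega>\<bar> \<bar>G \<omega>\<bar>) ^ k"
        by (intro power_mono) auto
      also have "\<dots> = 2 ^ k * (max \<bar>F \<omega>\<bar> \<bar>G \<omega>\<bar>) ^ k" by (simp add: power_mult_distrib)
      also have "\<dots> \<le> 2 ^ k * (\<bar>F \<omega>\<bar> ^ k + \<bar>G \<omega>\<bar> ^ k)"
        by (intro mult_left_mono) (auto simp: max_def)
      finally show "norm (\<bar>F \<omega> + G \<omega>\<bar> ^ k) \<le> norm (2 ^ k * (\<bar>F \<omega>\<bar> ^ k + \<bar>G \<omega>\<bar> ^ k))" by simp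
    qed
  qed simp
qed

lemma all_moments_sum:
  "finite A \<Longrightarrow> (\<And>a. a \<in> A \<Longrightarrow> all_moments (F a)) \<Longrightarrow> all_moments (\<lambda>\<omega>. \<Sum>a\<in>A. F a \<omega>)"
  by (induction A rule: finite_induct) (auto intro: all_moments_const all_moments_add)

lemma all_moments_power: "all_moments F \<Longrightarrow> all_moments (\<lambda>\<omega>. F \<omega> ^ n)"
  by (induction n) (auto intro: all_moments_const all_moments_mult)

text \<open>A variable of variance zero vanishes almost surely. Otherwise the normalized variable
  has the standard normal characteristic function, and Levy's uniqueness theorem identifies its law
  and hence its moments.\<close>

lemma L_all_moments:
  assumes Y: "Y \<in> L"
  shows "all_moments Y"
proof -
  note [measurable] = L_meas[OF Y]
  define v where "v = (\<integral>\<omega>. (Y \<omega>)\<^sup>2 \<partial>M)"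
  have v0: "0 \<le> v" unfolding v_def by simp
  show ?thesis
  proof (cases "v = 0")
    case True
    then have "AE \<omega> in M. (Y \<omega>)\<^sup>2 = 0"
      using integral_nonneg_eq_0_iff_AE[OF L_sq[OF Y]] by (simp add: v_def)
    then have ae: "AE \<omega> in M. Y \<omega> = 0" by simp
    have "integrable M (\<lambda>\<omega>. \<bar>Y \<omega>\<bar> ^ k)" for k
    proof -
      have "integrable M (\<lambda>\<omega>. 0 ^ k :: real)" by simp
      moreover have "AE \<omega> in M. \<bar>Y \<omega>\<bar> ^ k = 0 ^ k" using ae by eventually_elim simp
      ultimately show ?thesis using integrable_cong_AE[of "\<lambda>\<omega>. \<bar>Y \<omega>\<bar> ^ k" M "\<lambda>\<omega>. 0 ^ k"] by simp
    qed
    then show ?thesis by (simp add: all_moments_def)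
  next
    case False
    with v0 have v: "0 < v" by simp
    define Z where "Z \<omega> = Y \<omega> / sqrt v" for \<omega>
    have [measurable]: "Z \<in> borel_measurable M" unfolding Z_def by measurable
    have "distr M borel Z = std_normal_distribution"
    proof (rule Levy_uniqueness)
      show "real_distribution (distr M borel Z)" by (rule real_distribution_distr) simp
      show "real_distribution std_normal_distribution" by (rule real_dist_normal_dist)
      show "char (distr M borel Z) = char std_normal_distribution"
      proof
        fix t
        have "char (distr M borel Z) t = (CLINT \<omega>|M. iexp (t / sqrt v * Y \<omega>))"
          unfolding char_def by (subst integral_distr) (auto simp: Z_def)
        also have "\<dots> = exp (- of_real (\<integral>\<omega>. (t / sqrt v * Y \<omega>)\<^sup>2 \<partial>M) / 2)"
          by (rule L_char[OF L_scale[OF Y]])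
        also have "(\<integral>\<omega>. (t / sqrt v * Y \<omega>)\<^sup>2 \<partial>M) = t\<^sup>2"
          using v by (simp add: power_mult_distrib power_divide v_def[symmetric])
        finally show "char (distr M borel Z) t = char std_normal_distribution t"
          unfolding char_std_normal_distribution by (simp flip: exp_of_real)
      qed
    qed
    then have "integrable (distr M borel Z) (\<lambda>x. \<bar>x\<bar> ^ k)" for k
      using integrable_std_normal_moment_abs[of k] by (simp add: integrable_density)
    then have Zk: "integrable M (\<lambda>\<omega>. \<bar>Z \<omega>\<bar> ^ k)" for k
      by (subst (asm) integrable_distr_eq) auto
    have "integrable M (\<lambda>\<omega>. \<bar>Y \<omega>\<bar> ^ k)" for k
    proof -
      have "integrable M (\<lambda>\<omega>. sqrt v ^ k * \<bar>Z \<omega>\<bar> ^ k)" using Zk by simp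
      moreover have "sqrt v ^ k * \<bar>Z \<omega>\<bar> ^ k = \<bar>Y \<omega>\<bar> ^ k" for \<omega>
        unfolding power_mult_distrib[symmetric] Z_def using v by (simp add: abs_divide)
      ultimately show ?thesis by simp
    qed
    then show ?thesis by (simp add: all_moments_def)
  qed
qed

section \<open>Stein's identity tested against oscillating exponentials\<close>

definition osc :: "('a \<Rightarrow> real) \<Rightarrow> ('a \<Rightarrow> real) \<Rightarrow> complex" where
  "osc F V = (CLINT \<omega>|M. of_real (F \<omega>) * iexp (V \<omega>))"

lemma osc_integrable:
  assumes "all_moments F" "V \<in> borel_measurable M"
  shows "complex_integrable M (\<lambda>\<omega>. of_real (F \<omega>) * iexp (V \<omega>))"
proof (rule Bochner_Integration.integrable_bound[OF all_moments_integrable[OF assms(1)]])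
  have [measurable]: "F \<in> borel_measurable M" "V \<in> borel_measurable M" using assms by (auto simp: all_moments_def)
  show "(\<lambda>\<omega>. complex_of_real (F \<omega>) * iexp (V \<omega>)) \<in> borel_measurable M" by measurable
qed (simp add: norm_mult)

lemma osc_add:
  assumes "all_moments F" "all_moments G" "V \<in> borel_measurable M"
  shows "osc (\<lambda>\<omega>. F \<omega> + G \<omega>) V = osc F V + osc G V"
  unfolding osc_def using osc_integrable[OF assms(1,3)] osc_integrable[OF assms(2,3)]
  by (simp add: distrib_right)

lemma osc_cmult: "osc (\<lambda>\<omega>. c * F \<omega>) V = of_real c * osc F V"
  unfolding osc_def by (simp add: mult.assoc)

text \<open>The second-order remainder of the exponential is at most (h X)^2 / 2, so the difference
  quotient has an error quadratic in h with constant E |F X X| / 2.\<close>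

lemma osc_deriv:
  assumes F: "all_moments F" and X: "all_moments X" and V[measurable]: "V \<in> borel_measurable M"
  shows "((\<lambda>s. osc F (\<lambda>\<omega>. V \<omega> + s * X \<omega>)) has_vector_derivative
           \<i> * osc (\<lambda>\<omega>. F \<omega> * X \<omega>) (\<lambda>\<omega>. V \<omega> + s * X \<omega>)) (at s)"
proof (rule has_vector_derivative_quadratic)
  have [measurable]: "F \<in> borel_measurable M" "X \<in> borel_measurable M" using F X by (auto simp: all_moments_def)
  fix h :: real
  let ?W = "\<lambda>\<omega>. V \<omega> + s * X \<omega>"
  have FX: "all_moments (\<lambda>\<omega>. F \<omega> * X \<omega>)" by (intro all_moments_mult F X)
  have FXX: "all_moments (\<lambda>\<omega>. F \<omega> * X \<omega> * X \<omega>)" by (intro all_moments_mult F X)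
  have i1: "complex_integrable M (\<lambda>\<omega>. of_real (F \<omega>) * iexp (V \<omega> + (s + h) * X \<omega>))"
    by (rule osc_integrable[OF F]) measurable
  have i2: "complex_integrable M (\<lambda>\<omega>. of_real (F \<omega>) * iexp (?W \<omega>))"
    by (rule osc_integrable[OF F]) measurable
  have i3: "complex_integrable M (\<lambda>\<omega>. of_real (F \<omega> * X \<omega>) * iexp (?W \<omega>))"
    by (rule osc_integrable[OF FX]) measurable
  let ?R = "\<lambda>\<omega>. of_real (F \<omega>) * iexp (?W \<omega>) * (iexp (h * X \<omega>) - (\<Sum>k\<le>1. (\<i> * of_real (h * X \<omega>))^k / fact k))"
  have pt: "of_real (F \<omega>) * iexp (V \<omega> + (s + h) * X \<omega>) - of_real (F \<omega>) * iexp (?W \<omega>)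
         - of_real h * (\<i> * (of_real (F \<omega> * X \<omega>) * iexp (?W \<omega>))) = ?R \<omega>" for \<omega>
  proof -
    have "iexp (V \<omega> + (s + h) * X \<omega>) = iexp (?W \<omega>) * iexp (h * X \<omega>)"
      by (simp add: exp_add[symmetric] algebra_simps)
    then show ?thesis by (simp add: algebra_simps)
  qed
  have "osc F (\<lambda>\<omega>. V \<omega> + (s + h) * X \<omega>) - osc F ?W - of_real h * (\<i> * osc (\<lambda>\<omega>. F \<omega> * X \<omega>) ?W)
    = (CLINT \<omega>|M. of_real (F \<omega>) * iexp (V \<omega> + (s + h) * X \<omega>) - of_real (F \<omega>) * iexp (?W \<omega>)
         - of_real h * (\<i> * (of_real (F \<omega> * X \<omega>) * iexp (?W \<omega>))))"
    unfolding osc_def using i1 i2 i3 by simp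
  also have "\<dots> = (CLINT \<omega>|M. ?R \<omega>)"
    unfolding pt ..
  also have "norm \<dots> \<le> (\<integral>\<omega>. \<bar>F \<omega> * X \<omega> * X \<omega>\<bar> * h\<^sup>2 / 2 \<partial>M)"
  proof (rule norm_integral_le)
    show "integrable M (\<lambda>\<omega>. \<bar>F \<omega> * X \<omega> * X \<omega>\<bar> * h\<^sup>2 / 2)"
      using all_moments_integrable[OF FXX] by simp
    show "complex_integrable M (\<lambda>\<omega>. of_real (F \<omega>) * iexp (?W \<omega>) * (iexp (h * X \<omega>) - (\<Sum>k\<le>1. (\<i> * of_real (h * X \<omega>))^k / fact k)))"
    proof -
      have "complex_integrable M (\<lambda>\<omega>. of_real (F \<omega>) * iexp (V \<omega> + (s + h) * X \<omega>) - of_real (F \<omega>) * iexp (?W \<omega>)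
         - of_real h * (\<i> * (of_real (F \<omega> * X \<omega>) * iexp (?W \<omega>))))"
        using i1 i2 i3 by simp
      then show ?thesis unfolding pt .
    qed
    fix \<omega>
    have "norm (iexp (h * X \<omega>) - (\<Sum>k\<le>1. (\<i> * of_real (h * X \<omega>))^k / fact k)) \<le> \<bar>h * X \<omega>\<bar>\<^sup>2 / 2"
      using iexp_approx1[of "h * X \<omega>" 1] by (simp add: numeral_2_eq_2)
    then have "norm (of_real (F \<omega>) * iexp (?W \<omega>) * (iexp (h * X \<omega>) - (\<Sum>k\<le>1. (\<i> * of_real (h * X \<omega>))^k / fact k)))
      \<le> \<bar>F \<omega>\<bar> * 1 * (\<bar>h * X \<omega>\<bar>\<^sup>2 / 2)"
      unfolding norm_mult by (intro mult_mono) auto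
    then show "norm (of_real (F \<omega>) * iexp (?W \<omega>) * (iexp (h * X \<omega>) - (\<Sum>k\<le>1. (\<i> * of_real (h * X \<omega>))^k / fact k)))
      \<le> \<bar>F \<omega> * X \<omega> * X \<omega>\<bar> * h\<^sup>2 / 2"
      by (simp add: abs_mult power_mult_distrib power2_eq_square ac_simps)
  qed
  also have "\<dots> = ((\<integral>\<omega>. \<bar>F \<omega> * X \<omega> * X \<omega>\<bar> \<partial>M) / 2) * h\<^sup>2" by simp
  finally show "norm (osc F (\<lambda>\<omega>. V \<omega> + (s + h) * X \<omega>) - osc F ?W - of_real h * (\<i> * osc (\<lambda>\<omega>. F \<omega> * X \<omega>) ?W))
    \<le> ((\<integral>\<omega>. \<bar>F \<omega> * X \<omega> * X \<omega>\<bar> \<partial>M) / 2) * h\<^sup>2" .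
qed

definition cov :: "('a \<Rightarrow> real) \<Rightarrow> ('a \<Rightarrow> real) \<Rightarrow> real" where
  "cov Y Z = (\<integral>\<omega>. Y \<omega> * Z \<omega> \<partial>M)"

lemma cov_sym: "cov Y Z = cov Z Y" by (simp add: cov_def mult.commute)

lemma L_mult_integrable: "Y \<in> L \<Longrightarrow> Z \<in> L \<Longrightarrow> integrable M (\<lambda>\<omega>. Y \<omega> * Z \<omega>)"
  by (intro all_moments_integrable all_moments_mult L_all_moments)

lemma cov_add: "Y \<in> L \<Longrightarrow> V \<in> L \<Longrightarrow> X \<in> L \<Longrightarrow> cov Y (\<lambda>\<omega>. V \<omega> + s * X \<omega>) = cov Y V + s * cov Y X"
  unfolding cov_def using L_mult_integrable[of Y V] L_mult_integrable[of Y X]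
  by (simp add: distrib_left mult.left_commute)

text \<open>\<open>D\<close> plays the role of the derivative of \<open>F\<close> in the direction \<open>Y\<close>. The oscillating factor
  \<open>exp (\<i> V)\<close> makes the relation stable under multiplying \<open>F\<close> by \<open>X \<in> L\<close>: differentiate along
  \<open>V + s X\<close> at \<open>s = 0\<close>.\<close>

definition ibp :: "('a \<Rightarrow> real) \<Rightarrow> ('a \<Rightarrow> real) \<Rightarrow> ('a \<Rightarrow> real) \<Rightarrow> bool" where
  "ibp Y F D \<longleftrightarrow> all_moments F \<and> all_moments D \<and>
     (\<forall>V\<in>L. osc (\<lambda>\<omega>. Y \<omega> * F \<omega>) V = osc D V + \<i> * of_real (cov Y V) * osc F V)"

text \<open>Both sides arise by differentiating the characteristic function of V + s Y at s = 0:
  once under the expectation, once in the explicit Gaussian form, whose exponent has the linear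
  coefficient - cov Y V.\<close>

lemma ibp_const:
  assumes Y: "Y \<in> L" shows "ibp Y (\<lambda>\<omega>. 1) (\<lambda>\<omega>. 0)"
  unfolding ibp_def
proof (intro conjI ballI all_moments_const)
  fix V assume V: "V \<in> L"
  define w where "w s = - of_real ((\<integral>\<omega>. (V \<omega>)\<^sup>2 \<partial>M) + 2 * s * cov Y V + s\<^sup>2 * cov Y Y) / (2 :: complex)" for s
  have e: "osc (\<lambda>\<omega>. 1) (\<lambda>\<omega>. V \<omega> + s * Y \<omega>) = exp (w s)" for s
  proof -
    have "osc (\<lambda>\<omega>. 1) (\<lambda>\<omega>. V \<omega> + s * Y \<omega>) = exp (- of_real (\<integral>\<omega>. (V \<omega> + s * Y \<omega>)\<^sup>2 \<partial>M) / 2)"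
      unfolding osc_def using L_char[OF L_lin[OF V Y, of s]] by simp
    also have "(\<integral>\<omega>. (V \<omega> + s * Y \<omega>)\<^sup>2 \<partial>M) = (\<integral>\<omega>. V \<omega> * V \<omega> + 2 * s * (Y \<omega> * V \<omega>) + s\<^sup>2 * (Y \<omega> * Y \<omega>) \<partial>M)"
      by (simp add: power2_eq_square algebra_simps)
    also have "\<dots> = cov V V + 2 * s * cov Y V + s\<^sup>2 * cov Y Y"
      unfolding cov_def using L_mult_integrable Y V by simp
    finally show ?thesis by (simp add: w_def cov_def power2_eq_square)
  qed
  have d1: "((\<lambda>s. osc (\<lambda>\<omega>. 1) (\<lambda>\<omega>. V \<omega> + s * Y \<omega>)) has_vector_derivative \<i> * osc (\<lambda>\<omega>. 1 * Y \<omega>) (\<lambda>\<omega>. V \<omega> + 0 * Y \<omega>)) (at 0)"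
    by (rule osc_deriv[OF all_moments_const L_all_moments[OF Y] L_meas[OF V]])
  have w: "(w has_vector_derivative (- of_real (cov Y V))) (at 0)"
    unfolding w_def
    by (auto intro!: derivative_eq_intros simp: has_vector_derivative_def scaleR_conv_of_real)
  have "((\<lambda>s. exp (w s)) has_vector_derivative (- of_real (cov Y V)) * exp (w 0)) (at 0)"
    using field_vector_diff_chain_at[OF w, of exp "exp (w 0)"] by (simp add: o_def DERIV_exp)
  then have "\<i> * osc (\<lambda>\<omega>. 1 * Y \<omega>) (\<lambda>\<omega>. V \<omega> + 0 * Y \<omega>) = - of_real (cov Y V) * exp (w 0)"
    using vector_derivative_unique_at[OF d1] unfolding e by blast
  then have "\<i> * (\<i> * osc Y V) = \<i> * (- of_real (cov Y V) * osc (\<lambda>\<omega>. 1) V)"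
    using e[of 0] by simp
  then show "osc (\<lambda>\<omega>. Y \<omega> * 1) V = osc (\<lambda>\<omega>. 0) V + \<i> * of_real (cov Y V) * osc (\<lambda>\<omega>. 1) V"
    by (simp add: osc_def)
qed

text \<open>The new term \<open>cov Y X * F\<close> is what the product rule yields when the
  derivative falls on the coefficient cov Y (V + s X); all other terms just acquire a factor
  X.\<close>

lemma ibp_mult:
  assumes F: "ibp Y F D" and Y: "Y \<in> L" and X: "X \<in> L"
  shows "ibp Y (\<lambda>\<omega>. X \<omega> * F \<omega>) (\<lambda>\<omega>. X \<omega> * D \<omega> + cov Y X * F \<omega>)"
proof -
  have aF: "all_moments F" and aD: "all_moments D" using F by (auto simp: ibp_def)
  note aX = L_all_moments[OF X] and aY = L_all_moments[OF Y]
  have 1: "all_moments (\<lambda>\<omega>. X \<omega> * F \<omega>)" by (intro all_moments_mult aX aF)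
  have 2: "all_moments (\<lambda>\<omega>. X \<omega> * D \<omega>)" by (intro all_moments_mult aX aD)
  have 3: "all_moments (\<lambda>\<omega>. cov Y X * F \<omega>)" by (intro all_moments_mult all_moments_const aF)
  show ?thesis
    unfolding ibp_def
  proof (intro conjI ballI 1 all_moments_add 2 3)
    fix V assume V: "V \<in> L"
    note mV = L_meas[OF V]
    have e: "osc (\<lambda>\<omega>. Y \<omega> * F \<omega>) (\<lambda>\<omega>. V \<omega> + s * X \<omega>) = osc D (\<lambda>\<omega>. V \<omega> + s * X \<omega>)
       + \<i> * of_real (cov Y V + s * cov Y X) * osc F (\<lambda>\<omega>. V \<omega> + s * X \<omega>)" for s
      using F L_lin[OF V X, of s] cov_add[OF Y V X, of s] unfolding ibp_def by simp
    have d1: "((\<lambda>s. osc (\<lambda>\<omega>. Y \<omega> * F \<omega>) (\<lambda>\<omega>. V \<omega> + s * X \<omega>)) has_vector_derivative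
       \<i> * osc (\<lambda>\<omega>. Y \<omega> * F \<omega> * X \<omega>) (\<lambda>\<omega>. V \<omega> + 0 * X \<omega>)) (at 0)"
      by (rule osc_deriv[OF all_moments_mult[OF aY aF] aX mV])
    have d2: "((\<lambda>s. osc D (\<lambda>\<omega>. V \<omega> + s * X \<omega>)) has_vector_derivative \<i> * osc (\<lambda>\<omega>. D \<omega> * X \<omega>) (\<lambda>\<omega>. V \<omega> + 0 * X \<omega>)) (at 0)"
      by (rule osc_deriv[OF aD aX mV])
    have d3: "((\<lambda>s. osc F (\<lambda>\<omega>. V \<omega> + s * X \<omega>)) has_vector_derivative \<i> * osc (\<lambda>\<omega>. F \<omega> * X \<omega>) (\<lambda>\<omega>. V \<omega> + 0 * X \<omega>)) (at 0)"
      by (rule osc_deriv[OF aF aX mV])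
    have d4: "((\<lambda>s. \<i> * of_real (cov Y V + s * cov Y X)) has_vector_derivative \<i> * of_real (cov Y X)) (at 0)"
      by (auto intro!: derivative_eq_intros simp: has_vector_derivative_def scaleR_conv_of_real)
    have d5: "((\<lambda>s. osc (\<lambda>\<omega>. Y \<omega> * F \<omega>) (\<lambda>\<omega>. V \<omega> + s * X \<omega>)) has_vector_derivative
       \<i> * osc (\<lambda>\<omega>. D \<omega> * X \<omega>) V + (\<i> * of_real (cov Y V) * (\<i> * osc (\<lambda>\<omega>. F \<omega> * X \<omega>) V) + \<i> * of_real (cov Y X) * osc F V)) (at 0)"
      unfolding e
      using has_vector_derivative_add[OF d2 has_vector_derivative_mult[OF d4 d3]] by simp
    have "\<i> * osc (\<lambda>\<omega>. Y \<omega> * F \<omega> * X \<omega>) V =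
       \<i> * osc (\<lambda>\<omega>. D \<omega> * X \<omega>) V + (\<i> * of_real (cov Y V) * (\<i> * osc (\<lambda>\<omega>. F \<omega> * X \<omega>) V) + \<i> * of_real (cov Y X) * osc F V)"
      using vector_derivative_unique_at[OF d1 d5] by simp
    then have "\<i> * osc (\<lambda>\<omega>. Y \<omega> * F \<omega> * X \<omega>) V =
       \<i> * (osc (\<lambda>\<omega>. D \<omega> * X \<omega>) V + \<i> * of_real (cov Y V) * osc (\<lambda>\<omega>. F \<omega> * X \<omega>) V + of_real (cov Y X) * osc F V)"
      by (simp add: algebra_simps)
    then have "osc (\<lambda>\<omega>. Y \<omega> * F \<omega> * X \<omega>) V =
       osc (\<lambda>\<omega>. D \<omega> * X \<omega>) V + \<i> * of_real (cov Y V) * osc (\<lambda>\<omega>. F \<omega> * X \<omega>) V + of_real (cov Y X) * osc F V"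
      by simp
    then show "osc (\<lambda>\<omega>. Y \<omega> * (X \<omega> * F \<omega>)) V = osc (\<lambda>\<omega>. X \<omega> * D \<omega> + cov Y X * F \<omega>) V + \<i> * of_real (cov Y V) * osc (\<lambda>\<omega>. X \<omega> * F \<omega>) V"
      unfolding osc_add[OF 2 3 mV] osc_cmult by (simp add: ac_simps)
  qed
qed

lemma ibp_add:
  assumes "ibp Y F D" "ibp Y F' D'" "Y \<in> L"
  shows "ibp Y (\<lambda>\<omega>. F \<omega> + F' \<omega>) (\<lambda>\<omega>. D \<omega> + D' \<omega>)"
proof -
  have m: "all_moments F" "all_moments D" "all_moments F'" "all_moments D'" using assms by (auto simp: ibp_def)
  note aY = L_all_moments[OF assms(3)]
  show ?thesis
    unfolding ibp_def
  proof (intro conjI ballI all_moments_add m)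
    fix V assume V: "V \<in> L"
    note mV = L_meas[OF V]
    have "osc (\<lambda>\<omega>. Y \<omega> * F \<omega> + Y \<omega> * F' \<omega>) V = osc (\<lambda>\<omega>. Y \<omega> * F \<omega>) V + osc (\<lambda>\<omega>. Y \<omega> * F' \<omega>) V"
      by (rule osc_add[OF all_moments_mult all_moments_mult mV]) (intro aY m)+
    then show "osc (\<lambda>\<omega>. Y \<omega> * (F \<omega> + F' \<omega>)) V = osc (\<lambda>\<omega>. D \<omega> + D' \<omega>) V + \<i> * of_real (cov Y V) * osc (\<lambda>\<omega>. F \<omega> + F' \<omega>) V"
      using assms V unfolding ibp_def by (simp add: osc_add m mV algebra_simps)
  qed
qed

lemma ibp_cmult:
  assumes "ibp Y F D" shows "ibp Y (\<lambda>\<omega>. c * F \<omega>) (\<lambda>\<omega>. c * D \<omega>)"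
proof -
  have m: "all_moments F" "all_moments D" using assms by (auto simp: ibp_def)
  have "osc (\<lambda>\<omega>. Y \<omega> * (c * F \<omega>)) V = of_real c * osc (\<lambda>\<omega>. Y \<omega> * F \<omega>) V" for V
    using osc_cmult[of c "\<lambda>\<omega>. Y \<omega> * F \<omega>" V] by (simp add: ac_simps)
  then show ?thesis
    using assms unfolding ibp_def
    by (auto intro!: all_moments_mult all_moments_const m simp: osc_cmult algebra_simps)
qed

lemma ibp_zero: "ibp Y (\<lambda>\<omega>. 0) (\<lambda>\<omega>. 0)"
  unfolding ibp_def by (simp add: all_moments_const osc_def)

lemma ibp_sum:
  assumes "finite A" "\<And>a. a \<in> A \<Longrightarrow> ibp Y (F a) (D a)" "Y \<in> L"
  shows "ibp Y (\<lambda>\<omega>. \<Sum>a\<in>A. F a \<omega>) (\<lambda>\<omega>. \<Sum>a\<in>A. D a \<omega>)"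
  using assms by (induction A rule: finite_induct) (auto intro: ibp_zero ibp_add)

text \<open>The case V = 0, where the oscillating factor is 1 and the covariance term
  disappears.\<close>

lemma ibp_expectation:
  assumes "ibp Y F D" "Y \<in> L"
  shows "(\<integral>\<omega>. Y \<omega> * F \<omega> \<partial>M) = (\<integral>\<omega>. D \<omega> \<partial>M)"
proof -
  have o: "osc G (\<lambda>\<omega>. 0) = of_real (\<integral>\<omega>. G \<omega> \<partial>M)" for G :: "'a \<Rightarrow> real"
    by (simp add: osc_def)
  have "cov Y (\<lambda>\<omega>. 0) = 0" by (simp add: cov_def)
  then show ?thesis using assms L_zero unfolding ibp_def by (auto simp: o dest!: bspec[OF _ L_zero])
qed

text \<open>The derivative of Q in the direction Y consists of two halves, one per Gaussian factor;
  symmetry of S makes them equal and cancels the 1/2.\<close>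

lemma ibp_quadratic_mult:
  fixes g :: "'e \<Rightarrow> 'a \<Rightarrow> real" and S :: "'e \<Rightarrow> 'e \<Rightarrow> real"
  assumes fin: "finite E" and g: "\<And>e. e \<in> E \<Longrightarrow> g e \<in> L"
    and sym: "\<And>e f. e \<in> E \<Longrightarrow> f \<in> E \<Longrightarrow> S e f = S f e"
    and Y: "Y \<in> L" and F: "ibp Y F D"
  defines "Q \<equiv> \<lambda>\<omega>. (\<Sum>e\<in>E. \<Sum>f\<in>E. S e f * g e \<omega> * g f \<omega>) / 2"
    and "DQ \<equiv> \<lambda>\<omega>. (\<Sum>e\<in>E. \<Sum>f\<in>E. S e f * cov Y (g e) * g f \<omega>)"
  shows "ibp Y (\<lambda>\<omega>. Q \<omega> * F \<omega>) (\<lambda>\<omega>. Q \<omega> * D \<omega> + DQ \<omega> * F \<omega>)"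
proof -
  have "ibp Y (\<lambda>\<omega>. \<Sum>e\<in>E. \<Sum>f\<in>E. (S e f / 2) * (g e \<omega> * (g f \<omega> * F \<omega>)))
     (\<lambda>\<omega>. \<Sum>e\<in>E. \<Sum>f\<in>E. (S e f / 2) * (g e \<omega> * (g f \<omega> * D \<omega> + cov Y (g f) * F \<omega>) + cov Y (g e) * (g f \<omega> * F \<omega>)))"
    by (intro ibp_sum ibp_cmult ibp_mult fin g F Y)
  moreover have "(\<Sum>e\<in>E. \<Sum>f\<in>E. (S e f / 2) * (g e \<omega> * (g f \<omega> * F \<omega>))) = Q \<omega> * F \<omega>" for \<omega>
    by (simp add: Q_def sum_divide_distrib sum_distrib_right mult.assoc)
  moreover have "(\<Sum>e\<in>E. \<Sum>f\<in>E. (S e f / 2) * (g e \<omega> * (g f \<omega> * D \<omega> + cov Y (g f) * F \<omega>) + cov Y (g e) * (g f \<omega> * F \<omega>)))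
     = Q \<omega> * D \<omega> + DQ \<omega> * F \<omega>" for \<omega>
  proof -
    have "(\<Sum>e\<in>E. \<Sum>f\<in>E. (S e f / 2) * (g e \<omega> * (g f \<omega> * D \<omega> + cov Y (g f) * F \<omega>) + cov Y (g e) * (g f \<omega> * F \<omega>)))
      = (\<Sum>e\<in>E. \<Sum>f\<in>E. (S e f / 2) * g e \<omega> * g f \<omega> * D \<omega>)
        + ((\<Sum>e\<in>E. \<Sum>f\<in>E. (S e f * cov Y (g f) * g e \<omega>) * (F \<omega> / 2)) + (\<Sum>e\<in>E. \<Sum>f\<in>E. (S e f * cov Y (g e) * g f \<omega>) * (F \<omega> / 2)))"
      unfolding sum.distrib[symmetric] by (intro sum.cong refl) (simp add: algebra_simps)
    also have "(\<Sum>e\<in>E. \<Sum>f\<in>E. (S e f * cov Y (g f) * g e \<omega>) * (F \<omega> / 2)) = (\<Sum>e\<in>E. \<Sum>f\<in>E. (S e f * cov Y (g e) * g f \<omega>) * (F \<omega> / 2))"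
      by (subst sum.swap) (intro sum.cong refl, simp add: sym)
    also have "(\<Sum>e\<in>E. \<Sum>f\<in>E. (S e f * cov Y (g e) * g f \<omega>) * (F \<omega> / 2)) = DQ \<omega> * (F \<omega> / 2)"
      unfolding DQ_def by (simp only: sum_distrib_right)
    also have "(\<Sum>e\<in>E. \<Sum>f\<in>E. (S e f / 2) * g e \<omega> * g f \<omega> * D \<omega>) = Q \<omega> * D \<omega>"
      by (simp add: Q_def sum_divide_distrib sum_distrib_right)
    finally show ?thesis by simp
  qed
  ultimately show ?thesis by simp
qed

section \<open>Moments of a Gaussian quadratic form\<close>

context
  fixes E :: "'e set" and g :: "'e \<Rightarrow> 'a \<Rightarrow> real" and S :: "'e \<Rightarrow> 'e \<Rightarrow> real" and d :: "'e \<Rightarrow> real"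
    and Q :: "'a \<Rightarrow> real"
  assumes fin: "finite E" and g: "\<And>e. e \<in> E \<Longrightarrow> g e \<in> L"
    and sym: "\<And>e f. e \<in> E \<Longrightarrow> f \<in> E \<Longrightarrow> S e f = S f e"
    and cov_g: "\<And>e f. e \<in> E \<Longrightarrow> f \<in> E \<Longrightarrow> cov (g e) (g f) = (if e = f then d e else 0)"
    and S_d: "\<And>e f. e \<in> E \<Longrightarrow> f \<in> E \<Longrightarrow> S e f * d f = S e f"
    and Q_def: "\<And>\<omega>. Q \<omega> = (\<Sum>e\<in>E. \<Sum>f\<in>E. S e f * g e \<omega> * g f \<omega>) / 2"
begin

lemma quadratic_all_moments: "all_moments Q"
proof -
  have "all_moments (\<lambda>\<omega>. (\<Sum>e\<in>E. \<Sum>f\<in>E. S e f * g e \<omega> * g f \<omega>) * (1 / 2))"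
    by (intro all_moments_mult all_moments_sum all_moments_const fin L_all_moments g)
  then show ?thesis by (simp add: Q_def[abs_def])
qed

definition quad_mom :: "'e \<Rightarrow> 'e \<Rightarrow> nat \<Rightarrow> real" where
  "quad_mom e f n = (\<integral>\<omega>. g e \<omega> * (g f \<omega> * Q \<omega> ^ n) \<partial>M)"

text \<open>The expectation of (g^T S^k g) Q^n. The moments of Q alone do not satisfy a closed
  integration-by-parts identity; this family does.\<close>

definition quad_tmom :: "nat \<Rightarrow> nat \<Rightarrow> real" where
  "quad_tmom k n = (\<Sum>e\<in>E. \<Sum>f\<in>E. mat_pow E S k f e * quad_mom e f n)"

lemma gQ_moments: "e \<in> E \<Longrightarrow> f \<in> E \<Longrightarrow> all_moments (\<lambda>\<omega>. g e \<omega> * (g f \<omega> * Q \<omega> ^ n))"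
  by (intro all_moments_mult all_moments_power quadratic_all_moments L_all_moments g)

lemma DQ_cov:
  assumes "e \<in> E"
  shows "(\<Sum>h\<in>E. \<Sum>k\<in>E. S h k * cov (g e) (g h) * g k \<omega>) = d e * (\<Sum>k\<in>E. S e k * g k \<omega>)"
proof -
  have "(\<Sum>h\<in>E. \<Sum>k\<in>E. S h k * cov (g e) (g h) * g k \<omega>) = (\<Sum>h\<in>E. if h = e then d e * (\<Sum>k\<in>E. S e k * g k \<omega>) else 0)"
    using assms by (intro sum.cong refl) (auto simp: cov_g sum_distrib_left ac_simps)
  then show ?thesis using assms fin by simp
qed

lemma ibp_quadratic_power:
  assumes e: "e \<in> E"
  shows "ibp (g e) (\<lambda>\<omega>. Q \<omega> ^ n) (\<lambda>\<omega>. of_nat n * Q \<omega> ^ (n - 1) * (d e * (\<Sum>k\<in>E. S e k * g k \<omega>)))"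
proof (induction n)
  case 0
  then show ?case using ibp_const[OF g[OF e]] by simp
next
  case (Suc n)
  let ?D = "\<lambda>\<omega>. d e * (\<Sum>k\<in>E. S e k * g k \<omega>)"
  have "ibp (g e) (\<lambda>\<omega>. (\<Sum>e\<in>E. \<Sum>f\<in>E. S e f * g e \<omega> * g f \<omega>) / 2 * Q \<omega> ^ n)
     (\<lambda>\<omega>. (\<Sum>e\<in>E. \<Sum>f\<in>E. S e f * g e \<omega> * g f \<omega>) / 2 * (of_nat n * Q \<omega> ^ (n - 1) * ?D \<omega>)
        + (\<Sum>h\<in>E. \<Sum>k\<in>E. S h k * cov (g e) (g h) * g k \<omega>) * Q \<omega> ^ n)"
    by (rule ibp_quadratic_mult[OF fin g sym g[OF e] Suc])
  then have "ibp (g e) (\<lambda>\<omega>. Q \<omega> * Q \<omega> ^ n) (\<lambda>\<omega>. Q \<omega> * (of_nat n * Q \<omega> ^ (n - 1) * ?D \<omega>) + ?D \<omega> * Q \<omega> ^ n)"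
    unfolding DQ_cov[OF e] Q_def[symmetric] .
  moreover have "Q \<omega> * (of_nat n * Q \<omega> ^ (n - 1) * ?D \<omega>) + ?D \<omega> * Q \<omega> ^ n = of_nat (Suc n) * Q \<omega> ^ (Suc n - 1) * ?D \<omega>" for \<omega>
    by (cases n) (simp_all add: algebra_simps)
  ultimately show ?case by simp
qed

lemma quad_mom_rec:
  assumes e: "e \<in> E" and f: "f \<in> E"
  shows "quad_mom e f n = (if e = f then d e else 0) * (\<integral>\<omega>. Q \<omega> ^ n \<partial>M)
     + of_nat n * d e * (\<Sum>k\<in>E. S e k * quad_mom f k (n - 1))"
proof -
  let ?D = "\<lambda>\<omega>. of_nat n * Q \<omega> ^ (n - 1) * (d e * (\<Sum>k\<in>E. S e k * g k \<omega>))"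
  have "quad_mom e f n = (\<integral>\<omega>. g f \<omega> * ?D \<omega> + cov (g e) (g f) * Q \<omega> ^ n \<partial>M)"
    unfolding quad_mom_def
    by (rule ibp_expectation[OF ibp_mult[OF ibp_quadratic_power[OF e] g[OF e] g[OF f]] g[OF e]])
  also have "\<dots> = (\<integral>\<omega>. (\<Sum>k\<in>E. (of_nat n * d e * S e k) * (g f \<omega> * (g k \<omega> * Q \<omega> ^ (n - 1)))) + cov (g e) (g f) * Q \<omega> ^ n \<partial>M)"
    by (intro Bochner_Integration.integral_cong refl) (simp add: sum_distrib_left ac_simps)
  also have "\<dots> = (\<integral>\<omega>. (\<Sum>k\<in>E. (of_nat n * d e * S e k) * (g f \<omega> * (g k \<omega> * Q \<omega> ^ (n - 1)))) \<partial>M) + (\<integral>\<omega>. cov (g e) (g f) * Q \<omega> ^ n \<partial>M)"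
    by (intro Bochner_Integration.integral_add Bochner_Integration.integrable_sum integrable_mult_right
        all_moments_integrable gQ_moments all_moments_power quadratic_all_moments f) auto
  also have "(\<integral>\<omega>. (\<Sum>k\<in>E. (of_nat n * d e * S e k) * (g f \<omega> * (g k \<omega> * Q \<omega> ^ (n - 1)))) \<partial>M) =
     (\<Sum>k\<in>E. (of_nat n * d e * S e k) * quad_mom f k (n - 1))"
    unfolding quad_mom_def
    by (subst Bochner_Integration.integral_sum) (auto intro!: integrable_mult_right all_moments_integrable gQ_moments f)
  finally show ?thesis using e f by (simp add: cov_g sum_distrib_left ac_simps)
qed

text \<open>\<open>S_d\<close> forces \<open>S e f = 0\<close> unless \<open>d f = 1\<close>, so a
  positive power of S absorbs the variances of the coordinates. In this way coordinates of variance
  zero do no harm.\<close>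

lemma mat_pow_d:
  assumes "f \<in> E" "e \<in> E" shows "mat_pow E S (Suc k) f e * d e = mat_pow E S (Suc k) f e"
  unfolding mat_pow_Suc_right[OF fin assms] sum_distrib_right
  by (intro sum.cong refl) (simp add: mult.assoc S_d assms)

text \<open>Integrate one factor g by parts in (g^T S^k g) Q^n. Falling on the other g, the
  derivative produces the trace of S^k; falling on Q^n, it produces n Q^(n-1) and one more factor
  S.\<close>

lemma quad_tmom_rec:
  "quad_tmom (Suc k) n = mat_tr E (mat_pow E S (Suc k)) * (\<integral>\<omega>. Q \<omega> ^ n \<partial>M)
     + of_nat n * quad_tmom (Suc (Suc k)) (n - 1)"
proof -
  let ?P = "mat_pow E S (Suc k)"
  have "quad_tmom (Suc k) n = (\<Sum>e\<in>E. \<Sum>f\<in>E. (if e = f then ?P e e * (\<integral>\<omega>. Q \<omega> ^ n \<partial>M) else 0)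
      + of_nat n * (\<Sum>h\<in>E. ?P f e * S e h * quad_mom f h (n - 1)))"
    unfolding quad_tmom_def
  proof (intro sum.cong refl)
    fix e f assume e: "e \<in> E" and f: "f \<in> E"
    have "?P f e * quad_mom e f n = (if e = f then (?P f e * d e) * (\<integral>\<omega>. Q \<omega> ^ n \<partial>M) else 0)
        + of_nat n * ((?P f e * d e) * (\<Sum>h\<in>E. S e h * quad_mom f h (n - 1)))"
      unfolding quad_mom_rec[OF e f] by (simp add: algebra_simps del: mat_pow.simps)
    then show "?P f e * quad_mom e f n = (if e = f then ?P e e * (\<integral>\<omega>. Q \<omega> ^ n \<partial>M) else 0)
      + of_nat n * (\<Sum>h\<in>E. ?P f e * S e h * quad_mom f h (n - 1))"
      unfolding mat_pow_d[OF f e] by (auto simp: sum_distrib_left mult.assoc simp del: mat_pow.simps)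
  qed
  also have "\<dots> = (\<Sum>e\<in>E. \<Sum>f\<in>E. if e = f then ?P e e * (\<integral>\<omega>. Q \<omega> ^ n \<partial>M) else 0)
      + of_nat n * (\<Sum>e\<in>E. \<Sum>f\<in>E. \<Sum>h\<in>E. ?P f e * S e h * quad_mom f h (n - 1))"
    by (simp add: sum.distrib sum_distrib_left del: mat_pow.simps)
  also have "(\<Sum>e\<in>E. \<Sum>f\<in>E. if e = f then ?P e e * (\<integral>\<omega>. Q \<omega> ^ n \<partial>M) else 0) = mat_tr E ?P * (\<integral>\<omega>. Q \<omega> ^ n \<partial>M)"
    unfolding mat_tr_def sum_distrib_right using fin by (intro sum.cong refl) (simp del: mat_pow.simps)
  also have "(\<Sum>e\<in>E. \<Sum>f\<in>E. \<Sum>h\<in>E. ?P f e * S e h * quad_mom f h (n - 1)) = quad_tmom (Suc (Suc k)) (n - 1)"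
  proof -
    have "(\<Sum>e\<in>E. \<Sum>f\<in>E. \<Sum>h\<in>E. ?P f e * S e h * quad_mom f h (n - 1)) = (\<Sum>f\<in>E. \<Sum>h\<in>E. \<Sum>e\<in>E. ?P f e * S e h * quad_mom f h (n - 1))"
      by (subst sum.swap) (intro sum.cong refl sum.swap)
    also have "\<dots> = (\<Sum>f\<in>E. \<Sum>h\<in>E. mat_pow E S (Suc (Suc k)) h f * quad_mom f h (n - 1))"
    proof (intro sum.cong refl)
      fix f h assume f: "f \<in> E" and h: "h \<in> E"
      have "mat_pow E S (Suc (Suc k)) h f = mat_pow E S (Suc (Suc k)) f h"
        by (rule mat_pow_sym[OF fin sym h f])
      also have "\<dots> = (\<Sum>e\<in>E. ?P f e * S e h)" by (rule mat_pow_Suc_right[OF fin f h])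
      finally show "(\<Sum>e\<in>E. ?P f e * S e h * quad_mom f h (n - 1)) = mat_pow E S (Suc (Suc k)) h f * quad_mom f h (n - 1)"
        by (simp only: sum_distrib_right)
    qed
    finally show ?thesis by (simp add: quad_tmom_def del: mat_pow.simps)
  qed
  finally show ?thesis .
qed

text \<open>The recursion unrolled until the power of Q is exhausted; the falling factorials n (n-1)
  ... are written as binomial coefficients times factorials to match Leibniz' rule later.\<close>

lemma quad_tmom_eq:
  "quad_tmom (Suc k) n = (\<Sum>i\<le>n. of_nat (n choose i) * fact i * mat_tr E (mat_pow E S (Suc (k + i))) * (\<integral>\<omega>. Q \<omega> ^ (n - i) \<partial>M))"
proof (induction n arbitrary: k)
  case 0
  then show ?case using quad_tmom_rec[of k 0] by (simp del: mat_pow.simps)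
next
  case (Suc n)
  have "of_nat (Suc n) * (of_nat (n choose i) * fact i) = (of_nat (Suc n choose Suc i) * fact (Suc i) :: real)" for i
  proof -
    have "Suc n * (n choose i) = (Suc n choose Suc i) * Suc i" by (rule Suc_times_binomial_eq)
    then have "of_nat (Suc n) * of_nat (n choose i) = (of_nat (Suc n choose Suc i) * of_nat (Suc i) :: real)"
      by (metis of_nat_mult)
    then show ?thesis by (simp add: mult.assoc[symmetric] del: of_nat_Suc binomial_Suc_Suc)
  qed
  then have *: "of_nat (Suc n) * (of_nat (n choose i) * fact i * A * B) = (of_nat (Suc n choose Suc i) * fact (Suc i) * A * B :: real)" for i A B
    by (metis mult.assoc)
  have "quad_tmom (Suc k) (Suc n) = mat_tr E (mat_pow E S (Suc k)) * (\<integral>\<omega>. Q \<omega> ^ Suc n \<partial>M) + of_nat (Suc n) * quad_tmom (Suc (Suc k)) n"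
    using quad_tmom_rec[of k "Suc n"] by (simp only: diff_Suc_1)
  also have "of_nat (Suc n) * quad_tmom (Suc (Suc k)) n =
     (\<Sum>i\<le>n. of_nat (Suc n choose Suc i) * fact (Suc i) * mat_tr E (mat_pow E S (Suc (k + Suc i))) * (\<integral>\<omega>. Q \<omega> ^ (Suc n - Suc i) \<partial>M))"
    unfolding Suc.IH sum_distrib_left * by (simp only: add_Suc_right add_Suc diff_Suc_Suc)
  finally show ?case
    unfolding sum.atMost_Suc_shift by (simp del: mat_pow.simps power_Suc binomial_Suc_Suc fact_Suc)
qed

text \<open>One factor of Q^(n+1) is half of g^T S g, which is the case k = 1 of the family above.
  The result is the moment-cumulant recursion with cumulants i! tr S^(i+1) / 2 of order i +
  1.\<close>

lemma quadratic_moment_rec: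
  "(\<integral>\<omega>. Q \<omega> ^ Suc n \<partial>M) = (\<Sum>i\<le>n. of_nat (n choose i) * (fact i * mat_tr E (mat_pow E S (Suc i)) / 2) * (\<integral>\<omega>. Q \<omega> ^ (n - i) \<partial>M))"
proof -
  have "(\<integral>\<omega>. Q \<omega> ^ Suc n \<partial>M) = (\<integral>\<omega>. (\<Sum>e\<in>E. \<Sum>f\<in>E. (S e f / 2) * (g e \<omega> * (g f \<omega> * Q \<omega> ^ n))) \<partial>M)"
  proof (intro Bochner_Integration.integral_cong refl)
    fix \<omega>
    have "Q \<omega> ^ Suc n = (\<Sum>e\<in>E. \<Sum>f\<in>E. S e f * g e \<omega> * g f \<omega>) / 2 * Q \<omega> ^ n"
      unfolding Q_def[symmetric] by simp
    also have "\<dots> = (\<Sum>e\<in>E. \<Sum>f\<in>E. (S e f / 2) * (g e \<omega> * (g f \<omega> * Q \<omega> ^ n)))"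
      unfolding sum_divide_distrib sum_distrib_right by (intro sum.cong refl) simp
    finally show "Q \<omega> ^ Suc n = (\<Sum>e\<in>E. \<Sum>f\<in>E. (S e f / 2) * (g e \<omega> * (g f \<omega> * Q \<omega> ^ n)))" .
  qed
  also have "\<dots> = (\<Sum>e\<in>E. \<integral>\<omega>. (\<Sum>f\<in>E. (S e f / 2) * (g e \<omega> * (g f \<omega> * Q \<omega> ^ n))) \<partial>M)"
    by (intro Bochner_Integration.integral_sum Bochner_Integration.integrable_sum integrable_mult_right all_moments_integrable gQ_moments)
  also have "\<dots> = (\<Sum>e\<in>E. \<Sum>f\<in>E. (S e f / 2) * quad_mom e f n)"
  proof (intro sum.cong refl)
    fix e assume e: "e \<in> E"
    have "(\<integral>\<omega>. (\<Sum>f\<in>E. (S e f / 2) * (g e \<omega> * (g f \<omega> * Q \<omega> ^ n))) \<partial>M) = (\<Sum>f\<in>E. \<integral>\<omega>. (S e f / 2) * (g e \<omega> * (g f \<omega> * Q \<omega> ^ n)) \<partial>M)"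
      by (intro Bochner_Integration.integral_sum integrable_mult_right all_moments_integrable gQ_moments e)
    then show "(\<integral>\<omega>. (\<Sum>f\<in>E. (S e f / 2) * (g e \<omega> * (g f \<omega> * Q \<omega> ^ n))) \<partial>M) = (\<Sum>f\<in>E. (S e f / 2) * quad_mom e f n)"
      by (simp add: quad_mom_def)
  qed
  also have "\<dots> = quad_tmom (Suc 0) n / 2"
    unfolding quad_tmom_def sum_divide_distrib
    by (intro sum.cong refl) (simp add: mat_pow_1[OF fin] sym del: mat_pow.simps)
  finally show ?thesis
    unfolding quad_tmom_eq sum_divide_distrib by (simp add: ac_simps del: mat_pow.simps)
qed

end

end

section \<open>Edgeworth expansion of Gaussian quadratic forms\<close>

text \<open>The recursion \<open>m\<close> is Leibniz' rule for f' = L' f with f = exp L, so by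
  induction the derivatives of exp L at 0 are the numbers \<open>m n\<close>. The bound on \<tau>
  makes L holomorphic on the ball, and there the Taylor series of exp L converges.\<close>

lemma cumulant_series:
  fixes \<tau> m :: "nat \<Rightarrow> real" and s R :: real
  assumes \<tau>: "\<And>k. \<bar>\<tau> (k + 2)\<bar> \<le> s ^ k * \<tau> 2" and s: "0 \<le> s" and R: "0 < R" "s * R < 1"
    and m0: "m 0 = 1" and m: "\<And>n. m (Suc n) = (\<Sum>i\<le>n. of_nat (n choose i) * (fact i * \<tau> (Suc i) / 2) * m (n - i))"
  defines "L \<equiv> eval_fps (Abs_fps (\<lambda>n. complex_of_real (\<tau> n / (2 * real n))))"
  shows "L holomorphic_on ball 0 R"
    and "\<And>z. norm z < R \<Longrightarrow> (\<lambda>n. of_real (m n / fact n) * z ^ n) sums exp (L z)"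
    and "\<And>z. norm z < R \<Longrightarrow> (\<lambda>n. complex_of_real (\<tau> n / (2 * real n)) * z ^ n) sums L z"
proof -
  define A where "A = Abs_fps (\<lambda>n. complex_of_real (\<tau> n / (2 * real n)))"
  have t0: "0 \<le> \<tau> 2" using order.trans[OF abs_ge_zero \<tau>[of 0]] by simp
  \<comment> \<open>Shifted by two because \<tau> is controlled from index 2 on; finitely many terms
    do not affect convergence.\<close>
  have "summable (\<lambda>n. complex_of_real (\<tau> (n + 2) / (2 * real (n + 2))) * of_real R ^ (n + 2))"
  proof (rule summable_comparison_test')
    show "summable (\<lambda>n. (\<tau> 2 * R\<^sup>2) * (s * R) ^ n)"
      using R s by (intro summable_mult summable_geometric) (simp add: abs_mult)
    fix n :: nat assume "0 \<le> n"
    have "norm (complex_of_real (\<tau> (n + 2) / (2 * real (n + 2))) * of_real R ^ (n + 2)) = \<bar>\<tau> (n + 2)\<bar> / (2 * real (n + 2)) * R ^ (n + 2)"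
      using R by (simp add: norm_mult norm_power norm_divide abs_divide del: of_nat_add power_Suc of_nat_Suc)
    also have "\<dots> \<le> \<bar>\<tau> (n + 2)\<bar> * R ^ (n + 2)"
      using R by (intro mult_right_mono) (auto simp: field_simps mult_left_le)
    also have "\<dots> \<le> (s ^ n * \<tau> 2) * R ^ (n + 2)" using R by (intro mult_right_mono \<tau>) auto
    also have "\<dots> = (\<tau> 2 * R\<^sup>2) * (s * R) ^ n" by (simp add: power_mult_distrib power_add power2_eq_square ac_simps)
    finally show "norm (complex_of_real (\<tau> (n + 2) / (2 * real (n + 2))) * of_real R ^ (n + 2)) \<le> (\<tau> 2 * R\<^sup>2) * (s * R) ^ n" .
  qed
  then have "summable (\<lambda>n. fps_nth A n * of_real R ^ n)"
    using summable_iff_shift[of "\<lambda>n. complex_of_real (\<tau> n / (2 * real n)) * of_real R ^ n" 2] by (simp add: A_def)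
  then have rA: "ereal R \<le> fps_conv_radius A"
    using conv_radius_geI[of "fps_nth A" "of_real R"] R by (simp add: fps_conv_radius_def)
  have inA: "norm z < R \<Longrightarrow> ereal (norm z) < fps_conv_radius A" for z :: complex
    using rA by (meson ereal_less_eq(3) less_ereal.simps(1) order_less_le_trans)
  have LA: "L = eval_fps A" by (simp add: L_def A_def)
  have sub: "ball (0::complex) R \<subseteq> eball 0 (fps_conv_radius A)" using inA by (auto simp: eball_def dist_norm)
  then show holL: "L holomorphic_on ball 0 R" unfolding LA by (rule holomorphic_on_eval_fps)
  show "(\<lambda>n. complex_of_real (\<tau> n / (2 * real n)) * z ^ n) sums L z" if "norm z < R" for z
    using sums_eval_fps[OF inA[OF that]] by (simp add: LA A_def)
  define H where "H = eval_fps (fps_deriv A)"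
  have rD: "fps_conv_radius A \<le> fps_conv_radius (fps_deriv A)" by (rule fps_conv_radius_deriv)
  have holH: "H holomorphic_on ball 0 R"
    unfolding H_def by (rule holomorphic_on_eval_fps) (use sub rD in \<open>auto simp: eball_def intro: order_less_le_trans\<close>)
  define f where "f z = exp (L z)" for z
  have holf: "f holomorphic_on ball 0 R" unfolding f_def by (intro holomorphic_intros holL)
  have df: "deriv f z = H z * f z" if "z \<in> ball 0 R" for z
  proof (rule DERIV_imp_deriv)
    have "(L has_field_derivative H z) (at z)"
      unfolding LA H_def by (rule has_field_derivative_eval_fps) (use inA that in auto)
    then show "(f has_field_derivative H z * f z) (at z)"
      unfolding f_def by (auto intro!: derivative_eq_intros)
  qed
  have dH: "(deriv ^^ i) H 0 = of_real (fact i * \<tau> (Suc i) / 2)" for i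
  proof -
    have pos: "0 < fps_conv_radius (fps_deriv A)" using rA rD R by (meson ereal_less(2) order_less_le_trans)
    have "(deriv ^^ i) H 0 = fact i * fps_nth (fps_deriv A) i"
      unfolding H_def using fps_nth_conv_deriv[OF pos, of i] by simp
    also have "\<dots> = of_real (fact i * \<tau> (Suc i) / 2)" by (simp add: A_def field_simps del: of_nat_Suc)
    finally show ?thesis .
  qed
  \<comment> \<open>The coefficient of index 0 is a division by zero and hence 0, so L vanishes at
    0.\<close>
  have f0: "f 0 = 1" by (simp add: f_def LA eval_fps_at_0 A_def)
  have dfn: "(deriv ^^ n) f 0 = of_real (m n)" for n
  proof (induction n rule: less_induct)
    case (less n)
    show ?case
    proof (cases n)
      case 0
      then show ?thesis by (simp add: f0 m0)
    next
      case (Suc k)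
      have "(deriv ^^ n) f 0 = (deriv ^^ k) (deriv f) 0" by (simp add: Suc funpow_swap1)
      also have "\<dots> = (deriv ^^ k) (\<lambda>z. H z * f z) 0"
        by (rule higher_deriv_transform_within_open[where S = "ball 0 R"])
           (use R df holf holH in \<open>auto intro!: holomorphic_deriv holomorphic_intros\<close>)
      also have "\<dots> = (\<Sum>i = 0..k. of_nat (k choose i) * (deriv ^^ i) H 0 * (deriv ^^ (k - i)) f 0)"
        by (rule higher_deriv_mult[OF holH holf]) (use R in auto)
      also have "\<dots> = (\<Sum>i\<le>k. of_nat (k choose i) * of_real (fact i * \<tau> (Suc i) / 2) * of_real (m (k - i)))"
        unfolding atLeast0AtMost using Suc less.IH by (intro sum.cong refl) (simp add: dH)
      also have "\<dots> = of_real (m n)" unfolding Suc m by simp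
      finally show ?thesis .
    qed
  qed
  show "(\<lambda>n. of_real (m n / fact n) * z ^ n) sums exp (L z)" if "norm z < R" for z
    using holomorphic_power_series[OF holf, of z] that dfn by (simp add: f_def)
qed

text \<open>The series of signed moments is what is known to converge, so absolute values are
  reached through even powers: these sum to cosh (r Q), which monotone convergence shows to be
  integrable. Since exp (r |Q|) is at most 2 cosh (r Q), the exponential series may then be
  integrated termwise.\<close>

lemma (in prob_space) exp_moment_sums:
  fixes Q :: "'a \<Rightarrow> real" and f :: "complex \<Rightarrow> complex"
  assumes Q[measurable]: "Q \<in> borel_measurable M" and int: "\<And>n. integrable M (\<lambda>\<omega>. Q \<omega> ^ n)"
    and f: "\<And>z. norm z < R \<Longrightarrow> (\<lambda>n. of_real (expectation (\<lambda>\<omega>. Q \<omega> ^ n) / fact n) * z ^ n) sums f z"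
    and z: "norm z < R"
  shows "integrable M (\<lambda>\<omega>. exp (norm z * \<bar>Q \<omega>\<bar>))" and "(CLINT \<omega>|M. exp (z * of_real (Q \<omega>))) = f z"
proof -
  define r where "r = norm z"
  define c where "c n \<omega> = (if even n then (r * Q \<omega>) ^ n /\<^sub>R fact n else 0)" for n \<omega>
  have c0: "0 \<le> c n \<omega>" for n \<omega> by (simp add: c_def zero_le_even_power)
  have cs: "(\<lambda>n. c n \<omega>) sums cosh (r * Q \<omega>)" for \<omega> unfolding c_def by (rule cosh_converges)
  have ci: "integrable M (c n)" for n
    unfolding c_def[abs_def] using int[of n] by (cases "even n") (auto simp: power_mult_distrib)
  \<comment> \<open>Convergence at a point strictly beyond r turns into absolute convergence at
    r.\<close>
  obtain \<rho> where \<rho>: "r < \<rho>" "\<rho> < R" using z dense[of "norm z" R] unfolding r_def by blast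
  have "summable (\<lambda>n. norm (complex_of_real (expectation (\<lambda>\<omega>. Q \<omega> ^ n) / fact n) * of_real r ^ n))"
  proof (rule powser_insidea)
    show "summable (\<lambda>n. complex_of_real (expectation (\<lambda>\<omega>. Q \<omega> ^ n) / fact n) * of_real \<rho> ^ n)"
    proof -
      have "0 \<le> \<rho>" using \<rho>(1) norm_ge_zero[of z] unfolding r_def by linarith
      then show ?thesis using f[of "of_real \<rho>"] \<rho> by (simp add: sums_iff)
    qed
    show "norm (complex_of_real r) < norm (complex_of_real \<rho>)" using \<rho> by (auto simp: r_def)
  qed
  then have "summable (\<lambda>n. \<bar>expectation (\<lambda>\<omega>. Q \<omega> ^ n)\<bar> / fact n * r ^ n)"
    by (simp add: norm_mult norm_divide norm_power r_def)
  then have sc: "summable (\<lambda>n. expectation (c n))"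
  proof (rule summable_comparison_test'[where N = 0])
    fix n
    show "norm (expectation (c n)) \<le> \<bar>expectation (\<lambda>\<omega>. Q \<omega> ^ n)\<bar> / fact n * r ^ n"
      by (cases "even n") (auto simp: c_def[abs_def] power_mult_distrib abs_mult r_def field_simps)
  qed
  have "(\<integral>\<^sup>+\<omega>. ennreal (cosh (r * Q \<omega>)) \<partial>M) = (\<integral>\<^sup>+\<omega>. (\<Sum>n. ennreal (c n \<omega>)) \<partial>M)"
    using cs c0 by (intro nn_integral_cong) (simp add: suminf_ennreal2 sums_iff)
  also have "\<dots> = (\<Sum>n. \<integral>\<^sup>+\<omega>. ennreal (c n \<omega>) \<partial>M)"
    by (rule nn_integral_suminf) (use ci in measurable)
  also have "\<dots> = (\<Sum>n. ennreal (expectation (c n)))"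
    using ci c0 by (simp add: nn_integral_eq_integral)
  also have "\<dots> = ennreal (\<Sum>n. expectation (c n))"
    using sc c0 by (intro suminf_ennreal2) (auto intro: integral_nonneg)
  also have "\<dots> < \<infinity>" by simp
  finally have fin: "(\<integral>\<^sup>+\<omega>. ennreal (cosh (r * Q \<omega>)) \<partial>M) < \<infinity>" .
  have ich: "integrable M (\<lambda>\<omega>. cosh (r * Q \<omega>))"
  proof (rule integrableI_bounded)
    show "(\<lambda>\<omega>. cosh (r * Q \<omega>)) \<in> borel_measurable M" unfolding cosh_def by measurable
    show "(\<integral>\<^sup>+\<omega>. ennreal (norm (cosh (r * Q \<omega>))) \<partial>M) < \<infinity>"
      using fin by (simp add: cosh_real_nonneg)
  qed
  have le: "exp (r * \<bar>Q \<omega>\<bar>) \<le> 2 * cosh (r * Q \<omega>)" for \<omega>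
    by (cases "0 \<le> Q \<omega>") (auto simp: cosh_def)
  show ie: "integrable M (\<lambda>\<omega>. exp (norm z * \<bar>Q \<omega>\<bar>))"
    unfolding r_def[symmetric]
  proof (rule Bochner_Integration.integrable_bound)
    show "integrable M (\<lambda>\<omega>. 2 * cosh (r * Q \<omega>))" using ich by simp
    show "AE \<omega> in M. norm (exp (r * \<bar>Q \<omega>\<bar>)) \<le> norm (2 * cosh (r * Q \<omega>))"
      using le by (intro AE_I2) (simp add: cosh_real_nonneg)
  qed measurable
  define g where "g n \<omega> = (z * of_real (Q \<omega>)) ^ n /\<^sub>R fact n" for n \<omega>
  have gi: "complex_integrable M (g n)" for n
    unfolding g_def[abs_def] using int[of n] by (simp add: power_mult_distrib flip: of_real_power)
  have ng: "norm (g n \<omega>) = (r * \<bar>Q \<omega>\<bar>) ^ n /\<^sub>R fact n" for n \<omega>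
    by (simp add: g_def norm_mult norm_power r_def)
  have "(\<lambda>n. integral\<^sup>L M (g n)) sums (CLINT \<omega>|M. (\<Sum>n. g n \<omega>))"
  proof (rule sums_integral)
    show "complex_integrable M (g n)" for n by (rule gi)
    show "AE \<omega> in M. summable (\<lambda>n. norm (g n \<omega>))"
      unfolding ng by (intro AE_I2 sums_summable[OF exp_converges])
    show "summable (\<lambda>n. \<integral>\<omega>. norm (g n \<omega>) \<partial>M)"
    proof (rule summableI_nonneg_bounded)
      fix n
      have "(\<Sum>i<n. \<integral>\<omega>. norm (g i \<omega>) \<partial>M) = (\<integral>\<omega>. (\<Sum>i<n. norm (g i \<omega>)) \<partial>M)"
        using gi by (subst Bochner_Integration.integral_sum) auto
      also have "\<dots> \<le> (\<integral>\<omega>. exp (r * \<bar>Q \<omega>\<bar>) \<partial>M)"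
      proof (rule integral_mono)
        show "integrable M (\<lambda>\<omega>. \<Sum>i<n. norm (g i \<omega>))" using gi by auto
        show "integrable M (\<lambda>\<omega>. exp (r * \<bar>Q \<omega>\<bar>))" using ie by (simp add: r_def)
        fix \<omega>
        have "(\<Sum>i<n. (r * \<bar>Q \<omega>\<bar>) ^ i /\<^sub>R fact i) \<le> (\<Sum>i. (r * \<bar>Q \<omega>\<bar>) ^ i /\<^sub>R fact i)"
          using exp_converges[of "r * \<bar>Q \<omega>\<bar>"] by (intro sum_le_suminf) (auto simp: sums_iff r_def)
        then show "(\<Sum>i<n. norm (g i \<omega>)) \<le> exp (r * \<bar>Q \<omega>\<bar>)"
          unfolding ng using exp_converges[of "r * \<bar>Q \<omega>\<bar>"] by (simp add: sums_iff)
      qed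
      finally show "(\<Sum>i<n. \<integral>\<omega>. norm (g i \<omega>) \<partial>M) \<le> (\<integral>\<omega>. exp (r * \<bar>Q \<omega>\<bar>) \<partial>M)" .
    qed auto
  qed
  moreover have "(\<Sum>n. g n \<omega>) = exp (z * of_real (Q \<omega>))" for \<omega>
    unfolding g_def using exp_converges[of "z * of_real (Q \<omega>)"] by (simp add: sums_iff)
  moreover have "integral\<^sup>L M (g n) = of_real (expectation (\<lambda>\<omega>. Q \<omega> ^ n) / fact n) * z ^ n" for n
  proof -
    have "integral\<^sup>L M (g n) = (CLINT \<omega>|M. (z ^ n / fact n) * of_real (Q \<omega> ^ n))"
      unfolding g_def by (intro Bochner_Integration.integral_cong refl)
        (simp add: power_mult_distrib scaleR_conv_of_real field_simps)
    also have "\<dots> = (z ^ n / fact n) * of_real (expectation (\<lambda>\<omega>. Q \<omega> ^ n))" by (simp del: of_real_power)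
    finally show ?thesis by simp
  qed
  ultimately show "(CLINT \<omega>|M. exp (z * of_real (Q \<omega>))) = f z"
    using f[OF z] sums_unique2 by simp
qed

text \<open>For s |z| at most 1/2 the tail from index k + 2 is dominated by a geometric series of
  ratio 1/2, hence by twice its leading bound; the 2 cancels the one in the coefficients. The tails
  from index 4 and from index 2 are used, and the term of index 0 is 0 by division by zero.\<close>

lemma cumulant_remainder:
  fixes \<tau> :: "nat \<Rightarrow> real" and s :: real
  assumes \<tau>: "\<And>k. \<bar>\<tau> (k + 2)\<bar> \<le> s ^ k * \<tau> 2" and s: "0 \<le> s" and z: "s * norm z \<le> 1 / 2"
    and L: "(\<lambda>n. complex_of_real (\<tau> n / (2 * real n)) * z ^ n) sums l"
  shows "norm (l - (of_real (\<tau> 1) * z / 2 + of_real (\<tau> 2) * z\<^sup>2 / 4 + of_real (\<tau> 3) * z ^ 3 / 6)) \<le> \<tau> 2 * s\<^sup>2 * norm z ^ 4 / 4"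
    and "norm (l - of_real (\<tau> 1) * z / 2) \<le> \<tau> 2 * norm z ^ 2 / 2"
proof -
  have t0: "0 \<le> \<tau> 2" using order.trans[OF abs_ge_zero \<tau>[of 0]] by simp
  let ?a = "\<lambda>n. complex_of_real (\<tau> n / (2 * real n)) * z ^ n"
  have sa: "summable ?a" and sl: "suminf ?a = l" using L by (auto simp: sums_iff)
  have key: "norm (\<Sum>n. ?a (n + (k + 2))) \<le> \<tau> 2 * s ^ k * norm z ^ (k + 2) / real (k + 2)" for k
  proof -
    define B where "B = \<tau> 2 * s ^ k * norm z ^ (k + 2) / (2 * real (k + 2))"
    have B0: "0 \<le> B" unfolding B_def using s t0 by simp
    have gs: "(\<lambda>n. B * (s * norm z) ^ n) sums (B * (1 / (1 - s * norm z)))"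
      using z s by (intro sums_mult geometric_sums) (auto simp: abs_mult)
    have "norm (\<Sum>n. ?a (n + (k + 2))) \<le> (\<Sum>n. B * (s * norm z) ^ n)"
    proof (rule norm_suminf_le)
      show "summable (\<lambda>n. B * (s * norm z) ^ n)" using gs by (simp add: sums_iff)
      fix n
      have "norm (?a (n + (k + 2))) = \<bar>\<tau> (n + k + 2)\<bar> / (2 * real (n + k + 2)) * norm z ^ (n + k + 2)"
        by (simp only: norm_mult norm_of_real norm_power abs_divide add.assoc abs_mult abs_numeral abs_of_nat)
      also have "\<dots> \<le> (s ^ (n + k) * \<tau> 2) / (2 * real (k + 2)) * norm z ^ (n + k + 2)"
        using s t0 by (intro mult_right_mono frac_le \<tau>) auto
      also have "\<dots> = B * (s * norm z) ^ n"
        by (simp add: B_def power_add power_mult_distrib ac_simps)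
      finally show "norm (?a (n + (k + 2))) \<le> B * (s * norm z) ^ n" .
    qed
    also have "\<dots> = B * (1 / (1 - s * norm z))" using gs by (simp add: sums_iff)
    also have "\<dots> \<le> B * 2" using z B0 by (intro mult_left_mono) (auto simp: field_simps)
    also have "B * 2 = \<tau> 2 * s ^ k * norm z ^ (k + 2) / real (k + 2)"
      by (simp add: B_def field_simps del: power_Suc of_nat_Suc of_nat_add)
    finally show ?thesis .
  qed
  have "l = (\<Sum>n. ?a (n + 4)) + (\<Sum>n<4. ?a n)" using suminf_split_initial_segment[OF sa, of 4] sl by simp
  moreover have "(\<Sum>n<4. ?a n) = of_real (\<tau> 1) * z / 2 + of_real (\<tau> 2) * z\<^sup>2 / 4 + of_real (\<tau> 3) * z ^ 3 / 6"
    by (simp add: numeral_eq_Suc)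
  ultimately show "norm (l - (of_real (\<tau> 1) * z / 2 + of_real (\<tau> 2) * z\<^sup>2 / 4 + of_real (\<tau> 3) * z ^ 3 / 6)) \<le> \<tau> 2 * s\<^sup>2 * norm z ^ 4 / 4"
    using key[of 2] by simp
  have c: "(\<Sum>n<2. ?a n) = of_real (\<tau> 1) * z / 2"
    by (simp add: numeral_eq_Suc)
  have "l = (\<Sum>n. ?a (n + 2)) + (\<Sum>n<2. ?a n)" using suminf_split_initial_segment[OF sa, of 2] sl by simp
  then have "l - of_real (\<tau> 1) * z / 2 = (\<Sum>n. ?a (n + 2))"
    unfolding c by (simp only: add_diff_cancel_right')
  moreover have "norm (\<Sum>n. ?a (n + 2)) \<le> \<tau> 2 * norm z ^ 2 / 2"
    using key[of 0] by (simp only: power_0 mult_1_right add_0 of_nat_numeral)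
  ultimately show "norm (l - of_real (\<tau> 1) * z / 2) \<le> \<tau> 2 * norm z ^ 2 / 2"
    by (simp only:)
qed

section \<open>From complex to real derivatives, and the local Edgeworth estimate\<close>

lemma nth_deriv_Suc: "nth_deriv (Suc j) f = (\<lambda>u. vector_derivative (nth_deriv j f) (at u))"
  by (simp add: nth_deriv_def)

text \<open>The induction is over all u at once: to differentiate the identity of order j again it
  must hold in a neighbourhood, which the open set D provides.\<close>

lemma nth_deriv_holomorphic:
  assumes D: "open D" "\<Phi> holomorphic_on D" and f: "\<And>u. of_real u \<in> D \<Longrightarrow> f u = \<Phi> (of_real u)" and u: "of_real u \<in> D"
  shows "nth_deriv j f u = (deriv ^^ j) \<Phi> (of_real u)"
  using u
proof (induction j arbitrary: u)
  case 0
  then show ?case by (simp add: nth_deriv_def f)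
next
  case (Suc j)
  let ?G = "(deriv ^^ j) \<Phi>"
  have hol: "?G holomorphic_on D" by (rule holomorphic_higher_deriv[OF D(2,1)])
  have "(?G has_field_derivative deriv ?G (of_real u)) (at (of_real u))"
    by (rule holomorphic_derivI[OF hol D(1) Suc.prems])
  then have "((\<lambda>u. ?G (of_real u)) has_vector_derivative deriv ?G (of_real u)) (at u)"
    by (rule has_vector_derivative_real_field)
  moreover have "eventually (\<lambda>v. nth_deriv j f v = ?G (of_real v)) (nhds u)"
  proof -
    have "open (of_real -` D :: real set)" by (intro open_vimage D continuous_intros)
    then have "eventually (\<lambda>v. v \<in> (of_real -` D :: real set)) (nhds u)"
      using Suc.prems by (intro eventually_nhds_in_open) auto
    then show ?thesis by eventually_elim (rule Suc.IH, simp)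
  qed
  ultimately have "(nth_deriv j f has_vector_derivative deriv ?G (of_real u)) (at u)"
    using has_vector_derivative_cong_ev[of UNIV "nth_deriv j f" "\<lambda>u. ?G (of_real u)" u "deriv ?G (of_real u)"]
    by (auto dest: eventually_nhds_x_imp_x elim: eventually_mono)
  then show ?case by (simp add: nth_deriv_Suc vector_derivative_at)
qed

lemma one_plus_power_le:
  fixes x :: real assumes "0 \<le> x" shows "(1 + x) ^ q \<le> 2 ^ q * (1 + x ^ q)"
proof -
  have "(1 + x) ^ q \<le> (2 * max 1 x) ^ q" using assms by (intro power_mono) auto
  also have "\<dots> = 2 ^ q * max 1 x ^ q" by (simp add: power_mult_distrib)
  also have "\<dots> \<le> 2 ^ q * (1 + x ^ q)" using assms by (intro mult_left_mono) (auto simp: max_def)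
  finally show ?thesis .
qed

text \<open>The entire extension of the approximating function of the statement; there k is
  \<open>sqrt b * lambda3\<close>.\<close>

definition edgeworth :: "real \<Rightarrow> real \<Rightarrow> complex \<Rightarrow> complex" where
  "edgeworth l k z = exp (- of_real l * z\<^sup>2 / 2) * (1 + (\<i> * z) ^ 3 * of_real k / 6)"

lemma edgeworth_holomorphic: "edgeworth l k holomorphic_on A"
  unfolding edgeworth_def[abs_def] by (intro holomorphic_intros) auto

text \<open>Split the exponent into its Gaussian part and E = e1 + e, with e1 the cubic term and e
  the higher cumulants. Then exp E - 1 - e1 is e plus a Taylor remainder of size |E|^2. Here e is of
  order \<delta>^2 |z|^4, and the leading part of |E|^2 is of order \<delta>^2 |z|^6. The exponent 8
  is a common majorant of the powers that occur.\<close>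

lemma edgeworth_local_bound:
  fixes t2 t3 c s x u :: real and z w e :: complex
  assumes t2: "0 \<le> t2" "t2 \<le> 2 * c" and t3: "\<bar>t3\<bar> \<le> s * t2" and s: "0 \<le> s" "s \<le> 4 * \<delta>"
    and \<delta>: "0 < \<delta>" "\<delta> \<le> 1" and x: "\<delta> * x ^ 3 = 1" and u: "\<bar>u\<bar> \<le> x / 16"
    and w: "norm w \<le> 1 / (16 * (1 + \<bar>u\<bar>))" and z: "z = of_real u + w"
    and rem: "norm e \<le> t2 * s\<^sup>2 * norm z ^ 4 / 4"
  shows "norm (exp (- of_real t2 * z\<^sup>2 / 4 + of_real t3 * (\<i> * z) ^ 3 / 6 + e) - edgeworth (t2 / 2) t3 z)
     \<le> exp c * (32 * exp c * c\<^sup>2 + 8 * c) * \<delta>\<^sup>2 * (1 + \<bar>u\<bar>) ^ 8 * exp (- (t2 / 2) * u\<^sup>2 / 2)"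
proof -
  have c: "0 \<le> c" using t2 by simp
  have x1: "1 \<le> x"
  proof (rule ccontr)
    assume "\<not> 1 \<le> x"
    then have "x ^ 3 < 1"
    proof (cases "0 \<le> x")
      case True with \<open>\<not> 1 \<le> x\<close> show ?thesis by (simp add: power_less_one_iff)
    next
      case False then have "x ^ 3 < 0" by (simp add: odd_power_less_zero)
      then show ?thesis by linarith
    qed
    then have "\<delta> * x ^ 3 < 1 * 1"
      using \<delta> by (smt (verit) mult_le_cancel_left1 mult_le_cancel_left2 mult_less_cancel_left_pos)
    with x show False by simp
  qed
  define y where "y = norm z"
  have y0: "0 \<le> y" by (simp add: y_def)
  have w16: "norm w \<le> 1 / 16"
    using w by (rule order.trans) (simp add: field_simps)
  have yu: "y \<le> 1 + \<bar>u\<bar>"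
    unfolding y_def z using norm_triangle_ineq[of "complex_of_real u" w] w16 by simp
  have yx: "y \<le> x / 8"
    unfolding y_def z using norm_triangle_ineq[of "complex_of_real u" w] w16 u x1 by simp
  \<comment> \<open>Here the cube root in the range of u enters: |z| is at most x / 8 with \<delta>
    x^3 = 1, and 512 = 8^3.\<close>
  have dy: "\<delta> * y ^ 3 \<le> 1 / 512"
  proof -
    have "\<delta> * y ^ 3 \<le> \<delta> * (x / 8) ^ 3" using \<delta> yx y0 by (intro mult_left_mono power_mono) auto
    also have "\<dots> = 1 / 512" using x by (simp add: power_divide)
    finally show ?thesis .
  qed
  have d2y: "\<delta>\<^sup>2 * y ^ 4 \<le> 1 / 64"
  proof -
    have "\<delta> * y \<le> \<delta> * (x / 8)" using \<delta> yx by (intro mult_left_mono) auto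
    also have "\<dots> \<le> \<delta> * (x ^ 3 / 8)" using \<delta> x1 self_le_power[of x 3] by (intro mult_left_mono) auto
    also have "\<dots> = 1 / 8" using x by simp
    finally have "\<delta> * y \<le> 1 / 8" .
    then have "(\<delta> * y) * (\<delta> * y ^ 3) \<le> (1 / 8) * (1 / 512)" using dy \<delta> y0 by (intro mult_mono) auto
    then show ?thesis by (simp add: power2_eq_square power4_eq_xxxx power3_eq_cube ac_simps)
  qed
  define e1 where "e1 = of_real t3 * (\<i> * z) ^ 3 / 6"
  have e1: "norm e1 \<le> 4 / 3 * c * (\<delta> * y ^ 3)"
  proof -
    have "norm e1 = \<bar>t3\<bar> * y ^ 3 / 6" by (simp add: e1_def norm_mult norm_divide norm_power y_def)
    also have "\<dots> \<le> ((4 * \<delta>) * (2 * c)) * y ^ 3 / 6"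
      using order.trans[OF t3 mult_mono[OF s(2) t2(2)]] t2 \<delta> y0 by (intro divide_right_mono mult_right_mono) auto
    finally show ?thesis by (simp add: ac_simps)
  qed
  have e: "norm e \<le> 8 * c * (\<delta>\<^sup>2 * y ^ 4)"
  proof -
    have "s\<^sup>2 \<le> (4 * \<delta>)\<^sup>2" using s by (intro power_mono) auto
    then have "t2 * s\<^sup>2 \<le> (2 * c) * (4 * \<delta>)\<^sup>2" using t2 c by (intro mult_mono) auto
    then have "t2 * s\<^sup>2 * y ^ 4 / 4 \<le> (2 * c) * (4 * \<delta>)\<^sup>2 * y ^ 4 / 4"
      using y0 by (intro divide_right_mono mult_right_mono) auto
    then show ?thesis using rem by (simp add: y_def power_mult_distrib ac_simps)
  qed
  define E where "E = e1 + e"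
  have yl: "y ^ a \<le> (1 + \<bar>u\<bar>) ^ 8" if "a \<le> 8" for a
  proof -
    have "y ^ a \<le> (1 + \<bar>u\<bar>) ^ a" using yu y0 by (rule power_mono)
    also have "\<dots> \<le> (1 + \<bar>u\<bar>) ^ 8" using that by (intro power_increasing) auto
    finally show ?thesis .
  qed
  have nE: "norm E \<le> norm e1 + norm e" unfolding E_def by (rule norm_triangle_ineq)
  have Ec: "norm E \<le> c"
  proof -
    have "4 / 3 * c * (\<delta> * y ^ 3) \<le> 4 / 3 * c * (1 / 512)" using dy c by (intro mult_left_mono) auto
    moreover have "8 * c * (\<delta>\<^sup>2 * y ^ 4) \<le> 8 * c * (1 / 64)" using d2y c by (intro mult_left_mono) auto
    ultimately show ?thesis using nE e e1 c by linarith
  qed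
  \<comment> \<open>The generous constant 32 exceeds 32/9 + 2, the sum of the contributions of the
    cubic term and of the higher cumulants.\<close>
  have E2: "(norm E)\<^sup>2 \<le> 32 * c\<^sup>2 * \<delta>\<^sup>2 * (1 + \<bar>u\<bar>) ^ 8"
  proof -
    have "(norm E)\<^sup>2 \<le> (norm e1 + norm e)\<^sup>2" using nE by (intro power_mono) auto
    also have "\<dots> \<le> 2 * (norm e1)\<^sup>2 + 2 * (norm e)\<^sup>2"
      using sum_squares_ge_zero[of "norm e1 - norm e" 0] by (simp add: power2_eq_square algebra_simps)
    also have "(norm e1)\<^sup>2 \<le> (4 / 3 * c * (\<delta> * y ^ 3))\<^sup>2" using e1 by (intro power_mono) auto
    also have "(norm e)\<^sup>2 \<le> (8 * c * (\<delta>\<^sup>2 * y ^ 4))\<^sup>2" using e by (intro power_mono) auto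
    also have "2 * (4 / 3 * c * (\<delta> * y ^ 3))\<^sup>2 + 2 * (8 * c * (\<delta>\<^sup>2 * y ^ 4))\<^sup>2
       = (32 / 9 * c\<^sup>2 * \<delta>\<^sup>2) * y ^ 6 + (128 * c\<^sup>2 * \<delta>\<^sup>2 * y ^ 4) * (\<delta>\<^sup>2 * y ^ 4)"
      by (simp add: power2_eq_square power4_eq_xxxx power3_eq_cube eval_nat_numeral)
    also have "\<dots> \<le> (32 / 9 * c\<^sup>2 * \<delta>\<^sup>2) * (1 + \<bar>u\<bar>) ^ 8 + (128 * c\<^sup>2 * \<delta>\<^sup>2 * (1 + \<bar>u\<bar>) ^ 8) * (1 / 64)"
      using yl[of 6] yl[of 4] d2y y0 by (intro add_mono mult_mono mult_left_mono) auto
    also have "\<dots> \<le> 32 * c\<^sup>2 * \<delta>\<^sup>2 * (1 + \<bar>u\<bar>) ^ 8"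
    proof -
      have "0 \<le> c\<^sup>2 * \<delta>\<^sup>2 * (1 + \<bar>u\<bar>) ^ 8" by simp
      then show ?thesis by (simp add: mult.assoc)
    qed
    finally show ?thesis by simp
  qed
  \<comment> \<open>Only e1 is kept of the linear part of exp E; e is already of order \<delta>^2
    and joins the error.\<close>
  have eE: "norm (exp E - 1 - e1) \<le> (32 * exp c * c\<^sup>2 + 8 * c) * \<delta>\<^sup>2 * (1 + \<bar>u\<bar>) ^ 8"
  proof -
    have "norm (exp E - (\<Sum>k\<le>1. E ^ k / fact k)) \<le> exp \<bar>Re E\<bar> * norm E ^ Suc 1 / fact 1" by (rule Taylor_exp)
    then have "norm (exp E - 1 - E) \<le> exp \<bar>Re E\<bar> * (norm E)\<^sup>2"
      by (simp add: algebra_simps power2_eq_square)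
    also have "\<dots> \<le> exp c * (32 * c\<^sup>2 * \<delta>\<^sup>2 * (1 + \<bar>u\<bar>) ^ 8)"
      using E2 order.trans[OF abs_Re_le_cmod Ec] by (intro mult_mono) auto
    finally have 1: "norm (exp E - 1 - E) \<le> exp c * (32 * c\<^sup>2 * \<delta>\<^sup>2 * (1 + \<bar>u\<bar>) ^ 8)" .
    have "8 * c * (\<delta>\<^sup>2 * y ^ 4) \<le> 8 * c * (\<delta>\<^sup>2 * (1 + \<bar>u\<bar>) ^ 8)"
      using c yl[of 4] by (intro mult_left_mono) auto
    then have 2: "norm e \<le> 8 * c * (\<delta>\<^sup>2 * (1 + \<bar>u\<bar>) ^ 8)" using e by simp
    have "norm (exp E - 1 - e1) \<le> norm (exp E - 1 - E) + norm e"
      using norm_triangle_ineq[of "exp E - 1 - E" e] by (simp add: E_def algebra_simps)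
    also have "\<dots> \<le> (32 * exp c * c\<^sup>2 + 8 * c) * \<delta>\<^sup>2 * (1 + \<bar>u\<bar>) ^ 8"
      using 1 2 by (simp add: algebra_simps)
    finally show ?thesis .
  qed
  have main: "exp (- of_real t2 * z\<^sup>2 / 4 + of_real t3 * (\<i> * z) ^ 3 / 6 + e) - edgeworth (t2 / 2) t3 z
     = exp (- of_real t2 * z\<^sup>2 / 4) * (exp E - 1 - e1)"
  proof -
    have "exp (- of_real t2 * z\<^sup>2 / 4 + of_real t3 * (\<i> * z) ^ 3 / 6 + e) = exp (- of_real t2 * z\<^sup>2 / 4) * exp E"
      by (simp only: E_def e1_def exp_add[symmetric] add.assoc)
    moreover have "edgeworth (t2 / 2) t3 z = exp (- of_real t2 * z\<^sup>2 / 4) * (1 + e1)"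
      by (simp add: edgeworth_def e1_def mult.commute)
    ultimately show ?thesis by (simp only: right_diff_distrib distrib_left diff_diff_eq)
  qed
  \<comment> \<open>The radius 1 / (16 (1 + |u|)) keeps u w bounded, so Re (z^2) drops below u^2 by
    at most 1. The Gaussian factor then loses at most exp (t2 / 4), which is below exp c.\<close>
  have "norm (exp (- of_real t2 * z\<^sup>2 / 4)) \<le> exp c * exp (- (t2 / 2) * u\<^sup>2 / 2)"
  proof -
    have "Re (z\<^sup>2) = u\<^sup>2 + 2 * u * Re w + Re (w\<^sup>2)"
      by (simp add: z power2_eq_square algebra_simps)
    moreover have "\<bar>u * Re w\<bar> \<le> 1 / 16"
    proof -
      have "\<bar>u * Re w\<bar> \<le> (1 + \<bar>u\<bar>) * (1 / (16 * (1 + \<bar>u\<bar>)))"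
        unfolding abs_mult using order.trans[OF abs_Re_le_cmod w] by (intro mult_mono) auto
      also have "\<dots> = 1 / 16"
      proof -
        have "1 + \<bar>u\<bar> \<noteq> 0" by linarith
        then show ?thesis by (simp add: field_simps)
      qed
      finally show ?thesis .
    qed
    moreover have "\<bar>Re (w\<^sup>2)\<bar> \<le> 1 / 16"
    proof -
      have "\<bar>Re (w\<^sup>2)\<bar> \<le> (norm w)\<^sup>2" using abs_Re_le_cmod[of "w\<^sup>2"] by (simp add: norm_power)
      also have "\<dots> \<le> (1 / 16)\<^sup>2" using w16 by (intro power_mono) auto
      finally show ?thesis by (simp add: power2_eq_square)
    qed
    ultimately have r: "u\<^sup>2 - 1 \<le> Re (z\<^sup>2)" by linarith
    have "Re (- of_real t2 * z\<^sup>2 / 4) = - t2 * Re (z\<^sup>2) / 4" by simp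
    also have "\<dots> \<le> - t2 * (u\<^sup>2 - 1) / 4" using mult_left_mono[OF r t2(1)] by simp
    also have "\<dots> \<le> c + - (t2 / 2) * u\<^sup>2 / 2" using t2 c by (simp add: field_simps)
    finally show ?thesis unfolding norm_exp_eq_Re exp_add[symmetric] by simp
  qed
  then have "norm (exp (- of_real t2 * z\<^sup>2 / 4) * (exp E - 1 - e1)) \<le>
     (exp c * exp (- (t2 / 2) * u\<^sup>2 / 2)) * ((32 * exp c * c\<^sup>2 + 8 * c) * \<delta>\<^sup>2 * (1 + \<bar>u\<bar>) ^ 8)"
    unfolding norm_mult using eE by (intro mult_mono) auto
  then show ?thesis unfolding main by (simp only: ac_simps)
qed

text \<open>Cauchy's inequality on the disc of radius \<open>r\<close> about u, where the local
  bound is uniform; \<open>r ^ j\<close> accounts for 16^j and for j further powers of 1 + |u|. The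
  disc stays within x / 8 of the origin, hence inside the ball of radius 3 x / 16, and there 4
  \<delta> |z| is at most 3/4, so the cumulant series converges.\<close>

lemma deriv_expansion_bound:
  fixes \<tau> :: "nat \<Rightarrow> real" and c s x u :: real and L :: "complex \<Rightarrow> complex"
  assumes \<tau>: "\<And>k. \<bar>\<tau> (k + 2)\<bar> \<le> s ^ k * \<tau> 2" and \<tau>c: "\<tau> 2 \<le> 2 * c" and s: "0 \<le> s" "s \<le> 4 * \<delta>"
    and \<delta>: "0 < \<delta>" "\<delta> \<le> 1" and x: "\<delta> * x ^ 3 = 1" "1 \<le> x" and u: "\<bar>u\<bar> \<le> x / 16"
    and hol: "L holomorphic_on ball 0 (3 / 16 * x)"
    and L: "\<And>z. norm z < 3 / 16 * x \<Longrightarrow> (\<lambda>n. complex_of_real (\<tau> n / (2 * real n)) * z ^ n) sums L z"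
  defines "\<Phi> \<equiv> \<lambda>z. exp (L (\<i> * z) - of_real (\<tau> 1) * (\<i> * z) / 2)"
  shows "\<Phi> holomorphic_on ball 0 (3 / 16 * x)"
    and "norm ((deriv ^^ j) \<Phi> (of_real u) - (deriv ^^ j) (edgeworth (\<tau> 2 / 2) (\<tau> 3)) (of_real u))
      \<le> fact j * 16 ^ j * (exp c * (32 * exp c * c\<^sup>2 + 8 * c)) * \<delta>\<^sup>2 * (1 + \<bar>u\<bar>) ^ (8 + j) * exp (- (\<tau> 2 / 2) * u\<^sup>2 / 2)"
proof -
  have t0: "0 \<le> \<tau> 2" using order.trans[OF abs_ge_zero \<tau>[of 0]] by simp
  show hol\<Phi>: "\<Phi> holomorphic_on ball 0 (3 / 16 * x)"
    unfolding \<Phi>_def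
    by (intro holomorphic_intros holomorphic_on_compose_gen[OF _ hol, unfolded o_def]) (auto simp: norm_mult)
  define r where "r = 1 / (16 * (1 + \<bar>u\<bar>))"
  have r0: "0 < r" unfolding r_def by simp
  have r16: "r \<le> 1 / 16" unfolding r_def by (simp add: field_simps)
  define A where "A = exp c * (32 * exp c * c\<^sup>2 + 8 * c) * \<delta>\<^sup>2 * (1 + \<bar>u\<bar>) ^ 8 * exp (- (\<tau> 2 / 2) * u\<^sup>2 / 2)"
  have nz: "norm z \<le> x / 8" if "norm (of_real u - z) \<le> r" for z :: complex
    using norm_triangle_ineq4[of "complex_of_real u" "of_real u - z"] that r16 u x by simp
  have sub: "cball (of_real u) r \<subseteq> ball (0::complex) (3 / 16 * x)"
    using nz x by (force simp: dist_norm)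
  let ?D = "\<lambda>z. \<Phi> z - edgeworth (\<tau> 2 / 2) (\<tau> 3) z"
  have holD: "?D holomorphic_on ball 0 (3 / 16 * x)"
    by (intro holomorphic_intros hol\<Phi> edgeworth_holomorphic)
  have dx: "\<delta> * x \<le> 1"
    using mult_left_mono[OF self_le_power[of x 3], of \<delta>] x \<delta> by simp
  have "norm ((deriv ^^ j) ?D (of_real u)) \<le> fact j * A / r ^ j"
  proof (rule Cauchy_inequality)
    show "?D holomorphic_on ball (of_real u) r"
      using holD by (rule holomorphic_on_subset) (use sub ball_subset_cball in blast)
    show "continuous_on (cball (of_real u) r) ?D"
      using holomorphic_on_imp_continuous_on[OF holD] by (rule continuous_on_subset) (rule sub)
    show "0 < r" by (rule r0)
    fix z :: complex assume z: "norm (of_real u - z) = r"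
    define e where "e = L (\<i> * z) - (of_real (\<tau> 1) * (\<i> * z) / 2 + of_real (\<tau> 2) * (\<i> * z)\<^sup>2 / 4 + of_real (\<tau> 3) * (\<i> * z) ^ 3 / 6)"
    have zx: "norm z \<le> x / 8" using nz[of z] z by simp
    have "s * norm z \<le> (4 * \<delta>) * (x / 8)" using s zx \<delta> by (intro mult_mono) auto
    also have "\<dots> \<le> 1 / 2" using dx by simp
    finally have sz: "s * norm (\<i> * z) \<le> 1 / 2" by (simp add: norm_mult)
    have "norm e \<le> \<tau> 2 * s\<^sup>2 * norm (\<i> * z) ^ 4 / 4"
      unfolding e_def
      by (rule cumulant_remainder(1)[OF \<tau> s(1) sz L]) (use zx x in \<open>simp add: norm_mult\<close>)
    then have e: "norm e \<le> \<tau> 2 * s\<^sup>2 * norm z ^ 4 / 4" by (simp add: norm_mult)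
    have "norm (exp (- of_real (\<tau> 2) * z\<^sup>2 / 4 + of_real (\<tau> 3) * (\<i> * z) ^ 3 / 6 + e) - edgeworth (\<tau> 2 / 2) (\<tau> 3) z) \<le> A"
      unfolding A_def
    proof (rule edgeworth_local_bound[OF t0 \<tau>c _ s \<delta> x(1) u _ _ e])
      show "\<bar>\<tau> 3\<bar> \<le> s * \<tau> 2" using \<tau>[of 1] by (simp add: numeral_eq_Suc)
      show "norm (z - of_real u) \<le> 1 / (16 * (1 + \<bar>u\<bar>))" using z by (simp add: r_def norm_minus_commute)
    qed simp
    moreover have "- of_real (\<tau> 2) * z\<^sup>2 / 4 + of_real (\<tau> 3) * (\<i> * z) ^ 3 / 6 + e = L (\<i> * z) - of_real (\<tau> 1) * (\<i> * z) / 2"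
      by (simp add: e_def power_mult_distrib)
    ultimately show "norm (?D z) \<le> A" by (simp add: \<Phi>_def)
  qed
  also have "fact j * A / r ^ j = fact j * 16 ^ j * (exp c * (32 * exp c * c\<^sup>2 + 8 * c)) * \<delta>\<^sup>2 * (1 + \<bar>u\<bar>) ^ (8 + j) * exp (- (\<tau> 2 / 2) * u\<^sup>2 / 2)"
  proof -
    have rj: "r ^ j = 1 / (16 ^ j * (1 + \<bar>u\<bar>) ^ j)"
      unfolding r_def by (simp only: power_divide power_mult_distrib power_one)
    show ?thesis unfolding A_def rj by (simp add: power_add)
  qed
  also have "(deriv ^^ j) ?D (of_real u) = (deriv ^^ j) \<Phi> (of_real u) - (deriv ^^ j) (edgeworth (\<tau> 2 / 2) (\<tau> 3)) (of_real u)"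
    by (rule higher_deriv_diff[OF hol\<Phi> edgeworth_holomorphic]) (use u x in auto)
  finally show "norm ((deriv ^^ j) \<Phi> (of_real u) - (deriv ^^ j) (edgeworth (\<tau> 2 / 2) (\<tau> 3)) (of_real u))
      \<le> fact j * 16 ^ j * (exp c * (32 * exp c * c\<^sup>2 + 8 * c)) * \<delta>\<^sup>2 * (1 + \<bar>u\<bar>) ^ (8 + j) * exp (- (\<tau> 2 / 2) * u\<^sup>2 / 2)" .
qed

text \<open>Cauchy's inequality on a disc of radius 1, on which |z| is at most 2. This covers
  \<delta> > 1, where no smallness is claimed.\<close>

lemma edgeworth_deriv_crude:
  fixes l k c K u :: real
  assumes l: "0 \<le> l" "l \<le> c" and k: "\<bar>k\<bar> \<le> K" and u: "\<bar>u\<bar> \<le> 1"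
  shows "norm ((deriv ^^ j) (edgeworth l k) (of_real u)) \<le> fact j * (exp (2 * c) * (1 + 2 * K))"
proof -
  have "norm ((deriv ^^ j) (edgeworth l k) (of_real u)) \<le> fact j * (exp (2 * c) * (1 + 2 * K)) / 1 ^ j"
  proof (rule Cauchy_inequality)
    fix z :: complex assume z: "norm (of_real u - z) = 1"
    have nz: "norm z \<le> 2" using norm_triangle_ineq4[of "complex_of_real u" "of_real u - z"] z u by simp
    have "\<bar>Re (z\<^sup>2)\<bar> \<le> (norm z)\<^sup>2" using abs_Re_le_cmod[of "z\<^sup>2"] by (simp add: norm_power)
    also have "\<dots> \<le> 2\<^sup>2" using nz by (intro power_mono) auto
    finally have z4: "\<bar>Re (z\<^sup>2)\<bar> \<le> 4" by simp
    have "- l * Re (z\<^sup>2) / 2 \<le> l * \<bar>Re (z\<^sup>2)\<bar> / 2" using l by (simp add: abs_if mult_nonneg_nonneg)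
    also have "\<dots> \<le> c * 4 / 2" using l z4 by (intro divide_right_mono mult_mono) auto
    finally have 1: "norm (exp (- of_real l * z\<^sup>2 / 2)) \<le> exp (2 * c)" by simp
    have "norm ((\<i> * z) ^ 3 * of_real k / 6) = norm z ^ 3 * \<bar>k\<bar> / 6" by (simp add: norm_mult norm_power norm_divide)
    also have "\<dots> \<le> 2 ^ 3 * K / 6" using nz k by (intro divide_right_mono mult_mono power_mono) auto
    finally have "norm ((\<i> * z) ^ 3 * of_real k / 6) \<le> 2 * K" using k by simp
    then have 2: "norm (1 + (\<i> * z) ^ 3 * of_real k / 6) \<le> 1 + 2 * K"
      using norm_triangle_ineq[of 1 "(\<i> * z) ^ 3 * of_real k / 6"] by simp
    show "norm (edgeworth l k z) \<le> exp (2 * c) * (1 + 2 * K)"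
      unfolding edgeworth_def norm_mult using 1 2 by (intro mult_mono) auto
  qed (auto intro!: edgeworth_holomorphic holomorphic_on_imp_continuous_on)
  then show ?thesis by simp
qed

section \<open>The characteristic function of a Gaussian quadratic form\<close>

context gaussian_linear_space
begin

lemma all_moments_integrable_power: "all_moments F \<Longrightarrow> integrable M (\<lambda>\<omega>. F \<omega> ^ n)"
  by (intro all_moments_integrable all_moments_power)

text \<open>Repeated use of \<open>osc_deriv\<close> pulls down one factor i Z per derivative, so
  the derivatives exist on the whole line and are bounded by absolute moments.\<close>

lemma nth_deriv_char:
  assumes Z: "all_moments Z"
  shows "nth_deriv j (\<lambda>u. CLINT \<omega>|M. iexp (u * Z \<omega>)) = (\<lambda>u. \<i> ^ j * osc (\<lambda>\<omega>. Z \<omega> ^ j) (\<lambda>\<omega>. u * Z \<omega>))"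
    and "nth_deriv j (\<lambda>u. CLINT \<omega>|M. iexp (u * Z \<omega>)) differentiable (at u)"
    and "norm (nth_deriv j (\<lambda>u. CLINT \<omega>|M. iexp (u * Z \<omega>)) u) \<le> (\<integral>\<omega>. \<bar>Z \<omega>\<bar> ^ j \<partial>M)"
proof -
  have der: "((\<lambda>u. \<i> ^ j * osc (\<lambda>\<omega>. Z \<omega> ^ j) (\<lambda>\<omega>. u * Z \<omega>)) has_vector_derivative
      \<i> ^ Suc j * osc (\<lambda>\<omega>. Z \<omega> ^ Suc j) (\<lambda>\<omega>. u * Z \<omega>)) (at u)" for j u
    using has_vector_derivative_mult_right[OF osc_deriv[OF all_moments_power[OF Z] Z, of "\<lambda>\<omega>. 0" j u], of "\<i> ^ j"]
    by (simp add: ac_simps)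
  show *: "nth_deriv j (\<lambda>u. CLINT \<omega>|M. iexp (u * Z \<omega>)) = (\<lambda>u. \<i> ^ j * osc (\<lambda>\<omega>. Z \<omega> ^ j) (\<lambda>\<omega>. u * Z \<omega>))" for j
  proof (induction j)
    case 0
    then show ?case by (simp add: nth_deriv_def osc_def)
  next
    case (Suc j)
    then show ?case unfolding nth_deriv_Suc Suc using vector_derivative_at[OF der] by auto
  qed
  show "nth_deriv j (\<lambda>u. CLINT \<omega>|M. iexp (u * Z \<omega>)) differentiable (at u)"
    unfolding * by (rule differentiableI_vector[OF der])
  show "norm (nth_deriv j (\<lambda>u. CLINT \<omega>|M. iexp (u * Z \<omega>)) u) \<le> (\<integral>\<omega>. \<bar>Z \<omega>\<bar> ^ j \<partial>M)"
  proof -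
    have [measurable]: "Z \<in> borel_measurable M" using Z by (simp add: all_moments_def)
    have "norm (osc (\<lambda>\<omega>. Z \<omega> ^ j) (\<lambda>\<omega>. u * Z \<omega>)) \<le> (\<integral>\<omega>. \<bar>Z \<omega>\<bar> ^ j \<partial>M)"
      unfolding osc_def
      by (rule norm_integral_le)
         (use Z osc_integrable[OF all_moments_power[OF Z, of j], of "\<lambda>\<omega>. u * Z \<omega>"] in \<open>auto simp: all_moments_def norm_mult norm_power power_abs\<close>)
    then show ?thesis unfolding * by (simp add: norm_mult norm_power)
  qed
qed

text \<open>For \<delta> at most 1 the characteristic function is the restriction of exp (L (i z) -
  mean term), and the complex estimate applies. For \<delta> > 1 both functions are bounded
  separately: the derivatives of the first by absolute moments, which exponential moments at
  distance 1 / (8 \<delta>) control.\<close>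

lemma quadratic_char_expansion:
  fixes E :: "'e set" and g :: "'e \<Rightarrow> 'a \<Rightarrow> real" and S :: "'e \<Rightarrow> 'e \<Rightarrow> real" and d :: "'e \<Rightarrow> real"
    and Q :: "'a \<Rightarrow> real" and s c \<delta> u :: real
  assumes fin: "finite E" and g: "\<And>e. e \<in> E \<Longrightarrow> g e \<in> L"
    and sym: "\<And>e f. e \<in> E \<Longrightarrow> f \<in> E \<Longrightarrow> S e f = S f e"
    and cov_g: "\<And>e f. e \<in> E \<Longrightarrow> f \<in> E \<Longrightarrow> cov (g e) (g f) = (if e = f then d e else 0)"
    and S_d: "\<And>e f. e \<in> E \<Longrightarrow> f \<in> E \<Longrightarrow> S e f * d f = S e f"
    and Q_def: "\<And>\<omega>. Q \<omega> = (\<Sum>e\<in>E. \<Sum>f\<in>E. S e f * g e \<omega> * g f \<omega>) / 2"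
    and op: "\<And>h. (\<Sum>e\<in>E. (\<Sum>f\<in>E. S e f * h f)\<^sup>2) \<le> s\<^sup>2 * (\<Sum>e\<in>E. (h e)\<^sup>2)" and s: "0 \<le> s" "s \<le> 4 * \<delta>"
    and tr2: "mat_tr E (mat_pow E S 2) \<le> 2 * c"
  defines "l \<equiv> mat_tr E (mat_pow E S 2) / 2" and "k \<equiv> mat_tr E (mat_pow E S 3)"
    and "\<phi> \<equiv> \<lambda>u. CLINT \<omega>|M. iexp (u * (Q \<omega> - mat_tr E (mat_pow E S 1) / 2))"
  shows "nth_deriv j \<phi> differentiable (at u)"
    and "0 < \<delta> \<Longrightarrow> \<delta> \<le> 1 \<Longrightarrow> \<bar>u\<bar> \<le> \<delta> powr (-1/3) / 16 \<Longrightarrow>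
      norm (nth_deriv j \<phi> u - (deriv ^^ j) (edgeworth l k) (of_real u))
      \<le> fact j * 16 ^ j * (exp c * (32 * exp c * c\<^sup>2 + 8 * c)) * \<delta>\<^sup>2 * (1 + \<bar>u\<bar>) ^ (8 + j) * exp (- l * u\<^sup>2 / 2)"
    and "1 < \<delta> \<Longrightarrow> \<bar>u\<bar> \<le> 1 \<Longrightarrow>
      norm (nth_deriv j \<phi> u - (deriv ^^ j) (edgeworth l k) (of_real u))
      \<le> fact j * (8 * \<delta>) ^ j * (2 * exp c) + fact j * (exp (2 * c) * (1 + 2 * (8 * c * \<delta>)))"
proof -
  define \<tau> where "\<tau> n = mat_tr E (mat_pow E S n)" for n
  have \<tau>: "\<bar>\<tau> (k + 2)\<bar> \<le> s ^ k * \<tau> 2" for k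
    unfolding \<tau>_def by (rule mat_tr_pow_bound(1)[OF fin sym op s(1)])
  have t0: "0 \<le> \<tau> 2" unfolding \<tau>_def by (rule mat_tr_pow_bound(2)[OF fin sym op s(1)])
  have tc: "\<tau> 2 \<le> 2 * c" using tr2 by (simp add: \<tau>_def)
  have c: "0 \<le> c" using t0 tc by simp
  have aQ: "all_moments Q" by (rule quadratic_all_moments[OF fin g sym cov_g S_d Q_def])
  define Z where "Z \<omega> = Q \<omega> - \<tau> 1 / 2" for \<omega>
  have aZ: "all_moments Z"
    using all_moments_add[OF aQ all_moments_const[of "- \<tau> 1 / 2"]] by (simp add: Z_def[abs_def])
  have \<phi>: "\<phi> = (\<lambda>u. CLINT \<omega>|M. iexp (u * Z \<omega>))" by (simp add: \<phi>_def Z_def \<tau>_def)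
  show "nth_deriv j \<phi> differentiable (at u)" unfolding \<phi> by (rule nth_deriv_char(2)[OF aZ])
  have [measurable]: "Q \<in> borel_measurable M" "Z \<in> borel_measurable M" using aQ aZ by (auto simp: all_moments_def)
  define m where "m n = expectation (\<lambda>\<omega>. Q \<omega> ^ n)" for n
  have m0: "m 0 = 1" by (simp add: m_def prob_space)
  have m: "m (Suc n) = (\<Sum>i\<le>n. of_nat (n choose i) * (fact i * \<tau> (Suc i) / 2) * m (n - i))" for n
    unfolding m_def \<tau>_def by (rule quadratic_moment_rec[OF fin g sym cov_g S_d Q_def])
  define Lf where "Lf = eval_fps (Abs_fps (\<lambda>n. complex_of_real (\<tau> n / (2 * real n))))"
  note cs = cumulant_series[OF \<tau> s(1) _ _ m0 m, folded Lf_def]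
  have serE: "integrable M (\<lambda>\<omega>. exp (norm z * \<bar>Q \<omega>\<bar>))" "(CLINT \<omega>|M. exp (z * of_real (Q \<omega>))) = exp (Lf z)"
    if R: "0 < R" "s * R < 1" and z: "norm z < R" for R and z :: complex
  proof -
    have f: "(\<lambda>n. of_real (expectation (\<lambda>\<omega>. Q \<omega> ^ n) / fact n) * z ^ n) sums exp (Lf z)" if "norm z < R" for z
      using cs(2)[OF R that] by (simp add: m_def)
    note em = exp_moment_sums[of Q R "\<lambda>z. exp (Lf z)" z, OF _ all_moments_integrable_power[OF aQ] f z]
    show "integrable M (\<lambda>\<omega>. exp (norm z * \<bar>Q \<omega>\<bar>))" by (rule em(1)) auto
    show "(CLINT \<omega>|M. exp (z * of_real (Q \<omega>))) = exp (Lf z)" by (rule em(2)) auto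
  qed
  have l: "l = \<tau> 2 / 2" and k: "k = \<tau> 3" by (simp_all add: l_def k_def \<tau>_def)
  show "norm (nth_deriv j \<phi> u - (deriv ^^ j) (edgeworth l k) (of_real u))
      \<le> fact j * 16 ^ j * (exp c * (32 * exp c * c\<^sup>2 + 8 * c)) * \<delta>\<^sup>2 * (1 + \<bar>u\<bar>) ^ (8 + j) * exp (- l * u\<^sup>2 / 2)"
    if \<delta>: "0 < \<delta>" "\<delta> \<le> 1" and u: "\<bar>u\<bar> \<le> \<delta> powr (-1/3) / 16"
  proof -
    define x where "x = \<delta> powr (-1/3)"
    have "x ^ 3 = x powr 3" using \<delta> by (simp add: x_def powr_numeral)
    also have "\<dots> = \<delta> powr (-1)" unfolding x_def powr_powr by simp
    also have "\<dots> = 1 / \<delta>" using \<delta> by (simp add: powr_minus_divide)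
    finally have x3: "\<delta> * x ^ 3 = 1" using \<delta> by simp
    have x1: "1 \<le> x"
    proof -
      have "\<delta> powr (1/3) \<le> 1 powr (1/3)" using \<delta> by (intro powr_mono2) auto
      then show ?thesis using \<delta> unfolding x_def by (simp add: powr_minus_divide)
    qed
    have dx: "\<delta> * x \<le> 1" using mult_left_mono[OF self_le_power[of x 3], of \<delta>] x1 x3 \<delta> by simp
    \<comment> \<open>Large enough to contain all discs of the Cauchy estimate, small enough for s R
      to be at most 3/4.\<close>
    define R where "R = 3 / 16 * x"
    have "s * R \<le> (4 * \<delta>) * (3 / 16 * x)" unfolding R_def using s x1 \<delta> by (intro mult_mono) auto
    also have "\<dots> = 3 / 4 * (\<delta> * x)" by simp
    finally have "s * R \<le> 3 / 4 * (\<delta> * x)" .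
    then have "s * R < 1" using dx by linarith
    moreover have "0 < R" using x1 by (simp add: R_def)
    ultimately have R: "0 < R" "s * R < 1" by auto
    note S = cs(1)[OF R] cs(3)[OF R] serE[OF R]
    let ?\<Phi> = "\<lambda>z. exp (Lf (\<i> * z) - of_real (\<tau> 1) * (\<i> * z) / 2)"
    have hol: "?\<Phi> holomorphic_on ball 0 R"
      unfolding R_def
      by (rule deriv_expansion_bound(1)[OF \<tau> tc s \<delta> x3 x1 u[folded x_def] S(1)[unfolded R_def] S(2)[unfolded R_def]])
    have "nth_deriv j \<phi> u = (deriv ^^ j) ?\<Phi> (of_real u)"
    proof (rule nth_deriv_holomorphic[OF open_ball hol])
      show "complex_of_real u \<in> ball 0 R" using u x1 by (simp add: R_def x_def)
      fix v assume v: "complex_of_real v \<in> ball 0 R"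
      have "\<phi> v = (CLINT \<omega>|M. exp (\<i> * of_real v * of_real (Q \<omega>)) * exp (- of_real (\<tau> 1) * (\<i> * of_real v) / 2))"
        unfolding \<phi> Z_def exp_add[symmetric]
      proof (rule Bochner_Integration.integral_cong[OF refl])
        fix \<omega>
        have "\<i> * complex_of_real (v * (Q \<omega> - \<tau> 1 / 2)) = \<i> * of_real v * of_real (Q \<omega>) + - of_real (\<tau> 1) * (\<i> * of_real v) / 2"
          by (simp add: algebra_simps)
        then show "iexp (v * (Q \<omega> - \<tau> 1 / 2)) = exp (\<i> * of_real v * of_real (Q \<omega>) + - of_real (\<tau> 1) * (\<i> * of_real v) / 2)"
          by (rule arg_cong)
      qed
      also have "\<dots> = exp (Lf (\<i> * of_real v)) * exp (- of_real (\<tau> 1) * (\<i> * of_real v) / 2)"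
        using S(4)[of "\<i> * of_real v"] v by (simp add: norm_mult)
      finally show "\<phi> v = ?\<Phi> (of_real v)" unfolding exp_add[symmetric] by simp
    qed
    then show ?thesis
      unfolding l k using deriv_expansion_bound(2)[OF \<tau> tc s \<delta> x3 x1 u[folded x_def] S(1)[unfolded R_def] S(2)[unfolded R_def]] by simp
  qed
  show "norm (nth_deriv j \<phi> u - (deriv ^^ j) (edgeworth l k) (of_real u))
      \<le> fact j * (8 * \<delta>) ^ j * (2 * exp c) + fact j * (exp (2 * c) * (1 + 2 * (8 * c * \<delta>)))"
    if \<delta>: "1 < \<delta>" and u: "\<bar>u\<bar> \<le> 1"
  proof -
    \<comment> \<open>The radius r makes s r at most 1/2, as the remainder bound requires; the
      slightly larger R, still with s R below 1, is the radius of convergence that is used.\<close>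
    define r where "r = 1 / (8 * \<delta>)"
    define R where "R = 1 / (5 * \<delta>)"
    have "s * R \<le> (4 * \<delta>) * (1 / (5 * \<delta>))" unfolding R_def using s \<delta> by (intro mult_mono) auto
    also have "\<dots> < 1" using \<delta> by simp
    finally have "s * R < 1" .
    moreover have "0 < R" using \<delta> by (simp add: R_def)
    ultimately have R: "0 < R" "s * R < 1" by auto
    note S = cs(1)[OF R] cs(3)[OF R] serE[OF R]
    have r: "0 < r" "r < R" "r \<le> 1" using \<delta> by (auto simp: r_def R_def field_simps)
    have "s * r \<le> (4 * \<delta>) * (1 / (8 * \<delta>))" unfolding r_def using s \<delta> by (intro mult_mono) auto
    also have "\<dots> = 1 / 2" using \<delta> by simp
    finally have sr: "s * r \<le> 1 / 2" .
    have ie: "integrable M (\<lambda>\<omega>. exp (r * \<bar>Q \<omega>\<bar>))" using S(3)[of "of_real r"] r by simp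
    have iq: "integrable M (\<lambda>\<omega>. exp (v * Z \<omega>))" and eq: "expectation (\<lambda>\<omega>. exp (v * Z \<omega>)) \<le> exp c" if v: "\<bar>v\<bar> = r" for v
    proof -
      have i: "integrable M (\<lambda>\<omega>. exp (v * Q \<omega>))"
      proof (rule Bochner_Integration.integrable_bound[OF ie])
        have "v * Q \<omega> \<le> r * \<bar>Q \<omega>\<bar>" for \<omega> using abs_ge_self[of "v * Q \<omega>"] v by (simp add: abs_mult)
        then show "AE \<omega> in M. norm (exp (v * Q \<omega>)) \<le> norm (exp (r * \<bar>Q \<omega>\<bar>))" by simp
      qed measurable
      have ez: "exp (v * Z \<omega>) = exp (v * Q \<omega>) * exp (- v * \<tau> 1 / 2)" for \<omega>
        unfolding exp_add[symmetric] Z_def by (simp add: algebra_simps)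
      show "integrable M (\<lambda>\<omega>. exp (v * Z \<omega>))" unfolding ez using i by simp
      have nv: "norm (complex_of_real v) < R" using v r by simp
      have "complex_of_real (expectation (\<lambda>\<omega>. exp (v * Q \<omega>))) = (CLINT \<omega>|M. of_real (exp (v * Q \<omega>)))" by simp
      also have "\<dots> = (CLINT \<omega>|M. exp (of_real v * of_real (Q \<omega>)))" by (simp flip: exp_of_real)
      also have "\<dots> = exp (Lf (of_real v))" by (rule S(4)[OF nv])
      finally have e1: "complex_of_real (expectation (\<lambda>\<omega>. exp (v * Q \<omega>))) = exp (Lf (of_real v))" .
      have "complex_of_real (expectation (\<lambda>\<omega>. exp (v * Z \<omega>))) = exp (Lf (of_real v)) * exp (- of_real v * of_real (\<tau> 1) / 2)"
        unfolding ez using e1 by (simp flip: exp_of_real)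
      also have "\<dots> = exp (Lf (of_real v) - of_real (\<tau> 1) * of_real v / 2)"
        unfolding exp_add[symmetric] by (simp add: algebra_simps)
      finally have "norm (complex_of_real (expectation (\<lambda>\<omega>. exp (v * Z \<omega>)))) = exp (Re (Lf (of_real v) - of_real (\<tau> 1) * of_real v / 2))"
        by (simp only: norm_exp_eq_Re)
      moreover have "Re (Lf (of_real v) - of_real (\<tau> 1) * of_real v / 2) \<le> norm (Lf (of_real v) - of_real (\<tau> 1) * of_real v / 2)"
        by (rule complex_Re_le_cmod)
      \<comment> \<open>With the linear term removed, the cumulant series at a real point of modulus
        r has modulus at most c, because r is at most 1.\<close>
      moreover have "\<dots> \<le> \<tau> 2 * norm (complex_of_real v) ^ 2 / 2"
        by (rule cumulant_remainder(2)[OF \<tau> s(1) _ S(2)[OF nv]]) (use sr v in simp)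
      moreover have "\<tau> 2 * norm (complex_of_real v) ^ 2 / 2 \<le> (2 * c) * 1 ^ 2 / 2"
        using r v tc t0 c by (intro divide_right_mono mult_mono power_mono) auto
      ultimately have "norm (complex_of_real (expectation (\<lambda>\<omega>. exp (v * Z \<omega>)))) \<le> exp c" by simp
      then show "expectation (\<lambda>\<omega>. exp (v * Z \<omega>)) \<le> exp c" by simp
    qed
    have "(\<integral>\<omega>. \<bar>Z \<omega>\<bar> ^ j \<partial>M) \<le> (\<integral>\<omega>. (fact j / r ^ j) * (exp (r * Z \<omega>) + exp ((- r) * Z \<omega>)) \<partial>M)"
    proof (rule integral_mono)
      show "integrable M (\<lambda>\<omega>. \<bar>Z \<omega>\<bar> ^ j)" using aZ by (simp add: all_moments_def)
      show "integrable M (\<lambda>\<omega>. (fact j / r ^ j) * (exp (r * Z \<omega>) + exp ((- r) * Z \<omega>)))"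
        using iq[of r] iq[of "- r"] r by simp
      fix \<omega>
      \<comment> \<open>A single term of the exponential series is below its sum; this turns
        exponential moments into absolute moments of order j.\<close>
      have "(\<Sum>n\<in>{j}. (r * \<bar>Z \<omega>\<bar>) ^ n /\<^sub>R fact n) \<le> (\<Sum>n. (r * \<bar>Z \<omega>\<bar>) ^ n /\<^sub>R fact n)"
        by (rule sum_le_suminf[OF sums_summable[OF exp_converges]]) (use r in auto)
      also have "\<dots> = exp (r * \<bar>Z \<omega>\<bar>)" using exp_converges[of "r * \<bar>Z \<omega>\<bar>"] by (simp add: sums_iff)
      also have "\<dots> \<le> exp (r * Z \<omega>) + exp ((- r) * Z \<omega>)" by (cases "0 \<le> Z \<omega>") auto
      finally have "(fact j / r ^ j) * ((r * \<bar>Z \<omega>\<bar>) ^ j / fact j) \<le> (fact j / r ^ j) * (exp (r * Z \<omega>) + exp ((- r) * Z \<omega>))"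
        using r by (intro mult_left_mono) (auto simp: divide_inverse mult.commute)
      then show "\<bar>Z \<omega>\<bar> ^ j \<le> (fact j / r ^ j) * (exp (r * Z \<omega>) + exp ((- r) * Z \<omega>))"
        using r by (simp add: power_mult_distrib)
    qed
    also have "\<dots> = (fact j / r ^ j) * (expectation (\<lambda>\<omega>. exp (r * Z \<omega>)) + expectation (\<lambda>\<omega>. exp ((- r) * Z \<omega>)))"
      using iq[of r] iq[of "- r"] r by simp
    also have "\<dots> \<le> (fact j / r ^ j) * (exp c + exp c)"
      using eq[of r] eq[of "- r"] r by (intro mult_left_mono add_mono) auto
    also have "\<dots> = fact j * (8 * \<delta>) ^ j * (2 * exp c)" by (simp add: r_def power_divide)
    finally have 1: "norm (nth_deriv j \<phi> u) \<le> fact j * (8 * \<delta>) ^ j * (2 * exp c)"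
      using nth_deriv_char(3)[OF aZ, of j u] unfolding \<phi> by linarith
    have "\<bar>k\<bar> \<le> s * \<tau> 2" using \<tau>[of 1] by (simp add: k numeral_eq_Suc)
    also have "\<dots> \<le> (4 * \<delta>) * (2 * c)" using s tc t0 \<delta> by (intro mult_mono) auto
    finally have k8: "\<bar>k\<bar> \<le> 8 * c * \<delta>" by (simp add: ac_simps)
    have "norm ((deriv ^^ j) (edgeworth l k) (of_real u)) \<le> fact j * (exp (2 * c) * (1 + 2 * (8 * c * \<delta>)))"
      by (rule edgeworth_deriv_crude[OF _ _ k8 u]) (use t0 tc in \<open>auto simp: l\<close>)
    then show ?thesis using 1 norm_triangle_ineq4[of "nth_deriv j \<phi> u" "(deriv ^^ j) (edgeworth l k) (of_real u)"] by linarith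
  qed
qed

end

section \<open>Wiener integrals of deterministic functions\<close>

text \<open>Square integrability is required of the approximants only. The nonnegative integral is
  meaningful before the limit is known to be square integrable, which is then a consequence.\<close>

definition l2_lim :: "'x measure \<Rightarrow> (nat \<Rightarrow> 'x \<Rightarrow> real) \<Rightarrow> ('x \<Rightarrow> real) \<Rightarrow> bool" where
  "l2_lim N F f \<longleftrightarrow> f \<in> borel_measurable N \<and> (\<forall>l. F l \<in> borel_measurable N \<and> integrable N (\<lambda>x. (F l x)\<^sup>2)) \<and>
     (\<lambda>l. \<integral>\<^sup>+x. ennreal ((f x - F l x)\<^sup>2) \<partial>N) \<longlonglongrightarrow> 0"

lemma square_add_le:
  fixes a b s :: real shows "(a + s * b)\<^sup>2 \<le> 2 * a\<^sup>2 + 2 * s\<^sup>2 * b\<^sup>2"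
proof -
  have "(a + s * b)\<^sup>2 + (a - s * b)\<^sup>2 = 2 * a\<^sup>2 + 2 * s\<^sup>2 * b\<^sup>2"
    by (simp add: power2_eq_square algebra_simps)
  moreover have "0 \<le> (a - s * b)\<^sup>2" by simp
  ultimately show ?thesis by linarith
qed

lemma integrable_sq_add:
  fixes f g :: "'x \<Rightarrow> real"
  assumes [measurable]: "f \<in> borel_measurable N" "g \<in> borel_measurable N"
    and "integrable N (\<lambda>x. (f x)\<^sup>2)" "integrable N (\<lambda>x. (g x)\<^sup>2)"
  shows "integrable N (\<lambda>x. (f x + s * g x)\<^sup>2)"
proof (rule Bochner_Integration.integrable_bound)
  show "integrable N (\<lambda>x. 2 * (f x)\<^sup>2 + 2 * s\<^sup>2 * (g x)\<^sup>2)" using assms by simp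
  show "AE x in N. norm ((f x + s * g x)\<^sup>2) \<le> norm (2 * (f x)\<^sup>2 + 2 * s\<^sup>2 * (g x)\<^sup>2)"
    using square_add_le by (intro AE_I2) simp
qed measurable

lemma integrable_sq_mult:
  fixes f g w :: "'x \<Rightarrow> real"
  assumes [measurable]: "f \<in> borel_measurable N" "g \<in> borel_measurable N" "w \<in> borel_measurable N"
    and "integrable N (\<lambda>x. (f x)\<^sup>2)" "integrable N (\<lambda>x. (g x)\<^sup>2)" and w: "\<And>x. \<bar>w x\<bar> \<le> 1"
  shows "integrable N (\<lambda>x. w x * (f x * g x))"
proof (rule Bochner_Integration.integrable_bound)
  show "integrable N (\<lambda>x. (f x)\<^sup>2 + (g x)\<^sup>2)" using assms by simp
  show "AE x in N. norm (w x * (f x * g x)) \<le> norm ((f x)\<^sup>2 + (g x)\<^sup>2)"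
  proof (rule AE_I2)
    fix x
    have "0 \<le> (\<bar>f x\<bar> - \<bar>g x\<bar>)\<^sup>2" by simp
    then have "2 * (\<bar>f x\<bar> * \<bar>g x\<bar>) \<le> (f x)\<^sup>2 + (g x)\<^sup>2" by (simp add: power2_diff)
    moreover have "0 \<le> \<bar>f x\<bar> * \<bar>g x\<bar>" by simp
    ultimately have "\<bar>f x * g x\<bar> \<le> (f x)\<^sup>2 + (g x)\<^sup>2" unfolding abs_mult by linarith
    moreover have "\<bar>w x\<bar> * \<bar>f x * g x\<bar> \<le> 1 * \<bar>f x * g x\<bar>" by (intro mult_right_mono w) auto
    ultimately show "norm (w x * (f x * g x)) \<le> norm ((f x)\<^sup>2 + (g x)\<^sup>2)" by (simp add: abs_mult)
  qed
qed measurable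

lemma l2_lim_sq:
  assumes "l2_lim N F f"
  shows "integrable N (\<lambda>x. (f x)\<^sup>2)" and "eventually (\<lambda>l. integrable N (\<lambda>x. (f x - F l x)\<^sup>2)) sequentially"
    and "(\<lambda>l. \<integral>x. (f x - F l x)\<^sup>2 \<partial>N) \<longlonglongrightarrow> 0"
proof -
  have [measurable]: "f \<in> borel_measurable N" "F l \<in> borel_measurable N" for l using assms by (auto simp: l2_lim_def)
  have lim: "(\<lambda>l. \<integral>\<^sup>+x. ennreal ((f x - F l x)\<^sup>2) \<partial>N) \<longlonglongrightarrow> 0" using assms by (simp add: l2_lim_def)
  have "eventually (\<lambda>l. (\<integral>\<^sup>+x. ennreal ((f x - F l x)\<^sup>2) \<partial>N) < 1) sequentially"
    using lim by (rule order_tendstoD) simp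
  then show ev: "eventually (\<lambda>l. integrable N (\<lambda>x. (f x - F l x)\<^sup>2)) sequentially"
  proof eventually_elim
    case (elim l)
    then show ?case by (intro integrableI_bounded) (auto intro: order_less_trans)
  qed
  then obtain l where l: "integrable N (\<lambda>x. (f x - F l x)\<^sup>2)" by (auto dest!: eventually_happens)
  have "integrable N (\<lambda>x. ((f x - F l x) + 1 * F l x)\<^sup>2)"
    by (rule integrable_sq_add) (use l assms in \<open>auto simp: l2_lim_def\<close>)
  then show "integrable N (\<lambda>x. (f x)\<^sup>2)" by simp
  have "eventually (\<lambda>l. (\<integral>\<^sup>+x. ennreal ((f x - F l x)\<^sup>2) \<partial>N) = ennreal (\<integral>x. (f x - F l x)\<^sup>2 \<partial>N)) sequentially"
    using ev by eventually_elim (simp add: nn_integral_eq_integral)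
  from Lim_transform_eventually[OF lim this]
  have "(\<lambda>l. ennreal (\<integral>x. (f x - F l x)\<^sup>2 \<partial>N)) \<longlonglongrightarrow> ennreal 0" by simp
  then show "(\<lambda>l. \<integral>x. (f x - F l x)\<^sup>2 \<partial>N) \<longlonglongrightarrow> 0"
    by (rule tendsto_ennrealD) auto
qed

lemma young_ineq:
  fixes a b t :: real assumes "0 < t" shows "\<bar>a * b\<bar> \<le> (t * b\<^sup>2 + a\<^sup>2 / t) / 2"
proof -
  have "0 \<le> (t * \<bar>b\<bar> - \<bar>a\<bar>)\<^sup>2 / t" using assms by simp
  also have "\<dots> = t * b\<^sup>2 - 2 * (\<bar>a\<bar> * \<bar>b\<bar>) + a\<^sup>2 / t"
    using assms by (simp add: power2_diff field_simps power2_eq_square)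
  finally show ?thesis by (simp add: abs_mult)
qed

text \<open>Supplies the parameter for \<open>young_ineq\<close>, which does the work of
  Cauchy-Schwarz: a null sequence whose squares dominate both errors. The summand 1 / (l + 1) keeps
  it strictly positive.\<close>

lemma l2_lim_rate:
  assumes F: "l2_lim N F f" and G: "l2_lim N G g"
  obtains t where "\<And>l. 0 < t l" "t \<longlonglongrightarrow> 0"
    "\<And>l. (\<integral>x. (f x - F l x)\<^sup>2 \<partial>N) + (\<integral>x. (g x - G l x)\<^sup>2 \<partial>N) \<le> (t l)\<^sup>2"
proof
  let ?e = "\<lambda>l. (\<integral>x. (f x - F l x)\<^sup>2 \<partial>N) + (\<integral>x. (g x - G l x)\<^sup>2 \<partial>N) + 1 / real (Suc l)"
  have e: "0 < ?e l" for l
    by (intro add_nonneg_pos add_nonneg_nonneg) auto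
  show "0 < sqrt (?e l)" for l using e[of l] by simp
  have "?e \<longlonglongrightarrow> 0 + 0 + 0"
    by (intro tendsto_add l2_lim_sq(3)[OF F] l2_lim_sq(3)[OF G] LIMSEQ_Suc[OF lim_1_over_n])
  then show "(\<lambda>l. sqrt (?e l)) \<longlonglongrightarrow> 0" using tendsto_real_sqrt by fastforce
  show "(\<integral>x. (f x - F l x)\<^sup>2 \<partial>N) + (\<integral>x. (g x - G l x)\<^sup>2 \<partial>N) \<le> (sqrt (?e l))\<^sup>2" for l
    using e[of l] by simp
qed

text \<open>The difference of the products consists of error times error and error times limit.
  Young's inequality with parameter t bounds the latter by t times a constant plus error^2 / t,
  whose integral is at most t. The weight \<open>w\<close> is there for the correlation
  function.\<close>

lemma l2_lim_product:
  fixes w :: "'x \<Rightarrow> real"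
  assumes F: "l2_lim N F f" and G: "l2_lim N G g" and [measurable]: "w \<in> borel_measurable N" and w: "\<And>x. \<bar>w x\<bar> \<le> 1"
  shows "(\<lambda>l. \<integral>x. w x * (F l x * G l x) \<partial>N) \<longlonglongrightarrow> (\<integral>x. w x * (f x * g x) \<partial>N)"
proof -
  have [measurable]: "f \<in> borel_measurable N" "F l \<in> borel_measurable N" "g \<in> borel_measurable N" "G l \<in> borel_measurable N" for l
    using F G by (auto simp: l2_lim_def)
  obtain t where t: "\<And>l. 0 < t l" "t \<longlonglongrightarrow> 0"
    and te: "\<And>l. (\<integral>x. (f x - F l x)\<^sup>2 \<partial>N) + (\<integral>x. (g x - G l x)\<^sup>2 \<partial>N) \<le> (t l)\<^sup>2"
    using l2_lim_rate[OF F G] by blast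
  have sq: "integrable N (\<lambda>x. (f x)\<^sup>2)" "integrable N (\<lambda>x. (g x)\<^sup>2)"
      "integrable N (\<lambda>x. (F l x)\<^sup>2)" "integrable N (\<lambda>x. (G l x)\<^sup>2)" for l
    using l2_lim_sq(1)[OF F] l2_lim_sq(1)[OF G] F G by (auto simp: l2_lim_def)
  let ?A = "(\<integral>x. (f x)\<^sup>2 \<partial>N)" and ?B = "(\<integral>x. (g x)\<^sup>2 \<partial>N)"
  have "eventually (\<lambda>l. norm ((\<integral>x. w x * (F l x * G l x) \<partial>N) - (\<integral>x. w x * (f x * g x) \<partial>N)) \<le> ((t l)\<^sup>2 + t l * (?A + ?B) + t l) / 2) sequentially"
    using l2_lim_sq(2)[OF F] l2_lim_sq(2)[OF G]
  proof eventually_elim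
    case (elim l)
    note D = elim
    have "norm ((\<integral>x. w x * (F l x * G l x) \<partial>N) - (\<integral>x. w x * (f x * g x) \<partial>N)) = norm (\<integral>x. w x * (F l x * G l x) - w x * (f x * g x) \<partial>N)"
      by (subst Bochner_Integration.integral_diff) (auto intro!: integrable_sq_mult sq w)
    also have "\<dots> \<le> (\<integral>x. ((f x - F l x)\<^sup>2 + (g x - G l x)\<^sup>2 + t l * ((f x)\<^sup>2 + (g x)\<^sup>2) + ((f x - F l x)\<^sup>2 + (g x - G l x)\<^sup>2) / t l) / 2 \<partial>N)"
    proof (rule norm_integral_le)
      show "integrable N (\<lambda>x. ((f x - F l x)\<^sup>2 + (g x - G l x)\<^sup>2 + t l * ((f x)\<^sup>2 + (g x)\<^sup>2) + ((f x - F l x)\<^sup>2 + (g x - G l x)\<^sup>2) / t l) / 2)"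
        using D sq by simp
      show "integrable N (\<lambda>x. w x * (F l x * G l x) - w x * (f x * g x))"
        by (intro Bochner_Integration.integrable_diff integrable_sq_mult sq w) measurable
      fix x
      have "F l x * G l x - f x * g x = (f x - F l x) * (g x - G l x) - ((f x - F l x) * g x + (g x - G l x) * f x)"
        by (simp add: algebra_simps)
      then have "\<bar>F l x * G l x - f x * g x\<bar> \<le> \<bar>(f x - F l x) * (g x - G l x)\<bar> + (\<bar>(f x - F l x) * g x\<bar> + \<bar>(g x - G l x) * f x\<bar>)"
        by linarith
      also have "\<dots> \<le> (1 * (g x - G l x)\<^sup>2 + (f x - F l x)\<^sup>2 / 1) / 2 + ((t l * (g x)\<^sup>2 + (f x - F l x)\<^sup>2 / t l) / 2 + (t l * (f x)\<^sup>2 + (g x - G l x)\<^sup>2 / t l) / 2)"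
        by (intro add_mono young_ineq t) auto
      also have "\<dots> = ((f x - F l x)\<^sup>2 + (g x - G l x)\<^sup>2 + t l * ((f x)\<^sup>2 + (g x)\<^sup>2) + ((f x - F l x)\<^sup>2 + (g x - G l x)\<^sup>2) / t l) / 2"
        using t(1)[of l] by (simp add: field_simps)
      finally have b: "\<bar>F l x * G l x - f x * g x\<bar> \<le> ((f x - F l x)\<^sup>2 + (g x - G l x)\<^sup>2 + t l * ((f x)\<^sup>2 + (g x)\<^sup>2) + ((f x - F l x)\<^sup>2 + (g x - G l x)\<^sup>2) / t l) / 2" .
      have "norm (w x * (F l x * G l x) - w x * (f x * g x)) \<le> 1 * \<bar>F l x * G l x - f x * g x\<bar>"
        unfolding right_diff_distrib[symmetric] abs_mult real_norm_def by (intro mult_right_mono w) auto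
      from order.trans[OF this[unfolded mult_1_left] b] show "norm (w x * (F l x * G l x) - w x * (f x * g x)) \<le> ((f x - F l x)\<^sup>2 + (g x - G l x)\<^sup>2 + t l * ((f x)\<^sup>2 + (g x)\<^sup>2) + ((f x - F l x)\<^sup>2 + (g x - G l x)\<^sup>2) / t l) / 2"
        .
    qed
    also have "\<dots> = (((\<integral>x. (f x - F l x)\<^sup>2 \<partial>N) + (\<integral>x. (g x - G l x)\<^sup>2 \<partial>N)) + t l * (?A + ?B) + ((\<integral>x. (f x - F l x)\<^sup>2 \<partial>N) + (\<integral>x. (g x - G l x)\<^sup>2 \<partial>N)) / t l) / 2"
      using D sq by simp
    also have "\<dots> \<le> ((t l)\<^sup>2 + t l * (?A + ?B) + (t l)\<^sup>2 / t l) / 2"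
      using te[of l] t(1)[of l] by (intro divide_right_mono add_mono) auto
    finally show ?case using t(1)[of l] by (simp add: power2_eq_square)
  qed
  moreover have "(\<lambda>l. ((t l)\<^sup>2 + t l * (?A + ?B) + t l) / 2) \<longlonglongrightarrow> (0\<^sup>2 + 0 * (?A + ?B) + 0) / 2"
    by (intro tendsto_intros t) auto
  then have "(\<lambda>l. ((t l)\<^sup>2 + t l * (?A + ?B) + t l) / 2) \<longlonglongrightarrow> 0" by simp
  ultimately have "(\<lambda>l. (\<integral>x. w x * (F l x * G l x) \<partial>N) - (\<integral>x. w x * (f x * g x) \<partial>N)) \<longlonglongrightarrow> 0"
    by (rule Lim_null_comparison)
  then show ?thesis by (rule LIM_zero_cancel)
qed

lemma l2_lim_lin:
  assumes F: "l2_lim N F f" and G: "l2_lim N G g"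
  shows "l2_lim N (\<lambda>l x. F l x + s * G l x) (\<lambda>x. f x + s * g x)"
proof -
  have m[measurable]: "f \<in> borel_measurable N" "F l \<in> borel_measurable N" "g \<in> borel_measurable N" "G l \<in> borel_measurable N" for l
    using F G by (auto simp: l2_lim_def)
  have sq: "integrable N (\<lambda>x. (F l x)\<^sup>2)" "integrable N (\<lambda>x. (G l x)\<^sup>2)" for l
    using F G by (auto simp: l2_lim_def)
  have FL: "(\<lambda>l. \<integral>\<^sup>+x. ennreal ((f x - F l x)\<^sup>2) \<partial>N) \<longlonglongrightarrow> 0" and GL: "(\<lambda>l. \<integral>\<^sup>+x. ennreal ((g x - G l x)\<^sup>2) \<partial>N) \<longlonglongrightarrow> 0"
    using F G by (auto simp: l2_lim_def)
  have "(\<lambda>l. ennreal 2 * (\<integral>\<^sup>+x. ennreal ((f x - F l x)\<^sup>2) \<partial>N) + ennreal (2 * s\<^sup>2) * (\<integral>\<^sup>+x. ennreal ((g x - G l x)\<^sup>2) \<partial>N)) \<longlonglongrightarrow> ennreal 2 * 0 + ennreal (2 * s\<^sup>2) * 0"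
    by (intro tendsto_add ennreal_tendsto_cmult FL GL) auto
  then have up: "(\<lambda>l. ennreal 2 * (\<integral>\<^sup>+x. ennreal ((f x - F l x)\<^sup>2) \<partial>N) + ennreal (2 * s\<^sup>2) * (\<integral>\<^sup>+x. ennreal ((g x - G l x)\<^sup>2) \<partial>N)) \<longlonglongrightarrow> 0"
    by simp
  have le: "(\<integral>\<^sup>+x. ennreal ((f x + s * g x - (F l x + s * G l x))\<^sup>2) \<partial>N) \<le>
     ennreal 2 * (\<integral>\<^sup>+x. ennreal ((f x - F l x)\<^sup>2) \<partial>N) + ennreal (2 * s\<^sup>2) * (\<integral>\<^sup>+x. ennreal ((g x - G l x)\<^sup>2) \<partial>N)" for l
  proof -
    have "(\<integral>\<^sup>+x. ennreal ((f x + s * g x - (F l x + s * G l x))\<^sup>2) \<partial>N) \<le>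
      (\<integral>\<^sup>+x. ennreal 2 * ennreal ((f x - F l x)\<^sup>2) + ennreal (2 * s\<^sup>2) * ennreal ((g x - G l x)\<^sup>2) \<partial>N)"
    proof (rule nn_integral_mono)
      fix x
      let ?a = "f x - F l x"
      have "f x + s * g x - (F l x + s * G l x) = ?a + s * (g x - G l x)" by (simp add: algebra_simps)
      then have "(f x + s * g x - (F l x + s * G l x))\<^sup>2 \<le> 2 * ?a\<^sup>2 + 2 * s\<^sup>2 * (g x - G l x)\<^sup>2"
        using square_add_le[of ?a s "g x - G l x"] by (simp only:)
      then have "ennreal ((f x + s * g x - (F l x + s * G l x))\<^sup>2) \<le> ennreal (2 * ?a\<^sup>2 + 2 * s\<^sup>2 * (g x - G l x)\<^sup>2)"
        by (rule ennreal_leI)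
      also have "\<dots> = ennreal 2 * ennreal (?a\<^sup>2) + ennreal (2 * s\<^sup>2) * ennreal ((g x - G l x)\<^sup>2)"
        by (subst ennreal_plus) (simp_all add: ennreal_mult del: ennreal_plus)
      finally show "ennreal ((f x + s * g x - (F l x + s * G l x))\<^sup>2) \<le> ennreal 2 * ennreal (?a\<^sup>2) + ennreal (2 * s\<^sup>2) * ennreal ((g x - G l x)\<^sup>2)" .
    qed
    also have "\<dots> = ennreal 2 * (\<integral>\<^sup>+x. ennreal ((f x - F l x)\<^sup>2) \<partial>N) + ennreal (2 * s\<^sup>2) * (\<integral>\<^sup>+x. ennreal ((g x - G l x)\<^sup>2) \<partial>N)"
      by (simp add: nn_integral_add nn_integral_cmult)
    finally show ?thesis .
  qed
  have "(\<lambda>l. \<integral>\<^sup>+x. ennreal ((f x + s * g x - (F l x + s * G l x))\<^sup>2) \<partial>N) \<longlonglongrightarrow> 0"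
    by (rule tendsto_sandwich[OF _ always_eventually[OF allI[OF le]] tendsto_const up]) simp
  then show ?thesis
    unfolding l2_lim_def by (auto intro!: integrable_sq_add sq)
qed

lemma l2_lim_const: "f \<in> borel_measurable N \<Longrightarrow> integrable N (\<lambda>x. (f x)\<^sup>2) \<Longrightarrow> l2_lim N (\<lambda>l. f) f"
  by (simp add: l2_lim_def)

text \<open>Characteristic functions converge because exp (i y) is Lipschitz in y, and the variances
  on the right converge by \<open>l2_lim_product\<close>.\<close>

lemma (in prob_space) l2_lim_char:
  assumes F: "l2_lim M Y y" and ch: "\<And>l. (CLINT \<omega>|M. iexp (Y l \<omega>)) = exp (- of_real (\<integral>\<omega>. (Y l \<omega>)\<^sup>2 \<partial>M) / 2)"
  shows "(CLINT \<omega>|M. iexp (y \<omega>)) = exp (- of_real (\<integral>\<omega>. (y \<omega>)\<^sup>2 \<partial>M) / 2)"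
proof -
  have [measurable]: "y \<in> borel_measurable M" "Y l \<in> borel_measurable M" for l using F by (auto simp: l2_lim_def)
  obtain t where t: "\<And>l. 0 < t l" "t \<longlonglongrightarrow> 0"
    and te: "\<And>l. (\<integral>x. (y x - Y l x)\<^sup>2 \<partial>M) + (\<integral>x. (y x - Y l x)\<^sup>2 \<partial>M) \<le> (t l)\<^sup>2"
    using l2_lim_rate[OF F F] by blast
  have ii: "complex_integrable M (\<lambda>\<omega>. iexp (Z \<omega>))" if [measurable]: "Z \<in> borel_measurable M" for Z
    by (rule integrable_const_bound[of _ 1]) auto
  have "eventually (\<lambda>l. norm ((CLINT \<omega>|M. iexp (Y l \<omega>)) - (CLINT \<omega>|M. iexp (y \<omega>))) \<le> t l) sequentially"
    using l2_lim_sq(2)[OF F]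
  proof eventually_elim
    case (elim l)
    have "norm ((CLINT \<omega>|M. iexp (Y l \<omega>)) - (CLINT \<omega>|M. iexp (y \<omega>))) = norm (CLINT \<omega>|M. iexp (Y l \<omega>) - iexp (y \<omega>))"
      by (subst Bochner_Integration.integral_diff) (auto intro!: ii)
    also have "\<dots> \<le> (\<integral>\<omega>. (t l + (y \<omega> - Y l \<omega>)\<^sup>2 / t l) / 2 \<partial>M)"
    proof (rule norm_integral_le)
      show "integrable M (\<lambda>\<omega>. (t l + (y \<omega> - Y l \<omega>)\<^sup>2 / t l) / 2)" using elim by simp
      show "complex_integrable M (\<lambda>\<omega>. iexp (Y l \<omega>) - iexp (y \<omega>))" by (intro Bochner_Integration.integrable_diff ii) auto
      fix \<omega>
      have "iexp (Y l \<omega>) - iexp (y \<omega>) = iexp (Y l \<omega>) * (1 - iexp (y \<omega> - Y l \<omega>))"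
        by (simp add: right_diff_distrib exp_add[symmetric])
      then have "norm (iexp (Y l \<omega>) - iexp (y \<omega>)) = norm (iexp (y \<omega> - Y l \<omega>) - 1)"
        by (simp add: norm_mult norm_minus_commute)
      also have "\<dots> \<le> \<bar>y \<omega> - Y l \<omega>\<bar>" using iexp_approx1[of "y \<omega> - Y l \<omega>" 0] by simp
      also have "\<dots> \<le> (t l + (y \<omega> - Y l \<omega>)\<^sup>2 / t l) / 2" using young_ineq[OF t(1)[of l], of "y \<omega> - Y l \<omega>" 1] by simp
      finally show "norm (iexp (Y l \<omega>) - iexp (y \<omega>)) \<le> (t l + (y \<omega> - Y l \<omega>)\<^sup>2 / t l) / 2" .
    qed
    also have "\<dots> = (t l + (\<integral>\<omega>. (y \<omega> - Y l \<omega>)\<^sup>2 \<partial>M) / t l) / 2" using elim by (simp add: prob_space)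
    also have "\<dots> \<le> (t l + (t l)\<^sup>2 / t l) / 2"
    proof -
      have "0 \<le> (\<integral>x. (y x - Y l x)\<^sup>2 \<partial>M)" by simp
      then have "(\<integral>x. (y x - Y l x)\<^sup>2 \<partial>M) \<le> (t l)\<^sup>2" using te[of l] by linarith
      then show ?thesis using t(1)[of l] by (intro divide_right_mono add_mono) auto
    qed
    finally show ?case using t(1)[of l] by (simp add: power2_eq_square)
  qed
  then have "(\<lambda>l. (CLINT \<omega>|M. iexp (Y l \<omega>)) - (CLINT \<omega>|M. iexp (y \<omega>))) \<longlonglongrightarrow> 0"
    by (rule Lim_null_comparison) (rule t(2))
  then have "(\<lambda>l. CLINT \<omega>|M. iexp (Y l \<omega>)) \<longlonglongrightarrow> (CLINT \<omega>|M. iexp (y \<omega>))"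
    by (rule LIM_zero_cancel)
  moreover have "(\<lambda>l. CLINT \<omega>|M. iexp (Y l \<omega>)) \<longlonglongrightarrow> exp (- of_real (\<integral>\<omega>. (y \<omega>)\<^sup>2 \<partial>M) / 2)"
  proof -
    have "(\<lambda>l. \<integral>\<omega>. (Y l \<omega>)\<^sup>2 \<partial>M) \<longlonglongrightarrow> (\<integral>\<omega>. (y \<omega>)\<^sup>2 \<partial>M)"
      using l2_lim_product[OF F F, of "\<lambda>_. 1"] by (simp add: power2_eq_square)
    then show ?thesis unfolding ch by (intro tendsto_exp tendsto_divide tendsto_minus tendsto_of_real tendsto_const) auto
  qed
  ultimately show ?thesis by (rule LIMSEQ_unique)
qed

lemma (in prob_space) gaussian_rv_centered:
  assumes G: "gaussian_rv M Y" and mean: "expectation Y = 0"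
  shows "integrable M (\<lambda>\<omega>. (Y \<omega>)\<^sup>2)"
    and "(CLINT \<omega>|M. iexp (Y \<omega>)) = exp (- of_real (\<integral>\<omega>. (Y \<omega>)\<^sup>2 \<partial>M) / 2)"
proof -
  have [measurable]: "Y \<in> borel_measurable M" using G by (simp add: gaussian_rv_def)
  from G consider m where "AE \<omega> in M. Y \<omega> = m" | m s where "0 < s" "distributed M lborel Y (normal_density m s)"
    unfolding gaussian_rv_def by blast
  then have "integrable M (\<lambda>\<omega>. (Y \<omega>)\<^sup>2) \<and> (CLINT \<omega>|M. iexp (Y \<omega>)) = exp (- of_real (\<integral>\<omega>. (Y \<omega>)\<^sup>2 \<partial>M) / 2)"
  proof cases
    case (1 m)
    have "expectation Y = expectation (\<lambda>\<omega>. m)" by (rule integral_cong_AE) (use 1 in auto)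
    then have "m = 0" using mean by (simp add: prob_space)
    with 1 have ae: "AE \<omega> in M. Y \<omega> = 0" by simp
    have "integrable M (\<lambda>\<omega>. (Y \<omega>)\<^sup>2) \<longleftrightarrow> integrable M (\<lambda>\<omega>. 0::real)"
      by (rule integrable_cong_AE) (use ae in auto)
    moreover have "(\<integral>\<omega>. (Y \<omega>)\<^sup>2 \<partial>M) = (\<integral>\<omega>. 0 \<partial>M)" by (rule integral_cong_AE) (use ae in auto)
    moreover have "(CLINT \<omega>|M. iexp (Y \<omega>)) = (CLINT \<omega>|M. 1)" by (rule integral_cong_AE) (use ae in auto)
    ultimately show ?thesis by (simp add: prob_space)
  next
    case (2 m s)
    have m: "m = 0" using normal_distributed_expectation[OF 2] mean by simp
    have D: "distributed M lborel Y (normal_density 0 s)" using 2 m by simp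
    have i: "integrable M (\<lambda>\<omega>. (Y \<omega>)\<^sup>2)"
      using distributed_integrable[OF D, of "\<lambda>x. x\<^sup>2"] integrable_normal_moment[OF 2(1), of 0 2] by simp
    have v: "(\<integral>\<omega>. (Y \<omega>)\<^sup>2 \<partial>M) = s\<^sup>2" using normal_distributed_variance[OF 2(1) D] mean by simp
    have DZ: "distributed M lborel (\<lambda>x. (Y x - 0) / s) std_normal_density"
      using D normal_standard_normal_convert[OF 2(1), of Y 0] by simp
    have dZ: "distr M borel (\<lambda>x. Y x / s) = std_normal_distribution"
      using distributed_distr_eq_density[OF DZ] by (simp cong: distr_cong)
    have "(CLINT \<omega>|M. iexp (Y \<omega>)) = char (distr M borel (\<lambda>x. Y x / s)) s"
      unfolding char_def using 2(1) by (subst integral_distr) auto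
    also have "\<dots> = exp (- of_real (s\<^sup>2) / 2)"
      unfolding dZ char_std_normal_distribution by (simp flip: exp_of_real)
    finally show ?thesis using i v by simp
  qed
  then show "integrable M (\<lambda>\<omega>. (Y \<omega>)\<^sup>2)"
    "(CLINT \<omega>|M. iexp (Y \<omega>)) = exp (- of_real (\<integral>\<omega>. (Y \<omega>)\<^sup>2 \<partial>M) / 2)" by auto
qed

section \<open>Covariance structure of the driving process\<close>

locale correlated_wiener = prob_space M for M :: "'a measure" +
  fixes T :: real and \<rho> :: "real \<Rightarrow> real" and B :: "real \<Rightarrow> 'a \<Rightarrow> real \<times> real"
  assumes T_pos: "T > 0"
    and rho_meas: "set_borel_measurable borel {0..T} \<rho>" and rho_bound: "\<forall>t\<in>{0..T}. \<rho> t \<in> {-1..1}"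
    and B_gauss: "gaussian_process M {0..T} B" and B_indep: "independent_increments M {0..T} B"
    and B_mean: "\<forall>t\<in>{0..T}. (\<integral>\<omega>. B t \<omega> \<partial>M) = 0"
    and B_var1: "\<forall>t\<in>{0..T}. (\<integral>\<omega>. (fst (B t \<omega>))\<^sup>2 \<partial>M) = t"
    and B_var2: "\<forall>t\<in>{0..T}. (\<integral>\<omega>. (snd (B t \<omega>))\<^sup>2 \<partial>M) = t"
    and B_cov: "\<forall>t\<in>{0..T}. (\<integral>\<omega>. fst (B t \<omega>) * snd (B t \<omega>) \<partial>M) = (LBINT s:{0..t}. \<rho> s)"
begin

text \<open>\<rho> is controlled on [0, T] only; cut off outside, it is Borel and bounded by 1
  everywhere.\<close>

definition rho0 :: "real \<Rightarrow> real" where "rho0 s = indicator {0..T} s * \<rho> s"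

lemma rho0_meas[measurable]: "rho0 \<in> borel_measurable borel"
  using rho_meas unfolding set_borel_measurable_def rho0_def[abs_def] by simp

lemma rho0_bound: "\<bar>rho0 s\<bar> \<le> 1"
proof (cases "s \<in> {0..T}")
  case True
  then show ?thesis using bspec[OF rho_bound True] by (simp add: rho0_def abs_le_iff)
qed (simp add: rho0_def)

abbreviation time :: "real measure" where "time \<equiv> restrict_space lborel {0..T}"

lemma finite_measure_time: "finite_measure time"
  by (rule finite_measureI) (use T_pos in \<open>simp add: emeasure_restrict_space space_restrict_space\<close>)

lemma meas_time: "f \<in> borel_measurable borel \<Longrightarrow> f \<in> borel_measurable time"
  by (rule measurable_restrict_space1) simp

lemma integrable_time:
  fixes f :: "real \<Rightarrow> real"
  assumes "f \<in> borel_measurable time" "\<And>x. \<bar>f x\<bar> \<le> K" shows "integrable time f"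
  by (rule finite_measure.integrable_const_bound[OF finite_measure_time, of _ K]) (use assms in auto)

text \<open>The covariance of the stochastic integrals of (f1, f2) and (g1, g2) against (B_1,
  B_2).\<close>

definition ip :: "(real \<Rightarrow> real) \<Rightarrow> (real \<Rightarrow> real) \<Rightarrow> (real \<Rightarrow> real) \<Rightarrow> (real \<Rightarrow> real) \<Rightarrow> real" where
  "ip f1 f2 g1 g2 = (\<integral>x. f1 x * g1 x + f2 x * g2 x + rho0 x * (f1 x * g2 x) + rho0 x * (f2 x * g1 x) \<partial>time)"

lemma B_inner_gauss: "t \<in> {0..T} \<Longrightarrow> gaussian_rv M (\<lambda>\<omega>. c \<bullet> B t \<omega>)"
  using B_gauss[unfolded gaussian_process_def, rule_format, of "{t}" "\<lambda>_. c"] by simp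

lemma B_inner_meas: "t \<in> {0..T} \<Longrightarrow> (\<lambda>\<omega>. c \<bullet> B t \<omega>) \<in> borel_measurable M"
  using B_inner_gauss[of t c] by (simp add: gaussian_rv_def)

lemma fst_B_meas: "t \<in> {0..T} \<Longrightarrow> (\<lambda>\<omega>. fst (B t \<omega>)) \<in> borel_measurable M"
  using B_inner_meas[of t "(1, 0)"] by (simp add: inner_prod_def)

lemma snd_B_meas: "t \<in> {0..T} \<Longrightarrow> (\<lambda>\<omega>. snd (B t \<omega>)) \<in> borel_measurable M"
  using B_inner_meas[of t "(0, 1)"] by (simp add: inner_prod_def)

lemma B_meas: "t \<in> {0..T} \<Longrightarrow> B t \<in> borel_measurable M"
  using borel_measurable_Pair[OF fst_B_meas snd_B_meas, of t t] by simp

lemma gaussian_rv_sq_integrable: "gaussian_rv M Y \<Longrightarrow> integrable M (\<lambda>\<omega>. (Y \<omega>)\<^sup>2)"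
proof -
  assume g: "gaussian_rv M Y"
  then have [measurable]: "Y \<in> borel_measurable M" by (simp add: gaussian_rv_def)
  from g consider m where "AE \<omega> in M. Y \<omega> = m" | m s where "0 < s" "distributed M lborel Y (normal_density m s)"
    unfolding gaussian_rv_def by blast
  then show "integrable M (\<lambda>\<omega>. (Y \<omega>)\<^sup>2)"
  proof cases
    case (1 m)
    then have "integrable M (\<lambda>\<omega>. (Y \<omega>)\<^sup>2) \<longleftrightarrow> integrable M (\<lambda>\<omega>. m\<^sup>2)" by (intro integrable_cong_AE) auto
    then show ?thesis by simp
  next
    case (2 m s)
    have "integrable lborel (\<lambda>x. normal_density m s x * (x - m)\<^sup>2)" by (rule integrable_normal_moment[OF 2(1)])
    then have "integrable M (\<lambda>\<omega>. (Y \<omega> - m)\<^sup>2)" using distributed_integrable[OF 2(2), of "\<lambda>x. (x - m)\<^sup>2"] by simp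
    then have "integrable M (\<lambda>\<omega>. ((Y \<omega> - m) + 1 * m)\<^sup>2)" by (intro integrable_sq_add) auto
    then show ?thesis by simp
  qed
qed

lemma sq_integrable_imp_integrable:
  fixes Y :: "'a \<Rightarrow> real"
  assumes [measurable]: "Y \<in> borel_measurable M" and "integrable M (\<lambda>\<omega>. (Y \<omega>)\<^sup>2)"
  shows "integrable M Y"
  using integrable_sq_mult[of Y M "\<lambda>_. 1" "\<lambda>_. 1"] assms by simp

lemma B_inner_sq: "t \<in> {0..T} \<Longrightarrow> integrable M (\<lambda>\<omega>. (c \<bullet> B t \<omega>)\<^sup>2)"
  by (rule gaussian_rv_sq_integrable[OF B_inner_gauss])

lemma B_integrable: assumes t: "t \<in> {0..T}" shows "integrable M (B t)"
proof -
  have "integrable M (\<lambda>\<omega>. fst (B t \<omega>))" "integrable M (\<lambda>\<omega>. snd (B t \<omega>))"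
    using sq_integrable_imp_integrable[OF B_inner_meas B_inner_sq, OF t t, of "(1, 0)"]
      sq_integrable_imp_integrable[OF B_inner_meas B_inner_sq, OF t t, of "(0, 1)"]
    by (simp_all add: inner_prod_def)
  then have "integrable M (\<lambda>\<omega>. fst (B t \<omega>) *\<^sub>R (1, 0) + snd (B t \<omega>) *\<^sub>R (0, 1) :: real \<times> real)"
    by (intro Bochner_Integration.integrable_add integrable_scaleR_left)
  then show ?thesis by simp
qed

lemma B_inner_mean: "t \<in> {0..T} \<Longrightarrow> (\<integral>\<omega>. c \<bullet> B t \<omega> \<partial>M) = 0"
  using B_integrable[of t] B_mean by simp

lemma B_zero: "AE \<omega> in M. B 0 \<omega> = 0"
proof -
  have z: "0 \<in> {0..T}" using T_pos by simp
  have i: "integrable M (\<lambda>\<omega>. (fst (B 0 \<omega>))\<^sup>2)" "integrable M (\<lambda>\<omega>. (snd (B 0 \<omega>))\<^sup>2)"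
    using B_inner_sq[OF z, of "(1, 0)"] B_inner_sq[OF z, of "(0, 1)"] by (simp_all add: inner_prod_def)
  have "AE \<omega> in M. (fst (B 0 \<omega>))\<^sup>2 = 0"
    using integral_nonneg_eq_0_iff_AE[OF i(1)] bspec[OF B_var1 z] by simp
  moreover have "AE \<omega> in M. (snd (B 0 \<omega>))\<^sup>2 = 0"
    using integral_nonneg_eq_0_iff_AE[OF i(2)] bspec[OF B_var2 z] by simp
  ultimately show ?thesis by eventually_elim (simp add: prod_eq_iff)
qed

lemma B_inner_mult_integrable:
  "s \<in> {0..T} \<Longrightarrow> t \<in> {0..T} \<Longrightarrow> integrable M (\<lambda>\<omega>. (c \<bullet> B s \<omega>) * (d \<bullet> B t \<omega>))"
  using integrable_sq_mult[OF B_inner_meas B_inner_meas, of s t "\<lambda>_. 1"] B_inner_sq by simp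

definition corr :: "real \<times> real \<Rightarrow> real \<times> real \<Rightarrow> real \<Rightarrow> real" where
  "corr c d u = (fst c * fst d + snd c * snd d) * u + (fst c * snd d + snd c * fst d) * (LBINT s:{0..u}. \<rho> s)"

lemma B_cov_same:
  assumes s: "s \<in> {0..T}"
  shows "(\<integral>\<omega>. (c \<bullet> B s \<omega>) * (d \<bullet> B s \<omega>) \<partial>M) = corr c d s"
proof -
  have i: "integrable M (\<lambda>\<omega>. (fst (B s \<omega>))\<^sup>2)" "integrable M (\<lambda>\<omega>. (snd (B s \<omega>))\<^sup>2)" "integrable M (\<lambda>\<omega>. fst (B s \<omega>) * snd (B s \<omega>))"
    using B_inner_sq[OF s, of "(1, 0)"] B_inner_sq[OF s, of "(0, 1)"] B_inner_mult_integrable[OF s s, of "(1, 0)" "(0, 1)"]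
    by (simp_all add: inner_prod_def)
  have "(\<integral>\<omega>. (c \<bullet> B s \<omega>) * (d \<bullet> B s \<omega>) \<partial>M) =
    (\<integral>\<omega>. fst c * fst d * (fst (B s \<omega>))\<^sup>2 + snd c * snd d * (snd (B s \<omega>))\<^sup>2 + (fst c * snd d + snd c * fst d) * (fst (B s \<omega>) * snd (B s \<omega>)) \<partial>M)"
    by (intro Bochner_Integration.integral_cong refl) (simp add: inner_prod_def power2_eq_square algebra_simps)
  also have "\<dots> = fst c * fst d * s + snd c * snd d * s + (fst c * snd d + snd c * fst d) * (LBINT x:{0..s}. \<rho> x)"
    using i B_var1 B_var2 B_cov s by simp
  finally show ?thesis by (simp add: corr_def algebra_simps)
qed

text \<open>Replacing B_t by B_s changes nothing: the increment from s to t is independent of B_s -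
  B_0 and has mean zero, while B_0 vanishes almost surely.\<close>

lemma B_cov_le:
  assumes s: "s \<in> {0..T}" and t: "t \<in> {0..T}" and st: "s \<le> t"
  shows "(\<integral>\<omega>. (c \<bullet> B s \<omega>) * (d \<bullet> B t \<omega>) \<partial>M) = corr c d s"
proof -
  have z: "0 \<in> {0..T}" using T_pos by simp
  \<comment> \<open>The grid 0, s, t with two increments, encoded for
    \<open>independent_increments\<close>.\<close>
  define tt where "tt k = (if k = (0::nat) then 0 else if k = 1 then s else t)" for k
  have "indep_vars (\<lambda>_. borel) (\<lambda>k \<omega>. B (tt (Suc k)) \<omega> - B (tt k) \<omega>) {..<2}"
    using B_indep[unfolded independent_increments_def, rule_format, of 2 tt] s t st z
    by (auto simp: tt_def less_Suc_eq numeral_2_eq_2)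
  then have iv: "indep_vars (\<lambda>_. borel) (\<lambda>k \<omega>. (if k = 0 then c else d) \<bullet> (B (tt (Suc k)) \<omega> - B (tt k) \<omega>)) {..<2}"
    by (rule indep_vars_compose2) auto
  have ii: "integrable M (\<lambda>\<omega>. e \<bullet> (B u \<omega> - B v \<omega>))" if "u \<in> {0..T}" "v \<in> {0..T}" for e u v
    using B_integrable[OF that(1)] B_integrable[OF that(2)] by simp
  have "(\<integral>\<omega>. (\<Prod>k<2. (if k = 0 then c else d) \<bullet> (B (tt (Suc k)) \<omega> - B (tt k) \<omega>)) \<partial>M) =
    (\<Prod>k<2. \<integral>\<omega>. (if k = 0 then c else d) \<bullet> (B (tt (Suc k)) \<omega> - B (tt k) \<omega>) \<partial>M)"
    by (rule indep_vars_lebesgue_integral[OF _ iv]) (use s t z in \<open>auto simp: tt_def intro!: ii\<close>)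
  then have "(\<integral>\<omega>. (c \<bullet> (B s \<omega> - B 0 \<omega>)) * (d \<bullet> (B t \<omega> - B s \<omega>)) \<partial>M) =
     (\<integral>\<omega>. c \<bullet> (B s \<omega> - B 0 \<omega>) \<partial>M) * (\<integral>\<omega>. d \<bullet> (B t \<omega> - B s \<omega>) \<partial>M)"
    by (simp add: tt_def numeral_2_eq_2 lessThan_Suc mult.commute)
  moreover have "(\<integral>\<omega>. d \<bullet> (B t \<omega> - B s \<omega>) \<partial>M) = 0"
    using B_integrable[OF s] B_integrable[OF t] B_mean s t by simp
  moreover have "(\<integral>\<omega>. (c \<bullet> (B s \<omega> - B 0 \<omega>)) * (d \<bullet> (B t \<omega> - B s \<omega>)) \<partial>M) = (\<integral>\<omega>. (c \<bullet> B s \<omega>) * (d \<bullet> B t \<omega>) - (c \<bullet> B s \<omega>) * (d \<bullet> B s \<omega>) \<partial>M)"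
  proof (rule integral_cong_AE)
    note [measurable] = B_meas[OF s] B_meas[OF t] B_meas[OF z]
    show "(\<lambda>\<omega>. (c \<bullet> (B s \<omega> - B 0 \<omega>)) * (d \<bullet> (B t \<omega> - B s \<omega>))) \<in> borel_measurable M" by measurable
    show "(\<lambda>\<omega>. (c \<bullet> B s \<omega>) * (d \<bullet> B t \<omega>) - (c \<bullet> B s \<omega>) * (d \<bullet> B s \<omega>)) \<in> borel_measurable M" by measurable
    show "AE \<omega> in M. (c \<bullet> (B s \<omega> - B 0 \<omega>)) * (d \<bullet> (B t \<omega> - B s \<omega>)) = (c \<bullet> B s \<omega>) * (d \<bullet> B t \<omega>) - (c \<bullet> B s \<omega>) * (d \<bullet> B s \<omega>)"
      using B_zero by eventually_elim (simp add: inner_diff_right right_diff_distrib)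
  qed
  moreover have "\<dots> = (\<integral>\<omega>. (c \<bullet> B s \<omega>) * (d \<bullet> B t \<omega>) \<partial>M) - corr c d s"
    using B_cov_same[OF s, of c d] B_inner_mult_integrable[OF s t, of c d] B_inner_mult_integrable[OF s s, of c d] by simp
  ultimately show ?thesis by simp
qed

lemma B_cov_min:
  assumes s: "s \<in> {0..T}" and t: "t \<in> {0..T}"
  shows "(\<integral>\<omega>. (c \<bullet> B s \<omega>) * (d \<bullet> B t \<omega>) \<partial>M) = corr c d (min s t)"
proof (cases "s \<le> t")
  case True
  then show ?thesis using B_cov_le[OF s t] by simp
next
  case False
  then have "(\<integral>\<omega>. (d \<bullet> B t \<omega>) * (c \<bullet> B s \<omega>) \<partial>M) = corr d c t" using B_cov_le[OF t s] by simp
  then show ?thesis using False by (simp add: mult.commute corr_def algebra_simps)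
qed

lemma ip_indicator:
  assumes s: "s \<in> {0..T}" and t: "t \<in> {0..T}"
  shows "ip (\<lambda>x. fst c * indicator {0<..s} x) (\<lambda>x. snd c * indicator {0<..s} x)
     (\<lambda>x. fst d * indicator {0<..t} x) (\<lambda>x. snd d * indicator {0<..t} x) = corr c d (min s t)"
proof -
  let ?u = "min s t"
  have u: "0 \<le> ?u" "?u \<le> T" using s t by auto
  have i1: "integrable lborel (\<lambda>x. indicator {0<..?u} x :: real)" using u by simp
  have i2: "integrable lborel (\<lambda>x. indicator {0<..?u} x * rho0 x)"
    by (rule integrableI_bounded_set[where B = 1 and A = "{0<..?u}"])
       (use rho0_bound u in \<open>auto simp: emeasure_lborel_Ioc intro!: AE_I2\<close>)
  have "ip (\<lambda>x. fst c * indicator {0<..s} x) (\<lambda>x. snd c * indicator {0<..s} x)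
     (\<lambda>x. fst d * indicator {0<..t} x) (\<lambda>x. snd d * indicator {0<..t} x) =
    (\<integral>x. (fst c * fst d + snd c * snd d) * indicator {0<..?u} x + (fst c * snd d + snd c * fst d) * (indicator {0<..?u} x * rho0 x) \<partial>lborel)"
    unfolding ip_def using u
    by (subst integral_restrict_space) (auto intro!: Bochner_Integration.integral_cong simp: indicator_def algebra_simps)
  also have "\<dots> = (fst c * fst d + snd c * snd d) * ?u + (fst c * snd d + snd c * fst d) * (\<integral>x. indicator {0<..?u} x * rho0 x \<partial>lborel)"
    using i1 i2 u by simp
  also have "(\<integral>x. indicator {0<..?u} x * rho0 x \<partial>lborel) = (LBINT x:{0..?u}. \<rho> x)"
    unfolding set_lebesgue_integral_def
  proof (rule integral_cong_AE)
    show "(\<lambda>x. indicator {0<..?u} x * rho0 x) \<in> borel_measurable lborel" by measurable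
    have e: "indicator {0..?u} x *\<^sub>R \<rho> x = indicator {0..?u} x * rho0 x" for x
      using u by (auto simp: rho0_def indicator_def)
    show "(\<lambda>x. indicator {0..?u} x *\<^sub>R \<rho> x) \<in> borel_measurable lborel" unfolding e by measurable
    have "AE x in lborel. x \<noteq> (0::real)" by (rule AE_lborel_singleton)
    then show "AE x in lborel. indicator {0<..?u} x * rho0 x = indicator {0..?u} x *\<^sub>R \<rho> x"
      unfolding e by eventually_elim (auto simp: indicator_def)
  qed
  finally show ?thesis by (simp add: corr_def)
qed

section \<open>Elementary stochastic integrals and their limits\<close>

definition elem :: "real set \<Rightarrow> (real \<Rightarrow> real \<times> real) \<Rightarrow> 'a \<Rightarrow> real" where
  "elem F c \<omega> = (\<Sum>t\<in>F. c t \<bullet> B t \<omega>)"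
definition elem_fun :: "(real \<times> real \<Rightarrow> real) \<Rightarrow> real set \<Rightarrow> (real \<Rightarrow> real \<times> real) \<Rightarrow> real \<Rightarrow> real" where
  "elem_fun \<pi> F c x = (\<Sum>t\<in>F. \<pi> (c t) * indicator {0<..t} x)"

text \<open>Built from values of B rather than from increments: since B_0 = 0 almost surely, B_t is
  the integral of the indicator of (0, t]. Linear combinations then only require the union of two
  finite sets of times.\<close>

definition elementary :: "('a \<Rightarrow> real) \<Rightarrow> (real \<Rightarrow> real) \<Rightarrow> (real \<Rightarrow> real) \<Rightarrow> bool" where
  "elementary Y f1 f2 \<longleftrightarrow> (\<exists>F c. finite F \<and> F \<subseteq> {0..T} \<and> Y = elem F c \<and> f1 = elem_fun fst F c \<and> f2 = elem_fun snd F c)"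

lemma elementary_zero: "elementary (\<lambda>\<omega>. 0) (\<lambda>x. 0) (\<lambda>x. 0)"
  unfolding elementary_def by (intro exI[of _ "{}"]) (simp add: elem_def[abs_def] elem_fun_def[abs_def])

lemma elementary_B:
  assumes "t \<in> {0..T}"
  shows "elementary (\<lambda>\<omega>. c \<bullet> B t \<omega>) (\<lambda>x. fst c * indicator {0<..t} x) (\<lambda>x. snd c * indicator {0<..t} x)"
  unfolding elementary_def
proof (intro exI[of _ "{t}"] exI[of _ "\<lambda>_. c"] conjI)
  show "(\<lambda>\<omega>. c \<bullet> B t \<omega>) = elem {t} (\<lambda>_. c)" unfolding elem_def[abs_def] by simp
  have "elem_fun \<pi> {t} (\<lambda>_. c) = (\<lambda>x. \<pi> c * indicator {0<..t} x)" for \<pi>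
    unfolding elem_fun_def[abs_def] by (subst sum.insert) auto
  then show "(\<lambda>x. fst c * indicator {0<..t} x) = elem_fun fst {t} (\<lambda>_. c)"
    "(\<lambda>x. snd c * indicator {0<..t} x) = elem_fun snd {t} (\<lambda>_. c)" by simp_all
qed (use assms in auto)

lemma elementary_lin:
  assumes Y: "elementary Y f1 f2" and Z: "elementary Z g1 g2"
  shows "elementary (\<lambda>\<omega>. Y \<omega> + s * Z \<omega>) (\<lambda>x. f1 x + s * g1 x) (\<lambda>x. f2 x + s * g2 x)"
proof -
  obtain F c where F: "finite F" "F \<subseteq> {0..T}" "Y = elem F c" "f1 = elem_fun fst F c" "f2 = elem_fun snd F c"
    using Y unfolding elementary_def by blast
  obtain G d where G: "finite G" "G \<subseteq> {0..T}" "Z = elem G d" "g1 = elem_fun fst G d" "g2 = elem_fun snd G d"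
    using Z unfolding elementary_def by blast
  define e where "e t = (if t \<in> F then c t else 0) + s *\<^sub>R (if t \<in> G then d t else 0)" for t
  have sum: "(\<Sum>t\<in>F \<union> G. h (if t \<in> F then c t else 0) t + s * h (if t \<in> G then d t else 0) t) = (\<Sum>t\<in>F. h (c t) t) + s * (\<Sum>t\<in>G. h (d t) t)"
    if h0: "\<And>t. h 0 t = 0" for h :: "real \<times> real \<Rightarrow> real \<Rightarrow> real"
  proof -
    have "(\<Sum>t\<in>F \<union> G. h (if t \<in> F then c t else 0) t) = (\<Sum>t\<in>F. h (c t) t)"
      using F G h0 by (intro sum.mono_neutral_cong_right) auto
    moreover have "(\<Sum>t\<in>F \<union> G. h (if t \<in> G then d t else 0) t) = (\<Sum>t\<in>G. h (d t) t)"
      using F G h0 by (intro sum.mono_neutral_cong_right) auto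
    ultimately show ?thesis by (simp only: sum.distrib sum_distrib_left[symmetric])
  qed
  have "elem (F \<union> G) e \<omega> = Y \<omega> + s * Z \<omega>" for \<omega>
    unfolding F G elem_def e_def inner_add_left inner_scaleR_left
    by (rule sum[of "\<lambda>a t. a \<bullet> B t \<omega>"]) simp
  moreover have "elem_fun fst (F \<union> G) e x = f1 x + s * g1 x" for x
    unfolding F G elem_fun_def e_def fst_add fst_scaleR real_scaleR_def distrib_right mult.assoc
    by (rule sum[of "\<lambda>a t. fst a * indicator {0<..t} x"]) simp
  moreover have "elem_fun snd (F \<union> G) e x = f2 x + s * g2 x" for x
    unfolding F G elem_fun_def e_def snd_add snd_scaleR real_scaleR_def distrib_right mult.assoc
    by (rule sum[of "\<lambda>a t. snd a * indicator {0<..t} x"]) simp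
  ultimately show ?thesis
    unfolding elementary_def using F(1,2) G(1,2) by (intro exI[of _ "F \<union> G"] exI[of _ e]) (auto simp: fun_eq_iff)
qed

lemma elementary_gauss:
  assumes "elementary Y f1 f2"
  shows "Y \<in> borel_measurable M" "integrable M (\<lambda>\<omega>. (Y \<omega>)\<^sup>2)"
    "(CLINT \<omega>|M. iexp (Y \<omega>)) = exp (- of_real (\<integral>\<omega>. (Y \<omega>)\<^sup>2 \<partial>M) / 2)"
proof -
  obtain F c where F: "finite F" "F \<subseteq> {0..T}" "Y = elem F c" using assms unfolding elementary_def by blast
  have g: "gaussian_rv M Y" using B_gauss F unfolding gaussian_process_def elem_def[abs_def] by blast
  then show "Y \<in> borel_measurable M" by (simp add: gaussian_rv_def)
  have "expectation Y = (\<Sum>t\<in>F. \<integral>\<omega>. c t \<bullet> B t \<omega> \<partial>M)"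
    unfolding F(3) elem_def[abs_def] using F(2) by (intro Bochner_Integration.integral_sum) (auto intro!: integrable_inner_right B_integrable)
  also have "\<dots> = 0" using F(2) by (intro sum.neutral) (auto intro: B_inner_mean)
  finally have "expectation Y = 0" .
  from gaussian_rv_centered[OF g this]
  show "integrable M (\<lambda>\<omega>. (Y \<omega>)\<^sup>2)" "(CLINT \<omega>|M. iexp (Y \<omega>)) = exp (- of_real (\<integral>\<omega>. (Y \<omega>)\<^sup>2 \<partial>M) / 2)" by auto
qed

text \<open>Both sides are bilinear, so the claim reduces to a single pair of times, where
  \<open>B_cov_min\<close> and \<open>ip_indicator\<close> give the same value at the earlier
  time.\<close>

lemma elementary_isometry:
  assumes Y: "elementary Y f1 f2" and Z: "elementary Z g1 g2"
  shows "(\<integral>\<omega>. Y \<omega> * Z \<omega> \<partial>M) = ip f1 f2 g1 g2"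
proof -
  obtain F c where F: "finite F" "F \<subseteq> {0..T}" "Y = elem F c" "f1 = elem_fun fst F c" "f2 = elem_fun snd F c"
    using Y unfolding elementary_def by blast
  obtain G d where G: "finite G" "G \<subseteq> {0..T}" "Z = elem G d" "g1 = elem_fun fst G d" "g2 = elem_fun snd G d"
    using Z unfolding elementary_def by blast
  let ?I = "\<lambda>t x. indicator {0<..t} x :: real"
  let ?h = "\<lambda>s t x. fst (c s) * ?I s x * (fst (d t) * ?I t x) + snd (c s) * ?I s x * (snd (d t) * ?I t x)
     + rho0 x * (fst (c s) * ?I s x * (snd (d t) * ?I t x)) + rho0 x * (snd (c s) * ?I s x * (fst (d t) * ?I t x))"
  have hi: "integrable time (?h s t)" for s t
  proof (rule integrable_time)
    show "?h s t \<in> borel_measurable time" by (intro meas_time) measurable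
    fix x
    have b: "\<bar>r * (p * ?I s x * (q * ?I t x))\<bar> \<le> \<bar>p\<bar> * \<bar>q\<bar>" if "\<bar>r\<bar> \<le> 1" for r p q
    proof -
      have "\<bar>r * (p * ?I s x * (q * ?I t x))\<bar> = (\<bar>r\<bar> * (\<bar>?I s x\<bar> * \<bar>?I t x\<bar>)) * (\<bar>p\<bar> * \<bar>q\<bar>)"
        by (simp only: abs_mult ac_simps)
      also have "\<dots> \<le> (1 * (1 * 1)) * (\<bar>p\<bar> * \<bar>q\<bar>)"
        using that by (intro mult_right_mono mult_mono) (auto simp: indicator_def)
      finally show ?thesis by simp
    qed
    note b1 = b[of 1 "fst (c s)" "fst (d t)", unfolded mult_1_left] b[of 1 "snd (c s)" "snd (d t)", unfolded mult_1_left]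
      b[OF rho0_bound[of x], of "fst (c s)" "snd (d t)"] b[OF rho0_bound[of x], of "snd (c s)" "fst (d t)"]
    show "\<bar>?h s t x\<bar> \<le> \<bar>fst (c s)\<bar> * \<bar>fst (d t)\<bar> + \<bar>snd (c s)\<bar> * \<bar>snd (d t)\<bar> + \<bar>fst (c s)\<bar> * \<bar>snd (d t)\<bar> + \<bar>snd (c s)\<bar> * \<bar>fst (d t)\<bar>"
      by (intro order.trans[OF abs_triangle_ineq] add_mono b1) simp_all
  qed
  have "(\<integral>\<omega>. Y \<omega> * Z \<omega> \<partial>M) = (\<integral>\<omega>. (\<Sum>s\<in>F. \<Sum>t\<in>G. (c s \<bullet> B s \<omega>) * (d t \<bullet> B t \<omega>)) \<partial>M)"
    unfolding F G elem_def sum_product ..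
  also have "\<dots> = (\<Sum>s\<in>F. \<Sum>t\<in>G. \<integral>\<omega>. (c s \<bullet> B s \<omega>) * (d t \<bullet> B t \<omega>) \<partial>M)"
  proof -
    have "(\<integral>\<omega>. (\<Sum>s\<in>F. \<Sum>t\<in>G. (c s \<bullet> B s \<omega>) * (d t \<bullet> B t \<omega>)) \<partial>M) = (\<Sum>s\<in>F. \<integral>\<omega>. (\<Sum>t\<in>G. (c s \<bullet> B s \<omega>) * (d t \<bullet> B t \<omega>)) \<partial>M)"
      using F(2) G(2) by (intro Bochner_Integration.integral_sum Bochner_Integration.integrable_sum B_inner_mult_integrable) auto
    also have "\<dots> = (\<Sum>s\<in>F. \<Sum>t\<in>G. \<integral>\<omega>. (c s \<bullet> B s \<omega>) * (d t \<bullet> B t \<omega>) \<partial>M)"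
      using F(2) G(2) by (intro sum.cong refl Bochner_Integration.integral_sum B_inner_mult_integrable) auto
    finally show ?thesis .
  qed
  also have "\<dots> = (\<Sum>s\<in>F. \<Sum>t\<in>G. \<integral>x. ?h s t x \<partial>time)"
  proof (intro sum.cong refl)
    fix s t assume "s \<in> F" "t \<in> G"
    then have st: "s \<in> {0..T}" "t \<in> {0..T}" using F G by auto
    show "(\<integral>\<omega>. (c s \<bullet> B s \<omega>) * (d t \<bullet> B t \<omega>) \<partial>M) = (\<integral>x. ?h s t x \<partial>time)"
      using B_cov_min[OF st, of "c s" "d t"] ip_indicator[OF st, of "c s" "d t"] unfolding ip_def by simp
  qed
  also have "\<dots> = (\<integral>x. (\<Sum>s\<in>F. \<Sum>t\<in>G. ?h s t x) \<partial>time)"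
    using hi by (simp only: Bochner_Integration.integral_sum Bochner_Integration.integrable_sum)
  also have "\<dots> = ip f1 f2 g1 g2"
    unfolding ip_def F G elem_fun_def sum_product
    by (intro Bochner_Integration.integral_cong refl) (simp add: sum.distrib sum_distrib_left)
  finally show ?thesis .
qed

text \<open>One approximating sequence serves the variable and both components of its integrand, so
  integrals against B_1 and against B_2 lie in a common linear space and have joint
  covariances.\<close>

definition stoch_int :: "('a \<Rightarrow> real) \<Rightarrow> (real \<Rightarrow> real) \<Rightarrow> (real \<Rightarrow> real) \<Rightarrow> bool" where
  "stoch_int Y f1 f2 \<longleftrightarrow> (\<exists>Yl f1l f2l. (\<forall>l. elementary (Yl l) (f1l l) (f2l l)) \<and>
     l2_lim M Yl Y \<and> l2_lim time f1l f1 \<and> l2_lim time f2l f2)"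

lemma stoch_int_zero: "stoch_int (\<lambda>\<omega>. 0) (\<lambda>x. 0) (\<lambda>x. 0)"
  unfolding stoch_int_def
  by (intro exI[of _ "\<lambda>l \<omega>. 0"] exI[of _ "\<lambda>l x. 0"] conjI allI elementary_zero) (auto intro: l2_lim_const)

lemma stoch_int_lin:
  assumes "stoch_int Y f1 f2" "stoch_int Z g1 g2"
  shows "stoch_int (\<lambda>\<omega>. Y \<omega> + s * Z \<omega>) (\<lambda>x. f1 x + s * g1 x) (\<lambda>x. f2 x + s * g2 x)"
proof -
  obtain Yl f1l f2l where Y: "\<And>l. elementary (Yl l) (f1l l) (f2l l)" "l2_lim M Yl Y" "l2_lim time f1l f1" "l2_lim time f2l f2"
    using assms(1) unfolding stoch_int_def by blast
  obtain Zl g1l g2l where Z: "\<And>l. elementary (Zl l) (g1l l) (g2l l)" "l2_lim M Zl Z" "l2_lim time g1l g1" "l2_lim time g2l g2"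
    using assms(2) unfolding stoch_int_def by blast
  show ?thesis
    unfolding stoch_int_def
    by (intro exI[of _ "\<lambda>l \<omega>. Yl l \<omega> + s * Zl l \<omega>"] exI[of _ "\<lambda>l x. f1l l x + s * g1l l x"] exI[of _ "\<lambda>l x. f2l l x + s * g2l l x"]
        conjI allI elementary_lin l2_lim_lin Y Z)
qed

text \<open>Each of the four terms of \<open>ip\<close> is a product integral with weight 1 or
  \<open>rho0\<close>, so \<open>l2_lim_product\<close> passes the isometry to the limit.\<close>

lemma stoch_int_isometry:
  assumes "stoch_int Y f1 f2" "stoch_int Z g1 g2"
  shows "(\<integral>\<omega>. Y \<omega> * Z \<omega> \<partial>M) = ip f1 f2 g1 g2"
proof -
  obtain Yl f1l f2l where Y: "\<And>l. elementary (Yl l) (f1l l) (f2l l)" "l2_lim M Yl Y" "l2_lim time f1l f1" "l2_lim time f2l f2"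
    using assms(1) unfolding stoch_int_def by blast
  obtain Zl g1l g2l where Z: "\<And>l. elementary (Zl l) (g1l l) (g2l l)" "l2_lim M Zl Z" "l2_lim time g1l g1" "l2_lim time g2l g2"
    using assms(2) unfolding stoch_int_def by blast
  have rm: "rho0 \<in> borel_measurable time" by (rule meas_time) simp
  have int: "integrable time (\<lambda>x. f x * g x)" "integrable time (\<lambda>x. rho0 x * (f x * g x))"
    if "f \<in> borel_measurable time" "g \<in> borel_measurable time" "integrable time (\<lambda>x. (f x)\<^sup>2)" "integrable time (\<lambda>x. (g x)\<^sup>2)" for f g :: "real \<Rightarrow> real"
    using integrable_sq_mult[OF that(1,2) _ that(3,4), of "\<lambda>_. 1"] integrable_sq_mult[OF that(1,2) rm that(3,4) rho0_bound] by simp_all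
  have ipe: "ip a1 a2 b1 b2 = (\<integral>x. a1 x * b1 x \<partial>time) + (\<integral>x. a2 x * b2 x \<partial>time) + (\<integral>x. rho0 x * (a1 x * b2 x) \<partial>time) + (\<integral>x. rho0 x * (a2 x * b1 x) \<partial>time)"
    if "\<And>h. h \<in> {a1, a2, b1, b2} \<Longrightarrow> h \<in> borel_measurable time \<and> integrable time (\<lambda>x. (h x)\<^sup>2)" for a1 a2 b1 b2
    unfolding ip_def using that int by simp
  have lf: "h \<in> borel_measurable time \<and> integrable time (\<lambda>x. (h x)\<^sup>2)" if "h \<in> {f1, f2, g1, g2}" for h
    using that Y(3,4) Z(3,4) l2_lim_sq(1)[OF Y(3)] l2_lim_sq(1)[OF Y(4)] l2_lim_sq(1)[OF Z(3)] l2_lim_sq(1)[OF Z(4)]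
    by (auto simp: l2_lim_def)
  have lfl: "h \<in> borel_measurable time \<and> integrable time (\<lambda>x. (h x)\<^sup>2)" if "h \<in> {f1l l, f2l l, g1l l, g2l l}" for h l
    using that Y(3,4) Z(3,4) by (auto simp: l2_lim_def)
  have p1: "(\<lambda>l. \<integral>x. a l x * b l x \<partial>N) \<longlonglongrightarrow> (\<integral>x. a' x * b' x \<partial>N)" if "l2_lim N a a'" "l2_lim N b b'" for N :: "'n measure" and a b a' b'
    using l2_lim_product[OF that, of "\<lambda>_. 1"] by simp
  have e1: "ip f1 f2 g1 g2 = (\<integral>x. f1 x * g1 x \<partial>time) + (\<integral>x. f2 x * g2 x \<partial>time) + (\<integral>x. rho0 x * (f1 x * g2 x) \<partial>time) + (\<integral>x. rho0 x * (f2 x * g1 x) \<partial>time)"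
    by (rule ipe) (rule lf)
  have e2: "ip (f1l l) (f2l l) (g1l l) (g2l l) = (\<integral>x. f1l l x * g1l l x \<partial>time) + (\<integral>x. f2l l x * g2l l x \<partial>time) + (\<integral>x. rho0 x * (f1l l x * g2l l x) \<partial>time) + (\<integral>x. rho0 x * (f2l l x * g1l l x) \<partial>time)" for l
    by (rule ipe) (rule lfl)
  have "(\<lambda>l. ip (f1l l) (f2l l) (g1l l) (g2l l)) \<longlonglongrightarrow> ip f1 f2 g1 g2"
    unfolding e1 e2
    by (intro tendsto_add p1 l2_lim_product[OF _ _ rm rho0_bound] Y Z)
  moreover have "(\<lambda>l. \<integral>\<omega>. Yl l \<omega> * Zl l \<omega> \<partial>M) \<longlonglongrightarrow> (\<integral>\<omega>. Y \<omega> * Z \<omega> \<partial>M)"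
    by (intro p1 Y Z)
  ultimately show ?thesis unfolding elementary_isometry[OF Y(1) Z(1)] by (intro LIMSEQ_unique)
qed

definition wiener_space :: "('a \<Rightarrow> real) set" where
  "wiener_space = {Y. \<exists>f1 f2. stoch_int Y f1 f2}"

lemma gaussian_wiener_space: "gaussian_linear_space M wiener_space"
proof
  fix Y assume "Y \<in> wiener_space"
  then obtain f1 f2 where "stoch_int Y f1 f2" by (auto simp: wiener_space_def)
  then obtain Yl f1l f2l where Y: "\<And>l. elementary (Yl l) (f1l l) (f2l l)" "l2_lim M Yl Y"
    unfolding stoch_int_def by blast
  show "Y \<in> borel_measurable M" using Y(2) by (simp add: l2_lim_def)
  show "integrable M (\<lambda>\<omega>. (Y \<omega>)\<^sup>2)" by (rule l2_lim_sq(1)[OF Y(2)])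
  show "(CLINT \<omega>|M. iexp (Y \<omega>)) = exp (- of_real (\<integral>\<omega>. (Y \<omega>)\<^sup>2 \<partial>M) / 2)"
    by (rule l2_lim_char[OF Y(2) elementary_gauss(3)[OF Y(1)]])
next
  show "(\<lambda>\<omega>. 0) \<in> wiener_space" using stoch_int_zero by (auto simp: wiener_space_def)
  show "(\<lambda>\<omega>. Y \<omega> + s * Z \<omega>) \<in> wiener_space" if "Y \<in> wiener_space" "Z \<in> wiener_space" for Y Z s
    using that stoch_int_lin unfolding wiener_space_def by blast
qed

end

section \<open>Wiener integrals as members of the Gaussian space\<close>

context correlated_wiener
begin

lemma step_integral_elementary:
  assumes "\<forall>k\<le>m. \<tau> k \<in> {0..T}" "\<forall>k<m. \<tau> k \<le> \<tau> (Suc k)"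
  shows "elementary (step_integral (\<lambda>t \<omega>. e \<bullet> B t \<omega>) m c \<tau>) (\<lambda>x. fst e * step_fun m c \<tau> x) (\<lambda>x. snd e * step_fun m c \<tau> x)"
  using assms
proof (induction m)
  case 0
  then show ?case using elementary_zero by (simp add: step_integral_def[abs_def] step_fun_def)
next
  case (Suc m)
  have IH: "elementary (step_integral (\<lambda>t \<omega>. e \<bullet> B t \<omega>) m c \<tau>) (\<lambda>x. fst e * step_fun m c \<tau> x) (\<lambda>x. snd e * step_fun m c \<tau> x)"
    using Suc by auto
  have t: "\<tau> m \<in> {0..T}" "\<tau> (Suc m) \<in> {0..T}" "\<tau> m \<le> \<tau> (Suc m)" using Suc.prems by auto
  have ind: "indicator {\<tau> m<..\<tau> (Suc m)} x = (indicator {0<..\<tau> (Suc m)} x - indicator {0<..\<tau> m} x :: real)" for x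
    using t by (auto simp: indicator_def)
  have step: "step_fun (Suc m) c \<tau> x = step_fun m c \<tau> x + c m * (indicator {0<..\<tau> (Suc m)} x - indicator {0<..\<tau> m} x)" for x
    unfolding step_fun_def by (simp add: ind)
  have "elementary (\<lambda>\<omega>. (step_integral (\<lambda>t \<omega>. e \<bullet> B t \<omega>) m c \<tau> \<omega> + c m * (e \<bullet> B (\<tau> (Suc m)) \<omega>)) + (- c m) * (e \<bullet> B (\<tau> m) \<omega>))
     (\<lambda>x. (fst e * step_fun m c \<tau> x + c m * (fst e * indicator {0<..\<tau> (Suc m)} x)) + (- c m) * (fst e * indicator {0<..\<tau> m} x))
     (\<lambda>x. (snd e * step_fun m c \<tau> x + c m * (snd e * indicator {0<..\<tau> (Suc m)} x)) + (- c m) * (snd e * indicator {0<..\<tau> m} x))"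
    by (intro elementary_lin IH elementary_B t)
  moreover have "(\<lambda>\<omega>. (step_integral (\<lambda>t \<omega>. e \<bullet> B t \<omega>) m c \<tau> \<omega> + c m * (e \<bullet> B (\<tau> (Suc m)) \<omega>)) + (- c m) * (e \<bullet> B (\<tau> m) \<omega>)) =
      step_integral (\<lambda>t \<omega>. e \<bullet> B t \<omega>) (Suc m) c \<tau>"
    by (simp add: step_integral_def fun_eq_iff algebra_simps)
  moreover have "(k * step_fun m c \<tau> x + c m * (k * indicator {0<..\<tau> (Suc m)} x)) + (- c m) * (k * indicator {0<..\<tau> m} x) = k * step_fun (Suc m) c \<tau> x" for k x
    unfolding step by (simp add: algebra_simps)
  ultimately show ?case by simp
qed

text \<open>The nodes lie in [0, t], so the step functions vanish outside that interval; convergence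
  on [0, t] is therefore convergence on [0, T] to the integrand cut off at t.\<close>

lemma wiener_integral_stoch_int:
  assumes W: "is_wiener_integral M (\<lambda>t \<omega>. e \<bullet> B t \<omega>) f t Y" and t: "t \<in> {0..T}"
    and f: "set_borel_measurable borel {0..T} f"
  shows "stoch_int Y (\<lambda>x. fst e * (indicator {0..t} x * f x)) (\<lambda>x. snd e * (indicator {0..t} x * f x))"
proof -
  have Ym: "Y \<in> borel_measurable M" using W by (simp add: is_wiener_integral_def)
  from W obtain m c \<tau> where tau: "\<And>l. (\<forall>k\<le>m l. \<tau> l k \<in> {0..t}) \<and> (\<forall>k<m l. \<tau> l k \<le> \<tau> l (Suc k))"
    and l1: "(\<lambda>l. \<integral>\<^sup>+s\<in>{0..t}. ennreal ((f s - step_fun (m l) (c l) (\<tau> l) s)\<^sup>2) \<partial>lborel) \<longlonglongrightarrow> 0"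
    and l2: "(\<lambda>l. \<integral>\<^sup>+\<omega>. ennreal ((Y \<omega> - step_integral (\<lambda>t \<omega>. e \<bullet> B t \<omega>) (m l) (c l) (\<tau> l) \<omega>)\<^sup>2) \<partial>M) \<longlonglongrightarrow> 0"
    unfolding is_wiener_integral_def by blast
  let ?Y = "\<lambda>l. step_integral (\<lambda>t \<omega>. e \<bullet> B t \<omega>) (m l) (c l) (\<tau> l)" and ?f = "\<lambda>l. step_fun (m l) (c l) (\<tau> l)"
  have tauT: "(\<forall>k\<le>m l. \<tau> l k \<in> {0..T})" "(\<forall>k<m l. \<tau> l k \<le> \<tau> l (Suc k))" for l
    using tau[of l] t by auto
  have el: "elementary (?Y l) (\<lambda>x. fst e * ?f l x) (\<lambda>x. snd e * ?f l x)" for l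
    by (rule step_integral_elementary[OF tauT])
  have Y: "l2_lim M ?Y Y" unfolding l2_lim_def using Ym elementary_gauss(1,2)[OF el] l2 by blast
  have [measurable]: "step_fun k a b \<in> borel_measurable borel" for k a b
    unfolding step_fun_def[abs_def] by measurable
  have fm: "(\<lambda>x. indicator {0..t} x * f x) \<in> borel_measurable borel"
  proof -
    have "(\<lambda>x. indicator {0..t} x * (indicator {0..T} x *\<^sub>R f x)) \<in> borel_measurable borel"
      using f unfolding set_borel_measurable_def by measurable
    moreover have "indicator {0..t} x * (indicator {0..T} x *\<^sub>R f x) = indicator {0..t} x * f x" for x
      using t by (auto simp: indicator_def)
    ultimately show ?thesis by (simp only:)
  qed
  have F: "l2_lim time ?f (\<lambda>x. indicator {0..t} x * f x)"
    unfolding l2_lim_def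
  proof (intro conjI allI)
    show "(\<lambda>x. indicator {0..t} x * f x) \<in> borel_measurable time" by (rule meas_time[OF fm])
    show "?f l \<in> borel_measurable time" for l by (intro meas_time) measurable
    show "integrable time (\<lambda>x. (?f l x)\<^sup>2)" for l
    proof (rule integrable_time)
      show "(\<lambda>x. (?f l x)\<^sup>2) \<in> borel_measurable time" by (intro meas_time) measurable
      have "\<bar>?f l x\<bar> \<le> (\<Sum>k<m l. \<bar>c l k\<bar>)" for x
        unfolding step_fun_def by (rule order.trans[OF sum_abs]) (intro sum_mono, auto simp: indicator_def)
      then show "\<bar>(?f l x)\<^sup>2\<bar> \<le> (\<Sum>k<m l. \<bar>c l k\<bar>)\<^sup>2" for x
        using power_mono[of "\<bar>?f l x\<bar>" _ 2] by simp
    qed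
    have "(\<integral>\<^sup>+x. ennreal ((indicator {0..t} x * f x - ?f l x)\<^sup>2) \<partial>time) = (\<integral>\<^sup>+s\<in>{0..t}. ennreal ((f s - ?f l s)\<^sup>2) \<partial>lborel)" for l
    proof -
      have z: "?f l x = 0" if "x \<notin> {0..t}" for x
        unfolding step_fun_def
      proof (intro sum.neutral ballI)
        fix k assume k: "k \<in> {..<m l}"
        then have "\<tau> l k \<in> {0..t}" "\<tau> l (Suc k) \<in> {0..t}" using tau[of l] by auto
        then show "c l k * indicator {\<tau> l k<..\<tau> l (Suc k)} x = 0" using that by (auto simp: indicator_def)
      qed
      show ?thesis
        by (subst nn_integral_restrict_space) (use t in \<open>auto intro!: nn_integral_cong simp: indicator_def z\<close>)
    qed
    then show "(\<lambda>l. \<integral>\<^sup>+x. ennreal ((indicator {0..t} x * f x - ?f l x)\<^sup>2) \<partial>time) \<longlonglongrightarrow> 0" using l1 by simp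
  qed
  have zero: "l2_lim time (\<lambda>l x. 0) (\<lambda>x. 0)" by (rule l2_lim_const) auto
  have kF: "l2_lim time (\<lambda>l x. k * ?f l x) (\<lambda>x. k * (indicator {0..t} x * f x))" for k
    using l2_lim_lin[OF zero F, of k] by simp
  show ?thesis
    unfolding stoch_int_def
    by (intro exI[of _ ?Y] exI[of _ "\<lambda>l x. fst e * ?f l x"] exI[of _ "\<lambda>l x. snd e * ?f l x"] conjI allI el Y kF)
qed

end

text \<open>The end points of the pieces are the points u j clipped to [a, b]. A piece that misses
  (a, b] has both end points equal in this encoding and contributes nothing, so the sum telescopes
  over all j.\<close>

lemma clip_telescope:
  fixes G :: "real \<Rightarrow> real" and u :: "nat \<Rightarrow> real"
  assumes ab: "a < b" and u: "u 0 \<le> a" "b \<le> u n" and inc: "\<And>j. j < n \<Longrightarrow> u j < u (Suc j)"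
  shows "(\<Sum>j<n. G (max (max a (u j)) (min b (u (Suc j)))) - G (max a (u j))) = G b - G a"
proof -
  let ?c = "\<lambda>x. max a (min b x)"
  have "(\<Sum>j<n. G (max (max a (u j)) (min b (u (Suc j)))) - G (max a (u j))) = (\<Sum>j<n. G (?c (u (Suc j))) - G (?c (u j)))"
  proof (intro sum.cong refl)
    fix j assume "j \<in> {..<n}"
    then have j: "u j < u (Suc j)" using inc by simp
    consider "u (Suc j) \<le> a" | "b \<le> u j" | "a < u (Suc j)" "u j < b" by linarith
    then show "G (max (max a (u j)) (min b (u (Suc j)))) - G (max a (u j)) = G (?c (u (Suc j))) - G (?c (u j))"
      by cases (use j ab in \<open>auto simp: max_def min_def\<close>)
  qed
  also have "\<dots> = G (?c (u n)) - G (?c (u 0))" by (rule sum_lessThan_telescope)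
  also have "\<dots> = G b - G a" using u ab by (simp add: max_def min_def)
  finally show ?thesis .
qed

section \<open>Conditioning on the partitions\<close>

lemma overlap_cell:
  "overlap (cell p i) (cell q j) = of_bool (max (snd p i) (snd q j) < min (snd p (Suc i)) (snd q (Suc j)))"
proof -
  have "cell p i \<inter> cell q j = {max (snd p i) (snd q j)<..min (snd p (Suc i)) (snd q (Suc j))}"
    unfolding cell_def by auto
  then show ?thesis by (simp add: overlap_def)
qed

lemma measurable_sum_random:
  fixes F :: "nat \<Rightarrow> 'x \<Rightarrow> real"
  assumes [measurable]: "N \<in> measurable M (count_space UNIV)" "\<And>i. F i \<in> borel_measurable M"
  shows "(\<lambda>x. \<Sum>i<N x. F i x) \<in> borel_measurable M"
  by (rule measurable_compose_countable[where f = "\<lambda>n x. \<Sum>i<n. F i x" and g = N]) measurable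

text \<open>Discretizing the evaluation time makes the estimator jointly measurable in the partition and the
  path, although evaluation of an arbitrary path at a random time is not.\<close>

definition sample :: "real \<Rightarrow> nat \<Rightarrow> (real \<Rightarrow> real \<times> real) \<Rightarrow> real \<Rightarrow> real \<times> real" where
  "sample T k y s = (\<Sum>l\<le>k. of_bool (\<lfloor>real k * s / T\<rfloor> = int l) *\<^sub>R y (T * real l / real k))"

lemma sample_eq:
  assumes T: "0 < T" and s: "s \<in> {0..T}" and k: "0 < k"
  shows "sample T k y s = y (T * real_of_int \<lfloor>real k * s / T\<rfloor> / real k)"
    and "T * real_of_int \<lfloor>real k * s / T\<rfloor> / real k \<in> {0..T}"
    and "\<bar>T * real_of_int \<lfloor>real k * s / T\<rfloor> / real k - s\<bar> \<le> T / real k"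
proof -
  define f where "f = \<lfloor>real k * s / T\<rfloor>"
  have f0: "0 \<le> f" using T s by (simp add: f_def)
  have "real k * s / T \<le> real k" using T s k by (simp add: field_simps)
  then have fk: "f \<le> int k" unfolding f_def by linarith
  have up: "real_of_int f \<le> real k * s / T" and lo: "real k * s / T < real_of_int f + 1" unfolding f_def by linarith+
  have "sample T k y s = (\<Sum>l\<le>k. if l = nat f then y (T * real l / real k) else 0)"
    unfolding sample_def f_def[symmetric] using f0 by (intro sum.cong refl) auto
  also have "\<dots> = y (T * real_of_int f / real k)" using f0 fk by (simp add: nat_le_iff)
  finally show "sample T k y s = y (T * real_of_int \<lfloor>real k * s / T\<rfloor> / real k)" by (simp add: f_def)
  have a: "T * real_of_int f / real k \<le> s" using up T k by (simp add: field_simps)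
  have "s * real k \<le> T * real_of_int f + T" using lo T by (simp add: field_simps)
  then have "s \<le> (T * real_of_int f + T) / real k" using k by (simp add: pos_le_divide_eq)
  then have b: "s - T / real k \<le> T * real_of_int f / real k" by (simp add: add_divide_distrib)
  have c: "0 \<le> T * real_of_int f / real k" using f0 T by simp
  show "T * real_of_int \<lfloor>real k * s / T\<rfloor> / real k \<in> {0..T}" using a c s by (simp add: f_def)
  have "0 \<le> T / real k" using T by simp
  then show "\<bar>T * real_of_int \<lfloor>real k * s / T\<rfloor> / real k - s\<bar> \<le> T / real k" using a b unfolding f_def[symmetric] by linarith
qed

lemma sample_tendsto:
  assumes T: "0 < T" and s: "s \<in> {0..T}" and c: "continuous_on {0..T} y"
  shows "(\<lambda>k. sample T k y s) \<longlonglongrightarrow> y s"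
proof -
  let ?d = "\<lambda>k. T * real_of_int \<lfloor>real k * s / T\<rfloor> / real k"
  have ev: "eventually (\<lambda>k. 0 < k) sequentially" by (rule eventually_gt_at_top)
  have "(\<lambda>k. ?d k - s) \<longlonglongrightarrow> 0"
  proof (rule Lim_null_comparison)
    show "eventually (\<lambda>k. norm (?d k - s) \<le> T / real k) sequentially"
      using ev by eventually_elim (use sample_eq(3)[OF T s] in simp)
    show "(\<lambda>k. T / real k) \<longlonglongrightarrow> 0" by (rule lim_const_over_n)
  qed
  then have "?d \<longlonglongrightarrow> s" by (rule LIM_zero_cancel)
  moreover have "eventually (\<lambda>k. ?d k \<in> {0..T}) sequentially"
    using ev by eventually_elim (rule sample_eq(2)[OF T s])
  ultimately have "(\<lambda>k. y (?d k)) \<longlonglongrightarrow> y s" by (intro continuous_on_tendsto_compose[OF c _ s]) auto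
  moreover have "eventually (\<lambda>k. y (?d k) = sample T k y s) sequentially"
    using ev by eventually_elim (simp add: sample_eq(1)[OF T s])
  ultimately show ?thesis by (rule Lim_transform_eventually)
qed

definition theta_hat_sampled :: "real \<Rightarrow> nat \<Rightarrow> (partition \<times> partition) \<times> (real \<Rightarrow> real \<times> real) \<Rightarrow> real" where
  "theta_hat_sampled T k z =
     (\<Sum>i<fst (fst (fst z)). \<Sum>j<fst (snd (fst z)).
        (fst (sample T k (snd z) (snd (fst (fst z)) (Suc i))) - fst (sample T k (snd z) (snd (fst (fst z)) i))) *
        (snd (sample T k (snd z) (snd (snd (fst z)) (Suc j))) - snd (sample T k (snd z) (snd (snd (fst z)) j))) *
        overlap (cell (fst (fst z)) i) (cell (snd (fst z)) j))"

lemma partition_space_measurable[measurable]: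
  "(\<lambda>p. fst p) \<in> measurable partition_space (count_space UNIV)"
  "(\<lambda>p. snd p i) \<in> borel_measurable partition_space"
  unfolding partition_space_def by measurable

lemma partition_pair_space_measurable[measurable]:
  "(\<lambda>\<pi>. fst \<pi>) \<in> measurable partition_pair_space partition_space"
  "(\<lambda>\<pi>. snd \<pi>) \<in> measurable partition_pair_space partition_space"
  unfolding partition_pair_space_def by measurable

lemma sample_measurable:
  assumes T: "0 < T" and g[measurable]: "g \<in> borel_measurable S"
  shows "(\<lambda>z. sample T k (snd z) (g (fst z))) \<in> borel_measurable (S \<Otimes>\<^sub>M Pi\<^sub>M {0..T} (\<lambda>_. borel))"
proof -
  have c: "(\<lambda>z. snd z (T * real l / real k)) \<in> borel_measurable (S \<Otimes>\<^sub>M Pi\<^sub>M {0..T} (\<lambda>_. borel :: (real \<times> real) measure))"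
    if "l \<le> k" for l
  proof -
    have "T * real l / real k \<in> {0..T}" using T that by (cases "k = 0") (auto simp: field_simps)
    then show ?thesis by measurable
  qed
  have d: "(\<lambda>z. of_bool (\<lfloor>real k * g (fst z) / T\<rfloor> = int l) :: real) \<in> borel_measurable (S \<Otimes>\<^sub>M Pi\<^sub>M {0..T} (\<lambda>_. borel :: (real \<times> real) measure))" for l
    unfolding of_bool_def floor_eq_iff by measurable
  show ?thesis
    unfolding sample_def by (intro borel_measurable_sum borel_measurable_scaleR c d) simp
qed

lemma theta_hat_sampled_measurable:
  assumes T: "0 < T"
  shows "theta_hat_sampled T k \<in> borel_measurable (partition_pair_space \<Otimes>\<^sub>M Pi\<^sub>M {0..T} (\<lambda>_. borel))"
proof -
  let ?P = "partition_pair_space \<Otimes>\<^sub>M Pi\<^sub>M {0..T} (\<lambda>_. borel :: (real \<times> real) measure)"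
  have fs: "fst \<in> borel_measurable (borel :: (real \<times> real) measure)" "snd \<in> borel_measurable (borel :: (real \<times> real) measure)"
    by (intro borel_measurable_continuous_onI continuous_intros)+
  have [measurable]: "(\<lambda>z. fst (sample T k (snd z) (snd (fst (fst z)) i))) \<in> borel_measurable ?P" for i
    by (rule measurable_compose[OF sample_measurable[OF T, of "\<lambda>\<pi>. snd (fst \<pi>) i"] fs(1)]) measurable
  have [measurable]: "(\<lambda>z. snd (sample T k (snd z) (snd (snd (fst z)) i))) \<in> borel_measurable ?P" for i
    by (rule measurable_compose[OF sample_measurable[OF T, of "\<lambda>\<pi>. snd (snd \<pi>) i"] fs(2)]) measurable
  have [measurable]: "(\<lambda>z. snd (fst (fst z)) i) \<in> borel_measurable ?P" "(\<lambda>z. snd (snd (fst z)) i) \<in> borel_measurable ?P" for i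
    by measurable
  have n: "(\<lambda>z. fst (fst (fst z))) \<in> measurable ?P (count_space UNIV)"
    "(\<lambda>z. fst (snd (fst z))) \<in> measurable ?P (count_space UNIV)" by measurable
  have "(\<lambda>z. (fst (sample T k (snd z) (snd (fst (fst z)) (Suc i))) - fst (sample T k (snd z) (snd (fst (fst z)) i))) *
        (snd (sample T k (snd z) (snd (snd (fst z)) (Suc j))) - snd (sample T k (snd z) (snd (snd (fst z)) j))) *
        overlap (cell (fst (fst z)) i) (cell (snd (fst z)) j)) \<in> borel_measurable ?P" for i j
    unfolding overlap_cell of_bool_def by measurable
  then show ?thesis
    unfolding theta_hat_sampled_def[abs_def] by (intro measurable_sum_random n)
qed

text \<open>Subtracting the starting values leaves all increments unchanged and expresses the
  estimator through the process that the independence hypothesis speaks of.\<close>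

lemma theta_hat_sampled_tendsto:
  assumes T: "0 < T" and \<pi>: "\<pi> \<in> partition_pairs T"
    and c: "continuous_on {0..T} (\<lambda>t. X1 t \<omega>)" "continuous_on {0..T} (\<lambda>t. X2 t \<omega>)"
  shows "(\<lambda>k. theta_hat_sampled T k (\<pi>, \<lambda>t\<in>{0..T}. (X1 t \<omega> - X1 0 \<omega>, X2 t \<omega> - X2 0 \<omega>))) \<longlonglongrightarrow> theta_hat X1 X2 \<pi> \<omega>"
proof -
  let ?y = "\<lambda>t\<in>{0..T}. (X1 t \<omega> - X1 0 \<omega>, X2 t \<omega> - X2 0 \<omega>)"
  have cy: "continuous_on {0..T} ?y"
    by (rule continuous_on_eq[where f = "\<lambda>t. (X1 t \<omega> - X1 0 \<omega>, X2 t \<omega> - X2 0 \<omega>)"]) (auto intro!: continuous_intros c)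
  have in0: "snd p i \<in> {0..T}" if "is_partition T p" "i \<le> fst p" for p i
  proof -
    have inc: "a \<le> b \<Longrightarrow> b \<le> fst p \<Longrightarrow> snd p a \<le> snd p b" for a b
    proof (induction b)
      case (Suc b)
      have "snd p b < snd p (Suc b)" using that(1) Suc.prems by (simp add: is_partition_def)
      then show ?case using Suc by (cases "a = Suc b") auto
    qed simp
    show ?thesis using inc[of 0 i] inc[of i "fst p"] that by (auto simp: is_partition_def)
  qed
  have lim: "(\<lambda>k. sample T k ?y (snd p i)) \<longlonglongrightarrow> ?y (snd p i)" if "is_partition T p" "i \<le> fst p" for p i
    by (rule sample_tendsto[OF T in0[OF that] cy])
  have P: "is_partition T (fst \<pi>)" "is_partition T (snd \<pi>)" using \<pi> by (auto simp: partition_pairs_def)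
  have "(\<lambda>k. theta_hat_sampled T k (\<pi>, ?y)) \<longlonglongrightarrow> (\<Sum>i<fst (fst \<pi>). \<Sum>j<fst (snd \<pi>).
        (fst (?y (snd (fst \<pi>) (Suc i))) - fst (?y (snd (fst \<pi>) i))) *
        (snd (?y (snd (snd \<pi>) (Suc j))) - snd (?y (snd (snd \<pi>) j))) *
        overlap (cell (fst \<pi>) i) (cell (snd \<pi>) j))"
    unfolding theta_hat_sampled_def fst_conv snd_conv
    by (intro tendsto_sum tendsto_mult tendsto_diff tendsto_fst tendsto_snd tendsto_const lim P) auto
  also have "(\<Sum>i<fst (fst \<pi>). \<Sum>j<fst (snd \<pi>).
        (fst (?y (snd (fst \<pi>) (Suc i))) - fst (?y (snd (fst \<pi>) i))) *
        (snd (?y (snd (snd \<pi>) (Suc j))) - snd (?y (snd (snd \<pi>) j))) *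
        overlap (cell (fst \<pi>) i) (cell (snd \<pi>) j)) = theta_hat X1 X2 \<pi> \<omega>"
    unfolding theta_hat_def
  proof (intro sum.cong refl)
    fix i j assume "i \<in> {..<fst (fst \<pi>)}" "j \<in> {..<fst (snd \<pi>)}"
    then have "snd (fst \<pi>) (Suc i) \<in> {0..T}" "snd (fst \<pi>) i \<in> {0..T}" "snd (snd \<pi>) (Suc j) \<in> {0..T}" "snd (snd \<pi>) j \<in> {0..T}"
      using in0[OF P(1)] in0[OF P(2)] by (auto simp: Suc_le_eq simp del: atLeastAtMost_iff)
    then show "(fst (?y (snd (fst \<pi>) (Suc i))) - fst (?y (snd (fst \<pi>) i))) *
        (snd (?y (snd (snd \<pi>) (Suc j))) - snd (?y (snd (snd \<pi>) j))) * overlap (cell (fst \<pi>) i) (cell (snd \<pi>) j)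
      = (X1 (snd (fst \<pi>) (Suc i)) \<omega> - X1 (snd (fst \<pi>) i) \<omega>) * (X2 (snd (snd \<pi>) (Suc j)) \<omega> - X2 (snd (snd \<pi>) j) \<omega>) *
        overlap (cell (fst \<pi>) i) (cell (snd \<pi>) j)" by simp
  qed
  finally show ?thesis .
qed

text \<open>By independence the joint law of P and Y is the product of their laws, so Fubini's
  theorem integrates out Y first.\<close>

lemma (in prob_space) indep_integral:
  fixes f :: "'b \<times> 'c \<Rightarrow> complex"
  assumes P[measurable]: "P \<in> measurable M S" and Y[measurable]: "Y \<in> measurable M R"
    and iv: "\<And>A B. A \<in> sets S \<Longrightarrow> B \<in> sets R \<Longrightarrow>
      prob ((P -` A \<inter> space M) \<inter> (Y -` B \<inter> space M)) = prob (P -` A \<inter> space M) * prob (Y -` B \<inter> space M)"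
    and f[measurable]: "f \<in> borel_measurable (S \<Otimes>\<^sub>M R)" and b: "\<And>z. norm (f z) \<le> 1"
  shows "(\<lambda>\<pi>. CLINT \<omega>|M. f (\<pi>, Y \<omega>)) \<in> borel_measurable S"
    and "(CLINT \<omega>|M. f (P \<omega>, Y \<omega>)) = (CLINT \<omega>|M. (CLINT \<omega>'|M. f (P \<omega>, Y \<omega>')))"
proof -
  interpret P: prob_space "distr M S P" by (rule prob_space_distr) measurable
  interpret Y: prob_space "distr M R Y" by (rule prob_space_distr) measurable
  interpret PY: pair_prob_space "distr M S P" "distr M R Y" ..
  have d: "distr M S P \<Otimes>\<^sub>M distr M R Y = distr M (S \<Otimes>\<^sub>M R) (\<lambda>\<omega>. (P \<omega>, Y \<omega>))"
  proof (rule pair_measure_eqI)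
    fix A B assume "A \<in> sets (distr M S P)" "B \<in> sets (distr M R Y)"
    then have [measurable]: "A \<in> sets S" "B \<in> sets R" by auto
    have "(\<lambda>\<omega>. (P \<omega>, Y \<omega>)) -` (A \<times> B) \<inter> space M = (P -` A \<inter> space M) \<inter> (Y -` B \<inter> space M)" by auto
    then show "emeasure (distr M S P) A * emeasure (distr M R Y) B = emeasure (distr M (S \<Otimes>\<^sub>M R) (\<lambda>\<omega>. (P \<omega>, Y \<omega>))) (A \<times> B)"
      using iv[of A B] by (simp add: emeasure_distr emeasure_eq_measure ennreal_mult)
  qed (auto intro: P.sigma_finite_measure_axioms Y.sigma_finite_measure_axioms)
  have inner: "(CLINT \<omega>|M. f (\<pi>, Y \<omega>)) = (CLINT y|distr M R Y. f (\<pi>, y))" if "\<pi> \<in> space S" for \<pi>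
    by (subst integral_distr) (use that in auto)
  have "(\<lambda>\<pi>. CLINT y|distr M R Y. f (\<pi>, y)) \<in> borel_measurable S"
    by (rule Y.borel_measurable_lebesgue_integral) simp
  then show "(\<lambda>\<pi>. CLINT \<omega>|M. f (\<pi>, Y \<omega>)) \<in> borel_measurable S"
    by (subst measurable_cong[OF inner])
  have int: "complex_integrable (distr M S P \<Otimes>\<^sub>M distr M R Y) f"
    by (rule PY.integrable_const_bound[of _ 1]) (use b in auto)
  have "(CLINT \<omega>|M. f (P \<omega>, Y \<omega>)) = (CLINT z|distr M (S \<Otimes>\<^sub>M R) (\<lambda>\<omega>. (P \<omega>, Y \<omega>)). f z)"
    by (subst integral_distr) auto
  also have "\<dots> = (CLINT \<pi>|distr M S P. CLINT y|distr M R Y. f (\<pi>, y))"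
    unfolding d[symmetric] by (rule PY.integral_fst'[OF int, symmetric])
  also have "\<dots> = (CLINT \<omega>|M. CLINT y|distr M R Y. f (P \<omega>, y))"
    by (rule integral_distr) measurable
  also have "\<dots> = (CLINT \<omega>|M. (CLINT \<omega>'|M. f (P \<omega>, Y \<omega>')))"
    by (rule Bochner_Integration.integral_cong[OF refl]) (rule inner[symmetric], rule measurable_space[OF P])
  finally show "(CLINT \<omega>|M. f (P \<omega>, Y \<omega>)) = (CLINT \<omega>|M. (CLINT \<omega>'|M. f (P \<omega>, Y \<omega>')))" .
qed

text \<open>For the discretized estimator, \<open>indep_integral\<close> applied to the integrand
  times an indicator in P is the averaging property that defines conditional expectation. Dominated
  convergence along finer time grids carries it to the estimator itself.\<close>

lemma (in prob_space) cond_exp_characteristic: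
  fixes X1 X2 :: "real \<Rightarrow> 'a \<Rightarrow> real" and P :: "'a \<Rightarrow> partition \<times> partition"
  assumes T: "0 < T" and \<beta>: "0 < \<beta>"
    and X: "\<And>t. t \<in> {0..T} \<Longrightarrow> X1 t \<in> borel_measurable M" "\<And>t. t \<in> {0..T} \<Longrightarrow> X2 t \<in> borel_measurable M"
    and cont: "\<And>\<omega>. \<omega> \<in> space M \<Longrightarrow> continuous_on {0..T} (\<lambda>t. X1 t \<omega>)" "\<And>\<omega>. \<omega> \<in> space M \<Longrightarrow> continuous_on {0..T} (\<lambda>t. X2 t \<omega>)"
    and P[measurable]: "P \<in> measurable M partition_pair_space" and PT: "\<And>\<omega>. \<omega> \<in> space M \<Longrightarrow> P \<omega> \<in> partition_pairs T"
    and ind: "indep_set (sets (generated_by M partition_pair_space P))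
           (sets (generated_by M (Pi\<^sub>M {0..T} (\<lambda>_. borel)) (\<lambda>\<omega>. \<lambda>t\<in>{0..T}. (X1 t \<omega> - X1 0 \<omega>, X2 t \<omega> - X2 0 \<omega>))))"
  shows "AE \<omega> in M. complex_cond_exp M (generated_by M partition_pair_space P)
          (\<lambda>\<omega>. exp (\<i> * of_real (u * normalized_error T \<rho> \<sigma>1 \<sigma>2 X1 X2 \<beta> (P \<omega>) \<omega>))) \<omega>
        = cond_char_at M T \<rho> \<sigma>1 \<sigma>2 X1 X2 \<beta> (P \<omega>) u"
proof -
  let ?S = partition_pair_space and ?R = "Pi\<^sub>M {0..T} (\<lambda>_. borel :: (real \<times> real) measure)"
  define Y where "Y \<omega> = (\<lambda>t\<in>{0..T}. (X1 t \<omega> - X1 0 \<omega>, X2 t \<omega> - X2 0 \<omega>))" for \<omega>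
  define F where "F = generated_by M ?S P"
  have z: "0 \<in> {0..T}" using T by simp
  have Y[measurable]: "Y \<in> measurable M ?R"
    unfolding Y_def using X X[OF z] by (intro measurable_restrict borel_measurable_Pair borel_measurable_diff) auto
  have PS: "P \<in> space M \<rightarrow> space ?S" and YS: "Y \<in> space M \<rightarrow> space ?R" using measurable_space[OF P] measurable_space[OF Y] by auto
  have setsF: "sets F = {P -` A \<inter> space M |A. A \<in> sets ?S}" unfolding F_def generated_by_def by (rule sets_vimage_algebra2[OF PS])
  have setsG: "sets (generated_by M ?R Y) = {Y -` A \<inter> space M |A. A \<in> sets ?R}" unfolding generated_by_def by (rule sets_vimage_algebra2[OF YS])
  have spF: "space F = space M" by (simp add: F_def generated_by_def)
  have iv: "prob ((P -` A \<inter> space M) \<inter> (Y -` B \<inter> space M)) = prob (P -` A \<inter> space M) * prob (Y -` B \<inter> space M)"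
    if "A \<in> sets ?S" "B \<in> sets ?R" for A B
  proof -
    have "indep_set (sets F) (sets (generated_by M ?R Y))"
      using ind unfolding F_def Y_def[abs_def] .
    then show ?thesis
      using that unfolding indep_sets2_eq setsF setsG by blast
  qed
  have PF[measurable]: "P \<in> measurable F ?S" unfolding F_def generated_by_def by (rule measurable_vimage_algebra1[OF PS])
  have subalg: "subalgebra M F"
    unfolding subalgebra_def spF setsF by (auto intro: measurable_sets[OF P])
  interpret fin: finite_measure_subalgebra M F by unfold_locales (rule subalg)
  define f where "f k zz = iexp (u * ((theta_hat_sampled T k zz - theta T \<rho> \<sigma>1 \<sigma>2) / sqrt \<beta>))" for k zz
  have f[measurable]: "f k \<in> borel_measurable (?S \<Otimes>\<^sub>M ?R)" for k
    using theta_hat_sampled_measurable[OF T, of k] unfolding f_def by measurable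
  have nf: "norm (f k zz) \<le> 1" for k zz unfolding f_def by simp
  define h where "h \<pi> \<omega> = iexp (u * normalized_error T \<rho> \<sigma>1 \<sigma>2 X1 X2 \<beta> \<pi> \<omega>)" for \<pi> \<omega>
  have nh: "norm (h \<pi> \<omega>) \<le> 1" for \<pi> \<omega> unfolding h_def by simp
  have lim: "(\<lambda>k. f k (\<pi>, Y \<omega>)) \<longlonglongrightarrow> h \<pi> \<omega>" if "\<pi> \<in> partition_pairs T" "\<omega> \<in> space M" for \<pi> \<omega>
    unfolding f_def h_def normalized_error_def
    using theta_hat_sampled_tendsto[where ?X1.0 = X1 and ?X2.0 = X2 and \<omega> = \<omega> and \<pi> = \<pi>, OF T that(1) cont(1)[OF that(2)] cont(2)[OF that(2)]] unfolding Y_def[symmetric]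
    by (intro tendsto_intros) (use \<beta> in auto)
  define C where "C \<pi> = (CLINT \<omega>|M. h \<pi> \<omega>)" for \<pi>
  define Ck where "Ck k \<pi> = (CLINT \<omega>|M. f k (\<pi>, Y \<omega>))" for k \<pi>
  have Ckm[measurable]: "Ck k \<in> borel_measurable ?S" for k unfolding Ck_def by (rule indep_integral(1)[OF P Y iv f nf])
  have fY: "(\<lambda>\<omega>. f k (\<pi>, Y \<omega>)) \<in> borel_measurable M" if "\<pi> \<in> space ?S" for k \<pi> using that by measurable
  have pairs_space: "\<pi> \<in> space ?S" if "\<pi> \<in> partition_pairs T" for \<pi>
    by (simp add: partition_pair_space_def partition_space_def space_pair_measure space_PiM)
  have hm: "h \<pi> \<in> borel_measurable M" if "\<pi> \<in> partition_pairs T" for \<pi>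
    by (rule borel_measurable_LIMSEQ_metric[OF fY[OF pairs_space[OF that]] lim[OF that]])
  have Clim: "(\<lambda>k. Ck k \<pi>) \<longlonglongrightarrow> C \<pi>" if "\<pi> \<in> partition_pairs T" for \<pi>
    unfolding Ck_def C_def
    by (rule integral_dominated_convergence[where w = "\<lambda>_. 1"])
       (use that hm fY[OF pairs_space[OF that]] lim nf in auto)
  have nC: "norm (C \<pi>) \<le> 1" if "\<pi> \<in> partition_pairs T" for \<pi>
  proof -
    have "complex_integrable M (h \<pi>)" by (rule integrable_const_bound[of _ 1]) (use nh hm[OF that] in auto)
    then show ?thesis unfolding C_def
      using norm_integral_le[of M "\<lambda>_. 1" "h \<pi>"] nh by (simp add: prob_space)
  qed
  have nCk: "norm (Ck k \<pi>) \<le> 1" if "\<pi> \<in> partition_pairs T" for k \<pi>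
  proof -
    have "complex_integrable M (\<lambda>\<omega>. f k (\<pi>, Y \<omega>))"
      by (rule integrable_const_bound[of _ 1]) (use nf fY[OF pairs_space[OF that]] in auto)
    then show ?thesis unfolding Ck_def
      using norm_integral_le[of M "\<lambda>_. 1" "\<lambda>\<omega>. f k (\<pi>, Y \<omega>)"] nf by (simp add: prob_space)
  qed
  \<comment> \<open>Measurability is obtained for the composition with P as a limit of the
    discretized versions; pointwise convergence is available at partitions, and P takes its values
    there.\<close>
  have gF: "(\<lambda>\<omega>. C (P \<omega>)) \<in> borel_measurable F"
  proof (rule borel_measurable_LIMSEQ_metric)
    show "(\<lambda>\<omega>. Ck k (P \<omega>)) \<in> borel_measurable F" for k by measurable
    show "(\<lambda>k. Ck k (P \<omega>)) \<longlonglongrightarrow> C (P \<omega>)" if "\<omega> \<in> space F" for \<omega> using that by (intro Clim PT) (simp add: spF)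
  qed
  then have gM[measurable]: "(\<lambda>\<omega>. C (P \<omega>)) \<in> borel_measurable M" by (rule measurable_from_subalg[OF subalg])
  have hPm[measurable]: "(\<lambda>\<omega>. h (P \<omega>) \<omega>) \<in> borel_measurable M"
  proof (rule borel_measurable_LIMSEQ_metric)
    show "(\<lambda>\<omega>. f k (P \<omega>, Y \<omega>)) \<in> borel_measurable M" for k by measurable
    show "(\<lambda>k. f k (P \<omega>, Y \<omega>)) \<longlonglongrightarrow> h (P \<omega>) \<omega>" if "\<omega> \<in> space M" for \<omega> by (rule lim[OF PT[OF that] that])
  qed
  have ih: "complex_integrable M (\<lambda>\<omega>. h (P \<omega>) \<omega>)" by (rule integrable_const_bound[of _ 1]) (use nh in auto)
  have ig: "complex_integrable M (\<lambda>\<omega>. C (P \<omega>))" by (rule integrable_const_bound[of _ 1]) (use nC PT in auto)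
  have key: "(CLINT \<omega>|M. indicator A \<omega> * h (P \<omega>) \<omega>) = (CLINT \<omega>|M. indicator A \<omega> * C (P \<omega>))" if A: "A \<in> sets F" for A
  proof -
    obtain A' where A': "A' \<in> sets ?S" "A = P -` A' \<inter> space M" using A setsF by auto
    have [measurable]: "A \<in> sets M" using A subalg by (auto simp: subalgebra_def)
    note [measurable] = A'(1)
    have iA: "indicator A \<omega> = (indicator A' (P \<omega>) :: complex)" if "\<omega> \<in> space M" for \<omega>
      using that A' by (auto simp: indicator_def)
    have e: "(CLINT \<omega>|M. indicator A' (P \<omega>) * f k (P \<omega>, Y \<omega>)) = (CLINT \<omega>|M. indicator A' (P \<omega>) * Ck k (P \<omega>))" for k
    proof -
      have m: "(\<lambda>zz. indicator A' (fst zz) * f k zz) \<in> borel_measurable (?S \<Otimes>\<^sub>M ?R)" by measurable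
      have nb: "norm (indicator A' (fst zz) * f k zz) \<le> 1" for zz
        using nf[of k zz] by (simp add: indicator_def)
      have "(CLINT \<omega>|M. indicator A' (P \<omega>) * f k (P \<omega>, Y \<omega>)) = (CLINT \<omega>|M. (CLINT \<omega>'|M. indicator A' (P \<omega>) * f k (P \<omega>, Y \<omega>')))"
        using indep_integral(2)[OF P Y iv m nb] by (simp only: fst_conv)
      then show ?thesis by (simp add: Ck_def)
    qed
    have l1: "(\<lambda>k. CLINT \<omega>|M. indicator A' (P \<omega>) * f k (P \<omega>, Y \<omega>)) \<longlonglongrightarrow> (CLINT \<omega>|M. indicator A' (P \<omega>) * h (P \<omega>) \<omega>)"
    proof (rule integral_dominated_convergence[where w = "\<lambda>_. 1"])
      show "AE \<omega> in M. (\<lambda>k. indicator A' (P \<omega>) * f k (P \<omega>, Y \<omega>)) \<longlonglongrightarrow> indicator A' (P \<omega>) * h (P \<omega>) \<omega>"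
        by (intro AE_I2 tendsto_mult tendsto_const lim PT)
      show "AE \<omega> in M. norm (indicator A' (P \<omega>) * f k (P \<omega>, Y \<omega>)) \<le> 1" for k
        using nf by (intro AE_I2) (auto simp: indicator_def norm_mult)
    qed auto
    have l2: "(\<lambda>k. CLINT \<omega>|M. indicator A' (P \<omega>) * Ck k (P \<omega>)) \<longlonglongrightarrow> (CLINT \<omega>|M. indicator A' (P \<omega>) * C (P \<omega>))"
    proof (rule integral_dominated_convergence[where w = "\<lambda>_. 1"])
      show "AE \<omega> in M. (\<lambda>k. indicator A' (P \<omega>) * Ck k (P \<omega>)) \<longlonglongrightarrow> indicator A' (P \<omega>) * C (P \<omega>)"
        by (intro AE_I2 tendsto_mult tendsto_const Clim PT)
      show "AE \<omega> in M. norm (indicator A' (P \<omega>) * Ck k (P \<omega>)) \<le> 1" for k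
        using nCk[OF PT] by (intro AE_I2) (auto simp: indicator_def norm_mult)
    qed auto
    have "(CLINT \<omega>|M. indicator A' (P \<omega>) * h (P \<omega>) \<omega>) = (CLINT \<omega>|M. indicator A' (P \<omega>) * C (P \<omega>))"
      using LIMSEQ_unique[OF l1[unfolded e] l2] .
    then show ?thesis by (simp add: iA cong: Bochner_Integration.integral_cong)
  qed
  \<comment> \<open>Stated for a bounded linear functional so that real and imaginary parts are
    instances.\<close>
  have part: "AE \<omega> in M. real_cond_exp M F (\<lambda>\<omega>. \<phi> (h (P \<omega>) \<omega>)) \<omega> = \<phi> (C (P \<omega>))"
    if bl: "bounded_linear \<phi>" for \<phi> :: "complex \<Rightarrow> real"
  proof (rule fin.real_cond_exp_charact)
    show "integrable M (\<lambda>\<omega>. \<phi> (h (P \<omega>) \<omega>))" by (rule integrable_bounded_linear[OF bl ih])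
    show "integrable M (\<lambda>\<omega>. \<phi> (C (P \<omega>)))" by (rule integrable_bounded_linear[OF bl ig])
    show "(\<lambda>\<omega>. \<phi> (C (P \<omega>))) \<in> borel_measurable F"
      by (rule measurable_compose[OF gF]) (rule borel_measurable_continuous_onI[OF linear_continuous_on[OF bl]])
    fix A assume A: "A \<in> sets F"
    have [measurable]: "A \<in> sets M" using A subalg by (auto simp: subalgebra_def)
    have ind: "indicator A \<omega> *\<^sub>R \<phi> y = \<phi> (indicator A \<omega> * y)" for \<omega> y
      using linear_0[OF bounded_linear.linear[OF bl]] by (simp add: indicator_def)
    have i1: "complex_integrable M (\<lambda>\<omega>. indicator A \<omega> * h (P \<omega>) \<omega>)"
      by (rule integrable_const_bound[of _ 1]) (use nh in \<open>auto simp: indicator_def\<close>)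
    have i2: "complex_integrable M (\<lambda>\<omega>. indicator A \<omega> * C (P \<omega>))"
      by (rule integrable_const_bound[of _ 1]) (use nC PT in \<open>auto simp: indicator_def\<close>)
    show "(\<integral>\<omega>\<in>A. \<phi> (h (P \<omega>) \<omega>) \<partial>M) = (\<integral>\<omega>\<in>A. \<phi> (C (P \<omega>)) \<partial>M)"
      unfolding set_lebesgue_integral_def ind
      unfolding integral_bounded_linear[OF bl i1] integral_bounded_linear[OF bl i2] key[OF A] ..
  qed
  have "AE \<omega> in M. complex_cond_exp M F (\<lambda>\<omega>. h (P \<omega>) \<omega>) \<omega> = C (P \<omega>)"
    using part[OF bounded_linear_Re] part[OF bounded_linear_Im]
    by eventually_elim (simp add: complex_cond_exp_def)
  then show ?thesis by (simp add: F_def h_def C_def cond_char_at_def)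
qed

section \<open>The estimator as a Gaussian quadratic form\<close>

text \<open>An interval of length at most r that meets (a, b] lies in [a - r, b + r], of length at
  most 3 r. Clipping to that interval leaves the lengths of the meeting intervals unchanged and
  makes the sum telescope.\<close>

lemma meet_length_le:
  fixes u :: "nat \<Rightarrow> real"
  assumes inc: "\<And>j. j < n \<Longrightarrow> u j < u (Suc j)" and r: "\<And>j. j < n \<Longrightarrow> u (Suc j) - u j \<le> r"
    and ab: "a < b" "b - a \<le> r"
  shows "(\<Sum>j<n. of_bool (a < u (Suc j) \<and> u j < b) * (u (Suc j) - u j)) \<le> 3 * r"
proof -
  let ?c = "\<lambda>x. max (a - r) (min (b + r) x)"
  have r0: "0 < r" using ab by simp
  have "(\<Sum>j<n. of_bool (a < u (Suc j) \<and> u j < b) * (u (Suc j) - u j)) \<le> (\<Sum>j<n. ?c (u (Suc j)) - ?c (u j))"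
  proof (rule sum_mono)
    fix j assume "j \<in> {..<n}"
    then have j: "u j < u (Suc j)" "u (Suc j) - u j \<le> r" using inc r by auto
    show "of_bool (a < u (Suc j) \<and> u j < b) * (u (Suc j) - u j) \<le> ?c (u (Suc j)) - ?c (u j)"
    proof (cases "a < u (Suc j) \<and> u j < b")
      case True
      then have "?c (u (Suc j)) = u (Suc j)" "?c (u j) = u j" using j r0 ab by auto
      then show ?thesis using True by simp
    next
      case False
      have "?c (u j) \<le> ?c (u (Suc j))" using j by (auto simp: max_def min_def)
      then show ?thesis using False by auto
    qed
  qed
  also have "\<dots> = ?c (u n) - ?c (u 0)" by (rule sum_lessThan_telescope)
  also have "\<dots> \<le> (b + r) - (a - r)" using ab r0 by auto
  finally show ?thesis using ab by simp
qed

lemma is_partition_mono: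
  assumes "is_partition T p" shows "a \<le> b \<Longrightarrow> b \<le> fst p \<Longrightarrow> snd p a \<le> snd p b"
proof (induction b)
  case (Suc b)
  have "snd p b < snd p (Suc b)" using assms Suc.prems by (simp add: is_partition_def)
  then show ?case using Suc by (cases "a = Suc b") auto
qed simp

lemma is_partition_range:
  assumes "is_partition T p" "i \<le> fst p" shows "0 \<le> snd p i" "snd p i \<le> T"
  using is_partition_mono[OF assms(1), of 0 i] is_partition_mono[OF assms(1), of i "fst p"] assms
  by (auto simp: is_partition_def)

text \<open>\<open>cells\<close> is a set, so repeated cells would be summed once. They are
  distinct, since the right end point of a cell belongs to no later cell.\<close>

lemma sum_cells:
  assumes "is_partition T p"
  shows "(\<Sum>I\<in>cells p. F I) = (\<Sum>i<fst p. F (cell p i))"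
proof -
  have *: "cell p i \<noteq> cell p i'" if "i < i'" "i' < fst p" for i i'
  proof
    assume e: "cell p i = cell p i'"
    have "snd p i < snd p (Suc i)" using that assms by (simp add: is_partition_def)
    then have "snd p (Suc i) \<in> cell p i" by (simp add: cell_def)
    moreover have "snd p (Suc i) \<le> snd p i'" using is_partition_mono[OF assms, of "Suc i" i'] that by simp
    ultimately show False unfolding e by (simp add: cell_def)
  qed
  have "inj_on (cell p) {..<fst p}"
  proof (rule inj_onI)
    fix i i' assume "i \<in> {..<fst p}" "i' \<in> {..<fst p}" "cell p i = cell p i'"
    then show "i = i'" using *[of i i'] *[of i' i] by (cases i i' rule: linorder_cases) auto
  qed
  then show ?thesis unfolding cells_def by (simp add: sum.reindex)
qed

lemma cell_le_mesh:
  assumes "\<pi> \<in> partition_pairs T"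
  shows "i < fst (fst \<pi>) \<Longrightarrow> snd (fst \<pi>) (Suc i) - snd (fst \<pi>) i \<le> mesh \<pi>"
    and "j < fst (snd \<pi>) \<Longrightarrow> snd (snd \<pi>) (Suc j) - snd (snd \<pi>) j \<le> mesh \<pi>"
proof -
  have *: "snd p (Suc i) - snd p i \<le> Max (measure lborel ` cells p)" if "is_partition T p" "i < fst p" for p i
  proof -
    have "measure lborel (cell p i) \<le> Max (measure lborel ` cells p)"
      using that by (intro Max_ge) (auto simp: cells_def)
    moreover have "measure lborel (cell p i) = snd p (Suc i) - snd p i"
      using that by (simp add: cell_def is_partition_def less_imp_le)
    ultimately show ?thesis by simp
  qed
  show "i < fst (fst \<pi>) \<Longrightarrow> snd (fst \<pi>) (Suc i) - snd (fst \<pi>) i \<le> mesh \<pi>"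
    using *[of "fst \<pi>" i] assms by (auto simp: mesh_def partition_pairs_def)
  show "j < fst (snd \<pi>) \<Longrightarrow> snd (snd \<pi>) (Suc j) - snd (snd \<pi>) j \<le> mesh \<pi>"
    using *[of "snd \<pi>" j] assms by (auto simp: mesh_def partition_pairs_def)
qed

section \<open>Increments of the two integrals and their covariance measures\<close>

locale covariation_model = correlated_wiener M T \<rho> B
  for M :: "'a measure" and T :: real and \<rho> :: "real \<Rightarrow> real" and B :: "real \<Rightarrow> 'a \<Rightarrow> real \<times> real" +
  fixes \<sigma> :: real and \<sigma>1 \<sigma>2 :: "real \<Rightarrow> real" and X1 X2 :: "real \<Rightarrow> 'a \<Rightarrow> real"
  assumes s1_meas: "set_borel_measurable borel {0..T} \<sigma>1" and s1_bound: "\<forall>t\<in>{0..T}. 0 < \<sigma>1 t \<and> \<sigma>1 t \<le> \<sigma>"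
    and s2_meas: "set_borel_measurable borel {0..T} \<sigma>2" and s2_bound: "\<forall>t\<in>{0..T}. 0 < \<sigma>2 t \<and> \<sigma>2 t \<le> \<sigma>"
    and X1_int: "is_wiener_integral_process M T (\<lambda>t \<omega>. fst (B t \<omega>)) \<sigma>1 X1"
    and X2_int: "is_wiener_integral_process M T (\<lambda>t \<omega>. snd (B t \<omega>)) \<sigma>2 X2"
begin

sublocale W: gaussian_linear_space M wiener_space by (rule gaussian_wiener_space)

lemma X1_increment:
  assumes u: "0 \<le> u" "u \<le> v" "v \<le> T"
  shows "stoch_int (\<lambda>\<omega>. X1 v \<omega> - X1 u \<omega>) (\<lambda>x. indicator {u<..v} x * \<sigma>1 x) (\<lambda>x. 0)"
proof -
  have i: "stoch_int (\<lambda>\<omega>. X1 t \<omega> - X1 0 \<omega>) (\<lambda>x. indicator {0..t} x * \<sigma>1 x) (\<lambda>x. 0)" if "t \<in> {0..T}" for t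
    using wiener_integral_stoch_int[of "(1, 0)" \<sigma>1 t "\<lambda>\<omega>. X1 t \<omega> - X1 0 \<omega>"] X1_int that s1_meas
    by (simp add: is_wiener_integral_process_def inner_prod_def)
  have "stoch_int (\<lambda>\<omega>. (X1 v \<omega> - X1 0 \<omega>) + (-1) * (X1 u \<omega> - X1 0 \<omega>))
     (\<lambda>x. indicator {0..v} x * \<sigma>1 x + (-1) * (indicator {0..u} x * \<sigma>1 x)) (\<lambda>x. 0 + (-1) * 0)"
    by (rule stoch_int_lin; rule i) (use u in auto)
  moreover have "indicator {0..v} x * \<sigma>1 x + (-1) * (indicator {0..u} x * \<sigma>1 x) = indicator {u<..v} x * \<sigma>1 x" for x
    using u by (auto simp: indicator_def)
  ultimately show ?thesis by simp
qed

lemma X2_increment: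
  assumes u: "0 \<le> u" "u \<le> v" "v \<le> T"
  shows "stoch_int (\<lambda>\<omega>. X2 v \<omega> - X2 u \<omega>) (\<lambda>x. 0) (\<lambda>x. indicator {u<..v} x * \<sigma>2 x)"
proof -
  have i: "stoch_int (\<lambda>\<omega>. X2 t \<omega> - X2 0 \<omega>) (\<lambda>x. 0) (\<lambda>x. indicator {0..t} x * \<sigma>2 x)" if "t \<in> {0..T}" for t
    using wiener_integral_stoch_int[of "(0, 1)" \<sigma>2 t "\<lambda>\<omega>. X2 t \<omega> - X2 0 \<omega>"] X2_int that s2_meas
    by (simp add: is_wiener_integral_process_def inner_prod_def)
  have "stoch_int (\<lambda>\<omega>. (X2 v \<omega> - X2 0 \<omega>) + (-1) * (X2 u \<omega> - X2 0 \<omega>)) (\<lambda>x. 0 + (-1) * 0)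
     (\<lambda>x. indicator {0..v} x * \<sigma>2 x + (-1) * (indicator {0..u} x * \<sigma>2 x))"
    by (rule stoch_int_lin; rule i) (use u in auto)
  moreover have "indicator {0..v} x * \<sigma>2 x + (-1) * (indicator {0..u} x * \<sigma>2 x) = indicator {u<..v} x * \<sigma>2 x" for x
    using u by (auto simp: indicator_def)
  ultimately show ?thesis by simp
qed

definition s10 :: "real \<Rightarrow> real" where "s10 x = indicator {0..T} x * \<sigma>1 x"
definition s20 :: "real \<Rightarrow> real" where "s20 x = indicator {0..T} x * \<sigma>2 x"

lemma s_meas[measurable]: "s10 \<in> borel_measurable borel" "s20 \<in> borel_measurable borel"
  using s1_meas s2_meas unfolding set_borel_measurable_def s10_def[abs_def] s20_def[abs_def] by auto

lemma sigma_nonneg: "0 \<le> \<sigma>"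
  using bspec[OF s1_bound, of 0] T_pos by auto

lemma s_bound: "0 \<le> s10 x" "s10 x \<le> \<sigma>" "0 \<le> s20 x" "s20 x \<le> \<sigma>"
  using s1_bound s2_bound sigma_nonneg by (auto simp: s10_def s20_def indicator_def less_imp_le)

text \<open>Common form of the three set functions of the model; with densities cut off outside
  [0, T], one additivity lemma serves all of them.\<close>

definition mass :: "(real \<Rightarrow> real) \<Rightarrow> real set \<Rightarrow> real" where "mass h A = (\<integral>x. indicator A x * h x \<partial>lborel)"

definition h1 :: "real \<Rightarrow> real" where "h1 x = (s10 x)\<^sup>2"
definition h2 :: "real \<Rightarrow> real" where "h2 x = (s20 x)\<^sup>2"
definition hc :: "real \<Rightarrow> real" where "hc x = rho0 x * s10 x * s20 x"

lemma h_meas[measurable]: "h1 \<in> borel_measurable borel" "h2 \<in> borel_measurable borel" "hc \<in> borel_measurable borel"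
  unfolding h1_def[abs_def] h2_def[abs_def] hc_def[abs_def] by measurable

lemma h_bound: "\<bar>h1 x\<bar> \<le> \<sigma>\<^sup>2" "\<bar>h2 x\<bar> \<le> \<sigma>\<^sup>2" "\<bar>hc x\<bar> \<le> \<sigma>\<^sup>2"
proof -
  show "\<bar>h1 x\<bar> \<le> \<sigma>\<^sup>2" "\<bar>h2 x\<bar> \<le> \<sigma>\<^sup>2" unfolding h1_def h2_def using s_bound[of x] by (auto intro!: power_mono)
  have "\<bar>rho0 x\<bar> * \<bar>s10 x\<bar> * \<bar>s20 x\<bar> \<le> 1 * \<sigma> * \<sigma>"
    using s_bound[of x] rho0_bound[of x] by (intro mult_mono) auto
  then show "\<bar>hc x\<bar> \<le> \<sigma>\<^sup>2" by (simp add: hc_def abs_mult power2_eq_square)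
qed

lemma mass_integrable:
  assumes "h \<in> borel_measurable borel" "\<And>x. \<bar>h x\<bar> \<le> \<sigma>\<^sup>2" "A \<in> sets borel" "A \<subseteq> {0..T}"
  shows "integrable lborel (\<lambda>x. indicator A x * h x)"
proof (rule integrableI_bounded_set[where B = "\<sigma>\<^sup>2" and A = "{0..T}"])
  show "(\<lambda>x. indicator A x * h x) \<in> borel_measurable lborel" using assms(1,3) by measurable
  show "AE x in lborel. x \<in> {0..T} \<longrightarrow> norm (indicator A x * h x) \<le> \<sigma>\<^sup>2"
    using assms(2) by (intro AE_I2) (auto simp: indicator_def)
  show "AE x in lborel. x \<notin> {0..T} \<longrightarrow> indicator A x * h x = 0"
    using assms(4) by (intro AE_I2) (auto simp: indicator_def)
qed (auto simp: emeasure_lborel_Icc_eq)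

lemma mass_meas:
  assumes "A \<subseteq> {0..T}"
  shows "var_meas \<sigma>1 A = mass h1 A" "var_meas \<sigma>2 A = mass h2 A" "cov_meas \<rho> \<sigma>1 \<sigma>2 A = mass hc A"
  unfolding var_meas_def cov_meas_def set_lebesgue_integral_def mass_def
  using assms by (auto intro!: Bochner_Integration.integral_cong simp: h1_def h2_def hc_def s10_def s20_def rho0_def indicator_def)

lemma mass_interval:
  assumes h: "h \<in> borel_measurable borel" "\<And>x. \<bar>h x\<bar> \<le> \<sigma>\<^sup>2" and uv: "0 \<le> u" "u \<le> v" "v \<le> T"
  shows "mass h {u<..v} = mass h {0<..v} - mass h {0<..u}"
    and "mass h {u<..v} \<le> \<sigma>\<^sup>2 * (v - u)"
proof -
  have i: "integrable lborel (\<lambda>x. indicator {a<..b} x * h x)" if "0 \<le> a" "b \<le> T" for a b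
    by (rule mass_integrable[OF h]) (use that in auto)
  have "mass h {0<..v} - mass h {0<..u} = (\<integral>x. indicator {0<..v} x * h x - indicator {0<..u} x * h x \<partial>lborel)"
    unfolding mass_def by (rule Bochner_Integration.integral_diff[symmetric]) (use i uv in auto)
  also have "\<dots> = mass h {u<..v}"
    unfolding mass_def using uv by (intro Bochner_Integration.integral_cong refl) (auto simp: indicator_def)
  finally show "mass h {u<..v} = mass h {0<..v} - mass h {0<..u}" ..
  have "mass h {u<..v} \<le> (\<integral>x. indicator {u<..v} x * \<sigma>\<^sup>2 \<partial>lborel)"
    unfolding mass_def
  proof (rule integral_mono)
    show "integrable lborel (\<lambda>x. indicator {u<..v} x * h x)" using i uv by auto
    show "integrable lborel (\<lambda>x. indicator {u<..v} x * \<sigma>\<^sup>2)" using uv by simp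
    show "indicator {u<..v} x * h x \<le> indicator {u<..v} x * \<sigma>\<^sup>2" for x
      using h(2)[of x] by (auto simp: indicator_def)
  qed
  also have "\<dots> = \<sigma>\<^sup>2 * (v - u)" using uv by simp
  finally show "mass h {u<..v} \<le> \<sigma>\<^sup>2 * (v - u)" .
qed

lemma ip_mass:
  assumes "A \<subseteq> {0..T}" "A' \<subseteq> {0..T}"
  shows "ip (\<lambda>x. indicator A x * \<sigma>1 x) (\<lambda>x. 0) (\<lambda>x. indicator A' x * \<sigma>1 x) (\<lambda>x. 0) = mass h1 (A \<inter> A')"
    "ip (\<lambda>x. 0) (\<lambda>x. indicator A x * \<sigma>2 x) (\<lambda>x. 0) (\<lambda>x. indicator A' x * \<sigma>2 x) = mass h2 (A \<inter> A')"
    "ip (\<lambda>x. indicator A x * \<sigma>1 x) (\<lambda>x. 0) (\<lambda>x. 0) (\<lambda>x. indicator A' x * \<sigma>2 x) = mass hc (A \<inter> A')"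
  unfolding ip_def mass_def using assms
  by (subst integral_restrict_space; force intro!: Bochner_Integration.integral_cong
        simp: h1_def h2_def hc_def s10_def s20_def rho0_def indicator_def power2_eq_square)+

end

section \<open>The common refinement of a fixed pair of partitions\<close>

locale sampled_model = covariation_model +
  fixes \<pi> :: "partition \<times> partition"
  assumes \<pi>: "\<pi> \<in> partition_pairs T"
begin

abbreviation "m \<equiv> fst (fst \<pi>)"
abbreviation "n \<equiv> fst (snd \<pi>)"
abbreviation "s \<equiv> snd (fst \<pi>)"
abbreviation "t \<equiv> snd (snd \<pi>)"

lemma partitions: "is_partition T (fst \<pi>)" "is_partition T (snd \<pi>)"
  using \<pi> by (auto simp: partition_pairs_def)

sublocale two_grids s t m n
  by unfold_locales (use partitions in \<open>auto simp: is_partition_def\<close>)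

definition lo :: "nat \<times> nat \<Rightarrow> real" where "lo p = max (s (fst p)) (t (snd p))"
text \<open>The outer maximum turns an empty intersection into the degenerate interval (lo, lo], so
  sums may run over all index pairs and increments over empty cells are zero.\<close>

definition hi :: "nat \<times> nat \<Rightarrow> real" where "hi p = max (lo p) (min (s (Suc (fst p))) (t (Suc (snd p))))"
definition D :: "nat \<times> nat \<Rightarrow> real set" where "D p = {lo p<..hi p}"

lemma D_cell: "D p = cell (fst \<pi>) (fst p) \<inter> cell (snd \<pi>) (snd p)"
  unfolding D_def lo_def hi_def cell_def by auto

lemma lo_hi:
  assumes "p \<in> cells2" shows "0 \<le> lo p" "lo p \<le> hi p" "hi p \<le> T"
proof -
  have "fst p < m" "snd p < n" using assms by (auto simp: cells2_def)
  then have "0 \<le> s (fst p)" "s (fst p) \<le> T" "t (snd p) \<le> T" "s (Suc (fst p)) \<le> T"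
    using is_partition_range[OF partitions(1), of "fst p"] is_partition_range[OF partitions(1), of "Suc (fst p)"]
      is_partition_range[OF partitions(2), of "snd p"] by auto
  then show "0 \<le> lo p" "lo p \<le> hi p" "hi p \<le> T" by (auto simp: lo_def hi_def)
qed

lemma D_sub: "p \<in> cells2 \<Longrightarrow> D p \<subseteq> {0..T}"
  using lo_hi[of p] by (auto simp: D_def)

lemma D_disjoint:
  assumes "p \<in> cells2" "q \<in> cells2" "p \<noteq> q" shows "D p \<inter> D q = {}"
proof -
  have ps: "fst p < m" "fst q < m" "snd p < n" "snd q < n" using assms by (auto simp: cells2_def)
  have "fst p < fst q \<or> fst q < fst p \<or> snd p < snd q \<or> snd q < snd p" using assms(3) by (auto simp: prod_eq_iff)
  then show ?thesis
    using s_le[of "fst p" "fst q"] s_le[of "fst q" "fst p"] t_le[of "snd p" "snd q"] t_le[of "snd q" "snd p"] ps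
    unfolding D_cell cell_def by (elim disjE) auto
qed

lemma row_telescope:
  fixes G :: "real \<Rightarrow> real"
  assumes "i < m"
  shows "(\<Sum>j<n. G (hi (i, j)) - G (lo (i, j))) = G (s (Suc i)) - G (s i)"
  unfolding hi_def lo_def fst_conv snd_conv
  by (rule clip_telescope) (use assms s_less t_less partitions is_partition_range[OF partitions(1)] in \<open>auto simp: is_partition_def Suc_le_eq\<close>)

lemma col_telescope:
  fixes G :: "real \<Rightarrow> real"
  assumes "j < n"
  shows "(\<Sum>i<m. G (hi (i, j)) - G (lo (i, j))) = G (t (Suc j)) - G (t j)"
  unfolding hi_def lo_def fst_conv snd_conv max.commute[of "s _" "t _"] min.commute[of "s _" "t _"]
  by (rule clip_telescope) (use assms s_less t_less partitions is_partition_range[OF partitions(2)] in \<open>auto simp: is_partition_def Suc_le_eq\<close>)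

lemma cell_sub: "i < m \<Longrightarrow> cell (fst \<pi>) i \<subseteq> {0..T}" "j < n \<Longrightarrow> cell (snd \<pi>) j \<subseteq> {0..T}"
  using is_partition_range[OF partitions(1), of i] is_partition_range[OF partitions(1), of "Suc i"]
    is_partition_range[OF partitions(2), of j] is_partition_range[OF partitions(2), of "Suc j"]
  by (auto simp: cell_def)

text \<open>The mass of an interval is an increment of z \<mapsto> \<open>mass h {0<..z}\<close>, so
  the cells along a row or a column telescope to the original interval.\<close>

lemma mass_cells:
  assumes h: "h \<in> borel_measurable borel" "\<And>x. \<bar>h x\<bar> \<le> \<sigma>\<^sup>2"
  shows "i < m \<Longrightarrow> row (\<lambda>p. mass h (D p)) i = mass h (cell (fst \<pi>) i)"
    and "j < n \<Longrightarrow> col (\<lambda>p. mass h (D p)) j = mass h (cell (snd \<pi>) j)"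
proof -
  have d: "mass h (D p) = mass h {0<..hi p} - mass h {0<..lo p}" if "p \<in> cells2" for p
    unfolding D_def by (rule mass_interval(1)[OF h lo_hi[OF that]])
  show "row (\<lambda>p. mass h (D p)) i = mass h (cell (fst \<pi>) i)" if i: "i < m"
  proof -
    have "row (\<lambda>p. mass h (D p)) i = (\<Sum>j<n. mass h {0<..hi (i, j)} - mass h {0<..lo (i, j)})"
      unfolding row_def by (intro sum.cong refl d) (use i in \<open>auto simp: cells2_def\<close>)
    also have "\<dots> = mass h {0<..s (Suc i)} - mass h {0<..s i}" by (rule row_telescope[OF i])
    also have "\<dots> = mass h (cell (fst \<pi>) i)"
      unfolding cell_def by (rule mass_interval(1)[OF h, symmetric])
        (use i s_less is_partition_range[OF partitions(1)] in \<open>auto simp: Suc_le_eq less_imp_le\<close>)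
    finally show ?thesis .
  qed
  show "col (\<lambda>p. mass h (D p)) j = mass h (cell (snd \<pi>) j)" if j: "j < n"
  proof -
    have "col (\<lambda>p. mass h (D p)) j = (\<Sum>i<m. mass h {0<..hi (i, j)} - mass h {0<..lo (i, j)})"
      unfolding col_def by (intro sum.cong refl d) (use j in \<open>auto simp: cells2_def\<close>)
    also have "\<dots> = mass h {0<..t (Suc j)} - mass h {0<..t j}" by (rule col_telescope[OF j])
    also have "\<dots> = mass h (cell (snd \<pi>) j)"
      unfolding cell_def by (rule mass_interval(1)[OF h, symmetric])
        (use j t_less is_partition_range[OF partitions(2)] in \<open>auto simp: Suc_le_eq less_imp_le\<close>)
    finally show ?thesis .
  qed
qed

lemma overlap_meet:
  assumes "i < m" "j < n" shows "overlap (cell (fst \<pi>) i) (cell (snd \<pi>) j) = of_bool (meet i j)"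
  unfolding overlap_cell meet_def using s_less[OF assms(1)] t_less[OF assms(2)] by auto

definition a :: "nat \<times> nat \<Rightarrow> real" where "a p = mass h1 (D p)"
definition b :: "nat \<times> nat \<Rightarrow> real" where "b p = mass h2 (D p)"
definition c :: "nat \<times> nat \<Rightarrow> real" where "c p = mass hc (D p)"

lemma row_col:
  "i < m \<Longrightarrow> row a i = var_meas \<sigma>1 (cell (fst \<pi>) i)" "j < n \<Longrightarrow> col b j = var_meas \<sigma>2 (cell (snd \<pi>) j)"
  "i < m \<Longrightarrow> row c i = cov_meas \<rho> \<sigma>1 \<sigma>2 (cell (fst \<pi>) i)" "j < n \<Longrightarrow> col c j = cov_meas \<rho> \<sigma>1 \<sigma>2 (cell (snd \<pi>) j)"
  "i < m \<Longrightarrow> row b i = var_meas \<sigma>2 (cell (fst \<pi>) i)" "j < n \<Longrightarrow> col a j = var_meas \<sigma>1 (cell (snd \<pi>) j)"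
  unfolding a_def[abs_def] b_def[abs_def] c_def[abs_def]
  by (simp_all add: mass_cells h_bound mass_meas cell_sub)

lemma c_cov: "p \<in> cells2 \<Longrightarrow> c p = cov_meas \<rho> \<sigma>1 \<sigma>2 (cell (fst \<pi>) (fst p) \<inter> cell (snd \<pi>) (snd p))"
  unfolding c_def D_cell[symmetric] by (simp add: mass_meas D_sub)

lemma c_zero: "p \<in> cells2 \<Longrightarrow> \<not> meet (fst p) (snd p) \<Longrightarrow> c p = 0"
proof -
  assume "p \<in> cells2" "\<not> meet (fst p) (snd p)"
  then have "overlap (cell (fst \<pi>) (fst p)) (cell (snd \<pi>) (snd p)) = 0" using overlap_meet[of "fst p" "snd p"] by (auto simp: cells2_def)
  then have "D p = {}" unfolding D_cell overlap_def by (simp split: if_splits)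
  then show "c p = 0" by (simp add: c_def mass_def)
qed

lemma cov_union:
  assumes "i < m" "j < n"
  shows "cov_meas \<rho> \<sigma>1 \<sigma>2 (cell (fst \<pi>) i \<union> cell (snd \<pi>) j) = row c i + col c j - c (i, j)"
proof -
  let ?I = "cell (fst \<pi>) i" and ?J = "cell (snd \<pi>) j"
  have i: "integrable lborel (\<lambda>x. indicator A x * hc x)" if "A \<in> sets borel" "A \<subseteq> {0..T}" for A
    by (rule mass_integrable) (use that h_bound in auto)
  have sub: "?I \<subseteq> {0..T}" "?J \<subseteq> {0..T}" using cell_sub assms by auto
  have mb: "?I \<in> sets borel" "?J \<in> sets borel" by (auto simp: cell_def)
  have "mass hc (?I \<union> ?J) = (\<integral>x. indicator ?I x * hc x + indicator ?J x * hc x - indicator (?I \<inter> ?J) x * hc x \<partial>lborel)"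
    unfolding mass_def by (intro Bochner_Integration.integral_cong refl) (auto simp: indicator_def)
  also have "\<dots> = mass hc ?I + mass hc ?J - mass hc (?I \<inter> ?J)"
    unfolding mass_def using i[OF mb(1) sub(1)] i[OF mb(2) sub(2)] i[OF sets.Int[OF mb]] sub(1)
    by (simp add: le_infI1)
  finally show ?thesis
    using row_col(3,4) assms sub mass_meas(3) c_cov[of "(i, j)"] by (simp add: cells2_def le_infI1)
qed

text \<open>The right side is the second trace in \<open>Smat_tr_2\<close> for the weights of the
  refinement; \<open>mu3_eq\<close> plays the same role for the third.\<close>

lemma mu2_eq: "4 * mu2 \<rho> \<sigma>1 \<sigma>2 \<pi> = 2 * (\<Sum>i<m. \<Sum>j<n. row a i * col b j * of_bool (meet i j))
   + 2 * ((\<Sum>i<m. (row c i)\<^sup>2) + (\<Sum>j<n. (col c j)\<^sup>2) - (\<Sum>p\<in>cells2. (c p)\<^sup>2))"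
proof -
  have c: "c (i, j) = cov_meas \<rho> \<sigma>1 \<sigma>2 (cell (fst \<pi>) i \<inter> cell (snd \<pi>) j)" if "i < m" "j < n" for i j
    using c_cov[of "(i, j)"] that by (simp add: cells2_def)
  show ?thesis
    unfolding mu2_def Let_def sum_cells[OF partitions(1)] sum_cells[OF partitions(2)] sum_cells2
    by (simp add: row_col overlap_meet c)
qed

lemma mu3_eq: "8 * mu3 \<rho> \<sigma>1 \<sigma>2 \<pi> =
   2 * ((\<Sum>i<m. (row c i)^3) + (\<Sum>j<n. (col c j)^3) + 2 * (\<Sum>p\<in>cells2. (c p)^3)
     - 3 * (\<Sum>p\<in>cells2. (c p)\<^sup>2 * (row c (fst p) + col c (snd p)) - c p * row c (fst p) * col c (snd p)))
   + 6 * (\<Sum>i<m. \<Sum>j<n. row a i * col b j * (row c i + col c j - c (i, j)) * of_bool (meet i j))"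
proof -
  have c: "c (i, j) = cov_meas \<rho> \<sigma>1 \<sigma>2 (cell (fst \<pi>) i \<inter> cell (snd \<pi>) j)" if "i < m" "j < n" for i j
    using c_cov[of "(i, j)"] that by (simp add: cells2_def)
  have u: "cov_meas \<rho> \<sigma>1 \<sigma>2 (cell (fst \<pi>) i \<union> cell (snd \<pi>) j) = cov_meas \<rho> \<sigma>1 \<sigma>2 (cell (fst \<pi>) i)
     + cov_meas \<rho> \<sigma>1 \<sigma>2 (cell (snd \<pi>) j) - cov_meas \<rho> \<sigma>1 \<sigma>2 (cell (fst \<pi>) i \<inter> cell (snd \<pi>) j)" if "i < m" "j < n" for i j
    using cov_union[OF that] row_col(3,4) that c by simp
  show ?thesis
    unfolding mu3_def Let_def sum_cells[OF partitions(1)] sum_cells[OF partitions(2)] sum_cells2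
    by (simp add: row_col overlap_meet c u)
qed

lemma theta_eq: "theta T \<rho> \<sigma>1 \<sigma>2 = (\<Sum>p\<in>cells2. c p)"
proof -
  let ?G = "\<lambda>z. mass hc {0<..z}"
  have "(\<Sum>p\<in>cells2. c p) = (\<Sum>i<m. row c i)" unfolding sum_cells2 by (simp add: row_def)
  also have "\<dots> = (\<Sum>i<m. ?G (s (Suc i)) - ?G (s i))"
  proof (intro sum.cong refl)
    fix i assume "i \<in> {..<m}"
    then have i: "i < m" by simp
    then show "row c i = ?G (s (Suc i)) - ?G (s i)"
      using row_col(3)[OF i] mass_meas(3)[OF cell_sub(1)[OF i]] mass_interval(1)[OF h_meas(3) h_bound(3), of "s i" "s (Suc i)"]
        s_less[OF i] is_partition_range[OF partitions(1), of i] is_partition_range[OF partitions(1), of "Suc i"]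
      by (simp add: cell_def)
  qed
  also have "\<dots> = ?G T - ?G 0" using partitions(1) by (subst sum_lessThan_telescope) (simp add: is_partition_def)
  also have "\<dots> = theta T \<rho> \<sigma>1 \<sigma>2"
  proof -
    have "?G 0 = 0" by (simp add: mass_def)
    moreover have "theta T \<rho> \<sigma>1 \<sigma>2 = mass hc {0..T}" using mass_meas(3)[of "{0..T}"] by (simp add: theta_def cov_meas_def)
    moreover have "mass hc {0..T} = ?G T"
      unfolding mass_def
    proof (rule integral_cong_AE)
      have "AE x in lborel. x \<noteq> (0::real)" by (rule AE_lborel_singleton)
      then show "AE x in lborel. indicator {0..T} x * hc x = indicator {0<..T} x * hc x"
        by eventually_elim (auto simp: indicator_def)
    qed measurable
    ultimately show ?thesis by simp
  qed
  finally show ?thesis ..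
qed

text \<open>Grouped by intervals of the other grid, the sum covers the intervals that meet a given
  one. Their total length is at most three meshes, and the density is at most \<sigma>
  squared.\<close>

lemma overlap_mass_bound:
  shows "p \<in> cells2 \<Longrightarrow> (\<Sum>q\<in>cells2. kf p q * b q) \<le> 3 * \<sigma>\<^sup>2 * mesh \<pi>"
    and "q \<in> cells2 \<Longrightarrow> (\<Sum>p\<in>cells2. kf p q * a p) \<le> 3 * \<sigma>\<^sup>2 * mesh \<pi>"
proof -
  show "(\<Sum>q\<in>cells2. kf p q * b q) \<le> 3 * \<sigma>\<^sup>2 * mesh \<pi>" if p: "p \<in> cells2"
  proof -
    have pm: "fst p < m" using p by (auto simp: cells2_def)
    have "(\<Sum>q\<in>cells2. kf p q * b q) = (\<Sum>j<n. of_bool (meet (fst p) j) * col b j)"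
      unfolding sum_cells2' kf_def by (simp add: col_def sum_distrib_left)
    also have "\<dots> \<le> (\<Sum>j<n. of_bool (meet (fst p) j) * (\<sigma>\<^sup>2 * (t (Suc j) - t j)))"
    proof (intro sum_mono mult_left_mono)
      fix j assume "j \<in> {..<n}"
      then have j: "j < n" by simp
      show "col b j \<le> \<sigma>\<^sup>2 * (t (Suc j) - t j)"
        using row_col(2)[OF j] mass_meas(2)[OF cell_sub(2)[OF j]] mass_interval(2)[OF h_meas(2) h_bound(2), of "t j" "t (Suc j)"]
          t_less[OF j] is_partition_range[OF partitions(2), of j] is_partition_range[OF partitions(2), of "Suc j"] j
        by (simp add: cell_def)
    qed simp
    also have "\<dots> = \<sigma>\<^sup>2 * (\<Sum>j<n. of_bool (s (fst p) < t (Suc j) \<and> t j < s (Suc (fst p))) * (t (Suc j) - t j))"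
      unfolding meet_def sum_distrib_left by (intro sum.cong refl) (simp add: ac_simps)
    also have "\<dots> \<le> \<sigma>\<^sup>2 * (3 * mesh \<pi>)"
      by (intro mult_left_mono meet_length_le t_less s_less cell_le_mesh[OF \<pi>] pm) auto
    finally show ?thesis by simp
  qed
  show "(\<Sum>p\<in>cells2. kf p q * a p) \<le> 3 * \<sigma>\<^sup>2 * mesh \<pi>" if q: "q \<in> cells2"
  proof -
    have qn: "snd q < n" using q by (auto simp: cells2_def)
    have "(\<Sum>p\<in>cells2. kf p q * a p) = (\<Sum>i<m. of_bool (meet i (snd q)) * row a i)"
      unfolding sum_cells2 kf_def by (simp add: row_def sum_distrib_left)
    also have "\<dots> \<le> (\<Sum>i<m. of_bool (meet i (snd q)) * (\<sigma>\<^sup>2 * (s (Suc i) - s i)))"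
    proof (intro sum_mono mult_left_mono)
      fix i assume "i \<in> {..<m}"
      then have i: "i < m" by simp
      show "row a i \<le> \<sigma>\<^sup>2 * (s (Suc i) - s i)"
        using row_col(1)[OF i] mass_meas(1)[OF cell_sub(1)[OF i]] mass_interval(2)[OF h_meas(1) h_bound(1), of "s i" "s (Suc i)"]
          s_less[OF i] is_partition_range[OF partitions(1), of i] is_partition_range[OF partitions(1), of "Suc i"] i
        by (simp add: cell_def)
    qed simp
    also have "\<dots> = \<sigma>\<^sup>2 * (\<Sum>i<m. of_bool (t (snd q) < s (Suc i) \<and> s i < t (Suc (snd q))) * (s (Suc i) - s i))"
      unfolding meet_def sum_distrib_left by (intro sum.cong refl) (simp add: ac_simps conj_commute)
    also have "\<dots> \<le> \<sigma>\<^sup>2 * (3 * mesh \<pi>)"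
      by (intro mult_left_mono meet_length_le t_less s_less cell_le_mesh[OF \<pi>] qn) auto
    finally show ?thesis by simp
  qed
qed

definition x :: "nat \<times> nat \<Rightarrow> 'a \<Rightarrow> real" where "x p \<omega> = X1 (hi p) \<omega> - X1 (lo p) \<omega>"
definition y :: "nat \<times> nat \<Rightarrow> 'a \<Rightarrow> real" where "y p \<omega> = X2 (hi p) \<omega> - X2 (lo p) \<omega>"

lemma xy_stoch:
  assumes "p \<in> cells2"
  shows "stoch_int (x p) (\<lambda>z. indicator (D p) z * \<sigma>1 z) (\<lambda>z. 0)" "stoch_int (y p) (\<lambda>z. 0) (\<lambda>z. indicator (D p) z * \<sigma>2 z)"
  unfolding x_def[abs_def] y_def[abs_def] D_def using X1_increment[OF lo_hi[OF assms]] X2_increment[OF lo_hi[OF assms]] by auto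

lemma xy_L: "p \<in> cells2 \<Longrightarrow> x p \<in> wiener_space" "p \<in> cells2 \<Longrightarrow> y p \<in> wiener_space"
  using xy_stoch unfolding wiener_space_def by blast+

lemma xy_cov:
  assumes p: "p \<in> cells2" and q: "q \<in> cells2"
  shows "W.cov (x p) (x q) = (if p = q then a p else 0)" "W.cov (y p) (y q) = (if p = q then b p else 0)"
    "W.cov (x p) (y q) = (if p = q then c p else 0)"
proof -
  have m0: "mass h (D p \<inter> D q) = (if p = q then mass h (D p) else 0)" for h
    using D_disjoint[OF p q] by (auto simp: mass_def)
  show "W.cov (x p) (x q) = (if p = q then a p else 0)" "W.cov (y p) (y q) = (if p = q then b p else 0)"
    "W.cov (x p) (y q) = (if p = q then c p else 0)"
    unfolding W.cov_def a_def b_def c_def m0[symmetric]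
    using stoch_int_isometry[OF xy_stoch(1)[OF p] xy_stoch(1)[OF q]] stoch_int_isometry[OF xy_stoch(2)[OF p] xy_stoch(2)[OF q]]
      stoch_int_isometry[OF xy_stoch(1)[OF p] xy_stoch(2)[OF q]] ip_mass[OF D_sub[OF p] D_sub[OF q]] by auto
qed

lemma comb_cov:
  assumes p: "p \<in> cells2" and q: "q \<in> cells2"
  shows "W.cov (\<lambda>\<omega>. k * x p \<omega> + l * y p \<omega>) (\<lambda>\<omega>. k' * x q \<omega> + l' * y q \<omega>) =
    (if p = q then k * k' * a p + (k * l' + l * k') * c p + l * l' * b p else 0)"
proof -
  note L = xy_L[OF p] xy_L[OF q]
  have yx: "W.cov (y p) (x q) = (if p = q then c p else 0)" using xy_cov(3)[OF q p] W.cov_sym[of "y p" "x q"] by simp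
  have "W.cov (\<lambda>\<omega>. k * x p \<omega> + l * y p \<omega>) (\<lambda>\<omega>. k' * x q \<omega> + l' * y q \<omega>) =
    (\<integral>\<omega>. k * k' * (x p \<omega> * x q \<omega>) + k * l' * (x p \<omega> * y q \<omega>) + l * k' * (y p \<omega> * x q \<omega>) + l * l' * (y p \<omega> * y q \<omega>) \<partial>M)"
    unfolding W.cov_def by (intro Bochner_Integration.integral_cong refl) (simp add: algebra_simps)
  also have "\<dots> = k * k' * W.cov (x p) (x q) + k * l' * W.cov (x p) (y q) + l * k' * W.cov (y p) (x q) + l * l' * W.cov (y p) (y q)"
    unfolding W.cov_def using W.L_mult_integrable L by simp
  also have "\<dots> = (if p = q then k * k' * a p + (k * l' + l * k') * c p + l * l' * b p else 0)"
    unfolding xy_cov[OF p q] yx by (auto simp: algebra_simps)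
  finally show ?thesis .
qed

end

section \<open>Gram-Schmidt coordinates within a cell\<close>

context sampled_model
begin

lemma variance_nonneg:
  assumes p: "p \<in> cells2"
  shows "0 \<le> k\<^sup>2 * a p + 2 * k * l * c p + l\<^sup>2 * b p"
    and "k\<^sup>2 * a p + 2 * k * l * c p + l\<^sup>2 * b p = 0 \<Longrightarrow> AE \<omega> in M. k * x p \<omega> + l * y p \<omega> = 0"
proof -
  let ?Z = "\<lambda>\<omega>. k * x p \<omega> + l * y p \<omega>"
  have v: "(\<integral>\<omega>. (?Z \<omega>)\<^sup>2 \<partial>M) = k\<^sup>2 * a p + 2 * k * l * c p + l\<^sup>2 * b p"
    using comb_cov[OF p p, of k l k l] by (simp add: W.cov_def power2_eq_square algebra_simps)
  show "0 \<le> k\<^sup>2 * a p + 2 * k * l * c p + l\<^sup>2 * b p" unfolding v[symmetric] by simp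
  have "?Z \<in> wiener_space" using W.L_lin[OF W.L_scale[OF xy_L(1)[OF p]] xy_L(2)[OF p]] .
  then have "integrable M (\<lambda>\<omega>. (?Z \<omega>)\<^sup>2)" by (rule W.L_sq)
  then have "(\<integral>\<omega>. (?Z \<omega>)\<^sup>2 \<partial>M) = 0 \<longleftrightarrow> (AE \<omega> in M. (?Z \<omega>)\<^sup>2 = 0)"
    by (rule integral_nonneg_eq_0_iff_AE) simp
  then show "k\<^sup>2 * a p + 2 * k * l * c p + l\<^sup>2 * b p = 0 \<Longrightarrow> AE \<omega> in M. ?Z \<omega> = 0"
    unfolding v by simp
qed

lemma a_nonneg: "p \<in> cells2 \<Longrightarrow> 0 \<le> a p"
  using variance_nonneg(1)[of p 1 0] by simp

lemma a_zero:
  assumes p: "p \<in> cells2" "a p = 0" shows "c p = 0"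
proof (rule ccontr)
  assume c: "c p \<noteq> 0"
  \<comment> \<open>With l = 1 and a = 0 the variance is 2 k c + b; this k makes it -1.\<close>
  show False using variance_nonneg(1)[OF p(1), of "- (b p + 1) / (2 * c p)" 1] c p(2) by (simp add: field_simps)
qed

text \<open>The variance of y - (c / a) x, the part of y orthogonal to x. For a = 0 the division by
  zero gives b, which is right because x then vanishes almost surely.\<close>

definition resvar :: "nat \<times> nat \<Rightarrow> real" where "resvar p = b p - (c p)\<^sup>2 / a p"

lemma resvar_eq: "p \<in> cells2 \<Longrightarrow> resvar p = (- c p / a p)\<^sup>2 * a p + 2 * (- c p / a p) * 1 * c p + 1\<^sup>2 * b p"
  by (cases "a p = 0") (simp_all add: resvar_def power2_eq_square field_simps)

lemma resvar_nonneg: "p \<in> cells2 \<Longrightarrow> 0 \<le> resvar p"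
  unfolding resvar_eq by (rule variance_nonneg(1))

text \<open>When a variance vanishes, division by zero makes the corresponding coordinate zero; its variance
  \<open>gvar\<close> is then 0 instead of 1, and \<open>al\<close>, \<open>be\<close> vanish there.\<close>

definition gx :: "(nat \<times> nat) \<times> bool \<Rightarrow> real" where
  "gx e = (if snd e then 1 / sqrt (a (fst e)) else - (c (fst e) / a (fst e)) / sqrt (resvar (fst e)))"
definition gy :: "(nat \<times> nat) \<times> bool \<Rightarrow> real" where
  "gy e = (if snd e then 0 else 1 / sqrt (resvar (fst e)))"
definition g :: "(nat \<times> nat) \<times> bool \<Rightarrow> 'a \<Rightarrow> real" where
  "g e \<omega> = gx e * x (fst e) \<omega> + gy e * y (fst e) \<omega>"
definition gvar :: "(nat \<times> nat) \<times> bool \<Rightarrow> real" where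
  "gvar e = (if snd e then of_bool (a (fst e) \<noteq> 0) else of_bool (resvar (fst e) \<noteq> 0))"
definition al :: "nat \<times> nat \<Rightarrow> bool \<Rightarrow> real" where
  "al p e = (if e then sqrt (a p) else 0)"
definition be :: "nat \<times> nat \<Rightarrow> bool \<Rightarrow> real" where
  "be p e = (if e then c p / sqrt (a p) else sqrt (resvar p))"

lemma g_L: "e \<in> index \<Longrightarrow> g e \<in> wiener_space"
proof -
  assume "e \<in> index"
  then have p: "fst e \<in> cells2" by auto
  show ?thesis
    unfolding g_def[abs_def] by (rule W.L_lin[OF W.L_scale[OF xy_L(1)[OF p]] xy_L(2)[OF p]])
qed

lemma g_cov:
  assumes e: "e \<in> index" and f: "f \<in> index"
  shows "W.cov (g e) (g f) = (if e = f then gvar e else 0)"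
proof -
  have p: "fst e \<in> cells2" and q: "fst f \<in> cells2" using e f by auto
  note n = a_nonneg[OF p] resvar_nonneg[OF p] a_zero[OF p]
  have "W.cov (g e) (g f) = (if fst e = fst f then gx e * gx f * a (fst e) + (gx e * gy f + gy e * gx f) * c (fst e) + gy e * gy f * b (fst e) else 0)"
    unfolding g_def[abs_def] by (rule comb_cov[OF p q])
  also have "\<dots> = (if e = f then gvar e else 0)"
  proof (cases "fst e = fst f")
    case True
    consider (tt) "snd e" "snd f" | (ff) "\<not> snd e" "\<not> snd f" | (tf) "snd e" "\<not> snd f" | (ft) "\<not> snd e" "snd f" by blast
    then show ?thesis
    proof cases
      case tt
      then have "e = f" using True by (simp add: prod_eq_iff)
      then show ?thesis using tt n by (auto simp: gx_def gy_def gvar_def)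
    next
      case ff
      then have ef: "e = f" using True by (simp add: prod_eq_iff)
      have "gx e * gx e * a (fst e) + (gx e * gy e + gy e * gx e) * c (fst e) + gy e * gy e * b (fst e) = resvar (fst e) / (sqrt (resvar (fst e)))\<^sup>2"
        using ff unfolding resvar_eq[OF p] gx_def gy_def power2_eq_square by (simp add: add_divide_distrib diff_divide_distrib algebra_simps)
      also have "\<dots> = gvar e" using ff n by (simp add: gvar_def)
      finally show ?thesis using ef by simp
    next
      case tf
      then have "e \<noteq> f" by auto
      then show ?thesis using True tf n by (cases "a (fst e) = 0") (auto simp: gx_def gy_def)
    next
      case ft
      then have "e \<noteq> f" by auto
      then show ?thesis using True ft n by (cases "a (fst e) = 0") (auto simp: gx_def gy_def)
    qed
  qed auto
  finally show ?thesis .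
qed

lemma al_be:
  assumes p: "p \<in> cells2"
  shows "al p True * al p True + al p False * al p False = a p"
    "al p True * be p True + al p False * be p False = c p"
    "be p True * be p True + be p False * be p False = b p"
  using a_nonneg[OF p] resvar_nonneg[OF p] a_zero[OF p]
  by (auto simp: al_def be_def resvar_def power2_eq_square)

text \<open>Exact where the variances are positive. A coordinate that was set to zero replaces a
  variable of variance zero, which is why the identities hold almost surely only.\<close>

lemma decomposition:
  assumes p: "p \<in> cells2"
  shows "AE \<omega> in M. x p \<omega> = al p True * g (p, True) \<omega> + al p False * g (p, False) \<omega>"
    "AE \<omega> in M. y p \<omega> = be p True * g (p, True) \<omega> + be p False * g (p, False) \<omega>"
proof -
  note n = a_nonneg[OF p] resvar_nonneg[OF p] a_zero[OF p]
  show "AE \<omega> in M. x p \<omega> = al p True * g (p, True) \<omega> + al p False * g (p, False) \<omega>"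
  proof (cases "a p = 0")
    case True
    then show ?thesis using variance_nonneg(2)[OF p, of 1 0] by (simp add: al_def)
  next
    case False
    then show ?thesis by (simp add: al_def g_def gx_def gy_def)
  qed
  have t: "be p True * g (p, True) \<omega> = c p / a p * x p \<omega>" for \<omega>
    using n by (simp add: be_def g_def gx_def gy_def)
  show "AE \<omega> in M. y p \<omega> = be p True * g (p, True) \<omega> + be p False * g (p, False) \<omega>"
  proof (cases "resvar p = 0")
    case True
    then have "AE \<omega> in M. (- c p / a p) * x p \<omega> + 1 * y p \<omega> = 0"
      by (intro variance_nonneg(2)[OF p]) (simp only: resvar_eq[OF p])
    then show ?thesis by eventually_elim (simp only: t, simp add: True be_def)
  next
    case False
    then show ?thesis unfolding t by (simp add: be_def g_def gx_def gy_def algebra_simps)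
  qed
qed

text \<open>Increments over the intervals of each grid are sums of increments over refinement cells,
  and K depends only on the row of one cell and the column of the other.\<close>

lemma theta_hat_eq: "theta_hat X1 X2 \<pi> \<omega> = (\<Sum>p\<in>cells2. \<Sum>q\<in>cells2. kf p q * x p \<omega> * y q \<omega>)"
proof -
  have r: "row (\<lambda>p. x p \<omega>) i = X1 (s (Suc i)) \<omega> - X1 (s i) \<omega>" if "i < m" for i
    using row_telescope[OF that, of "\<lambda>z. X1 z \<omega>"] by (simp add: row_def x_def)
  have l: "col (\<lambda>p. y p \<omega>) j = X2 (t (Suc j)) \<omega> - X2 (t j) \<omega>" if "j < n" for j
    using col_telescope[OF that, of "\<lambda>z. X2 z \<omega>"] by (simp add: col_def y_def)
  show ?thesis
    unfolding sum_kf_prod theta_hat_def by (intro sum.cong refl) (simp add: r l overlap_meet)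
qed

lemma theta_hat_quadratic:
  "AE \<omega> in M. theta_hat X1 X2 \<pi> \<omega> = (\<Sum>e\<in>index. \<Sum>f\<in>index. Smat al be e f * g e \<omega> * g f \<omega>) / 2"
proof -
  have "AE \<omega> in M. \<forall>p\<in>cells2. x p \<omega> = al p True * g (p, True) \<omega> + al p False * g (p, False) \<omega>"
    "AE \<omega> in M. \<forall>p\<in>cells2. y p \<omega> = be p True * g (p, True) \<omega> + be p False * g (p, False) \<omega>"
    using decomposition by (simp_all add: AE_ball_countable finite_cells2 countable_finite)
  then show ?thesis
  proof eventually_elim
    case (elim \<omega>)
    have "(\<Sum>e\<in>index. \<Sum>f\<in>index. Smat al be e f * g e \<omega> * g f \<omega>) =
      (\<Sum>p\<in>cells2. \<Sum>q\<in>cells2. kf p q * x p \<omega> * y q \<omega> + kf q p * x q \<omega> * y p \<omega>)"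
      unfolding sum_index sum.distrib[symmetric]
      by (intro sum.cong refl) (use elim in \<open>simp add: Smat_def algebra_simps\<close>)
    also have "\<dots> = 2 * (\<Sum>p\<in>cells2. \<Sum>q\<in>cells2. kf p q * x p \<omega> * y q \<omega>)"
      unfolding sum.distrib by (subst (2) sum.swap) simp
    finally show ?case unfolding theta_hat_eq by simp
  qed
qed

lemma mesh_pos: "0 < mesh \<pi>"
proof -
  have "m \<noteq> 0" using partitions(1) T_pos by (cases "fst (fst \<pi>)") (auto simp: is_partition_def)
  then have "s (Suc 0) - s 0 \<le> mesh \<pi>" "s 0 < s (Suc 0)" using cell_le_mesh(1)[OF \<pi>, of 0] s_less[of 0] by auto
  then show ?thesis by simp
qed

lemma x_meas: "p \<in> cells2 \<Longrightarrow> x p \<in> borel_measurable M"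
  and y_meas: "p \<in> cells2 \<Longrightarrow> y p \<in> borel_measurable M"
  using W.L_meas xy_L by auto

lemma theta_hat_meas: "theta_hat X1 X2 \<pi> \<in> borel_measurable M"
  unfolding theta_hat_eq[abs_def] by (intro borel_measurable_sum borel_measurable_times borel_measurable_const x_meas y_meas)

section \<open>The normalized quadratic form and its expansion\<close>

context
  fixes \<beta> :: real assumes \<beta>: "0 < \<beta>"
begin

definition S :: "(nat \<times> nat) \<times> bool \<Rightarrow> (nat \<times> nat) \<times> bool \<Rightarrow> real" where
  "S e f = Smat al be e f / sqrt \<beta>"
definition Q :: "'a \<Rightarrow> real" where
  "Q \<omega> = (\<Sum>e\<in>index. \<Sum>f\<in>index. S e f * g e \<omega> * g f \<omega>) / 2"

lemma finite_index: "finite index" by (simp add: finite_cells2)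

lemma S_traces:
  "mat_tr index (mat_pow index S 1) / 2 = theta T \<rho> \<sigma>1 \<sigma>2 / sqrt \<beta>"
  "mat_tr index (mat_pow index S 2) = 2 * lambda2 \<rho> \<sigma>1 \<sigma>2 \<beta> \<pi>"
  "mat_tr index (mat_pow index S 3) = sqrt \<beta> * lambda3 \<rho> \<sigma>1 \<sigma>2 \<beta> \<pi>"
proof -
  have b3: "sqrt \<beta> * sqrt \<beta> = \<beta>" using \<beta> by simp
  have r2: "u / sqrt \<beta> * (v / sqrt \<beta>) = u * v / \<beta>" and r3: "u * v / \<beta> * (w / sqrt \<beta>) = u * v * w / (\<beta> * sqrt \<beta>)" for u v w
    using b3 by simp_all
  have "mat_tr index (mat_pow index S 1) = (\<Sum>e\<in>index. Smat al be e e) / sqrt \<beta>"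
    unfolding mat_tr_def One_nat_def by (simp add: mat_pow_1[OF finite_index] S_def sum_divide_distrib del: mat_pow.simps)
  also have "\<dots> = 2 * theta T \<rho> \<sigma>1 \<sigma>2 / sqrt \<beta>"
    unfolding theta_eq using Smat_tr_1[where al = al and be = be and a = a and b = b and c = c] al_be c_zero by simp
  finally show "mat_tr index (mat_pow index S 1) / 2 = theta T \<rho> \<sigma>1 \<sigma>2 / sqrt \<beta>" by simp
  have "mat_tr index (mat_pow index S 2) = (\<Sum>e\<in>index. \<Sum>f\<in>index. Smat al be e f * Smat al be f e) / \<beta>"
    unfolding mat_tr_pow_2[OF finite_index] S_def r2 by (simp add: sum_divide_distrib)
  also have "\<dots> = 4 * mu2 \<rho> \<sigma>1 \<sigma>2 \<pi> / \<beta>"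
    unfolding mu2_eq using Smat_tr_2[where al = al and be = be and a = a and b = b and c = c] al_be c_zero by simp
  finally show "mat_tr index (mat_pow index S 2) = 2 * lambda2 \<rho> \<sigma>1 \<sigma>2 \<beta> \<pi>" by (simp add: lambda2_def)
  have "mat_tr index (mat_pow index S 3) = (\<Sum>e\<in>index. \<Sum>f\<in>index. \<Sum>h\<in>index. Smat al be e f * Smat al be f h * Smat al be h e) / (\<beta> * sqrt \<beta>)"
    unfolding mat_tr_pow_3[OF finite_index] S_def r2 r3 by (simp add: sum_divide_distrib)
  also have "\<dots> = 8 * mu3 \<rho> \<sigma>1 \<sigma>2 \<pi> / (\<beta> * sqrt \<beta>)"
    unfolding mu3_eq using Smat_tr_3[where al = al and be = be and a = a and b = b and c = c] al_be c_zero by simp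
  also have "\<dots> = sqrt \<beta> * lambda3 \<rho> \<sigma>1 \<sigma>2 \<beta> \<pi>"
    unfolding lambda3_def using \<beta> b3 by (simp add: field_simps power2_eq_square)
  finally show "mat_tr index (mat_pow index S 3) = sqrt \<beta> * lambda3 \<rho> \<sigma>1 \<sigma>2 \<beta> \<pi>" .
qed

text \<open>The quadratic form agrees with the estimator almost surely, and the first trace centers
  it at \<theta>, so the expectations coincide for every u.\<close>

lemma cond_char_quadratic:
  "cond_char_at M T \<rho> \<sigma>1 \<sigma>2 X1 X2 \<beta> \<pi> = (\<lambda>u. CLINT \<omega>|M. iexp (u * (Q \<omega> - mat_tr index (mat_pow index S 1) / 2)))"
proof
  fix u
  have gm: "g e \<in> borel_measurable M" if "e \<in> index" for e using W.L_meas[OF g_L[OF that]] .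
  have Qm[measurable]: "Q \<in> borel_measurable M"
    unfolding Q_def[abs_def] by (intro borel_measurable_divide borel_measurable_sum borel_measurable_times borel_measurable_const gm)
  have [measurable]: "theta_hat X1 X2 \<pi> \<in> borel_measurable M" by (rule theta_hat_meas)
  show "cond_char_at M T \<rho> \<sigma>1 \<sigma>2 X1 X2 \<beta> \<pi> u = (CLINT \<omega>|M. iexp (u * (Q \<omega> - mat_tr index (mat_pow index S 1) / 2)))"
    unfolding cond_char_at_def normalized_error_def S_traces(1)
  proof (rule integral_cong_AE)
    have Q: "Q \<omega> = (\<Sum>e\<in>index. \<Sum>f\<in>index. Smat al be e f * g e \<omega> * g f \<omega>) / 2 / sqrt \<beta>" for \<omega>
      unfolding Q_def S_def by (simp add: sum_divide_distrib field_simps)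
    show "AE \<omega> in M. iexp (u * ((theta_hat X1 X2 \<pi> \<omega> - theta T \<rho> \<sigma>1 \<sigma>2) / sqrt \<beta>)) = iexp (u * (Q \<omega> - theta T \<rho> \<sigma>1 \<sigma>2 / sqrt \<beta>))"
      using theta_hat_quadratic by eventually_elim (simp only: Q diff_divide_distrib)
  qed measurable
qed

lemma S_op_bound: "(\<Sum>e\<in>index. (\<Sum>f\<in>index. S e f * h f)\<^sup>2) \<le> (2 * (3 * \<sigma>\<^sup>2 * mesh \<pi>) / sqrt \<beta>)\<^sup>2 * (\<Sum>e\<in>index. (h e)\<^sup>2)"
proof -
  have "(\<Sum>e\<in>index. (\<Sum>f\<in>index. S e f * h f)\<^sup>2) = (\<Sum>e\<in>index. (\<Sum>f\<in>index. Smat al be e f * h f)\<^sup>2) / \<beta>"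
    unfolding S_def using \<beta> by (simp add: sum_divide_distrib[symmetric] power_divide)
  also have "\<dots> \<le> (2 * (3 * \<sigma>\<^sup>2 * mesh \<pi>))\<^sup>2 * (\<Sum>e\<in>index. (h e)\<^sup>2) / \<beta>"
    using \<beta> mesh_pos
    by (intro divide_right_mono Smat_op_bound[where a = a and b = b] al_be overlap_mass_bound) auto
  finally show ?thesis using \<beta> by (simp add: power_divide)
qed

lemma op_alpha: "0 \<le> 2 * (3 * \<sigma>\<^sup>2 * mesh \<pi>) / sqrt \<beta>" "2 * (3 * \<sigma>\<^sup>2 * mesh \<pi>) / sqrt \<beta> \<le> 4 * alpha \<sigma> \<beta> \<pi>"
proof -
  \<comment> \<open>This is 6 \<le> 4 sqrt 3: the operator bound carries 6 \<sigma>^2 times the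
    mesh, while \<alpha> carries the factor sqrt 3.\<close>
  have r: "3 / 2 \<le> sqrt 3" by (rule real_le_rsqrt) (simp add: power2_eq_square)
  have "0 \<le> \<sigma>\<^sup>2 * mesh \<pi> / sqrt \<beta>" using mesh_pos \<beta> by simp
  then have "6 * (\<sigma>\<^sup>2 * mesh \<pi> / sqrt \<beta>) \<le> 4 * sqrt 3 * (\<sigma>\<^sup>2 * mesh \<pi> / sqrt \<beta>)"
    using r by (intro mult_right_mono) auto
  then show "2 * (3 * \<sigma>\<^sup>2 * mesh \<pi>) / sqrt \<beta> \<le> 4 * alpha \<sigma> \<beta> \<pi>" by (simp add: alpha_def)
  show "0 \<le> 2 * (3 * \<sigma>\<^sup>2 * mesh \<pi>) / sqrt \<beta>" using mesh_pos \<beta> by simp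
qed

lemma S_gvar: "e \<in> index \<Longrightarrow> f \<in> index \<Longrightarrow> S e f * gvar f = S e f"
  by (auto simp: S_def Smat_def gvar_def al_def be_def)

lemma S_sym: "S e f = S f e"
  unfolding S_def by (subst Smat_sym) simp

lemmas char_expansion_at = W.quadratic_char_expansion[OF finite_index g_L S_sym g_cov S_gvar Q_def S_op_bound op_alpha(1),
  folded cond_char_quadratic, unfolded S_traces(2,3)]

lemma char_expansion:
  fixes \<delta> c1 u :: real
  shows "nth_deriv j (cond_char_at M T \<rho> \<sigma>1 \<sigma>2 X1 X2 \<beta> \<pi>) differentiable (at u)"
    and "lambda2 \<rho> \<sigma>1 \<sigma>2 \<beta> \<pi> < c1 \<Longrightarrow> alpha \<sigma> \<beta> \<pi> < \<delta> \<Longrightarrow> \<delta> \<le> 1 \<Longrightarrow> \<bar>u\<bar> \<le> \<delta> powr (-1/3) / 16 \<Longrightarrow>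
      norm (nth_deriv j (cond_char_at M T \<rho> \<sigma>1 \<sigma>2 X1 X2 \<beta> \<pi>) u
        - (deriv ^^ j) (edgeworth (lambda2 \<rho> \<sigma>1 \<sigma>2 \<beta> \<pi>) (sqrt \<beta> * lambda3 \<rho> \<sigma>1 \<sigma>2 \<beta> \<pi>)) (of_real u))
      \<le> fact j * 16 ^ j * (exp c1 * (32 * exp c1 * c1\<^sup>2 + 8 * c1)) * \<delta>\<^sup>2 * (1 + \<bar>u\<bar>) ^ (8 + j)
        * exp (- lambda2 \<rho> \<sigma>1 \<sigma>2 \<beta> \<pi> * u\<^sup>2 / 2)"
    and "lambda2 \<rho> \<sigma>1 \<sigma>2 \<beta> \<pi> < c1 \<Longrightarrow> alpha \<sigma> \<beta> \<pi> < \<delta> \<Longrightarrow> 1 < \<delta> \<Longrightarrow> \<bar>u\<bar> \<le> 1 \<Longrightarrow>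
      norm (nth_deriv j (cond_char_at M T \<rho> \<sigma>1 \<sigma>2 X1 X2 \<beta> \<pi>) u
        - (deriv ^^ j) (edgeworth (lambda2 \<rho> \<sigma>1 \<sigma>2 \<beta> \<pi>) (sqrt \<beta> * lambda3 \<rho> \<sigma>1 \<sigma>2 \<beta> \<pi>)) (of_real u))
      \<le> fact j * (8 * \<delta>) ^ j * (2 * exp c1) + fact j * (exp (2 * c1) * (1 + 2 * (8 * c1 * \<delta>)))"
proof -
  have l: "2 * x / 2 = x" for x :: real by simp
  note E = char_expansion_at[unfolded l]
  show "nth_deriv j (cond_char_at M T \<rho> \<sigma>1 \<sigma>2 X1 X2 \<beta> \<pi>) differentiable (at u)"
    \<comment> \<open>Differentiability holds for all partitions, so \<delta> and c are taken to be
      \<alpha> and \<lambda>_2 themselves.\<close>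
    by (rule E(1)[OF _ _ _ _ _ op_alpha(2) order_refl])
  assume h: "lambda2 \<rho> \<sigma>1 \<sigma>2 \<beta> \<pi> < c1" "alpha \<sigma> \<beta> \<pi> < \<delta>"
  have s: "2 * (3 * \<sigma>\<^sup>2 * mesh \<pi>) / sqrt \<beta> \<le> 4 * \<delta>" and c: "2 * lambda2 \<rho> \<sigma>1 \<sigma>2 \<beta> \<pi> \<le> 2 * c1"
    using op_alpha h by auto
  have d: "0 < \<delta>" using op_alpha h by linarith
  show "norm (nth_deriv j (cond_char_at M T \<rho> \<sigma>1 \<sigma>2 X1 X2 \<beta> \<pi>) u
        - (deriv ^^ j) (edgeworth (lambda2 \<rho> \<sigma>1 \<sigma>2 \<beta> \<pi>) (sqrt \<beta> * lambda3 \<rho> \<sigma>1 \<sigma>2 \<beta> \<pi>)) (of_real u))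
      \<le> fact j * 16 ^ j * (exp c1 * (32 * exp c1 * c1\<^sup>2 + 8 * c1)) * \<delta>\<^sup>2 * (1 + \<bar>u\<bar>) ^ (8 + j)
        * exp (- lambda2 \<rho> \<sigma>1 \<sigma>2 \<beta> \<pi> * u\<^sup>2 / 2)" if "\<delta> \<le> 1" "\<bar>u\<bar> \<le> \<delta> powr (-1/3) / 16"
    by (rule E(2)[OF _ _ _ _ _ s c d that])
  show "norm (nth_deriv j (cond_char_at M T \<rho> \<sigma>1 \<sigma>2 X1 X2 \<beta> \<pi>) u
        - (deriv ^^ j) (edgeworth (lambda2 \<rho> \<sigma>1 \<sigma>2 \<beta> \<pi>) (sqrt \<beta> * lambda3 \<rho> \<sigma>1 \<sigma>2 \<beta> \<pi>)) (of_real u))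
      \<le> fact j * (8 * \<delta>) ^ j * (2 * exp c1) + fact j * (exp (2 * c1) * (1 + 2 * (8 * c1 * \<delta>)))" if "1 < \<delta>" "\<bar>u\<bar> \<le> 1"
    by (rule E(3)[OF _ _ _ _ _ s c that])
qed

end

end

section \<open>Assembly of the expansion\<close>

lemma powr_of_nat:
  fixes x :: real assumes "0 \<le> x" "n \<noteq> 0" shows "x powr real n = x ^ n"
  using assms by (cases "x = 0") (auto simp: powr_realpow)

text \<open>The first conjunct ties the conditional expectation, defined up to null sets for each u,
  to a deterministic kernel that can be differentiated in u. The second ensures that
  \<open>nth_deriv\<close> iterates genuine derivatives of this kernel rather than values that
  \<open>vector_derivative\<close> takes by default.\<close>

theorem proposition5:
  fixes M :: "'a measure"
    and T \<sigma> c c1 :: real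
    and \<rho> \<sigma>1 \<sigma>2 :: "real \<Rightarrow> real"
    and B :: "real \<Rightarrow> 'a \<Rightarrow> real \<times> real"
    and X1 X2 :: "real \<Rightarrow> 'a \<Rightarrow> real"
    and Part :: "nat \<Rightarrow> 'a \<Rightarrow> partition \<times> partition"
    and b :: "nat \<Rightarrow> real"
  assumes "prob_space M"
    and "T > 0"
    and "set_borel_measurable borel {0..T} \<rho>" "\<forall>t\<in>{0..T}. \<rho> t \<in> {-1..1}"
    and "set_borel_measurable borel {0..T} \<sigma>1" "\<forall>t\<in>{0..T}. 0 < \<sigma>1 t \<and> \<sigma>1 t \<le> \<sigma>"
    and "set_borel_measurable borel {0..T} \<sigma>2" "\<forall>t\<in>{0..T}. 0 < \<sigma>2 t \<and> \<sigma>2 t \<le> \<sigma>"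
    and "gaussian_process M {0..T} B" "independent_increments M {0..T} B"
    and "\<forall>t\<in>{0..T}. (\<integral>\<omega>. B t \<omega> \<partial>M) = 0"
    and "\<forall>t\<in>{0..T}. (\<integral>\<omega>. (fst (B t \<omega>))\<^sup>2 \<partial>M) = t"
    and "\<forall>t\<in>{0..T}. (\<integral>\<omega>. (snd (B t \<omega>))\<^sup>2 \<partial>M) = t"
    and "\<forall>t\<in>{0..T}. (\<integral>\<omega>. fst (B t \<omega>) * snd (B t \<omega>) \<partial>M) = (LBINT s:{0..t}. \<rho> s)"
    and "is_wiener_integral_process M T (\<lambda>t \<omega>. fst (B t \<omega>)) \<sigma>1 X1"
    and "is_wiener_integral_process M T (\<lambda>t \<omega>. snd (B t \<omega>)) \<sigma>2 X2"
    and "\<forall>n. Part n \<in> measurable M partition_pair_space"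
    and "\<forall>n. \<forall>\<omega>\<in>space M. Part n \<omega> \<in> partition_pairs T"
    and "\<forall>n. prob_space.indep_set M
           (sets (generated_by M partition_pair_space (Part n)))
           (sets (generated_by M (Pi\<^sub>M {0..T} (\<lambda>_. borel))
              (\<lambda>\<omega>. \<lambda>t\<in>{0..T}. (X1 t \<omega> - X1 0 \<omega>, X2 t \<omega> - X2 0 \<omega>))))"
    and "\<forall>n. b n > 0"
    and "tendsto_in_prob M (\<lambda>n \<omega>. (mesh (Part n \<omega>))\<^sup>2 / mu2 \<rho> \<sigma>1 \<sigma>2 (Part n \<omega>)) 0"
    and "c > 0" "tendsto_in_prob M (\<lambda>n \<omega>. 2 * mu2 \<rho> \<sigma>1 \<sigma>2 (Part n \<omega>) / b n) c"
    and "c1 > 0"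
  shows
    "(\<forall>n u. AE \<omega> in M.
        complex_cond_exp M (generated_by M partition_pair_space (Part n))
          (\<lambda>\<omega>. exp (\<i> * of_real (u * normalized_error T \<rho> \<sigma>1 \<sigma>2 X1 X2 (b n) (Part n \<omega>) \<omega>))) \<omega>
        = cond_char_at M T \<rho> \<sigma>1 \<sigma>2 X1 X2 (b n) (Part n \<omega>) u) \<and>
     (\<forall>n. \<forall>\<pi>\<in>partition_pairs T. \<forall>j u.
        nth_deriv j (cond_char_at M T \<rho> \<sigma>1 \<sigma>2 X1 X2 (b n) \<pi>) differentiable (at u)) \<and>
     (\<forall>j. \<exists>C>0. \<exists>q>0. \<exists>R :: nat \<Rightarrow> real \<Rightarrow> partition \<times> partition \<Rightarrow> real.
        (\<forall>n \<delta>. R n \<delta> \<in> borel_measurable partition_pair_space) \<and>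
        Limsup (at_right 0) (\<lambda>\<delta>. SUP n. SUP \<pi>\<in>good_partitions T \<rho> \<sigma>1 \<sigma>2 \<sigma> c1 (b n) \<delta>.
          ereal (\<bar>R n \<delta> \<pi>\<bar> / \<delta>\<^sup>2)) < \<infinity> \<and>
        (\<forall>n. \<forall>\<delta>>0. \<forall>\<pi>\<in>good_partitions T \<rho> \<sigma>1 \<sigma>2 \<sigma> c1 (b n) \<delta>.
           \<forall>u::real. \<bar>u\<bar> \<le> C * \<delta> powr (-1/3) \<longrightarrow>
             norm (nth_deriv j (cond_char_at M T \<rho> \<sigma>1 \<sigma>2 X1 X2 (b n) \<pi>) u
                   - nth_deriv j (\<lambda>u. of_real (exp (- lambda2 \<rho> \<sigma>1 \<sigma>2 (b n) \<pi> * u\<^sup>2 / 2)) *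
                       (1 + (\<i> * of_real u)^3 * of_real (sqrt (b n)) / 6
                            * of_real (lambda3 \<rho> \<sigma>1 \<sigma>2 (b n) \<pi>))) u)
             \<le> R n \<delta> \<pi> * (1 + \<bar>u\<bar> powr q) * exp (- lambda2 \<rho> \<sigma>1 \<sigma>2 (b n) \<pi> * u\<^sup>2 / 2)))"
proof -
  interpret correlated_wiener M T \<rho> B
    by (intro correlated_wiener.intro correlated_wiener_axioms.intro assms)
  interpret covariation_model M T \<rho> B \<sigma> \<sigma>1 \<sigma>2 X1 X2
    by (intro covariation_model.intro covariation_model_axioms.intro correlated_wiener_axioms assms) unfold_locales
  have b: "0 < b n" for n using assms by blast
  let ?\<phi> = "\<lambda>n \<pi>. cond_char_at M T \<rho> \<sigma>1 \<sigma>2 X1 X2 (b n) \<pi>"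
  let ?l = "\<lambda>n \<pi>. lambda2 \<rho> \<sigma>1 \<sigma>2 (b n) \<pi>"
  let ?\<psi> = "\<lambda>n \<pi> u. of_real (exp (- ?l n \<pi> * u\<^sup>2 / 2)) *
       (1 + (\<i> * of_real u)^3 * of_real (sqrt (b n)) / 6 * of_real (lambda3 \<rho> \<sigma>1 \<sigma>2 (b n) \<pi>))"
  have sm: "sampled_model M T \<rho> B \<sigma> \<sigma>1 \<sigma>2 X1 X2 \<pi>" if "\<pi> \<in> partition_pairs T" for \<pi>
    using that by unfold_locales
  have \<psi>: "nth_deriv j (?\<psi> n \<pi>) u = (deriv ^^ j) (edgeworth (?l n \<pi>) (sqrt (b n) * lambda3 \<rho> \<sigma>1 \<sigma>2 (b n) \<pi>)) (of_real u)" for j n \<pi> u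
    by (rule nth_deriv_holomorphic[of UNIV])
      (auto simp: edgeworth_def exp_of_real[symmetric] algebra_simps intro: edgeworth_holomorphic)
  define K :: "nat \<Rightarrow> real" where "K j = fact j * 16 ^ j * (exp c1 * (32 * exp c1 * c1\<^sup>2 + 8 * c1))" for j
  define K' :: "nat \<Rightarrow> real \<Rightarrow> real" where
    "K' j \<delta> = (fact j * (8 * \<delta>) ^ j * (2 * exp c1) + fact j * (exp (2 * c1) * (1 + 2 * (8 * c1 * \<delta>))))" for j \<delta>
  \<comment> \<open>The bound for \<open>\<delta> > 1\<close> is irrelevant for the limit superior; it only has to be finite.\<close>
  define R :: "nat \<Rightarrow> real \<Rightarrow> real" where
    "R j \<delta> = (if \<delta> \<le> 1 then K j * 2 ^ (8 + j) * \<delta>\<^sup>2 else K' j \<delta> * exp (c1 / 2))" for j \<delta>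
  have c1: "0 < c1" by fact
  have K: "0 \<le> K j" for j using c1 by (simp add: K_def)
  have K': "0 \<le> K' j \<delta>" if "0 \<le> \<delta>" for j \<delta> using c1 that by (simp add: K'_def)
  show ?thesis
  proof (intro conjI allI ballI)
    fix n u
    show "AE \<omega> in M. complex_cond_exp M (generated_by M partition_pair_space (Part n))
          (\<lambda>\<omega>. exp (\<i> * of_real (u * normalized_error T \<rho> \<sigma>1 \<sigma>2 X1 X2 (b n) (Part n \<omega>) \<omega>))) \<omega>
        = cond_char_at M T \<rho> \<sigma>1 \<sigma>2 X1 X2 (b n) (Part n \<omega>) u"
      using assms(15-19) by (intro cond_exp_characteristic T_pos b) (auto simp: is_wiener_integral_process_def)
  next
    fix n \<pi> j u assume "\<pi> \<in> partition_pairs T"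
    then show "nth_deriv j (?\<phi> n \<pi>) differentiable (at u)"
      by (rule sampled_model.char_expansion(1)[OF sm b])
  next
    fix j
    have lim: "Limsup (at_right 0) (\<lambda>\<delta>. SUP n. SUP \<pi>\<in>good_partitions T \<rho> \<sigma>1 \<sigma>2 \<sigma> c1 (b n) \<delta>. ereal (\<bar>R j \<delta>\<bar> / \<delta>\<^sup>2))
       \<le> ereal (K j * 2 ^ (8 + j))"
    proof (rule Limsup_bounded)
      have "eventually (\<lambda>\<delta>. \<delta> \<in> {0<..<1}) (at_right (0::real))" by (rule eventually_at_right_real) simp
      then show "\<forall>\<^sub>F \<delta> in at_right 0. (SUP n. SUP \<pi>\<in>good_partitions T \<rho> \<sigma>1 \<sigma>2 \<sigma> c1 (b n) \<delta>. ereal (\<bar>R j \<delta>\<bar> / \<delta>\<^sup>2)) \<le> ereal (K j * 2 ^ (8 + j))"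
      proof eventually_elim
        case (elim \<delta>)
        then have "\<bar>R j \<delta>\<bar> / \<delta>\<^sup>2 = K j * 2 ^ (8 + j)" using K[of j] by (simp add: R_def abs_mult)
        then show ?case by (auto intro!: SUP_least)
      qed
    qed
    have bound: "norm (nth_deriv j (?\<phi> n \<pi>) u - nth_deriv j (?\<psi> n \<pi>) u)
        \<le> R j \<delta> * (1 + \<bar>u\<bar> powr real (8 + j)) * exp (- ?l n \<pi> * u\<^sup>2 / 2)"
      if \<delta>: "0 < \<delta>" and good: "\<pi> \<in> good_partitions T \<rho> \<sigma>1 \<sigma>2 \<sigma> c1 (b n) \<delta>" and u: "\<bar>u\<bar> \<le> 1 / 16 * \<delta> powr (-1/3)" for n \<delta> \<pi> u
    proof -
      have \<pi>: "\<pi> \<in> partition_pairs T" "?l n \<pi> < c1" "alpha \<sigma> (b n) \<pi> < \<delta>"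
        using good by (auto simp: good_partitions_def)
      have p: "\<bar>u\<bar> powr real (8 + j) = \<bar>u\<bar> ^ (8 + j)" by (rule powr_of_nat) auto
      show ?thesis
      proof (cases "\<delta> \<le> 1")
        case True
        have "norm (nth_deriv j (?\<phi> n \<pi>) u - nth_deriv j (?\<psi> n \<pi>) u) \<le> K j * \<delta>\<^sup>2 * (1 + \<bar>u\<bar>) ^ (8 + j) * exp (- ?l n \<pi> * u\<^sup>2 / 2)"
          unfolding \<psi> K_def using u by (intro sampled_model.char_expansion(2)[OF sm b] \<pi> True) auto
        \<comment> \<open>Passing from a power of 1 + |u| to 1 + a power of |u| accounts for the
          factor 2^(8 + j) in \<open>R\<close>.\<close>
        also have "\<dots> \<le> K j * \<delta>\<^sup>2 * (2 ^ (8 + j) * (1 + \<bar>u\<bar> ^ (8 + j))) * exp (- ?l n \<pi> * u\<^sup>2 / 2)"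
          using K by (intro mult_right_mono mult_left_mono one_plus_power_le) auto
        finally show ?thesis unfolding p using True by (simp add: R_def ac_simps)
      next
        case False
        \<comment> \<open>For \<delta> > 1 the admissible u lie in [-1, 1], where the Gaussian
          weight is at least exp (- c1 / 2); this explains the factor exp (c1 / 2) in
          \<open>R\<close>.\<close>
        have "\<delta> powr (-1/3) \<le> 1 powr (-1/3)" using False by (intro powr_mono2') auto
        then have u1: "\<bar>u\<bar> \<le> 1" using u by simp
        have u2: "u\<^sup>2 \<le> 1" using u1 by (simp add: abs_square_le_1)
        have "?l n \<pi> * u\<^sup>2 \<le> c1 * 1"
          using \<pi>(2) u2 c1 by (intro mult_mono) auto
        then have e: "1 \<le> exp (c1 / 2) * exp (- ?l n \<pi> * u\<^sup>2 / 2)" unfolding exp_add[symmetric] by simp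
        have "norm (nth_deriv j (?\<phi> n \<pi>) u - nth_deriv j (?\<psi> n \<pi>) u) \<le> K' j \<delta>"
          unfolding \<psi> K'_def using False u1 by (intro sampled_model.char_expansion(3)[OF sm b] \<pi>) auto
        also have "\<dots> \<le> K' j \<delta> * ((1 + \<bar>u\<bar> powr real (8 + j)) * (exp (c1 / 2) * exp (- ?l n \<pi> * u\<^sup>2 / 2)))"
        proof -
          have "1 * 1 \<le> (1 + \<bar>u\<bar> powr real (8 + j)) * (exp (c1 / 2) * exp (- ?l n \<pi> * u\<^sup>2 / 2))"
            using e by (intro mult_mono) auto
          then show ?thesis using K'[of \<delta> j] \<delta> by (simp add: mult_le_cancel_left1)
        qed
        finally show ?thesis using False by (simp add: R_def ac_simps)
      qed
    qed
    show "\<exists>C>0. \<exists>q>0. \<exists>R :: nat \<Rightarrow> real \<Rightarrow> partition \<times> partition \<Rightarrow> real.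
        (\<forall>n \<delta>. R n \<delta> \<in> borel_measurable partition_pair_space) \<and>
        Limsup (at_right 0) (\<lambda>\<delta>. SUP n. SUP \<pi>\<in>good_partitions T \<rho> \<sigma>1 \<sigma>2 \<sigma> c1 (b n) \<delta>.
          ereal (\<bar>R n \<delta> \<pi>\<bar> / \<delta>\<^sup>2)) < \<infinity> \<and>
        (\<forall>n. \<forall>\<delta>>0. \<forall>\<pi>\<in>good_partitions T \<rho> \<sigma>1 \<sigma>2 \<sigma> c1 (b n) \<delta>.
           \<forall>u::real. \<bar>u\<bar> \<le> C * \<delta> powr (-1/3) \<longrightarrow>
             norm (nth_deriv j (?\<phi> n \<pi>) u - nth_deriv j (?\<psi> n \<pi>) u)
             \<le> R n \<delta> \<pi> * (1 + \<bar>u\<bar> powr q) * exp (- ?l n \<pi> * u\<^sup>2 / 2))"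
      \<comment> \<open>The remainder bound depends on \<delta> and j alone, hence it is measurable
        in the partition and uniform in n. The exponent 8 + j combines the local estimate with the j
        powers from Cauchy's inequality.\<close>
      using bound le_less_trans[OF lim, of \<infinity>]
      by (intro exI[of _ "1 / 16"] exI[of _ "real (8 + j)"] exI[of _ "\<lambda>n \<delta> \<pi>. R j \<delta>"] conjI allI ballI impI) auto
  qed
qed

end
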